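(* For every initial data $u_0\in L^2(\mathbb{R})$ (real-valued), the equation $$\partial_t u=-(-\Delta)^{\frac12}\mathcal{M}(u)+\partial_x\left(\frac{u^2}{2}\right),\qquad u(0,x)=u_0(x),\quad x\in\mathbb{R},$$ admits a global weak solution $u\in L^\infty_t(L^2_x)=L^\infty\big((0,+\infty),L^2(\mathbb{R})\big)$ that satisfies, for almost every $t>0$, the energy inequality $$\|u(t,\cdot)\|_{L^2}^2+\int_0^{t}\|u(s,\cdot)\|_{\mathcal{N}}^2\,ds\leq \|u_0\|_{L^2}^2 .$$
   Context: The operators are Fourier multipliers on $\mathbb{R}$: $\widehat{(-\Delta)^{a}f}(\xi)=|\xi|^{2a}\widehat f(\xi)$, and $\widehat{\mathcal{M}(f)}(\xi)=\mathfrak{m}(\xi)\widehat f(\xi)$ with $\mathfrak{m}(\xi)=\sqrt{(1+\xi^2)\frac{\tanh(\xi)}{\xi}}$ (so $\mathfrak m(0)=1$). $\mathcal{M}^{\frac12}$ is the multiplier with symbol $\mathfrak{m}(\xi)^{\frac12}$. The functional $\|\cdot\|_{\mathcal{N}}$ is $$\|f\|_{\mathcal{N}}=\left(\int_{\mathbb{R}}\left|(-\Delta)^{\frac14}\mathcal{M}^{\frac12}(f)\right|^2dx\right)^{\frac12},$$ where $(-\Delta)^{\frac14}\mathcal{M}^{\frac12}$ has symbol $|\xi|^{\frac12}\mathfrak m(\xi)^{\frac12}$, and $\mathcal{N}(\mathbb{R})$ is the set of real functions $f$ with $\|f\|_{\mathcal{N}}<+\infty$. A (global) weak solution is understood in the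 usual distributional sense: for all $\phi\in C_c^\infty([0,+\infty)\times\mathbb{R})$, $$\int_0^{+\infty}\!\!\int_{\mathbb{R}}\Big(u\,\partial_t\phi-u\,(-\Delta)^{\frac12}\mathcal{M}(\phi)-\frac{u^2}{2}\partial_x\phi\Big)dx\,dt+\int_{\mathbb{R}}u_0(x)\phi(0,x)\,dx=0.$$ *)

theory Defs
  imports "HOL-Analysis.Analysis"
begin

definition L2_fun :: "(real \<Rightarrow> 'a::euclidean_space) \<Rightarrow> bool" where
  "L2_fun f \<longleftrightarrow> f \<in> borel_measurable lborel \<and> integrable lborel (\<lambda>x. (norm (f x))\<^sup>2)"

definition L2norm :: "(real \<Rightarrow> 'a::euclidean_space) \<Rightarrow> real" where
  "L2norm f = sqrt (\<integral>x. (norm (f x))\<^sup>2 \<partial>lborel)"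

definition fourier :: "(real \<Rightarrow> complex) \<Rightarrow> real \<Rightarrow> complex" where
  "fourier f \<xi> = (\<integral>x. cis (- (x * \<xi>)) * f x \<partial>lborel)"

definition inverse_fourier :: "(real \<Rightarrow> complex) \<Rightarrow> real \<Rightarrow> complex" where
  "inverse_fourier g x = (\<integral>\<xi>. cis (x * \<xi>) * g \<xi> \<partial>lborel) / (2 * pi)"

(* The Fourier-Plancherel transform on L^2: the limit in L^2, as R tends to infinity, of the
   transforms of the truncations of f to [-R, R], which lie in both L^1 and L^2. It is a relation
   because F is only determined almost everywhere. *)
definition has_L2_fourier :: "(real \<Rightarrow> complex) \<Rightarrow> (real \<Rightarrow> complex) \<Rightarrow> bool" where
  "has_L2_fourier f F \<longleftrightarrow> L2_fun f \<and> L2_fun F \<and>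
     ((\<lambda>R. \<integral>\<^sup>+\<xi>. ennreal ((norm (F \<xi> - fourier (\<lambda>x. indicator {-R..R} x *\<^sub>R f x) \<xi>))\<^sup>2) \<partial>lborel)
        \<longlongrightarrow> 0) at_top"

(* g is the image in L^2 of the L^2 function f under the (possibly unbounded) Fourier multiplier
   with symbol \<sigma>; g is unique up to null sets. *)
definition has_L2_multiplier :: "(real \<Rightarrow> real) \<Rightarrow> (real \<Rightarrow> complex) \<Rightarrow> (real \<Rightarrow> complex) \<Rightarrow> bool" where
  "has_L2_multiplier \<sigma> f g \<longleftrightarrow> (\<exists>F G. has_L2_fourier f F \<and> has_L2_fourier g G \<and>
     (AE \<xi> in lborel. G \<xi> = \<sigma> \<xi> *\<^sub>R F \<xi>))"

(* Pointwise version for smooth compactly supported f, where all integrals converge absolutely.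
   The real part loses nothing when f is real and the symbol even, as it is below. *)
definition multiplier :: "(real \<Rightarrow> real) \<Rightarrow> (real \<Rightarrow> real) \<Rightarrow> real \<Rightarrow> real" where
  "multiplier \<sigma> f x =
     Re (inverse_fourier (\<lambda>\<xi>. \<sigma> \<xi> *\<^sub>R fourier (\<lambda>y. complex_of_real (f y)) \<xi>) x)"

definition frac_lap_symbol :: "real \<Rightarrow> real \<Rightarrow> real" where
  "frac_lap_symbol a \<xi> = \<bar>\<xi>\<bar> powr (2 * a)"

definition m_symbol :: "real \<Rightarrow> real" where
  "m_symbol \<xi> = (if \<xi> = 0 then 1 else sqrt ((1 + \<xi>\<^sup>2) * (tanh \<xi> / \<xi>)))"

(* For f in L^2 the set has at most one element, and the infimum of the empty set is \<top>: the
   value is finite exactly when the multiplier maps f into L^2. Functions f outside L^2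
   also get \<top>. *)
definition N_norm :: "(real \<Rightarrow> real) \<Rightarrow> ennreal" where
  "N_norm f = Inf {ennreal (L2norm g) | g.
     has_L2_multiplier (\<lambda>\<xi>. frac_lap_symbol (1/4) \<xi> * m_symbol \<xi> powr (1/2))
       (\<lambda>x. complex_of_real (f x)) g}"

definition partial_t :: "(real \<Rightarrow> real \<Rightarrow> real) \<Rightarrow> real \<Rightarrow> real \<Rightarrow> real" where
  "partial_t \<phi> t x = deriv (\<lambda>s. \<phi> s x) t"

definition partial_x :: "(real \<Rightarrow> real \<Rightarrow> real) \<Rightarrow> real \<Rightarrow> real \<Rightarrow> real" where
  "partial_x \<phi> t x = deriv (\<phi> t) x"

primrec C_k :: "nat \<Rightarrow> (real \<Rightarrow> real \<Rightarrow> real) \<Rightarrow> bool" where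
  "C_k 0 \<phi> \<longleftrightarrow> continuous_on UNIV (\<lambda>(t, x). \<phi> t x)"
| "C_k (Suc k) \<phi> \<longleftrightarrow>
     (\<forall>t x. (\<lambda>s. \<phi> s x) differentiable at t \<and> \<phi> t differentiable at x) \<and>
     C_k k (partial_t \<phi>) \<and> C_k k (partial_x \<phi>)"

(* Smooth compactly supported functions on the whole plane; their restrictions to
   [0, \<infinity>) \<times> \<real> are the test functions of the weak formulation, which only uses times t \<ge> 0. *)
definition test_fun :: "(real \<Rightarrow> real \<Rightarrow> real) \<Rightarrow> bool" where
  "test_fun \<phi> \<longleftrightarrow> (\<forall>k. C_k k \<phi>) \<and> compact (closure {(t, x). \<phi> t x \<noteq> 0})"

(* Elements of L^\<infinity>((0,\<infinity>), L^2) are given by jointly measurable representatives; the values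
   u t for t \<le> 0 are irrelevant. *)
definition Linfty_L2 :: "(real \<Rightarrow> real \<Rightarrow> real) \<Rightarrow> bool" where
  "Linfty_L2 u \<longleftrightarrow> set_borel_measurable lborel ({0<..} \<times> UNIV) (\<lambda>(t, x). u t x) \<and>
     (\<exists>C. AE t in lborel. 0 < t \<longrightarrow> L2_fun (u t) \<and> L2norm (u t) \<le> C)"

definition weak_integrand ::
  "(real \<Rightarrow> real \<Rightarrow> real) \<Rightarrow> (real \<Rightarrow> real \<Rightarrow> real) \<Rightarrow> real \<Rightarrow> real \<Rightarrow> real" where
  "weak_integrand u \<phi> t x = u t x * partial_t \<phi> t x
     - u t x * multiplier (\<lambda>\<xi>. frac_lap_symbol (1/2) \<xi> * m_symbol \<xi>) (\<phi> t) x
     - (u t x)\<^sup>2 / 2 * partial_x \<phi> t x"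

(* Integrability is demanded explicitly since the integral of a non-integrable function is 0. *)
definition weak_solution :: "(real \<Rightarrow> real) \<Rightarrow> (real \<Rightarrow> real \<Rightarrow> real) \<Rightarrow> bool" where
  "weak_solution u0 u \<longleftrightarrow> (\<forall>\<phi>. test_fun \<phi> \<longrightarrow>
     set_integrable lborel ({0<..} \<times> UNIV) (\<lambda>(t, x). weak_integrand u \<phi> t x) \<and>
     integrable lborel (\<lambda>x. u0 x * \<phi> 0 x) \<and>
     (LINT t:{0<..}|lborel. (\<integral>x. weak_integrand u \<phi> t x \<partial>lborel))
       + (\<integral>x. u0 x * \<phi> 0 x \<partial>lborel) = 0)"

end

theory Submission
  imports Defs "HOL-Probability.Sinc_Integral" "HOL-Complex_Analysis.Great_Picard"
begin

text \<open>Work with the spatial Fourier transform \<open>v\<close> of \<open>u\<close>. An explicit Euler scheme in time for the equation restricted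
  to the frequencies \<open>k / 2 ^ n\<close> with \<open>\<bar>k\<bar> \<le> 4 ^ n\<close> keeps \<open>u\<close> real; for real \<open>u\<close> the quadratic term does not change the
  \<open>L\<^sup>2\<close> norm, so for small time steps the discrete energy decreases by at least the dissipation. The sums over dyadic
  frequency cells are equicontinuous in time and converge along a subsequence; they form a martingale bounded in \<open>L\<^sup>2\<close>,
  whose limit is \<open>v\<close>. Since the symbol grows at least linearly, the dissipation bounds the contribution of the frequencies
  above \<open>R\<close> to the weak formulation by \<open>1 / sqrt R\<close>. For the frequencies below \<open>R\<close> weak convergence suffices: it gives
  pointwise convergence of the band-limited functions in \<open>x\<close>, hence of their squares by dominated convergence. Plancherel's
  identity for step functions reduces to the sine integral, and step functions are dense.\<close>

section \<open>Square integrable functions\<close>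

text \<open>Weak compactness alone does not carry the square of \<open>u\<close> to the limit, and
  strong compactness in \<open>x\<close> is never proved. What replaces it is an order of limits:
  the approximation parameter goes to infinity at a fixed cut-off \<open>R\<close>, and only then
  does \<open>R\<close>. This works because the loss at the cut-off is uniform in the approximation
  parameter after integration in time, which is all that the energy inequality offers. Frequencies
  are discretised, and not points, because the operator is then diagonal and the cancellation of the
  quadratic term survives exactly: the lattice of frequencies is closed under addition and the
  cut-off is symmetric. The spacing \<open>1 / 2 ^ n\<close> and the largest frequency
  \<open>2 ^ n\<close> are refined together. A second obstacle is measurability. A limit chosen
  separately at each time would not be a measurable function of time and space. Both
  \<open>v\<close> and the synthesis of \<open>u\<close> from \<open>v\<close> are therefore
  explicit limits along sequences fixed in advance, with a geometric rate.\<close>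

lemma borel_measurable_cnj' [measurable (raw)]:
  "f \<in> borel_measurable M \<Longrightarrow> (\<lambda>x. cnj (f x)) \<in> borel_measurable M"
  using measurable_compose[OF _ borel_measurable_continuous_onI[OF continuous_on_cnj[OF continuous_on_id]]] by blast

lemma L2_fun_measurable [measurable_dest]: "L2_fun f \<Longrightarrow> f \<in> borel_measurable lborel"
  by (simp add: L2_fun_def)

lemma L2_fun_integrable: "L2_fun f \<Longrightarrow> integrable lborel (\<lambda>x. (norm (f x))^2)"
  by (simp add: L2_fun_def)

lemma L2norm_nonneg [simp]: "L2norm f \<ge> 0"
  by (simp add: L2norm_def)

lemma L2norm_sq: "(L2norm f)\<^sup>2 = (LBINT x. (norm (f x))^2)"
  by (simp add: L2norm_def)

lemma L2_fun_nn:
  assumes "L2_fun f" shows "(\<integral>\<^sup>+x. ennreal ((norm (f x))^2) \<partial>lborel) = ennreal ((L2norm f)^2)"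
  unfolding L2norm_sq by (rule nn_integral_eq_integral) (use assms L2_fun_integrable in auto)

lemma L2_funI_nn:
  assumes "f \<in> borel_measurable lborel" "(\<integral>\<^sup>+x. ennreal ((norm (f x))^2) \<partial>lborel) < \<infinity>"
  shows "L2_fun f"
  unfolding L2_fun_def using assms by (auto intro!: integrableI_bounded)

lemma L2norm_le_nn:
  assumes "f \<in> borel_measurable lborel" "(\<integral>\<^sup>+x. ennreal ((norm (f x))^2) \<partial>lborel) \<le> ennreal C" "0 \<le> C"
  shows "L2_fun f" "(L2norm f)\<^sup>2 \<le> C"
proof -
  show L: "L2_fun f" by (rule L2_funI_nn) (use assms in \<open>auto intro: le_less_trans\<close>)
  show "(L2norm f)\<^sup>2 \<le> C" using assms(2,3) L2_fun_nn[OF L] by (simp add: ennreal_le_iff)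
qed

lemma L2_fun_bound:
  assumes "L2_fun f" "g \<in> borel_measurable lborel" "AE x in lborel. norm (g x) \<le> C * norm (f x)"
  shows "L2_fun g"
  unfolding L2_fun_def
proof
  have "integrable lborel (\<lambda>x. C^2 * (norm (f x))^2)" using assms(1) by (simp add: L2_fun_def)
  then show "integrable lborel (\<lambda>x. (norm (g x))^2)"
  proof (rule Bochner_Integration.integrable_bound)
    show "AE x in lborel. norm ((norm (g x))^2) \<le> norm (C^2 * (norm (f x))^2)"
      using assms(3)
    proof eventually_elim
      case (elim x)
      then have "(norm (g x))\<^sup>2 \<le> (C * norm (f x))^2" by (intro power_mono) auto
      then show ?case by (simp add: power_mult_distrib)
    qed
  qed (use assms(2) in measurable)
qed (use assms in auto)

lemma norm_add_sq_le: "(norm (a + b :: 'a::real_normed_vector))\<^sup>2 \<le> 2 * (norm a)^2 + 2 * (norm b)^2"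
proof -
  have "(norm (a + b))\<^sup>2 \<le> (norm a + norm b)^2" by (intro power_mono norm_triangle_ineq) auto
  also have "\<dots> \<le> 2 * (norm a)^2 + 2 * (norm b)^2" using sum_squares_bound[of "norm a" "norm b"]
    by (simp add: power2_sum)
  finally show ?thesis .
qed

lemma L2_fun_add:
  assumes f: "L2_fun f" and g: "L2_fun g" shows "L2_fun (\<lambda>x. f x + g x)"
  unfolding L2_fun_def
proof
  have "integrable lborel (\<lambda>x. 2 * (norm (f x))^2 + 2 * (norm (g x))^2)"
    using f g by (simp add: L2_fun_def)
  then show "integrable lborel (\<lambda>x. (norm (f x + g x))^2)"
    by (rule Bochner_Integration.integrable_bound) (use f g norm_add_sq_le in \<open>auto simp: L2_fun_def\<close>)
qed (use f g in measurable)

lemma L2_fun_cmult: "L2_fun f \<Longrightarrow> L2_fun (\<lambda>x. c * f x :: complex)"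
  by (rule L2_fun_bound[where f=f and C="norm c"]) (auto simp: L2_fun_def norm_mult)

lemma L2_fun_uminus: "L2_fun f \<Longrightarrow> L2_fun (\<lambda>x. - f x)"
  by (rule L2_fun_bound[where f=f and C=1]) (auto simp: L2_fun_def)

lemma L2_fun_diff: "L2_fun f \<Longrightarrow> L2_fun g \<Longrightarrow> L2_fun (\<lambda>x. f x - g x)"
  using L2_fun_add[of f "\<lambda>x. - g x"] L2_fun_uminus[of g] by simp

lemma L2_fun_cnj: "L2_fun f \<Longrightarrow> L2_fun (\<lambda>x. cnj (f x))"
  by (rule L2_fun_bound[where f=f and C=1]) (auto simp: L2_fun_def)

lemma L2_fun_indicator: "L2_fun f \<Longrightarrow> A \<in> sets borel \<Longrightarrow> L2_fun (\<lambda>x. indicator A x *\<^sub>R f x)"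
  by (rule L2_fun_bound[where f=f and C=1]) (auto simp: L2_fun_def split: split_indicator)

lemma L2_fun_sum:
  "finite I \<Longrightarrow> (\<And>i. i \<in> I \<Longrightarrow> L2_fun (f i)) \<Longrightarrow> L2_fun (\<lambda>x. \<Sum>i\<in>I. f i x)"
proof (induction rule: finite_induct)
  case empty
  then show ?case by (simp add: L2_fun_def)
next
  case (insert i I)
  then show ?case by (auto intro: L2_fun_add)
qed

lemma L2_fun_of_real_iff: "L2_fun (\<lambda>x. complex_of_real (f x)) \<longleftrightarrow> L2_fun f"
proof -
  have "f \<in> borel_measurable lborel" if [measurable]: "(\<lambda>x. complex_of_real (f x)) \<in> borel_measurable lborel"
  proof -
    have "(\<lambda>x. Re (complex_of_real (f x))) \<in> borel_measurable lborel" by measurable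
    then show ?thesis by (simp only: Re_complex_of_real)
  qed
  moreover have "(\<lambda>x. complex_of_real (f x)) \<in> borel_measurable lborel" if [measurable]: "f \<in> borel_measurable lborel"
    by measurable
  ultimately have "(\<lambda>x. complex_of_real (f x)) \<in> borel_measurable lborel \<longleftrightarrow> f \<in> borel_measurable lborel"
    by blast
  then show ?thesis unfolding L2_fun_def norm_of_real real_norm_def by (simp only:)
qed

lemma L2norm_of_real: "L2norm (\<lambda>x. complex_of_real (f x)) = L2norm f"
  by (simp add: L2norm_def)

lemma L2norm_cnj: "L2norm (\<lambda>x. cnj (f x)) = L2norm f"
  by (simp add: L2norm_def)

lemma L2norm_cmult: "L2norm (\<lambda>x. c * f x :: complex) = norm c * L2norm f"
  by (simp add: L2norm_def norm_mult power_mult_distrib real_sqrt_mult)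

lemma L2norm_minus_commute: "L2norm (\<lambda>x. f x - g x) = L2norm (\<lambda>x. g x - f x)"
  by (simp add: L2norm_def norm_minus_commute)

lemma L2norm_0_AE:
  assumes "L2_fun f" "L2norm f = 0" shows "AE x in lborel. f x = 0"
proof -
  have "(LBINT x. (norm (f x))^2) = 0" using assms(2) L2norm_sq[of f] by simp
  then have "AE x in lborel. (norm (f x))^2 = 0"
    using assms(1) by (subst (asm) integral_nonneg_eq_0_iff_AE) (auto simp: L2_fun_def)
  then show ?thesis by simp
qed

lemma L2_norm_mult_integrable:
  assumes f: "L2_fun f" and g: "L2_fun g" shows "integrable lborel (\<lambda>x. norm (f x) * norm (g x))"
proof -
  have "integrable lborel (\<lambda>x. (norm (f x))^2 + (norm (g x))^2)"
    using f g by (simp add: L2_fun_def)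
  then show ?thesis
  proof (rule Bochner_Integration.integrable_bound)
    show "AE x in lborel. norm (norm (f x) * norm (g x)) \<le> norm ((norm (f x))^2 + (norm (g x))^2)"
    proof (rule AE_I2)
      fix x
      have "2 * (norm (f x) * norm (g x)) \<le> (norm (f x))^2 + (norm (g x))^2"
        using sum_squares_bound[of "norm (f x)" "norm (g x)"] by (simp add: mult.assoc)
      moreover have "0 \<le> norm (f x) * norm (g x)" by simp
      ultimately have "norm (f x) * norm (g x) \<le> (norm (f x))^2 + (norm (g x))^2" by linarith
      then show "norm (norm (f x) * norm (g x)) \<le> norm ((norm (f x))^2 + (norm (g x))^2)" by simp
    qed
  qed (use f g in measurable)
qed

lemma L2_mult_integrable:
  assumes f: "L2_fun f" and g: "L2_fun (g :: real \<Rightarrow> complex)" shows "integrable lborel (\<lambda>x. f x * g x)"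
  by (rule Bochner_Integration.integrable_bound[OF L2_norm_mult_integrable[OF f g]])
     (use f g in \<open>auto simp: L2_fun_def norm_mult\<close>)

lemma L2_Cauchy_Schwarz:
  assumes f: "L2_fun f" and g: "L2_fun g"
  shows "(LBINT x. norm (f x) * norm (g x)) \<le> L2norm f * L2norm g"
proof -
  define a b s where "a = (LBINT x. (norm (f x))^2)" and "b = (LBINT x. (norm (g x))^2)"
    and "s = (LBINT x. norm (f x) * norm (g x))"
  have quad: "0 \<le> a - 2 * t * s + t^2 * b" for t
  proof -
    have "0 \<le> (LBINT x. (norm (f x) - t * norm (g x))^2)" by simp
    also have "\<dots> = (LBINT x. (norm (f x))^2 - (2 * t) * (norm (f x) * norm (g x)) + t^2 * (norm (g x))^2)"
      by (simp add: power2_diff power_mult_distrib algebra_simps)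
    also have "\<dots> = a - 2 * t * s + t^2 * b"
      unfolding a_def b_def s_def
      using L2_fun_integrable[OF f] L2_fun_integrable[OF g] L2_norm_mult_integrable[OF f g] by simp
    finally show ?thesis .
  qed
  have s0: "0 \<le> s" "0 \<le> a" "0 \<le> b" unfolding s_def a_def b_def by auto
  have "s\<^sup>2 \<le> a * b"
  proof (cases "b = 0")
    case True
    have "s = 0"
    proof (rule ccontr)
      assume "s \<noteq> 0"
      then have "s > 0" using s0 by simp
      then have "2 * ((a + 1) / s) * s = 2 * (a + 1)" by simp
      \<comment> \<open>With \<open>b = 0\<close> the quadratic is affine in \<open>t\<close>; at
        \<open>(a + 1) / s\<close> its value is \<open>- a - 2\<close>.\<close>
      then show False using quad[of "(a + 1) / s"] s0 True by simp
    qed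
    then show ?thesis using True by simp
  next
    case False
    then show ?thesis using quad[of "s / b"] s0
      by (simp add: field_simps power2_eq_square)
  qed
  then have "s \<le> sqrt (a * b)" by (rule real_le_rsqrt)
  then show ?thesis by (simp add: L2norm_def a_def b_def s_def real_sqrt_mult)
qed

lemma L2_integral_mult_le:
  assumes f: "L2_fun f" and g: "L2_fun (g :: real \<Rightarrow> complex)"
  shows "norm (LBINT x. f x * g x) \<le> L2norm f * L2norm g"
proof -
  have "norm (LBINT x. f x * g x) \<le> (LBINT x. norm (f x * g x))" by (rule integral_norm_bound)
  also have "\<dots> \<le> L2norm f * L2norm g" using L2_Cauchy_Schwarz[OF f g] by (simp add: norm_mult)
  finally show ?thesis .
qed

lemma L2norm_triangle:
  assumes f: "L2_fun f" and g: "L2_fun g"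
  shows "L2norm (\<lambda>x. f x + g x) \<le> L2norm f + L2norm g"
proof (rule power2_le_imp_le)
  have "(L2norm (\<lambda>x. f x + g x))\<^sup>2 \<le> (LBINT x. (norm (f x))^2 + 2 * (norm (f x) * norm (g x)) + (norm (g x))^2)"
    unfolding L2norm_sq
  proof (rule integral_mono)
    show "integrable lborel (\<lambda>x. (norm (f x + g x))^2)" using L2_fun_add[OF f g] by (simp add: L2_fun_def)
    show "integrable lborel (\<lambda>x. (norm (f x))^2 + 2 * (norm (f x) * norm (g x)) + (norm (g x))^2)"
      using L2_fun_integrable[OF f] L2_fun_integrable[OF g] L2_norm_mult_integrable[OF f g] by simp
    fix x
    have "(norm (f x + g x))\<^sup>2 \<le> (norm (f x) + norm (g x))^2" by (intro power_mono norm_triangle_ineq) auto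
    then show "(norm (f x + g x))\<^sup>2 \<le> (norm (f x))^2 + 2 * (norm (f x) * norm (g x)) + (norm (g x))^2"
      by (simp add: power2_sum algebra_simps)
  qed
  also have "\<dots> = (L2norm f)^2 + 2 * (LBINT x. norm (f x) * norm (g x)) + (L2norm g)^2"
    unfolding L2norm_sq
    using L2_fun_integrable[OF f] L2_fun_integrable[OF g] L2_norm_mult_integrable[OF f g] by simp
  also have "\<dots> \<le> (L2norm f + L2norm g)^2"
    using L2_Cauchy_Schwarz[OF f g] by (simp add: power2_sum)
  finally show "(L2norm (\<lambda>x. f x + g x))\<^sup>2 \<le> (L2norm f + L2norm g)^2" .
qed simp

lemma L2norm_triangle_diff:
  assumes "L2_fun f" "L2_fun g" "L2_fun h"
  shows "L2norm (\<lambda>x. f x - h x) \<le> L2norm (\<lambda>x. f x - g x) + L2norm (\<lambda>x. g x - h x)"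
  using L2norm_triangle[OF L2_fun_diff[OF assms(1,2)] L2_fun_diff[OF assms(2,3)]] by simp

lemma L2norm_abs_diff_le:
  assumes "L2_fun f" "L2_fun g" shows "\<bar>L2norm f - L2norm g\<bar> \<le> L2norm (\<lambda>x. f x - g x)"
proof -
  have 0: "L2_fun (\<lambda>x. 0 :: 'a)" by (simp add: L2_fun_def)
  show ?thesis
    using L2norm_triangle_diff[OF assms 0] L2norm_triangle_diff[OF assms(2,1) 0]
    by (simp add: L2norm_minus_commute[of g f])
qed

lemma L2norm_tendsto:
  assumes "\<And>k. L2_fun (f k)" "L2_fun F" "((\<lambda>k. L2norm (\<lambda>x. f k x - F x)) \<longlongrightarrow> 0) net"
  shows "((\<lambda>k. L2norm (f k)) \<longlongrightarrow> L2norm F) net"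
  by (rule LIM_zero_cancel, rule Lim_null_comparison[OF _ assms(3)])
     (use L2norm_abs_diff_le[OF assms(1,2)] in auto)

lemma L2_integral_tendsto:
  fixes g :: "real \<Rightarrow> complex"
  assumes "\<And>k. L2_fun (f k)" "L2_fun F" "((\<lambda>k. L2norm (\<lambda>x. f k x - F x)) \<longlongrightarrow> 0) net" "L2_fun g"
  shows "((\<lambda>k. (LBINT x. f k x * g x)) \<longlongrightarrow> (LBINT x. F x * g x)) net"
proof (rule LIM_zero_cancel, rule Lim_null_comparison)
  show "\<forall>\<^sub>F k in net. norm ((LBINT x. f k x * g x) - (LBINT x. F x * g x)) \<le> L2norm (\<lambda>x. f k x - F x) * L2norm g"
  proof (intro always_eventually allI)
    fix k
    have "(LBINT x. f k x * g x) - (LBINT x. F x * g x) = (LBINT x. (f k x - F x) * g x)"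
      using L2_mult_integrable[OF assms(1)[of k] assms(4)] L2_mult_integrable[OF assms(2,4)]
      by (simp add: left_diff_distrib)
    then show "norm ((LBINT x. f k x * g x) - (LBINT x. F x * g x)) \<le> L2norm (\<lambda>x. f k x - F x) * L2norm g"
      using L2_integral_mult_le[OF L2_fun_diff[OF assms(1)[of k] assms(2)] assms(4)] by simp
  qed
  show "((\<lambda>k. L2norm (\<lambda>x. f k x - F x) * L2norm g) \<longlongrightarrow> 0) net"
    using tendsto_mult[OF assms(3) tendsto_const[of "L2norm g"]] by simp
qed

text \<open>Weighting the increments by \<open>2 ^ k\<close> makes the series of increments converge almost everywhere,
  so that no subsequence has to be extracted.\<close>

lemma L2_rapid_limit:
  fixes f :: "nat \<Rightarrow> real \<Rightarrow> complex"
  assumes L2: "\<And>k. L2_fun (f k)"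
    and summ: "summable (\<lambda>k. 2 ^ k * (L2norm (\<lambda>x. f (Suc k) x - f k x))^2)"
  shows "AE x in lborel. convergent (\<lambda>k. f k x)"
    and "F \<in> borel_measurable lborel \<Longrightarrow> AE x in lborel. (\<lambda>k. f k x) \<longlonglongrightarrow> F x \<Longrightarrow>
      L2_fun F \<and> (\<lambda>k. L2norm (\<lambda>x. f k x - F x)) \<longlonglongrightarrow> 0"
proof -
  have [measurable]: "f k \<in> borel_measurable lborel" for k using L2 by (simp add: L2_fun_def)
  have sqrt1: "sqrt ((1/2) ^ l) * (sqrt (2 ^ l) * y) = y" for l and y :: real
  proof -
    have "sqrt ((1/2) ^ l) * sqrt (2 ^ l) = sqrt ((1/2 :: real) ^ l * 2 ^ l)" by (simp only: real_sqrt_mult)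
    also have "(1/2 :: real) ^ l * 2 ^ l = 1" by (simp add: power_divide)
    finally show ?thesis by (metis mult.assoc mult_1 real_sqrt_one)
  qed
  define d where "d k x = norm (f (Suc k) x - f k x)" for k x
  have [measurable]: "d k \<in> borel_measurable lborel" for k unfolding d_def by measurable
  define S where "S x = (\<Sum>k. ennreal (2 ^ k * (d k x)^2))" for x
  have [measurable]: "S \<in> borel_measurable lborel" unfolding S_def by measurable
  have "(\<integral>\<^sup>+x. S x \<partial>lborel) = (\<Sum>k. \<integral>\<^sup>+x. ennreal (2 ^ k * (d k x)^2) \<partial>lborel)"
    unfolding S_def by (rule nn_integral_suminf) measurable
  also have "\<dots> = (\<Sum>k. ennreal (2 ^ k * (L2norm (\<lambda>x. f (Suc k) x - f k x))^2))"
  proof (rule suminf_cong)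
    fix k
    have "(\<integral>\<^sup>+x. ennreal (2 ^ k * (d k x)^2) \<partial>lborel) = (\<integral>\<^sup>+x. ennreal (2 ^ k) * ennreal ((d k x)^2) \<partial>lborel)"
      by (simp add: ennreal_mult)
    also have "\<dots> = ennreal (2 ^ k) * ennreal ((L2norm (\<lambda>x. f (Suc k) x - f k x))^2)"
      using L2_fun_nn[OF L2_fun_diff[OF L2[of "Suc k"] L2[of k]]] by (subst nn_integral_cmult) (auto simp: d_def)
    finally show "(\<integral>\<^sup>+x. ennreal (2 ^ k * (d k x)^2) \<partial>lborel) = ennreal (2 ^ k * (L2norm (\<lambda>x. f (Suc k) x - f k x))^2)"
      by (simp add: ennreal_mult)
  qed
  also have "\<dots> = ennreal (\<Sum>k. 2 ^ k * (L2norm (\<lambda>x. f (Suc k) x - f k x))^2)"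
    by (rule suminf_ennreal2) (use summ in auto)
  finally obtain B where B: "(\<integral>\<^sup>+x. S x \<partial>lborel) = ennreal B" "B \<ge> 0"
    using suminf_nonneg[OF summ] by auto
  have fin: "AE x in lborel. S x \<noteq> \<infinity>" by (rule nn_integral_PInf_AE) (use B in auto)
  \<comment> \<open>Cauchy-Schwarz with the weights \<open>2 ^ l\<close> and
    \<open>(1/2) ^ l\<close>. The geometric sum from \<open>k\<close> on is at most
    \<open>2 * (1/2) ^ k\<close>, and this becomes the rate of convergence.\<close>
  have sq: "ennreal ((norm (f m x - f k x))^2) \<le> ennreal (2 * (1/2) ^ k) * S x" if "S x \<noteq> \<infinity>" "k \<le> m" for x k m
  proof -
    have "norm (f m x - f k x) \<le> (\<Sum>l\<in>{k..<m}. d l x)"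
      using \<open>k \<le> m\<close>
    proof (induction m rule: dec_induct)
      case (step m)
      have "norm (f (Suc m) x - f k x) \<le> d m x + norm (f m x - f k x)"
        unfolding d_def using norm_triangle_ineq[of "f (Suc m) x - f m x" "f m x - f k x"] by simp
      then show ?case using step by (simp add: sum.atLeastLessThan_Suc)
    qed simp
    then have "(norm (f m x - f k x))\<^sup>2 \<le> (\<Sum>l\<in>{k..<m}. d l x)^2" by (intro power_mono) auto
    also have "\<dots> = (\<Sum>l\<in>{k..<m}. sqrt ((1/2) ^ l) * (sqrt (2 ^ l) * d l x))^2"
      by (simp only: sqrt1)
    also have "\<dots> \<le> (\<Sum>l\<in>{k..<m}. (sqrt ((1/2) ^ l))^2) * (\<Sum>l\<in>{k..<m}. (sqrt (2 ^ l) * d l x)^2)"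
      by (rule Cauchy_Schwarz_ineq_sum)
    also have "\<dots> = (\<Sum>l\<in>{k..<m}. (1/2) ^ l) * (\<Sum>l\<in>{k..<m}. 2 ^ l * (d l x)^2)"
      by (simp add: power_mult_distrib)
    also have "\<dots> \<le> (2 * (1/2) ^ k) * (\<Sum>l\<in>{k..<m}. 2 ^ l * (d l x)^2)"
    proof (rule mult_right_mono)
      have "(\<Sum>l\<in>{k..<m}. (1/2) ^ l) = 2 * (1/2 :: real) ^ k - 2 * (1/2) ^ m" if "k \<le> m" for m k :: nat
        using that by (induction m rule: dec_induct) (auto simp: sum.atLeastLessThan_Suc)
      then show "(\<Sum>l\<in>{k..<m}. (1/2) ^ l) \<le> (2 * (1/2) ^ k :: real)" using \<open>k \<le> m\<close> by simp
    qed (simp add: sum_nonneg)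
    finally have "ennreal ((norm (f m x - f k x))^2) \<le> ennreal (2 * (1/2) ^ k) * ennreal (\<Sum>l\<in>{k..<m}. 2 ^ l * (d l x)^2)"
      by (simp add: ennreal_mult[symmetric] sum_nonneg ennreal_le_iff)
    also have "ennreal (\<Sum>l\<in>{k..<m}. 2 ^ l * (d l x)^2) = (\<Sum>l\<in>{k..<m}. ennreal (2 ^ l * (d l x)^2))"
      by (rule sum_ennreal[symmetric]) auto
    also have "\<dots> \<le> S x" unfolding S_def by (rule sum_le_suminf) auto
    finally show ?thesis by (simp add: mult_left_mono)
  qed
  have conv: "convergent (\<lambda>k. f k x)" if "S x \<noteq> \<infinity>" for x
  proof -
    have "summable (\<lambda>k. 2 ^ k * (d k x)^2)"
      using that unfolding S_def by (intro summable_suminf_not_top) auto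
    then have "summable (\<lambda>k. ((1/2) ^ k + 2 ^ k * (d k x)^2))" by (intro summable_add summable_geometric) auto
    then have "summable (\<lambda>k. d k x)"
    proof (rule summable_comparison_test[rotated], intro exI allI impI)
      fix k :: nat
      \<comment> \<open>The two factors multiply to the increment itself, so summability of the
        weighted squares gives summability of the increments.\<close>
      have "2 * sqrt ((1/2) ^ k) * (sqrt (2 ^ k) * d k x) \<le> (sqrt ((1/2) ^ k))^2 + (sqrt (2 ^ k) * d k x)^2"
        by (rule sum_squares_bound)
      moreover have "2 * sqrt ((1/2) ^ k) * (sqrt (2 ^ k) * d k x) = 2 * d k x"
        using sqrt1[of k "d k x"] by (simp only: mult.assoc)
      ultimately have "2 * d k x \<le> (1/2) ^ k + 2 ^ k * (d k x)^2" by (simp add: power_mult_distrib)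
      moreover have "0 \<le> d k x" by (simp add: d_def)
      ultimately show "norm (d k x) \<le> (1/2) ^ k + 2 ^ k * (d k x)^2" by simp
    qed
    then have "summable (\<lambda>k. f (Suc k) x - f k x)" unfolding d_def by (rule summable_norm_cancel)
    then have "convergent (\<lambda>n. \<Sum>k<n. f (Suc k) x - f k x)" by (simp add: summable_iff_convergent)
    then have "convergent (\<lambda>n. f n x - f 0 x)" by (simp add: sum_lessThan_telescope[of "\<lambda>n. f n x"])
    from convergent_add[OF this convergent_const[of "f 0 x"]] show ?thesis by simp
  qed
  then show "AE x in lborel. convergent (\<lambda>k. f k x)" using fin by auto
  assume [measurable]: "F \<in> borel_measurable lborel" and lim: "AE x in lborel. (\<lambda>k. f k x) \<longlonglongrightarrow> F x"
  have main: "(\<integral>\<^sup>+x. ennreal ((norm (f k x - F x))^2) \<partial>lborel) \<le> ennreal (2 * (1/2) ^ k * B)" for k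
  proof -
    have "(\<integral>\<^sup>+x. ennreal ((norm (f k x - F x))^2) \<partial>lborel) \<le> (\<integral>\<^sup>+x. ennreal (2 * (1/2) ^ k) * S x \<partial>lborel)"
    proof (rule nn_integral_mono_AE)
      show "AE x in lborel. ennreal ((norm (f k x - F x))^2) \<le> ennreal (2 * (1/2) ^ k) * S x"
        using fin lim
      proof eventually_elim
        case (elim x)
        have "(\<lambda>m. ennreal ((norm (f m x - f k x))^2)) \<longlonglongrightarrow> ennreal ((norm (F x - f k x))^2)"
          by (intro tendsto_ennrealI tendsto_intros elim)
        then have "ennreal ((norm (F x - f k x))^2) \<le> ennreal (2 * (1/2) ^ k) * S x"
          by (rule Lim_bounded[where M=k]) (use sq[OF elim(1)] in auto)
        then show ?case by (simp add: norm_minus_commute)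
      qed
    qed
    also have "\<dots> = ennreal (2 * (1/2) ^ k) * ennreal B" by (subst nn_integral_cmult) (auto simp: B)
    finally show ?thesis using B(2) by (simp add: ennreal_mult)
  qed
  have m: "L2_fun (\<lambda>x. f k x - F x)" "(L2norm (\<lambda>x. f k x - F x))\<^sup>2 \<le> 2 * (1/2) ^ k * B" for k
    using L2norm_le_nn[OF _ main[of k]] B(2) by auto
  have "L2_fun F" using L2_fun_diff[OF L2[of 0] m(1)[of 0]] by simp
  moreover have "(\<lambda>k. (L2norm (\<lambda>x. f k x - F x))^2) \<longlonglongrightarrow> 0"
  proof (rule Lim_null_comparison)
    show "\<forall>\<^sub>F k in sequentially. norm ((L2norm (\<lambda>x. f k x - F x))^2) \<le> 2 * (1/2) ^ k * B" using m(2) by simp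
    have "(\<lambda>k. (1/2::real) ^ k) \<longlonglongrightarrow> 0" by (rule LIMSEQ_realpow_zero) auto
    then show "(\<lambda>k. 2 * (1/2) ^ k * B) \<longlonglongrightarrow> 0" by (intro tendsto_mult_left_zero tendsto_mult_right_zero)
  qed
  then have "(\<lambda>k. sqrt ((L2norm (\<lambda>x. f k x - F x))^2)) \<longlonglongrightarrow> sqrt 0" by (rule tendsto_real_sqrt)
  ultimately show "L2_fun F \<and> (\<lambda>k. L2norm (\<lambda>x. f k x - F x)) \<longlonglongrightarrow> 0" by simp
qed

lemma L2_dominated_tendsto:
  fixes f :: "nat \<Rightarrow> real \<Rightarrow> complex"
  assumes [measurable]: "\<And>k. f k \<in> borel_measurable lborel" "F \<in> borel_measurable lborel"
    and g: "L2_fun g" and dom: "\<And>k x. norm (f k x) \<le> norm (g x)"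
    and lim: "\<And>x. (\<lambda>k. f k x) \<longlonglongrightarrow> F x"
  shows "L2_fun F" "(\<lambda>k. L2norm (\<lambda>x. f k x - F x)) \<longlonglongrightarrow> 0"
proof -
  have domF: "norm (F x) \<le> norm (g x)" for x
    using tendsto_norm[OF lim[of x]] by (rule Lim_bounded[where M=0]) (use dom in auto)
  then show "L2_fun F" by (intro L2_fun_bound[OF g, where C=1]) auto
  have [measurable]: "g \<in> borel_measurable lborel" using g by (simp add: L2_fun_def)
  have "(\<lambda>k. (LBINT x. (norm (f k x - F x))^2)) \<longlonglongrightarrow> integral\<^sup>L lborel (\<lambda>_::real. 0 :: real)"
  proof (rule integral_dominated_convergence[where w="\<lambda>x. (2 * norm (g x))^2" and f="\<lambda>_::real. 0 :: real" and M=lborel and s="\<lambda>k x. (norm (f k x - F x))^2"])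
    show "integrable lborel (\<lambda>x. (2 * norm (g x))^2)"
      using g by (simp add: L2_fun_def power_mult_distrib)
    show "AE x in lborel. (\<lambda>k. (norm (f k x - F x))^2) \<longlonglongrightarrow> 0"
    proof (rule AE_I2)
      fix x
      have "(\<lambda>k. (norm (f k x - F x))^2) \<longlonglongrightarrow> (norm (F x - F x))^2" by (intro tendsto_intros lim)
      then show "(\<lambda>k. (norm (f k x - F x))^2) \<longlonglongrightarrow> 0" by simp
    qed
    show "AE x in lborel. norm ((norm (f k x - F x))^2) \<le> (2 * norm (g x))^2" for k
    proof (rule AE_I2)
      fix x
      have "norm (f k x - F x) \<le> norm (f k x) + norm (F x)" by (rule norm_triangle_ineq4)
      also have "\<dots> \<le> 2 * norm (g x)" using dom[of k x] domF[of x] by simp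
      finally show "norm ((norm (f k x - F x))^2) \<le> (2 * norm (g x))^2"
        using power_mono[of "norm (f k x - F x)" "2 * norm (g x)" 2] by simp
    qed
  qed measurable
  then have "(\<lambda>k. sqrt (LBINT x. (norm (f k x - F x))^2)) \<longlonglongrightarrow> sqrt 0"
    by (intro tendsto_real_sqrt) simp
  then show "(\<lambda>k. L2norm (\<lambda>x. f k x - F x)) \<longlonglongrightarrow> 0" unfolding L2norm_def by simp
qed

lemma L2_integral_tendsto2:
  fixes f g :: "'i \<Rightarrow> real \<Rightarrow> complex"
  assumes f: "\<And>k. L2_fun (f k)" "L2_fun F" "((\<lambda>k. L2norm (\<lambda>x. f k x - F x)) \<longlongrightarrow> 0) net"
    and g: "\<And>k. L2_fun (g k)" "L2_fun G" "((\<lambda>k. L2norm (\<lambda>x. g k x - G x)) \<longlongrightarrow> 0) net"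
  shows "((\<lambda>k. (LBINT x. f k x * g k x)) \<longlongrightarrow> (LBINT x. F x * G x)) net"
proof -
  have *: "((\<lambda>k. (LBINT x. f k x * (g k x - G x))) \<longlongrightarrow> 0) net"
  proof (rule Lim_null_comparison)
    show "\<forall>\<^sub>F k in net. norm (LBINT x. f k x * (g k x - G x)) \<le> L2norm (f k) * L2norm (\<lambda>x. g k x - G x)"
      by (intro always_eventually allI L2_integral_mult_le f L2_fun_diff g)
    show "((\<lambda>k. L2norm (f k) * L2norm (\<lambda>x. g k x - G x)) \<longlongrightarrow> 0) net"
      using tendsto_mult[OF L2norm_tendsto[OF f] g(3)] by simp
  qed
  have "(LBINT x. f k x * (g k x - G x)) + (LBINT x. f k x * G x) = (LBINT x. f k x * g k x)" for k
    by (subst Bochner_Integration.integral_add[symmetric])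
       (auto intro!: L2_mult_integrable f g L2_fun_diff simp: algebra_simps)
  then show ?thesis using tendsto_add[OF * L2_integral_tendsto[OF f g(2)]] by simp
qed

text \<open>The exchanges of integrals below all have this shape: a bounded oscillating kernel times
  a product of two integrable functions. Absolute integrability on the plane is settled here once
  and for all.\<close>

lemma lborel_pair_kernel_integrable:
  fixes f g :: "real \<Rightarrow> complex" and k :: "real \<Rightarrow> real \<Rightarrow> complex"
  assumes f: "integrable lborel f" and g: "integrable lborel g"
    and [measurable]: "case_prod k \<in> borel_measurable (lborel \<Otimes>\<^sub>M lborel)" and k: "\<And>x y. norm (k x y) \<le> C"
  shows "integrable (lborel \<Otimes>\<^sub>M lborel) (\<lambda>(x, y). k x y * (f x * g y))"
proof -
  have [measurable]: "f \<in> borel_measurable lborel" "g \<in> borel_measurable lborel" using f g by auto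
  have C: "0 \<le> C" using k[of 0 0] norm_ge_zero order_trans by blast
  have "integrable (lborel \<Otimes>\<^sub>M lborel) (\<lambda>(x, y). f x * g y)"
  proof (rule lborel_pair.Fubini_integrable)
    have "(\<lambda>x. (LBINT y. norm (case (x, y) of (x, y) \<Rightarrow> f x * g y))) = (\<lambda>x. norm (f x) * (LBINT y. norm (g y)))"
      by (simp add: norm_mult)
    then show "integrable lborel (\<lambda>x. (LBINT y. norm (case (x, y) of (x, y) \<Rightarrow> f x * g y)))" using f by simp
    show "AE x in lborel. integrable lborel (\<lambda>y. case (x, y) of (x, y) \<Rightarrow> f x * g y)" using g by simp
  qed measurable
  then have "integrable (lborel \<Otimes>\<^sub>M lborel) (\<lambda>z. C * norm (case z of (x, y) \<Rightarrow> f x * g y))" by simp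
  then show ?thesis
  proof (rule Bochner_Integration.integrable_bound)
    show "AE z in lborel \<Otimes>\<^sub>M lborel. norm (case z of (x, y) \<Rightarrow> k x y * (f x * g y)) \<le> norm (C * norm (case z of (x, y) \<Rightarrow> f x * g y))"
      using k C by (auto simp: norm_mult intro!: AE_I2 mult_right_mono)
  qed measurable
qed

lemma complex_indicator: "complex_of_real (indicator A x) = indicator A x"
  by (simp split: split_indicator)

lemma integrable_indicator_Icc: "integrable lborel (indicator {a..b :: real} :: real \<Rightarrow> complex)"
proof -
  have "integrable lborel (\<lambda>x. complex_of_real (indicator {a..b} x))"
    by (intro integrable_of_real integrable_real_indicator) (auto simp: emeasure_lborel_Icc_eq)
  then show ?thesis by (simp only: complex_indicator)
qed

section \<open>Plancherel theory\<close>

lemma cis_measurable [measurable (raw)]: "f \<in> borel_measurable M \<Longrightarrow> (\<lambda>x. cis (f x)) \<in> borel_measurable M"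
  using measurable_compose[OF _ borel_measurable_continuous_onI[OF continuous_on_cis[OF continuous_on_id]]] by blast

lemma fourier_measurable [measurable (raw)]:
  assumes [measurable]: "f \<in> borel_measurable lborel" "g \<in> borel_measurable M"
  shows "(\<lambda>\<xi>. fourier f (g \<xi>)) \<in> borel_measurable M"
proof -
  have "fourier f \<in> borel_measurable borel" unfolding fourier_def by measurable
  then show ?thesis by (rule measurable_compose[rotated]) measurable
qed

lemma cis_mult_integrable: "integrable lborel f \<Longrightarrow> integrable lborel (\<lambda>x. cis (a * x) * f x)"
  by (rule Bochner_Integration.integrable_bound[of _ f]) (auto simp: norm_mult)

lemma fourier_integrand_integrable: "integrable lborel f \<Longrightarrow> integrable lborel (\<lambda>x. cis (- (x * \<xi>)) * f x)"
  using cis_mult_integrable[of f "-\<xi>"] by (simp add: mult.commute)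

lemma fourier_bound: "norm (fourier f \<xi>) \<le> (LBINT x. norm (f x))"
  unfolding fourier_def by (rule order_trans[OF integral_norm_bound]) (simp add: norm_mult)

lemma fourier_add: "integrable lborel f \<Longrightarrow> integrable lborel g \<Longrightarrow> fourier (\<lambda>x. f x + g x) \<xi> = fourier f \<xi> + fourier g \<xi>"
  using fourier_integrand_integrable[of f \<xi>] fourier_integrand_integrable[of g \<xi>] by (simp add: fourier_def distrib_left)

lemma fourier_diff: "integrable lborel f \<Longrightarrow> integrable lborel g \<Longrightarrow> fourier (\<lambda>x. f x - g x) \<xi> = fourier f \<xi> - fourier g \<xi>"
  using fourier_integrand_integrable[of f \<xi>] fourier_integrand_integrable[of g \<xi>] by (simp add: fourier_def right_diff_distrib)

lemma fourier_cmult: "fourier (\<lambda>x. c * f x) \<xi> = c * fourier f \<xi>"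
  by (simp add: fourier_def mult.left_commute)

text \<open>This is the Dirichlet kernel. The function \<open>sinc\<close> also carries the value at
  \<open>z = 0\<close>, where the antiderivative used otherwise would divide by zero.\<close>

lemma cis_integral:
  assumes "0 \<le> R"
  shows "(LBINT \<xi>. indicator {-R..R} \<xi> * cis (z * \<xi>)) = complex_of_real (2 * R * sinc (R * z))"
proof (cases "z = 0")
  case True
  have "(LBINT \<xi>. (indicator {-R..R} \<xi> :: complex)) = 2 * R"
  proof -
    have "(LBINT \<xi>. (indicator {-R..R} \<xi> :: complex)) = (LBINT \<xi>. complex_of_real (indicator {-R..R} \<xi>))"
      by (intro Bochner_Integration.integral_cong refl) (simp split: split_indicator)
    also have "\<dots> = complex_of_real (measure lborel {-R..R})" by (simp only: integral_complex_of_real integral_indicator) simp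
    finally show ?thesis using assms by simp
  qed
  then show ?thesis using True by simp
next
  case False
  have "(LBINT \<xi>. indicator {-R..R} \<xi> *\<^sub>R cis (z * \<xi>)) = cis (z * R) / (\<i> * z) - cis (z * (-R)) / (\<i> * z)"
  proof (rule integral_FTC_atLeastAtMost)
    show "((\<lambda>x. cis (z * x) / (\<i> * z)) has_vector_derivative cis (z * x)) (at x within {-R..R})" for x
      unfolding has_vector_derivative_def
      by (rule derivative_eq_intros refl | simp)+ (auto simp: False fun_eq_iff scaleR_conv_of_real field_simps)
  qed (use assms in \<open>auto intro!: continuous_intros\<close>)
  also have "\<dots> = (cis (R * z) - cis (- (R * z))) / (\<i> * z)"
    by (simp add: diff_divide_distrib mult.commute)
  also have "\<dots> = 2 * sin (R * z) / z"
    using False by (simp add: complex_eq_iff cis.code Re_divide Im_divide power2_eq_square field_simps)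
  finally have "(LBINT \<xi>. indicator {-R..R} \<xi> *\<^sub>R cis (z * \<xi>)) = 2 * sin (R * z) / z" .
  moreover have "indicator {-R..R} \<xi> *\<^sub>R cis (z * \<xi>) = indicator {-R..R} \<xi> * cis (z * \<xi>)" for \<xi>
    by (simp split: split_indicator)
  ultimately show ?thesis using False by simp
qed

lemma sinc_integral:
  assumes "c \<le> d"
  shows "(LBINT y. indicator {c..d} y * complex_of_real (2 * R * sinc (R * (y - x))))
    = complex_of_real (2 * (Si (R * (d - x)) - Si (R * (c - x))))"
proof -
  have "(LBINT y. indicator {c..d} y *\<^sub>R (2 * R * sinc (R * (y - x)))) = 2 * Si (R * (d - x)) - 2 * Si (R * (c - x))"
  proof (rule integral_FTC_atLeastAtMost)
    fix y
    have "((\<lambda>y. 2 * Si (R * (y - x))) has_real_derivative (2 * (sinc (R * (y - x)) * R))) (at y)"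
      by (rule DERIV_cmult, rule DERIV_chain2[where f=Si, OF DERIV_Si]) (auto intro!: derivative_eq_intros)
    then show "((\<lambda>y. 2 * Si (R * (y - x))) has_vector_derivative (2 * R * sinc (R * (y - x)))) (at y within {c..d})"
      by (auto simp: has_real_derivative_iff_has_vector_derivative mult_ac intro: has_vector_derivative_at_within)
  next
    show "continuous_on {c..d} (\<lambda>y. 2 * R * sinc (R * (y - x)))"
      by (intro continuous_intros)
  qed (use assms in auto)
  then have "(LBINT y. complex_of_real (indicator {c..d} y *\<^sub>R (2 * R * sinc (R * (y - x))))) = complex_of_real (2 * Si (R * (d - x)) - 2 * Si (R * (c - x)))"
    by (simp only: integral_complex_of_real)
  moreover have "complex_of_real (indicator {c..d} y *\<^sub>R (2 * R * sinc (R * (y - x)))) = indicator {c..d} y * complex_of_real (2 * R * sinc (R * (y - x)))" for y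
    by (simp split: split_indicator)
  ultimately show ?thesis by (simp only: right_diff_distrib)
qed

lemma Si_at_bot: "(Si \<longlongrightarrow> - (pi / 2)) at_bot"
proof -
  have "((\<lambda>x. - Si (- x)) \<longlongrightarrow> - (pi / 2)) at_bot"
    using filterlim_compose[OF Si_at_top filterlim_uminus_at_top_at_bot] by (intro tendsto_minus)
  moreover have "- Si (- x) = Si x" for x
    using Si_neg[of x] Si_neg[of "-x"] by (cases "0 \<le> x") auto
  ultimately show ?thesis by simp
qed

lemma Si_scaled_limit:
  assumes "z \<noteq> 0" shows "(\<lambda>n::nat. Si (real n * z)) \<longlonglongrightarrow> sgn z * (pi / 2)"
proof (cases "z > 0")
  case True
  have "filterlim (\<lambda>n. real n * z) at_top sequentially"
    by (rule filterlim_at_top_mult_tendsto_pos[OF tendsto_const True]) (rule filterlim_real_sequentially)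
  from filterlim_compose[OF Si_at_top this] show ?thesis using True by simp
next
  case False
  then have "z < 0" using assms by simp
  have "filterlim (\<lambda>n. real n * z) at_bot sequentially"
    using \<open>z < 0\<close> filterlim_tendsto_neg_mult_at_bot[OF tendsto_const \<open>z < 0\<close> filterlim_real_sequentially]
    by (simp add: mult.commute)
  from filterlim_compose[OF Si_at_bot this] show ?thesis using \<open>z < 0\<close> by simp
qed

text \<open>The cut-off in \<xi> is what permits Fubini: the transform of an indicator decays only
  like \<open>1 / \<xi>\<close>, so the uncut double integral need not converge absolutely.
  Integration over \<xi> leaves the Dirichlet kernel, whose integral over the interval is a
  difference of two values of \<open>Si\<close>.\<close>

lemma fourier_inner_interval_cutoff:
  fixes f :: "real \<Rightarrow> complex"
  assumes f: "integrable lborel f" and cd: "c \<le> d" and R: "0 \<le> R"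
  shows "(LBINT \<xi>. indicator {-R..R} \<xi> * (fourier f \<xi> * cnj (fourier (indicator {c..d}) \<xi>)))
    = (LBINT x. f x * complex_of_real (2 * (Si (R * (d - x)) - Si (R * (c - x)))))"
proof -
  have [measurable]: "f \<in> borel_measurable lborel" using f by auto
  define e where "e \<xi> = cnj (fourier (indicator {c..d}) \<xi>)" for \<xi>
  have e: "e \<xi> = (LBINT y. cis (y * \<xi>) * indicator {c..d} y)" for \<xi>
  proof -
    have "e \<xi> = (LBINT y. cnj (cis (- (y * \<xi>)) * indicator {c..d} y))"
      unfolding e_def fourier_def by (simp only: Bochner_Integration.integral_cnj)
    also have "\<dots> = (LBINT y. cis (y * \<xi>) * indicator {c..d} y)"
      by (intro Bochner_Integration.integral_cong refl) (simp add: cis_cnj split: split_indicator)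
    finally show ?thesis .
  qed
  have ind: "integrable lborel (indicator {c..d} :: real \<Rightarrow> complex)" "integrable lborel (indicator {-R..R} :: real \<Rightarrow> complex)"
    by (rule integrable_indicator_Icc)+
  have eb: "norm (e \<xi>) \<le> (LBINT x. norm (indicator {c..d} x :: complex))" for \<xi>
    unfolding e_def by (simp add: fourier_bound)
  have [measurable]: "e \<in> borel_measurable lborel" unfolding e_def by measurable
  have inner: "(LBINT \<xi>. indicator {-R..R} \<xi> * cis (- (x * \<xi>)) * e \<xi>)
      = complex_of_real (2 * (Si (R * (d - x)) - Si (R * (c - x))))" for x
  proof -
    have int: "integrable (lborel \<Otimes>\<^sub>M lborel) (\<lambda>(\<xi>, y). cis (y * \<xi> - x * \<xi>) * (indicator {-R..R} \<xi> * indicator {c..d} y))"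
      by (rule lborel_pair_kernel_integrable[OF ind(2,1), where C=1]) (auto simp: split_beta')
    have "(LBINT \<xi>. indicator {-R..R} \<xi> * cis (- (x * \<xi>)) * e \<xi>)
       = (LBINT \<xi>. (LBINT y. cis (y * \<xi> - x * \<xi>) * (indicator {-R..R} \<xi> * indicator {c..d} y)))"
    proof (rule Bochner_Integration.integral_cong[OF refl])
      fix \<xi>
      have "indicator {-R..R} \<xi> * cis (- (x * \<xi>)) * e \<xi> = (LBINT y. (indicator {-R..R} \<xi> * cis (- (x * \<xi>))) * (cis (y * \<xi>) * indicator {c..d} y))"
        unfolding e by simp
      also have "\<dots> = (LBINT y. cis (y * \<xi> - x * \<xi>) * (indicator {-R..R} \<xi> * indicator {c..d} y))"
      proof (rule Bochner_Integration.integral_cong[OF refl])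
        fix y
        have "cis (y * \<xi> - x * \<xi>) = cis (- (x * \<xi>)) * cis (y * \<xi>)" by (simp add: cis_mult)
        then show "(indicator {-R..R} \<xi> * cis (- (x * \<xi>))) * (cis (y * \<xi>) * indicator {c..d} y) = cis (y * \<xi> - x * \<xi>) * (indicator {-R..R} \<xi> * indicator {c..d} y)"
          by (simp only: mult_ac)
      qed
      finally show "indicator {-R..R} \<xi> * cis (- (x * \<xi>)) * e \<xi> = (LBINT y. cis (y * \<xi> - x * \<xi>) * (indicator {-R..R} \<xi> * indicator {c..d} y))" .
    qed
    also have "\<dots> = (LBINT y. (LBINT \<xi>. cis (y * \<xi> - x * \<xi>) * (indicator {-R..R} \<xi> * indicator {c..d} y)))"
      by (rule lborel_pair.Fubini_integral[symmetric]) (use int in simp)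
    also have "\<dots> = (LBINT y. indicator {c..d} y * complex_of_real (2 * R * sinc (R * (y - x))))"
    proof (rule Bochner_Integration.integral_cong[OF refl])
      fix y
      have "(LBINT \<xi>. cis (y * \<xi> - x * \<xi>) * (indicator {-R..R} \<xi> * indicator {c..d} y))
        = (LBINT \<xi>. indicator {c..d} y * (indicator {-R..R} \<xi> * cis ((y - x) * \<xi>)))"
        by (intro Bochner_Integration.integral_cong refl) (simp add: algebra_simps)
      then show "(LBINT \<xi>. cis (y * \<xi> - x * \<xi>) * (indicator {-R..R} \<xi> * indicator {c..d} y))
        = indicator {c..d} y * complex_of_real (2 * R * sinc (R * (y - x)))"
        using cis_integral[OF R, of "y - x"] by (simp only: integral_mult_right_zero)
    qed
    also have "\<dots> = complex_of_real (2 * (Si (R * (d - x)) - Si (R * (c - x))))"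
      by (rule sinc_integral[OF cd])
    finally show ?thesis .
  qed
  have int: "integrable (lborel \<Otimes>\<^sub>M lborel) (\<lambda>(\<xi>, x). (cis (- (x * \<xi>)) * e \<xi>) * (indicator {-R..R} \<xi> * f x))"
  proof (rule lborel_pair_kernel_integrable[OF ind(2) f])
    show "norm (cis (- (x * \<xi>)) * e \<xi>) \<le> (LBINT x. norm (indicator {c..d} x :: complex))" for x \<xi>
      using eb[of \<xi>] by (simp add: norm_mult)
  qed measurable
  have "(LBINT \<xi>. indicator {-R..R} \<xi> * (fourier f \<xi> * e \<xi>))
    = (LBINT \<xi>. (LBINT x. (cis (- (x * \<xi>)) * e \<xi>) * (indicator {-R..R} \<xi> * f x)))"
  proof (rule Bochner_Integration.integral_cong[OF refl])
    fix \<xi>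
    have "indicator {-R..R} \<xi> * (fourier f \<xi> * e \<xi>) = (indicator {-R..R} \<xi> * e \<xi>) * (LBINT x. cis (- (x * \<xi>)) * f x)"
      by (simp add: fourier_def)
    also have "\<dots> = (LBINT x. (indicator {-R..R} \<xi> * e \<xi>) * (cis (- (x * \<xi>)) * f x))"
      by (simp only: integral_mult_right_zero)
    finally show "indicator {-R..R} \<xi> * (fourier f \<xi> * e \<xi>) = (LBINT x. (cis (- (x * \<xi>)) * e \<xi>) * (indicator {-R..R} \<xi> * f x))"
      by (simp only: mult_ac)
  qed
  also have "\<dots> = (LBINT x. (LBINT \<xi>. (cis (- (x * \<xi>)) * e \<xi>) * (indicator {-R..R} \<xi> * f x)))"
    by (rule lborel_pair.Fubini_integral[symmetric]) (use int in simp)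
  also have "\<dots> = (LBINT x. f x * complex_of_real (2 * (Si (R * (d - x)) - Si (R * (c - x)))))"
  proof (rule Bochner_Integration.integral_cong[OF refl])
    fix x
    have "(LBINT \<xi>. (cis (- (x * \<xi>)) * e \<xi>) * (indicator {-R..R} \<xi> * f x)) = (LBINT \<xi>. f x * (indicator {-R..R} \<xi> * cis (- (x * \<xi>)) * e \<xi>))"
      by (simp only: mult_ac)
    then show "(LBINT \<xi>. (cis (- (x * \<xi>)) * e \<xi>) * (indicator {-R..R} \<xi> * f x)) = f x * complex_of_real (2 * (Si (R * (d - x)) - Si (R * (c - x))))"
      using inner[of x] by (simp only: integral_mult_right_zero)
  qed
  finally show ?thesis unfolding e_def .
qed

text \<open>As the cut-off grows, \<open>Si (n * (d - x)) - Si (n * (c - x))\<close> tends to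
  \<open>pi\<close> inside the interval and to \<open>0\<close> outside; twice this is the factor
  \<open>2 * pi\<close> of Plancherel's identity. Boundedness of \<open>Si\<close> supplies the
  dominating multiple of \<open>norm (f x)\<close>.\<close>

lemma fourier_inner_interval:
  fixes f :: "real \<Rightarrow> complex"
  assumes f: "integrable lborel f"
  shows "(\<lambda>n::nat. (LBINT \<xi>. indicator {-real n..real n} \<xi> * (fourier f \<xi> * cnj (fourier (indicator {c..d}) \<xi>))))
    \<longlonglongrightarrow> 2 * pi * (LBINT x. f x * indicator {c..d} x)"
proof (cases "c \<le> d")
  case False
  then show ?thesis by (simp add: fourier_def)
next
  case True
  have [measurable]: "f \<in> borel_measurable lborel" using f by auto
  obtain B where B: "\<And>T. \<bar>Si T\<bar> \<le> B" using bounded_Si by blast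
  have "(\<lambda>n::nat. (LBINT x. f x * complex_of_real (2 * (Si (real n * (d - x)) - Si (real n * (c - x))))))
     \<longlonglongrightarrow> (LBINT x. f x * (2 * pi * indicator {c..d} x))"
  proof (rule integral_dominated_convergence[where w="\<lambda>x. (4 * B) * norm (f x)"])
    show "integrable lborel (\<lambda>x. (4 * B) * norm (f x))" using f by simp
    \<comment> \<open>At the two end points the limit differs from the claimed value, so they are
      left out as a null set.\<close>
    show "AE x in lborel. (\<lambda>n::nat. f x * complex_of_real (2 * (Si (real n * (d - x)) - Si (real n * (c - x))))) \<longlonglongrightarrow> f x * (2 * pi * indicator {c..d} x)"
      using AE_lborel_singleton[of c] AE_lborel_singleton[of d]
    proof eventually_elim
      case (elim x)
      have "(\<lambda>n::nat. f x * complex_of_real (2 * (Si (real n * (d - x)) - Si (real n * (c - x))))) \<longlonglongrightarrow>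
         f x * complex_of_real (2 * (sgn (d - x) * (pi / 2) - sgn (c - x) * (pi / 2)))"
        by (intro tendsto_intros Si_scaled_limit) (use elim in auto)
      moreover have "complex_of_real (2 * (sgn (d - x) * (pi / 2) - sgn (c - x) * (pi / 2))) = 2 * pi * indicator {c..d} x"
        using elim True by (auto split: split_indicator simp: sgn_if)
      ultimately show ?case by simp
    qed
    show "AE x in lborel. norm (f x * complex_of_real (2 * (Si (real n * (d - x)) - Si (real n * (c - x))))) \<le> (4 * B) * norm (f x)" for n
    proof (rule AE_I2)
      fix x
      have "\<bar>2 * (Si (real n * (d - x)) - Si (real n * (c - x)))\<bar> \<le> 4 * B"
      proof -
        have "\<bar>a\<bar> \<le> B \<Longrightarrow> \<bar>b\<bar> \<le> B \<Longrightarrow> \<bar>2 * (a - b)\<bar> \<le> 4 * B" for a b by (auto simp: abs_le_iff)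
        then show ?thesis using B by blast
      qed
      then show "norm (f x * complex_of_real (2 * (Si (real n * (d - x)) - Si (real n * (c - x))))) \<le> (4 * B) * norm (f x)"
        unfolding norm_mult norm_of_real by (subst mult.commute) (rule mult_right_mono, auto)
    qed
  qed measurable
  moreover have "(LBINT x. f x * (2 * pi * indicator {c..d} x)) = 2 * pi * (LBINT x. f x * indicator {c..d} x)"
    by (subst integral_mult_right_zero[symmetric]) (intro Bochner_Integration.integral_cong refl, simp split: split_indicator)
  ultimately show ?thesis by (simp add: fourier_inner_interval_cutoff[OF f True])
qed

section \<open>Density of the step functions in \<open>L\<^sup>2\<close>\<close>

text \<open>The closed intervals may overlap. Sums and multiples are then step functions again
  without a common refinement, and linearity of the transform reduces everything to one
  interval.\<close>

inductive step_fun :: "(real \<Rightarrow> complex) \<Rightarrow> bool" where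
  step_zero: "step_fun (\<lambda>x. 0)"
| step_add: "step_fun f \<Longrightarrow> step_fun (\<lambda>x. f x + c * indicator {a..b} x)"

lemma step_fun_interval: "step_fun (\<lambda>x. c * indicator {a..b} x)"
  using step_add[OF step_zero, of c a b] by simp

lemma step_fun_plus: "step_fun g \<Longrightarrow> step_fun f \<Longrightarrow> step_fun (\<lambda>x. f x + g x)"
proof (induction rule: step_fun.induct)
  case (step_add g c a b)
  from step_fun.step_add[OF step_add.IH[OF step_add.prems], of c a b] show ?case by (simp add: add.assoc)
qed simp

lemma step_fun_cmult: "step_fun f \<Longrightarrow> step_fun (\<lambda>x. d * f x)"
proof (induction rule: step_fun.induct)
  case step_zero
  show ?case using step_fun.step_zero by simp
next
  case (step_add f c a b)
  from step_fun.step_add[OF step_add.IH, of "d * c" a b] show ?case by (simp add: distrib_left mult.assoc)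
qed

lemma step_fun_minus: "step_fun f \<Longrightarrow> step_fun g \<Longrightarrow> step_fun (\<lambda>x. f x - g x)"
  using step_fun_plus[of "\<lambda>x. (-1) * g x" f] step_fun_cmult[of g "-1"] by simp

text \<open>Approximants of a function on \<open>[-R, R]\<close> can thus be taken to vanish outside
  this interval, where convergence in \<open>L2norm\<close> implies convergence in
  \<open>L\<^sup>1\<close>.\<close>

lemma step_fun_restrict: "step_fun f \<Longrightarrow> step_fun (\<lambda>x. indicator {c..d} x *\<^sub>R f x)"
proof (induction rule: step_fun.induct)
  case step_zero
  show ?case using step_fun.step_zero by simp
next
  case (step_add f e a b)
  have "indicator {c..d} x *\<^sub>R (f x + e * indicator {a..b} x) = indicator {c..d} x *\<^sub>R f x + e * indicator {max c a..min d b} x" for x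
    by (auto split: split_indicator)
  then show ?case using step_fun.step_add[OF step_add.IH, of e "max c a" "min d b"] by simp
qed

lemma step_fun_L1: "step_fun f \<Longrightarrow> integrable lborel f"
  by (induction rule: step_fun.induct) (auto intro!: Bochner_Integration.integrable_add integrable_indicator_Icc)

lemma L2_fun_indicator_Icc: "L2_fun (\<lambda>x. c * indicator {a..b} x :: complex)"
proof (rule L2_fun_cmult)
  have "integrable lborel (\<lambda>x. indicator {a..b} x :: real)"
    by (intro integrable_real_indicator) (auto simp: emeasure_lborel_Icc_eq)
  moreover have "(norm (indicator {a..b} x :: complex))\<^sup>2 = indicator {a..b} x" for x by (simp split: split_indicator)
  ultimately show "L2_fun (indicator {a..b} :: real \<Rightarrow> complex)" unfolding L2_fun_def by simp
qed

lemma step_fun_L2: "step_fun f \<Longrightarrow> L2_fun f"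
proof (induction rule: step_fun.induct)
  case step_zero
  then show ?case by (simp add: L2_fun_def)
qed (intro L2_fun_add L2_fun_indicator_Icc)

definition L2_approx :: "(real \<Rightarrow> complex) \<Rightarrow> bool" where
  "L2_approx f \<longleftrightarrow> L2_fun f \<and> (\<forall>e>0. \<exists>s. step_fun s \<and> L2norm (\<lambda>x. f x - s x) < e)"

lemma L2_approx_step: "step_fun s \<Longrightarrow> L2_approx s"
  unfolding L2_approx_def using step_fun_L2[of s] by (auto intro!: exI[of _ s] simp: L2norm_def)

lemma L2_approx_limit:
  assumes F: "L2_fun F" and lim: "(\<lambda>k. L2norm (\<lambda>x. f k x - F x)) \<longlonglongrightarrow> 0" and f: "\<And>k. L2_approx (f k)"
  shows "L2_approx F"
  unfolding L2_approx_def
proof (intro conjI allI impI F)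
  fix e :: real assume "e > 0"
  then obtain k where k: "L2norm (\<lambda>x. f k x - F x) < e / 2"
    using order_tendstoD(2)[OF lim, of "e/2"] eventually_happens[of _ sequentially] by (auto simp: eventually_sequentially)
  obtain s where s: "step_fun s" "L2norm (\<lambda>x. f k x - s x) < e / 2"
    using f[of k] \<open>e > 0\<close> unfolding L2_approx_def by (meson half_gt_zero)
  have "L2norm (\<lambda>x. F x - s x) \<le> L2norm (\<lambda>x. F x - f k x) + L2norm (\<lambda>x. f k x - s x)"
    by (rule L2norm_triangle_diff) (use F f s step_fun_L2 in \<open>auto simp: L2_approx_def\<close>)
  then show "\<exists>s. step_fun s \<and> L2norm (\<lambda>x. F x - s x) < e"
    using k s by (intro exI[of _ s]) (simp add: L2norm_minus_commute[of F "f k"])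
qed

lemma L2_approx_seq:
  assumes "L2_approx f"
  obtains s where "\<And>k. step_fun (s k)" "(\<lambda>k. L2norm (\<lambda>x. s k x - f x)) \<longlonglongrightarrow> 0"
proof -
  have "\<exists>s. step_fun s \<and> L2norm (\<lambda>x. f x - s x) < inverse (real (Suc k))" for k
    using assms unfolding L2_approx_def by simp
  then obtain s where s: "\<And>k. step_fun (s k)" "\<And>k. L2norm (\<lambda>x. f x - s k x) < inverse (real (Suc k))" by metis
  have "(\<lambda>k. L2norm (\<lambda>x. s k x - f x)) \<longlonglongrightarrow> 0"
    by (rule Lim_null_comparison[OF _ LIMSEQ_inverse_real_of_nat])
       (use s(2) in \<open>auto simp: L2norm_minus_commute[of _ f] intro!: always_eventually less_imp_le\<close>)
  then show ?thesis using that s(1) by blast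
qed

lemma L2_approx_add:
  assumes f: "L2_approx f" and g: "L2_approx g" shows "L2_approx (\<lambda>x. f x + g x)"
proof -
  obtain s where s: "\<And>k. step_fun (s k)" "(\<lambda>k. L2norm (\<lambda>x. s k x - f x)) \<longlonglongrightarrow> 0" using L2_approx_seq[OF f] by blast
  obtain r where r: "\<And>k. step_fun (r k)" "(\<lambda>k. L2norm (\<lambda>x. r k x - g x)) \<longlonglongrightarrow> 0" using L2_approx_seq[OF g] by blast
  have L2: "L2_fun f" "L2_fun g" using f g by (auto simp: L2_approx_def)
  show ?thesis
  proof (rule L2_approx_limit[where f="\<lambda>k x. s k x + r k x"])
    show "(\<lambda>k. L2norm (\<lambda>x. (s k x + r k x) - (f x + g x))) \<longlonglongrightarrow> 0"
    proof (rule Lim_null_comparison)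
      show "\<forall>\<^sub>F k in sequentially. norm (L2norm (\<lambda>x. (s k x + r k x) - (f x + g x))) \<le> L2norm (\<lambda>x. s k x - f x) + L2norm (\<lambda>x. r k x - g x)"
      proof (intro always_eventually allI)
        fix k
        show "norm (L2norm (\<lambda>x. (s k x + r k x) - (f x + g x))) \<le> L2norm (\<lambda>x. s k x - f x) + L2norm (\<lambda>x. r k x - g x)"
          using L2norm_triangle[OF L2_fun_diff[OF step_fun_L2[OF s(1)[of k]] L2(1)] L2_fun_diff[OF step_fun_L2[OF r(1)[of k]] L2(2)]]
          by (simp add: algebra_simps)
      qed
      show "(\<lambda>k. L2norm (\<lambda>x. s k x - f x) + L2norm (\<lambda>x. r k x - g x)) \<longlonglongrightarrow> 0"
        using tendsto_add[OF s(2) r(2)] by simp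
    qed
  qed (use L2 s r L2_approx_step step_fun_plus L2_fun_add in auto)
qed

lemma L2_approx_cmult:
  assumes f: "L2_approx f" shows "L2_approx (\<lambda>x. c * f x)"
proof -
  obtain s where s: "\<And>k. step_fun (s k)" "(\<lambda>k. L2norm (\<lambda>x. s k x - f x)) \<longlonglongrightarrow> 0" using L2_approx_seq[OF f] by blast
  have L2: "L2_fun f" using f by (auto simp: L2_approx_def)
  show ?thesis
  proof (rule L2_approx_limit[where f="\<lambda>k x. c * s k x"])
    have "(\<lambda>k. norm c * L2norm (\<lambda>x. s k x - f x)) \<longlonglongrightarrow> 0" using tendsto_mult_left_zero[OF s(2)] tendsto_mult_right_zero[OF s(2)] by auto
    then show "(\<lambda>k. L2norm (\<lambda>x. c * s k x - c * f x)) \<longlonglongrightarrow> 0"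
      by (simp only: right_diff_distrib[symmetric] L2norm_cmult)
  qed (use L2 s L2_approx_step step_fun_cmult L2_fun_cmult in auto)
qed

lemma L2_approx_sum: "finite I \<Longrightarrow> (\<And>i. i \<in> I \<Longrightarrow> L2_approx (f i)) \<Longrightarrow> L2_approx (\<lambda>x. \<Sum>i\<in>I. f i x)"
proof (induction rule: finite_induct)
  case empty
  then show ?case using L2_approx_step[OF step_zero] by simp
next
  case (insert i I)
  then show ?case using L2_approx_add[of "f i" "\<lambda>x. \<Sum>i\<in>I. f i x"] by simp
qed

text \<open>Induction over the generation of the Borel sets by intervals. The intersection with
  \<open>{-N..N}\<close> turns a complement into a subtraction from one interval and dominates the
  partial sums in the case of a disjoint union.\<close>

lemma L2_approx_borel:
  assumes "A \<in> sets borel" shows "L2_approx (indicator (A \<inter> {-N..N}))"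
  using assms
proof (induction A rule: borel_set_induct)
  case empty
  show ?case using L2_approx_step[OF step_zero] by simp
next
  case (interval a b)
  have "indicator ({a..b} \<inter> {-N..N}) = (\<lambda>x. 1 * indicator {max a (-N)..min b N} x :: complex)"
    by (auto simp: fun_eq_iff split: split_indicator)
  then show ?case using L2_approx_step[OF step_fun_interval] by metis
next
  case (compl A)
  have "indicator (- A \<inter> {-N..N}) = (\<lambda>x. 1 * indicator {-N..N} x + (-1) * indicator (A \<inter> {-N..N}) x :: complex)"
    by (auto simp: fun_eq_iff split: split_indicator)
  then show ?case using L2_approx_add[OF L2_approx_step[OF step_fun_interval] L2_approx_cmult[OF compl(2)]] by metis
next
  case (union A)
  have m[measurable]: "A i \<in> sets borel" for i using union by auto
  let ?f = "\<lambda>n x. \<Sum>i<n. indicator (A i \<inter> {-N..N}) x :: complex"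
  have disj: "(\<Sum>i<n. indicator (A i \<inter> {-N..N}) x) = (indicator ((\<Union>i<n. A i) \<inter> {-N..N}) x :: complex)" for n x
  proof (induction n)
    case (Suc n)
    have "x \<in> A n \<Longrightarrow> i < n \<Longrightarrow> x \<notin> A i" for i
      using union(1)[unfolded disjoint_family_on_def, rule_format, of i n] by auto
    then show ?case using Suc by (auto simp: lessThan_Suc split: split_indicator)
  qed simp
  have "L2_fun (indicator (\<Union> (range A) \<inter> {-N..N}) :: real \<Rightarrow> complex)"
    by (rule L2_fun_bound[where f="\<lambda>x. 1 * indicator {-N..N} x :: complex" and C=1, OF L2_fun_indicator_Icc])
       (auto simp: indicator_def)
  moreover have "(\<lambda>n. L2norm (\<lambda>x. ?f n x - indicator (\<Union> (range A) \<inter> {-N..N}) x)) \<longlonglongrightarrow> 0"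
  proof (rule L2_dominated_tendsto(2)[where g="\<lambda>x. 1 * indicator {-N..N} x :: complex"])
    show "L2_fun (\<lambda>x. 1 * indicator {-N..N} x :: complex)" by (rule L2_fun_indicator_Icc)
    show "norm (?f n x) \<le> norm (1 * indicator {-N..N} x :: complex)" for n x
      unfolding disj by (auto split: split_indicator)
    show "(\<lambda>n. ?f n x) \<longlonglongrightarrow> indicator (\<Union> (range A) \<inter> {-N..N}) x" for x
    proof (cases "x \<in> \<Union> (range A)")
      case True
      then obtain i where "x \<in> A i" by auto
      have "eventually (\<lambda>n. ?f n x = indicator (\<Union> (range A) \<inter> {-N..N}) x) sequentially"
        by (rule eventually_mono[OF eventually_gt_at_top[of i]]) (use \<open>x \<in> A i\<close> in \<open>auto simp: disj split: split_indicator\<close>)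
      then show ?thesis by (rule tendsto_eventually)
    next
      case False
      then have "?f n x = 0" for n unfolding disj by (auto simp: indicator_def)
      moreover have "indicator (\<Union> (range A) \<inter> {-N..N}) x = (0 :: complex)" using False by (auto simp: indicator_def)
      ultimately show ?thesis by simp
    qed
  qed measurable
  ultimately show ?case by (rule L2_approx_limit[where f="?f"]) (intro L2_approx_sum union finite_lessThan)
qed

theorem L2_fun_approx:
  assumes f: "L2_fun f" shows "L2_approx f"
proof -
  have fm[measurable]: "f \<in> borel_measurable lborel" using f by (simp add: L2_fun_def)
  obtain F where F: "\<And>i. simple_function lborel (F i)" "\<And>x. (\<lambda>i. F i x) \<longlonglongrightarrow> f x"
     "\<And>i x. dist (F i x) 0 \<le> 2 * dist (f x) 0"
    using borel_measurable_implies_sequence_metric[OF fm, of 0] by (auto simp: space_lborel)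
  have [measurable]: "F i \<in> borel_measurable lborel" for i using F(1) borel_measurable_simple_function by blast
  let ?g = "\<lambda>i x. indicator {-real i..real i} x *\<^sub>R F i x"
  have "(\<lambda>i. L2norm (\<lambda>x. ?g i x - f x)) \<longlonglongrightarrow> 0"
  proof (rule L2_dominated_tendsto(2)[where g="\<lambda>x. 2 * f x"])
    show "L2_fun (\<lambda>x. 2 * f x)" using f by (rule L2_fun_cmult)
    show "norm (?g i x) \<le> norm (2 * f x)" for i x
      using F(3)[of i x] by (auto simp: norm_mult split: split_indicator)
    show "(\<lambda>i. ?g i x) \<longlonglongrightarrow> f x" for x
    proof (rule Lim_transform_eventually[OF F(2)])
      obtain n :: nat where "\<bar>x\<bar> \<le> n" using real_arch_simple by blast
      show "eventually (\<lambda>i. F i x = ?g i x) sequentially"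
        using eventually_ge_at_top[of n]
      proof eventually_elim
        case (elim i)
        then have "real n \<le> real i" by simp
        then have "\<bar>x\<bar> \<le> real i" using \<open>\<bar>x\<bar> \<le> n\<close> by linarith
        then show ?case by (auto simp: indicator_def)
      qed
    qed
  qed measurable
  moreover have "L2_approx (?g i)" for i
  proof -
    have fin: "finite (range (F i))" using F(1)[of i] by (auto simp: simple_function_def space_lborel)
    have "?g i x = (\<Sum>y\<in>range (F i). y * indicator ((F i -` {y}) \<inter> {-real i..real i}) x)" for x
    proof -
      have "(\<Sum>y\<in>range (F i). y * indicator ((F i -` {y}) \<inter> {-real i..real i}) x) = (\<Sum>y\<in>{F i x}. y * indicator ((F i -` {y}) \<inter> {-real i..real i}) x)"
        by (rule sum.mono_neutral_right) (use fin in \<open>auto simp: indicator_def\<close>)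
      then show ?thesis by (simp add: indicator_def)
    qed
    moreover have "L2_approx (\<lambda>x. \<Sum>y\<in>range (F i). y * indicator ((F i -` {y}) \<inter> {-real i..real i}) x)"
    proof (intro L2_approx_sum fin L2_approx_cmult L2_approx_borel)
      fix y show "F i -` {y} \<in> sets borel"
        using measurable_sets[of "F i" lborel borel "{y}"] by (simp add: space_lborel)
    qed
    ultimately show ?thesis by presburger
  qed
  ultimately show ?thesis by (rule L2_approx_limit[OF f])
qed

lemma L2_fun_step_seq:
  assumes "L2_fun f"
  obtains s where "\<And>k. step_fun (s k)" "(\<lambda>k. L2norm (\<lambda>x. s k x - f x)) \<longlonglongrightarrow> 0"
  using L2_approx_seq[OF L2_fun_approx[OF assms]] by blast

section \<open>Plancherel's identity: step functions, truncations, all of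
  \<open>L\<^sup>2\<close>\<close>

text \<open>The identity is kept as a limit of cut-off integrals because the product of the two
  transforms is not yet known to be integrable. In this form it is additive in \<open>g\<close>, and
  the induction adds one interval at a time.\<close>

lemma fourier_step_inner:
  assumes f: "integrable lborel f" and "step_fun g"
  shows "(\<lambda>n::nat. (LBINT \<xi>. indicator {-real n..real n} \<xi> * (fourier f \<xi> * cnj (fourier g \<xi>))))
    \<longlonglongrightarrow> 2 * pi * (LBINT x. f x * cnj (g x))"
  using assms(2)
proof (induction rule: step_fun.induct)
  case step_zero
  then show ?case by (simp add: fourier_def)
next
  case (step_add g c a b)
  have [measurable]: "f \<in> borel_measurable lborel" "g \<in> borel_measurable lborel" using f step_fun_L1[OF step_add(1)] by auto
  have int: "integrable lborel (\<lambda>\<xi>. indicator {-real n..real n} \<xi> * (fourier f \<xi> * cnj (fourier h \<xi>)))" if "integrable lborel h" for h and n :: nat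
  proof (rule Bochner_Integration.integrable_bound[where f="\<lambda>\<xi>. ((LBINT x. norm (f x)) * (LBINT x. norm (h x))) *\<^sub>R (indicator {-real n..real n} \<xi> :: complex)"])
    show "integrable lborel (\<lambda>\<xi>. ((LBINT x. norm (f x)) * (LBINT x. norm (h x))) *\<^sub>R (indicator {-real n..real n} \<xi> :: complex))"
      by (intro integrable_scaleR_right integrable_indicator_Icc)
    have [measurable]: "h \<in> borel_measurable lborel" using that by auto
    show "(\<lambda>\<xi>. indicator {-real n..real n} \<xi> * (fourier f \<xi> * cnj (fourier h \<xi>))) \<in> borel_measurable lborel" by measurable
    show "AE \<xi> in lborel. norm (indicator {-real n..real n} \<xi> * (fourier f \<xi> * cnj (fourier h \<xi>)))
      \<le> norm (((LBINT x. norm (f x)) * (LBINT x. norm (h x))) *\<^sub>R (indicator {-real n..real n} \<xi> :: complex))"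
      by (intro AE_I2) (auto simp: norm_mult abs_mult intro!: mult_mono fourier_bound split: split_indicator)
  qed
  let ?i = "indicator {a..b} :: real \<Rightarrow> complex"
  have ci: "integrable lborel (\<lambda>x. c * ?i x)" by (intro integrable_mult_right integrable_indicator_Icc)
  have eq: "(LBINT \<xi>. indicator {-real n..real n} \<xi> * (fourier f \<xi> * cnj (fourier (\<lambda>x. g x + c * ?i x) \<xi>)))
    = (LBINT \<xi>. indicator {-real n..real n} \<xi> * (fourier f \<xi> * cnj (fourier g \<xi>)))
      + cnj c * (LBINT \<xi>. indicator {-real n..real n} \<xi> * (fourier f \<xi> * cnj (fourier ?i \<xi>)))" for n :: nat
  proof -
    have "(LBINT \<xi>. indicator {-real n..real n} \<xi> * (fourier f \<xi> * cnj (fourier (\<lambda>x. g x + c * ?i x) \<xi>)))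
      = (LBINT \<xi>. indicator {-real n..real n} \<xi> * (fourier f \<xi> * cnj (fourier g \<xi>)) + cnj c * (indicator {-real n..real n} \<xi> * (fourier f \<xi> * cnj (fourier ?i \<xi>))))"
      by (intro Bochner_Integration.integral_cong refl)
         (simp add: fourier_add[OF step_fun_L1[OF step_add(1)] ci] fourier_cmult algebra_simps)
    also have "\<dots> = (LBINT \<xi>. indicator {-real n..real n} \<xi> * (fourier f \<xi> * cnj (fourier g \<xi>)))
      + (LBINT \<xi>. cnj c * (indicator {-real n..real n} \<xi> * (fourier f \<xi> * cnj (fourier ?i \<xi>))))"
      by (rule Bochner_Integration.integral_add)
         (intro int integrable_mult_right step_fun_L1[OF step_add(1)] integrable_indicator_Icc)+
    finally show ?thesis by (simp only: integral_mult_right_zero)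
  qed
  have intf: "integrable lborel (\<lambda>x. f x * cnj (h x))" if "step_fun h" for h
    using that
  proof (induction rule: step_fun.induct)
    case (step_add h c a b)
    have "integrable lborel (\<lambda>x. cnj c * (f x * indicator {a..b} x))"
      by (intro integrable_mult_right Bochner_Integration.integrable_bound[OF f]) (auto split: split_indicator)
    from Bochner_Integration.integrable_add[OF step_add.IH this] show ?case
      by (rule Bochner_Integration.integrable_cong[THEN iffD1, rotated 2]) (auto simp: algebra_simps split: split_indicator)
  qed simp
  have "(LBINT x. f x * cnj (g x + c * ?i x)) = (LBINT x. f x * cnj (g x) + cnj c * (f x * ?i x))"
    by (intro Bochner_Integration.integral_cong refl) (auto simp: algebra_simps split: split_indicator)
  also have "\<dots> = (LBINT x. f x * cnj (g x)) + (LBINT x. cnj c * (f x * ?i x))"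
    by (rule Bochner_Integration.integral_add[OF intf[OF step_add(1)]])
       (intro integrable_mult_right Bochner_Integration.integrable_bound[OF f], auto split: split_indicator)
  also have "\<dots> = (LBINT x. f x * cnj (g x)) + cnj c * (LBINT x. f x * ?i x)" by (simp only: integral_mult_right_zero)
  finally have "2 * pi * (LBINT x. f x * cnj (g x + c * ?i x))
    = 2 * pi * (LBINT x. f x * cnj (g x)) + cnj c * (2 * pi * (LBINT x. f x * ?i x))"
    by (simp only: distrib_left mult_ac)
  then show ?case unfolding eq
    using tendsto_add[OF step_add.IH tendsto_mult[OF tendsto_const[of "cnj c"] fourier_inner_interval[OF f, of a b]]] by presburger
qed

text \<open>For \<open>f = g = s\<close> the cut-off integrals are nonnegative and increasing, so
  their convergence yields integrability of the squared transform as well as the value of its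
  integral.\<close>

lemma fourier_step_L2:
  assumes s: "step_fun s"
  shows "L2_fun (fourier s)" "L2norm (fourier s) = sqrt (2 * pi) * L2norm s"
proof -
  have [measurable]: "s \<in> borel_measurable lborel" using step_fun_L1[OF s] by auto
  define I where "I n = (LBINT \<xi>. (indicator {-real n..real n} \<xi> * (norm (fourier s \<xi>))^2))" for n :: nat
  have "complex_of_real (I n) = (LBINT \<xi>. indicator {-real n..real n} \<xi> * (fourier s \<xi> * cnj (fourier s \<xi>)))" for n
    unfolding I_def by (subst integral_complex_of_real[symmetric])
      (intro Bochner_Integration.integral_cong refl, auto simp: complex_norm_square[symmetric] split: split_indicator)
  moreover have "(LBINT x. s x * cnj (s x)) = complex_of_real ((L2norm s)^2)"
    unfolding L2norm_sq by (subst integral_complex_of_real[symmetric])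
      (intro Bochner_Integration.integral_cong refl, auto simp: complex_norm_square[symmetric])
  ultimately have "(\<lambda>n. complex_of_real (I n)) \<longlonglongrightarrow> complex_of_real (2 * pi * (L2norm s)^2)"
    using fourier_step_inner[OF step_fun_L1[OF s] s] by simp
  then have lim: "I \<longlonglongrightarrow> 2 * pi * (L2norm s)^2" by (simp only: tendsto_of_real_iff)
  have inti: "integrable lborel (\<lambda>\<xi>. indicator {-real n..real n} \<xi> * (norm (fourier s \<xi>))^2)" for n :: nat
  proof (rule Bochner_Integration.integrable_bound[where f="\<lambda>\<xi>. (LBINT x. norm (s x))^2 * indicator {-real n..real n} \<xi>"])
    show "integrable lborel (\<lambda>\<xi>. (LBINT x. norm (s x))^2 * indicator {-real n..real n} \<xi> :: real)"
      by (intro integrable_mult_right integrable_real_indicator) (auto simp: emeasure_lborel_Icc_eq)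
    show "AE \<xi> in lborel. norm (indicator {-real n..real n} \<xi> * (norm (fourier s \<xi>))^2) \<le> norm ((LBINT x. norm (s x))^2 * indicator {-real n..real n} \<xi> :: real)"
      using fourier_bound[of s] by (intro AE_I2) (auto intro!: power_mono split: split_indicator)
  qed measurable
  have "incseq I"
    unfolding I_def
    by (intro incseq_SucI integral_mono inti) (auto split: split_indicator)
  have "integrable lborel (\<lambda>\<xi>. (norm (fourier s \<xi>))^2) \<and> (LBINT \<xi>. (norm (fourier s \<xi>))^2) = 2 * pi * (L2norm s)^2"
  proof (intro conjI)
    have A: "AE \<xi> in lborel. mono (\<lambda>n::nat. indicator {-real n..real n} \<xi> * (norm (fourier s \<xi>))^2)"
      by (intro AE_I2 monoI) (auto split: split_indicator)
    have B: "AE \<xi> in lborel. (\<lambda>n::nat. indicator {-real n..real n} \<xi> * (norm (fourier s \<xi>))^2) \<longlonglongrightarrow> (norm (fourier s \<xi>))^2"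
    proof (intro AE_I2)
      fix \<xi> :: real
      obtain m :: nat where "\<bar>\<xi>\<bar> \<le> m" using real_arch_simple by blast
      have "eventually (\<lambda>n::nat. indicator {-real n..real n} \<xi> * (norm (fourier s \<xi>))^2 = (norm (fourier s \<xi>))^2) sequentially"
        using eventually_ge_at_top[of m]
      proof eventually_elim
        case (elim n)
        then have "real m \<le> real n" by simp
        then have "\<bar>\<xi>\<bar> \<le> real n" using \<open>\<bar>\<xi>\<bar> \<le> m\<close> by linarith
        then show ?case by (auto simp: indicator_def)
      qed
      then show "(\<lambda>n::nat. indicator {-real n..real n} \<xi> * (norm (fourier s \<xi>))^2) \<longlonglongrightarrow> (norm (fourier s \<xi>))^2"
        by (rule tendsto_eventually)
    qed
    have C: "(\<lambda>n. (LBINT \<xi>. indicator {-real n..real n} \<xi> * (norm (fourier s \<xi>))^2)) \<longlonglongrightarrow> 2 * pi * (L2norm s)^2"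
      using lim unfolding I_def .
    have D: "(\<lambda>\<xi>. (norm (fourier s \<xi>))^2) \<in> borel_measurable lborel" by measurable
    show "integrable lborel (\<lambda>\<xi>. (norm (fourier s \<xi>))^2)"
      by (rule integrable_monotone_convergence[OF inti A B C D])
    show "(LBINT \<xi>. (norm (fourier s \<xi>))^2) = 2 * pi * (L2norm s)^2"
      by (rule integral_monotone_convergence[OF inti A B C D])
  qed
  then show "L2_fun (fourier s)" "L2norm (fourier s) = sqrt (2 * pi) * L2norm s"
    by (auto simp: L2_fun_def L2norm_def real_sqrt_mult)
qed

lemma L2_Fatou:
  fixes g :: "nat \<Rightarrow> real \<Rightarrow> complex"
  assumes g: "\<And>l. L2_fun (g l)" and G: "G \<in> borel_measurable lborel" and lim: "AE x in lborel. (\<lambda>l. g l x) \<longlonglongrightarrow> G x"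
    and B: "\<And>l. L2norm (g l) \<le> B l" "B \<longlonglongrightarrow> C"
  shows "L2_fun G" "L2norm G \<le> C"
proof -
  have gm[measurable]: "g l \<in> borel_measurable lborel" for l using g by (simp add: L2_fun_def)
  note G[measurable]
  have B0: "0 \<le> B l" for l using B(1)[of l] L2norm_nonneg order_trans by blast
  have C: "0 \<le> C" by (rule LIMSEQ_le_const[OF B(2)]) (use B0 in auto)
  have "(\<integral>\<^sup>+x. ennreal ((norm (G x))^2) \<partial>lborel) \<le> (\<integral>\<^sup>+x. liminf (\<lambda>l. ennreal ((norm (g l x))^2)) \<partial>lborel)"
  proof (rule nn_integral_mono_AE)
    show "AE x in lborel. ennreal ((norm (G x))^2) \<le> liminf (\<lambda>l. ennreal ((norm (g l x))^2))"
      using lim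
    proof eventually_elim
      case (elim x)
      have "(\<lambda>l. ennreal ((norm (g l x))^2)) \<longlonglongrightarrow> ennreal ((norm (G x))^2)"
        by (intro tendsto_ennrealI tendsto_intros elim)
      from lim_imp_Liminf[OF sequentially_bot this] show ?case by simp
    qed
  qed
  also have "\<dots> \<le> liminf (\<lambda>l. \<integral>\<^sup>+x. ennreal ((norm (g l x))^2) \<partial>lborel)"
    by (rule nn_integral_liminf) measurable
  also have "\<dots> \<le> liminf (\<lambda>l. ennreal ((B l)^2))"
    by (rule Liminf_mono) (auto simp: L2_fun_nn[OF g] intro!: ennreal_leI power_mono B always_eventually)
  also have "\<dots> = ennreal (C^2)"
    by (intro lim_imp_Liminf tendsto_ennrealI tendsto_power B) simp
  finally have "(\<integral>\<^sup>+x. ennreal ((norm (G x))^2) \<partial>lborel) \<le> ennreal (C^2)" .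
  from L2norm_le_nn[OF G this] show "L2_fun G" "L2norm G \<le> C" using C by (auto intro: power2_le_imp_le)
qed

text \<open>Fatou's lemma for \<open>g l - F\<close>, with bounds that tend to \<open>0\<close>,
  identifies the limit in norm with the pointwise limit; no subsequence has to be extracted.\<close>

lemma L2_limit_unique:
  fixes g :: "nat \<Rightarrow> real \<Rightarrow> complex"
  assumes "\<And>l. L2_fun (g l)" "L2_fun F" "G \<in> borel_measurable lborel"
    and "(\<lambda>l. L2norm (\<lambda>x. g l x - F x)) \<longlonglongrightarrow> 0" and "AE x in lborel. (\<lambda>l. g l x) \<longlonglongrightarrow> G x"
  shows "L2_fun G" "AE x in lborel. F x = G x"
proof -
  have m: "(\<lambda>x. G x - F x) \<in> borel_measurable lborel" using assms(2,3) by (intro borel_measurable_diff) (auto simp: L2_fun_def)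
  have l: "AE x in lborel. (\<lambda>l. g l x - F x) \<longlonglongrightarrow> G x - F x"
    using assms(5) by eventually_elim (intro tendsto_intros)
  have *: "L2_fun (\<lambda>x. G x - F x)" "L2norm (\<lambda>x. G x - F x) \<le> 0"
    by (rule L2_Fatou[OF L2_fun_diff[OF assms(1,2)] m l order_refl assms(4)])+
  show "L2_fun G" using L2_fun_add[OF *(1) assms(2)] by simp
  have "L2norm (\<lambda>x. G x - F x) = 0" using *(2) L2norm_nonneg[of "\<lambda>x. G x - F x"] by linarith
  from L2norm_0_AE[OF *(1) this] show "AE x in lborel. F x = G x" by eventually_elim simp
qed

abbreviation trunc :: "real \<Rightarrow> (real \<Rightarrow> complex) \<Rightarrow> real \<Rightarrow> complex" where
  "trunc R f \<equiv> (\<lambda>x. indicator {-R..R} x *\<^sub>R f x)"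

lemma trunc_L1_bound:
  assumes f: "L2_fun f"
  shows "integrable lborel (trunc R f)" "(LBINT x. norm (trunc R f x)) \<le> L2norm (indicator {-R..R} :: real \<Rightarrow> complex) * L2norm f"
proof -
  have i: "L2_fun (indicator {-R..R} :: real \<Rightarrow> complex)" using L2_fun_indicator_Icc[of 1 "-R" R] by simp
  have eq: "trunc R f = (\<lambda>x. indicator {-R..R} x * f x)" by (auto simp: indicator_def)
  show "integrable lborel (trunc R f)" unfolding eq by (rule L2_mult_integrable[OF i f])
  show "(LBINT x. norm (trunc R f x)) \<le> L2norm (indicator {-R..R} :: real \<Rightarrow> complex) * L2norm f"
  proof -
    have "(LBINT x. norm (trunc R f x)) = (LBINT x. norm (indicator {-R..R} x :: complex) * norm (f x))"
      by (intro Bochner_Integration.integral_cong refl) (simp split: split_indicator)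
    then show ?thesis using L2_Cauchy_Schwarz[OF i f] by (simp only:)
  qed
qed

lemma trunc_L2: "L2_fun f \<Longrightarrow> L2_fun (trunc R f)"
  by (rule L2_fun_indicator) auto

lemma L2norm_mono:
  assumes "L2_fun g" "f \<in> borel_measurable lborel" "\<And>x. norm (f x) \<le> norm (g x)"
  shows "L2norm f \<le> L2norm g"
proof -
  have "L2_fun f" by (rule L2_fun_bound[OF assms(1,2), where C=1]) (use assms(3) in auto)
  then show ?thesis unfolding L2norm_def using assms
    by (intro real_sqrt_le_mono integral_mono power_mono) (auto simp: L2_fun_def)
qed

lemma L2norm_trunc_le: "L2_fun f \<Longrightarrow> L2norm (trunc R f) \<le> L2norm f"
  by (rule L2norm_mono) (auto simp: L2_fun_def split: split_indicator)

text \<open>Step functions supported in the same interval approximate the truncation in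
  \<open>L2norm\<close> and in \<open>L\<^sup>1\<close>. The second makes their transforms converge
  at every \<xi>, and Fatou's lemma then carries the isometry from step functions to the
  truncation.\<close>

lemma fourier_trunc_L2:
  assumes f: "L2_fun f"
  shows "L2_fun (fourier (trunc R f))" "L2norm (fourier (trunc R f)) = sqrt (2 * pi) * L2norm (trunc R f)"
proof -
  let ?f = "trunc R f"
  have f': "L2_fun ?f" by (rule trunc_L2[OF f])
  obtain s where s: "\<And>k. step_fun (s k)" "(\<lambda>k. L2norm (\<lambda>x. s k x - f x)) \<longlonglongrightarrow> 0" using L2_fun_step_seq[OF f] by blast
  define r where "r k = trunc R (s k)" for k
  have r: "step_fun (r k)" for k unfolding r_def by (rule step_fun_restrict[OF s(1)])
  have r2: "L2_fun (r k)" for k by (rule step_fun_L2[OF r])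
  define e where "e k = L2norm (\<lambda>x. r k x - ?f x)" for k
  have req: "(\<lambda>x. r k x - ?f x) = trunc R (\<lambda>x. s k x - f x)" for k by (simp add: r_def fun_eq_iff scaleR_diff_right)
  have sf: "L2_fun (\<lambda>x. s k x - f x)" for k by (rule L2_fun_diff[OF step_fun_L2[OF s(1)] f])
  have "e \<longlonglongrightarrow> 0"
    by (rule Lim_null_comparison[OF _ s(2)]) (use L2norm_trunc_le[OF sf] in \<open>auto simp: e_def req\<close>)
  have fm: "fourier ?f \<in> borel_measurable lborel" using f' by (intro fourier_measurable) (auto simp: L2_fun_def)
  have pw: "(\<lambda>k. fourier (r k) \<xi>) \<longlonglongrightarrow> fourier ?f \<xi>" for \<xi>
  proof (rule LIM_zero_cancel, rule Lim_null_comparison)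
    let ?c = "L2norm (indicator {-R..R} :: real \<Rightarrow> complex)"
    show "\<forall>\<^sub>F k in sequentially. norm (fourier (r k) \<xi> - fourier ?f \<xi>) \<le> ?c * L2norm (\<lambda>x. s k x - f x)"
    proof (intro always_eventually allI)
      fix k
      have "fourier (r k) \<xi> - fourier ?f \<xi> = fourier (\<lambda>x. r k x - ?f x) \<xi>"
        by (rule fourier_diff[symmetric, OF step_fun_L1[OF r] trunc_L1_bound(1)[OF f]])
      also have "norm \<dots> \<le> (LBINT x. norm (r k x - ?f x))" by (rule fourier_bound)
      also have "(LBINT x. norm (r k x - ?f x)) = (LBINT x. norm (trunc R (\<lambda>x. s k x - f x) x))"
        by (simp add: r_def scaleR_diff_right del: norm_scaleR)
      also have "(LBINT x. norm (trunc R (\<lambda>x. s k x - f x) x)) \<le> ?c * L2norm (\<lambda>x. s k x - f x)" by (rule trunc_L1_bound(2)[OF sf])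
      finally show "norm (fourier (r k) \<xi> - fourier ?f \<xi>) \<le> ?c * L2norm (\<lambda>x. s k x - f x)" .
    qed
    show "(\<lambda>k. ?c * L2norm (\<lambda>x. s k x - f x)) \<longlonglongrightarrow> 0"
      using tendsto_mult[OF tendsto_const[of ?c] s(2)] by simp
  qed
  have d: "L2_fun (\<lambda>\<xi>. fourier (r l) \<xi> - fourier (r k) \<xi>)"
     "L2norm (\<lambda>\<xi>. fourier (r l) \<xi> - fourier (r k) \<xi>) \<le> sqrt (2 * pi) * (e l + e k)" for k l
  proof -
    have eq: "(\<lambda>\<xi>. fourier (r l) \<xi> - fourier (r k) \<xi>) = fourier (\<lambda>x. r l x - r k x)"
      by (simp add: fun_eq_iff fourier_diff[OF step_fun_L1[OF r] step_fun_L1[OF r]])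
    show "L2_fun (\<lambda>\<xi>. fourier (r l) \<xi> - fourier (r k) \<xi>)"
      unfolding eq by (rule fourier_step_L2[OF step_fun_minus[OF r r]])
    have "L2norm (\<lambda>x. r l x - r k x) \<le> e l + e k"
      using L2norm_triangle_diff[OF r2[of l] f' r2[of k]] by (simp add: e_def L2norm_minus_commute[of ?f])
    then show "L2norm (\<lambda>\<xi>. fourier (r l) \<xi> - fourier (r k) \<xi>) \<le> sqrt (2 * pi) * (e l + e k)"
      unfolding eq fourier_step_L2(2)[OF step_fun_minus[OF r r]] by (simp add: mult_left_mono)
  qed
  \<comment> \<open>Here \<open>l\<close> tends to infinity with \<open>k\<close> fixed: a bound on
    differences of approximants becomes a rate for the distance to the limit.\<close>
  have Fat: "L2_fun (\<lambda>\<xi>. fourier ?f \<xi> - fourier (r k) \<xi>)"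
     "L2norm (\<lambda>\<xi>. fourier ?f \<xi> - fourier (r k) \<xi>) \<le> sqrt (2 * pi) * (0 + e k)" for k
  proof -
    have rm: "fourier (r k) \<in> borel_measurable lborel" using r2[of k] by (intro fourier_measurable) (auto simp: L2_fun_def)
    have lim: "AE \<xi> in lborel. (\<lambda>l. fourier (r l) \<xi> - fourier (r k) \<xi>) \<longlonglongrightarrow> fourier ?f \<xi> - fourier (r k) \<xi>"
      by (intro AE_I2 tendsto_intros pw)
    have B: "(\<lambda>l. sqrt (2 * pi) * (e l + e k)) \<longlonglongrightarrow> sqrt (2 * pi) * (0 + e k)"
      by (intro tendsto_intros \<open>e \<longlonglongrightarrow> 0\<close>)
    show "L2_fun (\<lambda>\<xi>. fourier ?f \<xi> - fourier (r k) \<xi>)"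
     "L2norm (\<lambda>\<xi>. fourier ?f \<xi> - fourier (r k) \<xi>) \<le> sqrt (2 * pi) * (0 + e k)"
      by (rule L2_Fatou[OF d(1) borel_measurable_diff[OF fm rm] lim d(2) B])+
  qed
  have r2f: "L2_fun (fourier (r k))" for k by (rule fourier_step_L2[OF r])
  show f2: "L2_fun (fourier ?f)" using L2_fun_add[OF Fat(1)[of 0] r2f[of 0]] by simp
  have "(\<lambda>k. L2norm (\<lambda>\<xi>. fourier (r k) \<xi> - fourier ?f \<xi>)) \<longlonglongrightarrow> 0"
  proof (rule Lim_null_comparison)
    show "\<forall>\<^sub>F k in sequentially. norm (L2norm (\<lambda>\<xi>. fourier (r k) \<xi> - fourier ?f \<xi>)) \<le> sqrt (2 * pi) * e k"
      using Fat(2) by (simp add: L2norm_minus_commute[of "fourier ?f"])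
    show "(\<lambda>k. sqrt (2 * pi) * e k) \<longlonglongrightarrow> 0" using tendsto_mult[OF tendsto_const \<open>e \<longlonglongrightarrow> 0\<close>] by simp
  qed
  then have "(\<lambda>k. L2norm (fourier (r k))) \<longlonglongrightarrow> L2norm (fourier ?f)" by (rule L2norm_tendsto[OF r2f f2])
  moreover have "(\<lambda>k. sqrt (2 * pi) * L2norm (r k)) \<longlonglongrightarrow> sqrt (2 * pi) * L2norm ?f"
    using \<open>e \<longlonglongrightarrow> 0\<close> unfolding e_def by (intro tendsto_intros L2norm_tendsto r2 f')
  ultimately show "L2norm (fourier ?f) = sqrt (2 * pi) * L2norm ?f"
    unfolding fourier_step_L2(2)[OF r] by (rule LIMSEQ_unique)
qed

lemma trunc_eventually: "eventually (\<lambda>R. trunc R f x = f x) at_top"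
  using eventually_ge_at_top[of "\<bar>x\<bar>"] by eventually_elim (auto simp: indicator_def)

lemma trunc_tendsto:
  assumes f: "L2_fun f" shows "((\<lambda>R. L2norm (\<lambda>x. trunc R f x - f x)) \<longlongrightarrow> 0) at_top"
proof (rule tendsto_at_topI_sequentially)
  fix X :: "nat \<Rightarrow> real" assume X: "filterlim X at_top sequentially"
  show "(\<lambda>n. L2norm (\<lambda>x. trunc (X n) f x - f x)) \<longlonglongrightarrow> 0"
  proof (rule L2_dominated_tendsto(2)[where g=f])
    show "(\<lambda>k. trunc (X k) f x) \<longlonglongrightarrow> f x" for x
      by (rule tendsto_eventually) (rule eventually_compose_filterlim[OF trunc_eventually X])
  qed (use f in \<open>auto simp: L2_fun_def split: split_indicator\<close>)
qed

lemma fourier_trunc_diff: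
  assumes f: "L2_fun f" shows "L2norm (\<lambda>\<xi>. fourier (trunc R f) \<xi> - fourier (trunc S f) \<xi>) = sqrt (2 * pi) * L2norm (\<lambda>x. trunc R f x - trunc S f x)"
proof -
  let ?d = "\<lambda>x. trunc R f x - trunc S f x"
  have eq: "(\<lambda>\<xi>. fourier (trunc R f) \<xi> - fourier (trunc S f) \<xi>) = fourier ?d"
    by (simp add: fun_eq_iff fourier_diff[OF trunc_L1_bound(1)[OF f] trunc_L1_bound(1)[OF f]])
  \<comment> \<open>The difference of two truncations is itself a truncated function, so the
    isometry for truncations applies to it.\<close>
  have "trunc (max R S) ?d = ?d" by (auto simp: fun_eq_iff indicator_def)
  then show ?thesis using fourier_trunc_L2(2)[OF L2_fun_diff[OF trunc_L2[OF f] trunc_L2[OF f]], of "max R S" R S] unfolding eq by simp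
qed

text \<open>Convergence of a nonnegative integral becomes convergence of a norm, for which the
  triangle inequality is available.\<close>

lemma has_L2_fourier_iff:
  "has_L2_fourier f F \<longleftrightarrow> L2_fun f \<and> L2_fun F \<and> ((\<lambda>R. L2norm (\<lambda>\<xi>. fourier (trunc R f) \<xi> - F \<xi>)) \<longlongrightarrow> 0) at_top"
proof -
  have "((\<lambda>R. \<integral>\<^sup>+\<xi>. ennreal ((norm (F \<xi> - fourier (trunc R f) \<xi>))^2) \<partial>lborel) \<longlongrightarrow> 0) at_top
    \<longleftrightarrow> ((\<lambda>R. L2norm (\<lambda>\<xi>. fourier (trunc R f) \<xi> - F \<xi>)) \<longlongrightarrow> 0) at_top" if f: "L2_fun f" and F: "L2_fun F"
  proof -
    have "(\<integral>\<^sup>+\<xi>. ennreal ((norm (F \<xi> - fourier (trunc R f) \<xi>))^2) \<partial>lborel) = ennreal ((L2norm (\<lambda>\<xi>. fourier (trunc R f) \<xi> - F \<xi>))^2)" for R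
      using L2_fun_nn[OF L2_fun_diff[OF F fourier_trunc_L2(1)[OF f, of R]]] by (simp add: L2norm_minus_commute)
    then have "((\<lambda>R. \<integral>\<^sup>+\<xi>. ennreal ((norm (F \<xi> - fourier (trunc R f) \<xi>))^2) \<partial>lborel) \<longlongrightarrow> 0) at_top
      \<longleftrightarrow> ((\<lambda>R. ennreal ((L2norm (\<lambda>\<xi>. fourier (trunc R f) \<xi> - F \<xi>))^2)) \<longlongrightarrow> ennreal 0) at_top" by simp
    also have "\<dots> \<longleftrightarrow> ((\<lambda>R. (L2norm (\<lambda>\<xi>. fourier (trunc R f) \<xi> - F \<xi>))^2) \<longlongrightarrow> 0) at_top"
      by (rule tendsto_ennreal_iff) auto
    also have "\<dots> \<longleftrightarrow> ((\<lambda>R. L2norm (\<lambda>\<xi>. fourier (trunc R f) \<xi> - F \<xi>)) \<longlongrightarrow> 0) at_top"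
    proof
      assume "((\<lambda>R. (L2norm (\<lambda>\<xi>. fourier (trunc R f) \<xi> - F \<xi>))^2) \<longlongrightarrow> 0) at_top"
      from tendsto_real_sqrt[OF this] show "((\<lambda>R. L2norm (\<lambda>\<xi>. fourier (trunc R f) \<xi> - F \<xi>)) \<longlongrightarrow> 0) at_top" by simp
    next
      assume "((\<lambda>R. L2norm (\<lambda>\<xi>. fourier (trunc R f) \<xi> - F \<xi>)) \<longlongrightarrow> 0) at_top"
      from tendsto_power[OF this, of 2] show "((\<lambda>R. (L2norm (\<lambda>\<xi>. fourier (trunc R f) \<xi> - F \<xi>))^2) \<longlongrightarrow> 0) at_top" by simp
    qed
    finally show ?thesis .
  qed
  then show ?thesis unfolding has_L2_fourier_def by blast
qed

lemma has_L2_fourier_L2: "has_L2_fourier f F \<Longrightarrow> L2_fun f" "has_L2_fourier f F \<Longrightarrow> L2_fun F"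
  by (auto simp: has_L2_fourier_def)

theorem L2_fourier_exists:
  assumes f: "L2_fun f" shows "\<exists>F. has_L2_fourier f F"
proof -
  \<comment> \<open>With errors \<open>(1/4) ^ k\<close> the squared increments are of order
    \<open>(1/16) ^ k\<close> and beat the weight \<open>2 ^ k\<close>. The limit along all real
    radii is recovered afterwards by comparison with these radii.\<close>
  have "\<exists>R. L2norm (\<lambda>x. trunc R f x - f x) < (1/4) ^ k" for k :: nat
    using order_tendstoD(2)[OF trunc_tendsto[OF f], of "(1/4) ^ k"] eventually_happens'[OF trivial_limit_at_top_linorder] by auto
  then obtain R where R: "\<And>k. L2norm (\<lambda>x. trunc (R k) f x - f x) < (1/4) ^ k" by metis
  define \<psi> where "\<psi> k = fourier (trunc (R k) f)" for k
  have \<psi>: "L2_fun (\<psi> k)" for k unfolding \<psi>_def by (rule fourier_trunc_L2[OF f])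
  have tri: "L2norm (\<lambda>\<xi>. \<psi> k \<xi> - fourier (trunc S f) \<xi>) \<le> sqrt (2 * pi) * ((1/4) ^ k + L2norm (\<lambda>x. trunc S f x - f x))" for k S
  proof -
    have "L2norm (\<lambda>x. trunc (R k) f x - trunc S f x) \<le> (1/4) ^ k + L2norm (\<lambda>x. trunc S f x - f x)"
      using L2norm_triangle_diff[OF trunc_L2[OF f] f trunc_L2[OF f], of "R k" S] R[of k]
      by (simp add: L2norm_minus_commute[of f])
    then show ?thesis unfolding \<psi>_def fourier_trunc_diff[OF f] by (simp add: mult_left_mono)
  qed
  have rap: "2 ^ k * (L2norm (\<lambda>\<xi>. \<psi> (Suc k) \<xi> - \<psi> k \<xi>))^2 \<le> 8 * pi * (1/8) ^ k" for k
  proof -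
    have "L2norm (\<lambda>\<xi>. \<psi> (Suc k) \<xi> - \<psi> k \<xi>) \<le> sqrt (2 * pi) * ((1/4) ^ Suc k + L2norm (\<lambda>x. trunc (R k) f x - f x))"
      using tri[of "Suc k" "R k"] unfolding \<psi>_def[of k] .
    also have "\<dots> \<le> sqrt (2 * pi) * (2 * (1/4) ^ k)"
    proof (rule mult_left_mono)
      have "0 \<le> (1/4 :: real) ^ k" by simp
      then show "(1/4) ^ Suc k + L2norm (\<lambda>x. trunc (R k) f x - f x) \<le> 2 * (1/4) ^ k"
        using R[of k] unfolding power_Suc by linarith
    qed simp
    finally have "(L2norm (\<lambda>\<xi>. \<psi> (Suc k) \<xi> - \<psi> k \<xi>))\<^sup>2 \<le> (sqrt (2 * pi) * (2 * (1/4) ^ k))^2"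
      by (rule power_mono) simp
    also have "\<dots> = 8 * pi * (1/16) ^ k" by (simp add: power_mult_distrib power2_eq_square power_divide power_mult[symmetric] mult.commute power_even_eq[symmetric]) (simp add: power_mult_distrib[symmetric])
    finally have "2 ^ k * (L2norm (\<lambda>\<xi>. \<psi> (Suc k) \<xi> - \<psi> k \<xi>))^2 \<le> 2 ^ k * (8 * pi * (1/16) ^ k)" by simp
    also have "\<dots> = 8 * pi * (2 * (1/16)) ^ k" by (simp only: power_mult_distrib mult_ac)
    finally show ?thesis by simp
  qed
  have summ: "summable (\<lambda>k. 2 ^ k * (L2norm (\<lambda>\<xi>. \<psi> (Suc k) \<xi> - \<psi> k \<xi>))^2)"
  proof (rule summable_comparison_test)
    show "\<exists>N. \<forall>n\<ge>N. norm (2 ^ n * (L2norm (\<lambda>\<xi>. \<psi> (Suc n) \<xi> - \<psi> n \<xi>))^2) \<le> 8 * pi * (1/8) ^ n" using rap by auto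
    show "summable (\<lambda>n. 8 * pi * (1/8::real) ^ n)" by (intro summable_mult summable_geometric) auto
  qed
  have \<psi>m[measurable]: "\<psi> k \<in> borel_measurable lborel" for k using \<psi> by (simp add: L2_fun_def)
  define F where "F \<xi> = lim (\<lambda>k. \<psi> k \<xi>)" for \<xi>
  have Fm: "F \<in> borel_measurable lborel" unfolding F_def by measurable
  have "AE \<xi> in lborel. (\<lambda>k. \<psi> k \<xi>) \<longlonglongrightarrow> F \<xi>"
    using L2_rapid_limit(1)[OF \<psi> summ] by eventually_elim (simp add: F_def convergent_LIMSEQ_iff)
  from L2_rapid_limit(2)[OF \<psi> summ Fm this] have F: "L2_fun F" "(\<lambda>k. L2norm (\<lambda>\<xi>. \<psi> k \<xi> - F \<xi>)) \<longlonglongrightarrow> 0" by auto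
  have bound: "L2norm (\<lambda>\<xi>. fourier (trunc S f) \<xi> - F \<xi>) \<le> sqrt (2 * pi) * L2norm (\<lambda>x. trunc S f x - f x)" for S
  proof (rule LIMSEQ_le_const)
    have "(\<lambda>k. (1/4::real) ^ k) \<longlonglongrightarrow> 0" by (rule LIMSEQ_realpow_zero) auto
    then have "(\<lambda>k. L2norm (\<lambda>\<xi>. \<psi> k \<xi> - F \<xi>) + sqrt (2 * pi) * ((1/4) ^ k + L2norm (\<lambda>x. trunc S f x - f x)))
       \<longlonglongrightarrow> 0 + sqrt (2 * pi) * (0 + L2norm (\<lambda>x. trunc S f x - f x))"
      by (intro tendsto_intros F) simp
    then show "(\<lambda>k. L2norm (\<lambda>\<xi>. \<psi> k \<xi> - F \<xi>) + sqrt (2 * pi) * ((1/4) ^ k + L2norm (\<lambda>x. trunc S f x - f x)))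
       \<longlonglongrightarrow> sqrt (2 * pi) * L2norm (\<lambda>x. trunc S f x - f x)" by simp
    have "L2norm (\<lambda>\<xi>. fourier (trunc S f) \<xi> - F \<xi>) \<le> L2norm (\<lambda>\<xi>. \<psi> k \<xi> - F \<xi>) + sqrt (2 * pi) * ((1/4) ^ k + L2norm (\<lambda>x. trunc S f x - f x))" for k
      using L2norm_triangle_diff[OF fourier_trunc_L2(1)[OF f, of S] \<psi>[of k] F(1)] tri[of k S]
      by (simp add: L2norm_minus_commute[of "fourier (trunc S f)" "\<psi> k"])
    then show "\<exists>N. \<forall>n\<ge>N. L2norm (\<lambda>\<xi>. fourier (trunc S f) \<xi> - F \<xi>) \<le> L2norm (\<lambda>\<xi>. \<psi> n \<xi> - F \<xi>) + sqrt (2 * pi) * ((1/4) ^ n + L2norm (\<lambda>x. trunc S f x - f x))"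
      by blast
  qed
  have "((\<lambda>R. L2norm (\<lambda>\<xi>. fourier (trunc R f) \<xi> - F \<xi>)) \<longlongrightarrow> 0) at_top"
  proof (rule Lim_null_comparison)
    show "\<forall>\<^sub>F S in at_top. norm (L2norm (\<lambda>\<xi>. fourier (trunc S f) \<xi> - F \<xi>)) \<le> sqrt (2 * pi) * L2norm (\<lambda>x. trunc S f x - f x)"
      using bound by simp
    show "((\<lambda>S. sqrt (2 * pi) * L2norm (\<lambda>x. trunc S f x - f x)) \<longlongrightarrow> 0) at_top"
      using tendsto_mult[OF tendsto_const trunc_tendsto[OF f]] by simp
  qed
  then show ?thesis using f F unfolding has_L2_fourier_iff by blast
qed

theorem L2_fourier_norm:
  assumes "has_L2_fourier f F" shows "L2norm F = sqrt (2 * pi) * L2norm f"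
proof -
  have f: "L2_fun f" "L2_fun F" and lim: "((\<lambda>R. L2norm (\<lambda>\<xi>. fourier (trunc R f) \<xi> - F \<xi>)) \<longlongrightarrow> 0) at_top"
    using assms by (auto simp: has_L2_fourier_iff)
  have "((\<lambda>R. L2norm (fourier (trunc R f))) \<longlongrightarrow> L2norm F) at_top"
    by (rule L2norm_tendsto[OF fourier_trunc_L2(1)[OF f(1)] f(2) lim])
  moreover have "((\<lambda>R. sqrt (2 * pi) * L2norm (trunc R f)) \<longlongrightarrow> sqrt (2 * pi) * L2norm f) at_top"
    by (intro tendsto_intros L2norm_tendsto trunc_L2 f trunc_tendsto)
  ultimately show ?thesis unfolding fourier_trunc_L2(2)[OF f(1)]
    by (rule tendsto_unique[OF trivial_limit_at_top_linorder])
qed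

lemma has_L2_fourier_add:
  assumes f: "has_L2_fourier f F" and g: "has_L2_fourier g G"
  shows "has_L2_fourier (\<lambda>x. f x + c * g x) (\<lambda>\<xi>. F \<xi> + c * G \<xi>)"
proof -
  note f' = f[unfolded has_L2_fourier_iff] and g' = g[unfolded has_L2_fourier_iff]
  have eq: "fourier (trunc R (\<lambda>x. f x + c * g x)) \<xi> = fourier (trunc R f) \<xi> + c * fourier (trunc R g) \<xi>" for R \<xi>
  proof -
    have eq: "trunc R (\<lambda>x. f x + c * g x) = (\<lambda>x. trunc R f x + c * trunc R g x)" by (auto simp: fun_eq_iff scaleR_add_right)
    have "integrable lborel (trunc R f)" "integrable lborel (\<lambda>x. c * trunc R g x)"
      by (rule trunc_L1_bound(1) integrable_mult_right | simp add: f' g')+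
    then show ?thesis by (simp only: eq fourier_add fourier_cmult)
  qed
  have "((\<lambda>R. L2norm (\<lambda>\<xi>. fourier (trunc R (\<lambda>x. f x + c * g x)) \<xi> - (F \<xi> + c * G \<xi>))) \<longlongrightarrow> 0) at_top"
  proof (rule Lim_null_comparison)
    show "\<forall>\<^sub>F R in at_top. norm (L2norm (\<lambda>\<xi>. fourier (trunc R (\<lambda>x. f x + c * g x)) \<xi> - (F \<xi> + c * G \<xi>)))
      \<le> L2norm (\<lambda>\<xi>. fourier (trunc R f) \<xi> - F \<xi>) + norm c * L2norm (\<lambda>\<xi>. fourier (trunc R g) \<xi> - G \<xi>)"
    proof (intro always_eventually allI)
      fix R
      have "(\<lambda>\<xi>. fourier (trunc R (\<lambda>x. f x + c * g x)) \<xi> - (F \<xi> + c * G \<xi>)) = (\<lambda>\<xi>. (fourier (trunc R f) \<xi> - F \<xi>) + c * (fourier (trunc R g) \<xi> - G \<xi>))"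
        unfolding eq by (simp add: algebra_simps)
      then show "norm (L2norm (\<lambda>\<xi>. fourier (trunc R (\<lambda>x. f x + c * g x)) \<xi> - (F \<xi> + c * G \<xi>)))
        \<le> L2norm (\<lambda>\<xi>. fourier (trunc R f) \<xi> - F \<xi>) + norm c * L2norm (\<lambda>\<xi>. fourier (trunc R g) \<xi> - G \<xi>)"
        using L2norm_triangle[OF L2_fun_diff[OF fourier_trunc_L2(1)[of f R], of F] L2_fun_cmult[OF L2_fun_diff[OF fourier_trunc_L2(1)[of g R], of G]], of c] f' g'
        by (simp add: L2norm_cmult)
    qed
    show "((\<lambda>R. L2norm (\<lambda>\<xi>. fourier (trunc R f) \<xi> - F \<xi>) + norm c * L2norm (\<lambda>\<xi>. fourier (trunc R g) \<xi> - G \<xi>)) \<longlongrightarrow> 0) at_top"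
      using tendsto_add[OF f'[THEN conjunct2, THEN conjunct2] tendsto_mult[OF tendsto_const g'[THEN conjunct2, THEN conjunct2]], of "norm c"] by simp
  qed
  then show ?thesis using f' g' unfolding has_L2_fourier_iff by (intro conjI L2_fun_add L2_fun_cmult) auto
qed

lemma has_L2_fourier_zero: "has_L2_fourier (\<lambda>x. 0) (\<lambda>x. 0)"
  by (simp add: has_L2_fourier_def L2_fun_def fourier_def)

lemma has_L2_fourier_cmult: "has_L2_fourier g G \<Longrightarrow> has_L2_fourier (\<lambda>x. c * g x) (\<lambda>x. c * G x)"
  using has_L2_fourier_add[OF has_L2_fourier_zero, of g G c] by simp

text \<open>The difference of the two candidates is a transform of \<open>0\<close>, hence null by
  the isometry.\<close>

lemma has_L2_fourier_unique:
  assumes "has_L2_fourier f F" "has_L2_fourier f F'" shows "AE \<xi> in lborel. F \<xi> = F' \<xi>"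
proof -
  have d: "has_L2_fourier (\<lambda>x. 0) (\<lambda>\<xi>. F \<xi> - F' \<xi>)"
    using has_L2_fourier_add[OF assms, of "-1"] by simp
  have "L2norm (\<lambda>\<xi>. F \<xi> - F' \<xi>) = 0" using L2_fourier_norm[OF d] by (simp add: L2norm_def)
  from L2norm_0_AE[OF has_L2_fourier_L2(2)[OF d] this] show ?thesis by eventually_elim simp
qed

lemma has_L2_fourier_cong_AE:
  assumes "has_L2_fourier f F" "AE x in lborel. f x = f' x" "AE \<xi> in lborel. F \<xi> = F' \<xi>"
    and m: "f' \<in> borel_measurable lborel" "F' \<in> borel_measurable lborel"
  shows "has_L2_fourier f' F'"
proof -
  note f = assms(1)[unfolded has_L2_fourier_def]
  have L: "L2_fun f'" by (rule L2_fun_bound[where f=f and C=1]) (use f m assms(2) in auto)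
  have LF: "L2_fun F'" by (rule L2_fun_bound[where f=F and C=1]) (use f m assms(3) in auto)
  have eq: "fourier (trunc R f') \<xi> = fourier (trunc R f) \<xi>" for R \<xi>
    unfolding fourier_def
  proof (rule integral_cong_AE)
    show "AE x in lborel. cis (- (x * \<xi>)) * trunc R f' x = cis (- (x * \<xi>)) * trunc R f x"
      using assms(2) by eventually_elim simp
  qed (use f m in \<open>auto simp: L2_fun_def intro!: borel_measurable_times borel_measurable_scaleR borel_measurable_indicator cis_measurable\<close>)
  have "(\<integral>\<^sup>+\<xi>. ennreal ((norm (F' \<xi> - fourier (trunc R f') \<xi>))^2) \<partial>lborel) = (\<integral>\<^sup>+\<xi>. ennreal ((norm (F \<xi> - fourier (trunc R f) \<xi>))^2) \<partial>lborel)" for R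
    unfolding eq by (rule nn_integral_cong_AE) (use assms(3) in eventually_elim, simp)
  then show ?thesis using f L LF unfolding has_L2_fourier_def by simp
qed

text \<open>Polarisation: the isometry relates the squared norms of \<open>f + c * g\<close> and
  \<open>F + c * G\<close> for every complex \<open>c\<close>. Comparing the mixed terms leaves a
  condition on the defect \<open>d\<close> of the claimed identity.\<close>

theorem L2_fourier_inner:
  assumes f: "has_L2_fourier f F" and g: "has_L2_fourier g G"
  shows "(LBINT \<xi>. F \<xi> * cnj (G \<xi>)) = 2 * pi * (LBINT x. f x * cnj (g x))"
proof -
  have pol: "complex_of_real ((L2norm (\<lambda>x. a x + c * b x))^2) = complex_of_real ((L2norm a)^2) + of_real ((norm c)^2) * of_real ((L2norm b)^2)
      + cnj c * (LBINT x. a x * cnj (b x)) + c * cnj (LBINT x. a x * cnj (b x))"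
    if a: "L2_fun a" and b: "L2_fun b" for a b c
  proof -
    have i: "integrable lborel (\<lambda>x. a x * cnj (b x))" by (rule L2_mult_integrable[OF a L2_fun_cnj[OF b]])
    have n: "complex_of_real ((L2norm h)^2) = (LBINT x. h x * cnj (h x))" for h
      unfolding L2norm_sq by (subst integral_complex_of_real[symmetric])
        (intro Bochner_Integration.integral_cong refl, simp add: complex_norm_square[symmetric])
    have "complex_of_real ((L2norm (\<lambda>x. a x + c * b x))^2)
      = (LBINT x. a x * cnj (a x) + (c * cnj c) * (b x * cnj (b x)) + cnj c * (a x * cnj (b x)) + c * cnj (a x * cnj (b x)))"
      unfolding n by (intro Bochner_Integration.integral_cong refl) (simp add: algebra_simps)
    also have "\<dots> = (LBINT x. a x * cnj (a x)) + (c * cnj c) * (LBINT x. b x * cnj (b x)) + cnj c * (LBINT x. a x * cnj (b x)) + c * (LBINT x. cnj (a x * cnj (b x)))"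
      using i integrable_cnj[OF i] L2_mult_integrable[OF a L2_fun_cnj[OF a]] L2_mult_integrable[OF b L2_fun_cnj[OF b]]
      by (simp del: integral_cnj integrable_cnj complex_cnj_mult)
    finally show ?thesis by (simp only: n[symmetric] Bochner_Integration.integral_cnj complex_norm_square)
  qed
  define d where "d = (LBINT \<xi>. F \<xi> * cnj (G \<xi>)) - 2 * pi * (LBINT x. f x * cnj (g x))"
  note L = has_L2_fourier_L2[OF f] has_L2_fourier_L2[OF g]
  have "cnj c * d + c * cnj d = 0" for c
  proof -
    have sq: "complex_of_real ((L2norm H)^2) = 2 * pi * complex_of_real ((L2norm h)^2)" if "has_L2_fourier h H" for h H
      using L2_fourier_norm[OF that] by (simp add: power_mult_distrib flip: of_real_power)
    have "complex_of_real ((L2norm (\<lambda>x. F x + c * G x))^2) = 2 * pi * complex_of_real ((L2norm (\<lambda>x. f x + c * g x))^2)"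
      by (rule sq[OF has_L2_fourier_add[OF f g]])
    then show ?thesis unfolding pol[OF L(1,3)] pol[OF L(2,4)] sq[OF f] sq[OF g] d_def by (simp add: algebra_simps)
  qed
  \<comment> \<open>The condition says that twice the real part of \<open>cnj c * d\<close>
    vanishes: \<open>c = 1\<close> settles the real part of \<open>d\<close>,
    \<open>c = \<i>\<close> the imaginary part.\<close>
  from this[of 1] this[of \<i>] have "d = 0" by (simp add: complex_eq_iff)
  then show ?thesis by (simp add: d_def)
qed

section \<open>The Galerkin scheme\<close>

text \<open>The transform of \<open>u\<^sup>2 / 2\<close> is \<open>1 / (4 * pi)\<close> times the
  convolution of the transform of \<open>u\<close> with itself. On a lattice of spacing
  \<open>1 / 2 ^ n\<close> the frequency contributes one factor \<open>1 / 2 ^ n\<close> and the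
  Riemann sum of the convolution another; hence \<alpha> is later
  \<open>1 / (4 * pi * 4 ^ n)\<close>.\<close>

definition galerkin_rhs :: "(int \<Rightarrow> real) \<Rightarrow> real \<Rightarrow> nat \<Rightarrow> (int \<Rightarrow> complex) \<Rightarrow> int \<Rightarrow> complex" where
  "galerkin_rhs w \<alpha> K c k = (if \<bar>k\<bar> \<le> int K then
     - (of_real (w k) * c k) + \<i> * of_real \<alpha> * of_int k * (\<Sum>j=-int K..int K. c j * c (k - j)) else 0)"

text \<open>The first condition makes the trigonometric sum with coefficients \<open>c\<close> real,
  the second makes it band-limited.\<close>

definition hermitian_seq :: "nat \<Rightarrow> (int \<Rightarrow> complex) \<Rightarrow> bool" where
  "hermitian_seq K c \<longleftrightarrow> (\<forall>k. c (- k) = cnj (c k)) \<and> (\<forall>k. \<bar>k\<bar> > int K \<longrightarrow> c k = 0)"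

text \<open>The trilinear form is symmetric in the three frequencies \<open>a\<close>, \<open>b\<close> and \<open>- a - b\<close>, whose sum vanishes.\<close>

lemma galerkin_cancel:
  assumes c: "hermitian_seq K c"
  shows "(\<Sum>k=-int K..int K. of_int k * (cnj (c k) * (\<Sum>j=-int K..int K. c j * c (k - j)))) = 0"
proof -
  let ?Z = "{-int K..int K}"
  have supp: "c k = 0" if "k \<notin> ?Z" for k using that c by (auto simp: hermitian_seq_def)
  define T where "T = (\<Sum>a\<in>?Z. \<Sum>b\<in>?Z. of_int a * (c a * (c b * c (- a - b))))"
  have 1: "T = (\<Sum>a\<in>?Z. \<Sum>b\<in>?Z. of_int b * (c a * (c b * c (- a - b))))"
  proof -
    have "T = (\<Sum>b\<in>?Z. \<Sum>a\<in>?Z. of_int a * (c a * (c b * c (- a - b))))" unfolding T_def by (rule sum.swap)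
    also have "\<dots> = (\<Sum>a\<in>?Z. \<Sum>b\<in>?Z. of_int b * (c a * (c b * c (- a - b))))"
    proof (intro sum.cong refl)
      fix a b :: int
      have "- b - a = - a - b" by simp
      then show "of_int b * (c b * (c a * c (- b - a))) = of_int b * (c a * (c b * c (- a - b)))"
        by (simp only: mult.left_commute)
    qed
    finally show ?thesis .
  qed
  \<comment> \<open>The reflection of \<open>b\<close> to \<open>- a - b\<close> exchanges the
    second and the third frequency. It does not preserve the range of summation, but the indices
    that leave it carry a factor \<open>c (- a - b)\<close> that vanishes.\<close>
  have refl1: "(\<Sum>b\<in>?Z. of_int b * (c b * c (- a - b))) = (\<Sum>b\<in>?Z. of_int (- a - b) * (c b * c (- a - b)))" for a
  proof -
    have fin: "finite {b\<in>?Z. - a - b \<notin> ?Z}" by (rule finite_subset[of _ ?Z]) auto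
    show ?thesis
      by (rule sum.reindex_bij_witness_not_neutral[where S'="{b\<in>?Z. - a - b \<notin> ?Z}" and T'="{b\<in>?Z. - a - b \<notin> ?Z}"
          and i="\<lambda>b. - a - b" and j="\<lambda>b. - a - b", OF fin fin]) (auto simp: supp)
  qed
  have "T = (\<Sum>a\<in>?Z. c a * (\<Sum>b\<in>?Z. of_int b * (c b * c (- a - b))))"
    unfolding 1 sum_distrib_left by (intro sum.cong refl) (simp only: mult.left_commute)
  also have "\<dots> = (\<Sum>a\<in>?Z. \<Sum>b\<in>?Z. of_int (- a - b) * (c a * (c b * c (- a - b))))"
    unfolding refl1 sum_distrib_left by (intro sum.cong refl) (simp only: mult.left_commute)
  also have "\<dots> = (\<Sum>a\<in>?Z. \<Sum>b\<in>?Z. - (of_int a * (c a * (c b * c (- a - b)))) - of_int b * (c a * (c b * c (- a - b))))"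
    by (intro sum.cong refl) (simp add: algebra_simps)
  also have "\<dots> = - T - T" by (subst (2) 1) (simp add: T_def sum_subtractf sum_negf)
  finally have "3 * T = 0" by simp
  then have T0: "T = 0" by simp
  have "(\<Sum>k\<in>?Z. of_int k * (cnj (c k) * (\<Sum>j\<in>?Z. c j * c (k - j)))) = (\<Sum>a\<in>?Z. of_int (- a) * (c a * (\<Sum>j\<in>?Z. c j * c (- a - j))))"
    by (rule sum.reindex_bij_witness[where i="\<lambda>b. - b" and j="\<lambda>b. - b"]) (use c in \<open>auto simp: hermitian_seq_def\<close>)
  also have "\<dots> = - T" by (simp add: T_def sum_distrib_left sum_negf)
  finally show ?thesis using T0 by simp
qed

text \<open>The right-hand side has to be bounded by the dissipation, not merely by the energy,
  because the dissipation pays for the error of an Euler step. Since \<open>w 0\<close> may vanish,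
  \<open>c 0\<close> escapes the dissipation. The factor \<open>k = j + (k - j)\<close> helps: each
  summand multiplies the coefficient of its own frequency, so that frequency \<open>0\<close> drops
  out, and the remaining coefficient is bounded by the energy. The constant depends on
  \<open>K\<close> and \<open>h\<close>, which is harmless for the choice of a time step.\<close>

lemma galerkin_rhs_bound:
  fixes w :: "int \<Rightarrow> real"
  assumes h: "h > 0" and w: "\<And>k. 0 \<le> w k" "\<And>k. k \<noteq> 0 \<Longrightarrow> 0 < w k"
  shows "\<exists>A\<ge>0. \<forall>c. hermitian_seq K c \<longrightarrow> h * (\<Sum>k=-int K..int K. (norm (c k))^2) \<le> E0 \<longrightarrow>
    (\<Sum>k=-int K..int K. (norm (galerkin_rhs w \<alpha> K c k))^2) \<le> A * (\<Sum>k=-int K..int K. w k * (norm (c k))^2)"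
proof -
  let ?Z = "{-int K..int K}"
  \<comment> \<open>The summand at \<open>j = 0\<close> is \<open>0\<close> because its numerator
    is, whatever the value of \<open>w 0\<close>.\<close>
  define M where "M = (\<Sum>j\<in>?Z. (of_int j)^2 / w j)"
  define W where "W = (\<Sum>j\<in>?Z. w j)"
  define e where "e = sqrt (\<bar>E0\<bar> / h)"
  define L where "L = 2 * real (card ?Z) * e"
  define A where "A = real (card ?Z) * (2 * W + 2 * \<alpha>\<^sup>2 * L^2 * M)"
  have M0: "0 \<le> M" "0 \<le> W" unfolding M_def W_def using w(1) by (auto intro!: sum_nonneg)
  then have "A \<ge> 0" unfolding A_def by simp
  moreover have "(\<Sum>k\<in>?Z. (norm (galerkin_rhs w \<alpha> K c k))^2) \<le> A * (\<Sum>k\<in>?Z. w k * (norm (c k))^2)"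
    if c: "hermitian_seq K c" and E: "h * (\<Sum>k\<in>?Z. (norm (c k))^2) \<le> E0" for c
  proof -
  define n where "n = (\<Sum>k\<in>?Z. w k * (norm (c k))^2)"
  have n0: "0 \<le> n" unfolding n_def using w(1) by (auto intro!: sum_nonneg)
  have supp: "c k = 0" if "k \<notin> ?Z" for k using that c by (auto simp: hermitian_seq_def)
  have n1: "w k * (norm (c k))^2 \<le> n" if "k \<in> ?Z" for k
    unfolding n_def by (rule member_le_sum[OF that]) (use w(1) in auto)
  have ce: "norm (c k) \<le> e" for k
  proof (cases "k \<in> ?Z")
    case True
    have "h * (norm (c k))^2 \<le> h * (\<Sum>k\<in>?Z. (norm (c k))^2)"
      by (intro mult_left_mono member_le_sum[OF True]) (use h in auto)
    then have "h * (norm (c k))^2 \<le> \<bar>E0\<bar>" using E by linarith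
    then have "(norm (c k))\<^sup>2 \<le> \<bar>E0\<bar> / h" using h by (simp add: pos_le_divide_eq mult.commute)
    then show ?thesis unfolding e_def by (rule real_le_rsqrt)
  next
    case False
    then show ?thesis using supp h by (simp add: e_def)
  qed
  have e0: "0 \<le> e" using h by (simp add: e_def)
  have jc: "\<bar>of_int j\<bar> * norm (c j) \<le> sqrt (M * n)" for j
  proof (cases "j \<in> ?Z \<and> j \<noteq> 0")
    case True
    have "(of_int j)\<^sup>2 / w j \<le> M" unfolding M_def by (rule member_le_sum) (use True w(1) in auto)
    then have "((of_int j)^2 / w j) * (w j * (norm (c j))^2) \<le> M * n"
      by (intro mult_mono n1) (use True w M0 in auto)
    then have "(\<bar>of_int j\<bar> * norm (c j))\<^sup>2 \<le> M * n" using w(2)[of j] True by (simp add: power_mult_distrib)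
    then show ?thesis by (rule real_le_rsqrt)
  next
    case False
    then show ?thesis using supp[of j] M0 n0 by auto
  qed
  have conv: "norm (of_int k * (\<Sum>j\<in>?Z. c j * c (k - j))) \<le> L * sqrt (M * n)" for k
  proof -
    have "norm (of_int k * (\<Sum>j\<in>?Z. c j * c (k - j))) = norm (\<Sum>j\<in>?Z. of_int k * (c j * c (k - j)))"
      by (simp add: sum_distrib_left)
    also have "\<dots> \<le> (\<Sum>j\<in>?Z. 2 * e * sqrt (M * n))"
    proof (rule sum_norm_le)
      fix j
      have "norm (of_int k * (c j * c (k - j))) = \<bar>of_int j + of_int (k - j)\<bar> * (norm (c j) * norm (c (k - j)))"
        by (simp add: norm_mult)
      also have "\<dots> \<le> (\<bar>of_int j\<bar> + \<bar>of_int (k - j)\<bar>) * (norm (c j) * norm (c (k - j)))"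
        by (intro mult_right_mono abs_triangle_ineq) auto
      also have "\<dots> = (\<bar>of_int j\<bar> * norm (c j)) * norm (c (k - j)) + (\<bar>of_int (k - j)\<bar> * norm (c (k - j))) * norm (c j)"
        by (simp add: algebra_simps)
      also have "\<dots> \<le> sqrt (M * n) * e + sqrt (M * n) * e"
        by (intro add_mono mult_mono jc ce) (use M0 n0 in auto)
      finally show "norm (of_int k * (c j * c (k - j))) \<le> 2 * e * sqrt (M * n)" by (simp add: algebra_simps)
    qed
    also have "\<dots> = L * sqrt (M * n)" by (simp add: L_def)
    finally show ?thesis .
  qed
  have D: "(norm (galerkin_rhs w \<alpha> K c k))\<^sup>2 \<le> (2 * W + 2 * \<alpha>\<^sup>2 * L^2 * M) * n" if k: "k \<in> ?Z" for k
  proof -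
    have "w k \<le> W" unfolding W_def by (rule member_le_sum[OF k]) (use w(1) in auto)
    then have "w k * (w k * (norm (c k))^2) \<le> W * n" by (intro mult_mono n1 k) (use w(1) M0 in auto)
    then have a: "(norm (- (of_real (w k) * c k)))\<^sup>2 \<le> W * n" using w(1)[of k]
      by (simp add: norm_mult power_mult_distrib power2_eq_square mult_ac)
    have "(norm (of_int k * (\<Sum>j\<in>?Z. c j * c (k - j))))\<^sup>2 \<le> (L * sqrt (M * n))^2"
      by (rule power_mono[OF conv]) simp
    also have "\<dots> = L^2 * (M * n)" using M0 n0 by (simp add: power_mult_distrib)
    finally have b: "(norm (\<i> * of_real \<alpha> * of_int k * (\<Sum>j\<in>?Z. c j * c (k - j))))\<^sup>2 \<le> \<alpha>\<^sup>2 * (L^2 * (M * n))"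
      by (simp add: norm_mult power_mult_distrib mult_left_mono mult.assoc)
    have "galerkin_rhs w \<alpha> K c k = - (of_real (w k) * c k) + \<i> * of_real \<alpha> * of_int k * (\<Sum>j\<in>?Z. c j * c (k - j))"
      using k by (auto simp: galerkin_rhs_def)
    then have "(norm (galerkin_rhs w \<alpha> K c k))\<^sup>2 \<le> 2 * (norm (- (of_real (w k) * c k)))^2
        + 2 * (norm (\<i> * of_real \<alpha> * of_int k * (\<Sum>j\<in>?Z. c j * c (k - j))))^2"
      by (simp only: norm_add_sq_le)
    also have "\<dots> \<le> 2 * (W * n) + 2 * (\<alpha>\<^sup>2 * (L^2 * (M * n)))" using a b by linarith
    finally show ?thesis by (simp only: distrib_right mult.assoc)
  qed
  have "(\<Sum>k\<in>?Z. (norm (galerkin_rhs w \<alpha> K c k))^2) \<le> (\<Sum>k\<in>?Z. (2 * W + 2 * \<alpha>\<^sup>2 * L^2 * M) * n)"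
    by (rule sum_mono[OF D])
  then show ?thesis
    unfolding n_def[symmetric] by (simp add: A_def mult.assoc)
  qed
  ultimately show ?thesis by blast
qed

lemma hermitian_galerkin_rhs:
  assumes c: "hermitian_seq K c" and w: "\<And>k. w (- k) = w k"
  shows "hermitian_seq K (\<lambda>k. c k + of_real \<tau> * galerkin_rhs w \<alpha> K c k)"
proof -
  have cn: "c (- k) = cnj (c k)" for k using c by (simp add: hermitian_seq_def)
  have "(\<Sum>j=-int K..int K. c j * c (- k - j)) = cnj (\<Sum>j=-int K..int K. c j * c (k - j))" for k
  proof -
    have "(\<Sum>j=-int K..int K. c j * c (- k - j)) = (\<Sum>j=-int K..int K. c (- j) * c (- (k - j)))"
      by (rule sum.reindex_bij_witness[where i="\<lambda>b. - b" and j="\<lambda>b. - b"]) auto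
    then show ?thesis by (simp only: cn) simp
  qed
  then have "galerkin_rhs w \<alpha> K c (- k) = cnj (galerkin_rhs w \<alpha> K c k)" for k
    by (simp add: galerkin_rhs_def w cn)
  then show ?thesis using c by (auto simp: hermitian_seq_def galerkin_rhs_def)
qed

text \<open>The exact flow would dissipate at the rate \<open>2 * n\<close>, where \<open>n\<close>
  is the weighted sum. An explicit step costs \<open>\<tau>\<^sup>2\<close> times the squared
  right-hand side, at most \<open>\<tau> * n\<close>, and what remains is the dissipation in the
  claim. The energy inequality of the theorem asks for half of the true dissipation only, which is
  the room an explicit scheme needs.\<close>

lemma galerkin_energy_step:
  assumes c: "hermitian_seq K c" and w: "\<And>k. 0 \<le> w k" and \<tau>: "0 \<le> \<tau>" "\<tau> * A \<le> 1"
    and A: "(\<Sum>k=-int K..int K. (norm (galerkin_rhs w \<alpha> K c k))^2) \<le> A * (\<Sum>k=-int K..int K. w k * (norm (c k))^2)"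
  shows "(\<Sum>k=-int K..int K. (norm (c k + of_real \<tau> * galerkin_rhs w \<alpha> K c k))^2) + \<tau> * (\<Sum>k=-int K..int K. w k * (norm (c k))^2)
     \<le> (\<Sum>k=-int K..int K. (norm (c k))^2)"
proof -
  let ?Z = "{-int K..int K}" and ?D = "galerkin_rhs w \<alpha> K c"
  define n where "n = (\<Sum>k\<in>?Z. w k * (norm (c k))^2)"
  have n0: "0 \<le> n" unfolding n_def using w by (auto intro!: sum_nonneg)
  have sq: "(norm (a + of_real \<tau> * b))\<^sup>2 = (norm a)^2 + 2 * \<tau> * Re (cnj a * b) + \<tau>\<^sup>2 * (norm b)^2" for a b :: complex
    by (simp add: cmod_power2) (simp add: power2_eq_square algebra_simps)
  have "(\<Sum>k\<in>?Z. cnj (c k) * ?D k) = - of_real n + \<i> * of_real \<alpha> * (\<Sum>k\<in>?Z. of_int k * (cnj (c k) * (\<Sum>j\<in>?Z. c j * c (k - j))))"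
  proof -
    have "(\<Sum>k\<in>?Z. cnj (c k) * ?D k) = (\<Sum>k\<in>?Z. - of_real (w k * (norm (c k))^2) + \<i> * of_real \<alpha> * (of_int k * (cnj (c k) * (\<Sum>j\<in>?Z. c j * c (k - j)))))"
    proof (rule sum.cong[OF refl])
      fix k assume "k \<in> ?Z"
      then have "?D k = - (of_real (w k) * c k) + \<i> * of_real \<alpha> * of_int k * (\<Sum>j\<in>?Z. c j * c (k - j))"
        by (auto simp: galerkin_rhs_def)
      moreover have "of_real (w k * (norm (c k))^2) = of_real (w k) * (cnj (c k) * c k)"
        by (simp only: of_real_mult complex_norm_square mult.commute[of "cnj (c k)"])
      ultimately show "cnj (c k) * ?D k = - of_real (w k * (norm (c k))^2) + \<i> * of_real \<alpha> * (of_int k * (cnj (c k) * (\<Sum>j\<in>?Z. c j * c (k - j))))"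
        by (simp only:) (simp add: algebra_simps)
    qed
    also have "\<dots> = - of_real n + \<i> * of_real \<alpha> * (\<Sum>k\<in>?Z. of_int k * (cnj (c k) * (\<Sum>j\<in>?Z. c j * c (k - j))))"
      unfolding n_def by (simp only: sum.distrib sum_negf of_real_sum sum_distrib_left)
    finally show ?thesis .
  qed
  then have "Re (\<Sum>k\<in>?Z. cnj (c k) * ?D k) = - n" unfolding galerkin_cancel[OF c] by simp
  then have re: "(\<Sum>k\<in>?Z. Re (cnj (c k) * ?D k)) = - n" by (simp only: Re_sum)
  have "(\<Sum>k\<in>?Z. (norm (c k + of_real \<tau> * ?D k))^2)
     = (\<Sum>k\<in>?Z. (norm (c k))^2) + 2 * \<tau> * (\<Sum>k\<in>?Z. Re (cnj (c k) * ?D k)) + \<tau>\<^sup>2 * (\<Sum>k\<in>?Z. (norm (?D k))^2)"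
    unfolding sq sum.distrib sum_distrib_left ..
  also have "\<dots> \<le> (\<Sum>k\<in>?Z. (norm (c k))^2) - 2 * \<tau> * n + \<tau>\<^sup>2 * (A * n)"
    using mult_left_mono[OF A, of "\<tau>\<^sup>2"] unfolding re n_def[symmetric] by simp
  also have "\<tau>\<^sup>2 * (A * n) \<le> \<tau> * n"
    using mult_right_mono[OF \<tau>(2), of "\<tau> * n"] \<tau>(1) n0 by (simp add: power2_eq_square mult_ac)
  finally show ?thesis unfolding n_def[symmetric] by simp
qed

text \<open>One time step serves all times: the energy inequality itself keeps the energy below
  \<open>E0\<close>, so the constant found for this bound stays valid along the induction.\<close>

lemma galerkin_scheme_exists:
  assumes h: "h > 0" and w: "\<And>k. 0 \<le> w k" "\<And>k. k \<noteq> 0 \<Longrightarrow> 0 < w k" "\<And>k. w (- k) = w k"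
    and c0: "hermitian_seq K c0" "h * (\<Sum>k=-int K..int K. (norm (c0 k))^2) \<le> E0" and \<delta>: "\<delta> > 0"
  obtains \<tau> c where "0 < \<tau>" "\<tau> \<le> \<delta>" "c 0 = c0"
    "\<And>m k. c (Suc m) k = c m k + of_real \<tau> * galerkin_rhs w \<alpha> K (c m) k"
    "\<And>m. hermitian_seq K (c m)"
    "\<And>m. h * (\<Sum>k=-int K..int K. (norm (c m k))^2) + \<tau> * (\<Sum>l<m. h * (\<Sum>k=-int K..int K. w k * (norm (c l k))^2)) \<le> E0"
proof -
  have "\<exists>A\<ge>0. \<forall>c. hermitian_seq K c \<longrightarrow> h * (\<Sum>k=-int K..int K. (norm (c k))^2) \<le> E0 \<longrightarrow>
    (\<Sum>k=-int K..int K. (norm (galerkin_rhs w \<alpha> K c k))^2) \<le> A * (\<Sum>k=-int K..int K. w k * (norm (c k))^2)"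
    by (rule galerkin_rhs_bound) (fact h w)+
  then obtain A where A': "A \<ge> 0 \<and> (\<forall>c. hermitian_seq K c \<longrightarrow> h * (\<Sum>k=-int K..int K. (norm (c k))^2) \<le> E0 \<longrightarrow>
    (\<Sum>k=-int K..int K. (norm (galerkin_rhs w \<alpha> K c k))^2) \<le> A * (\<Sum>k=-int K..int K. w k * (norm (c k))^2))" ..
  note A = conjunct1[OF A'] conjunct2[OF A']
  \<comment> \<open>The summand \<open>1\<close> avoids a division by zero and still leaves
    \<open>\<tau> * A \<le> 1\<close>.\<close>
  define \<tau> where "\<tau> = min \<delta> (1 / (A + 1))"
  have \<tau>: "0 < \<tau>" "\<tau> \<le> \<delta>" using \<delta> A(1) by (auto simp: \<tau>_def)
  have "\<tau> * A \<le> 1 / (A + 1) * A" using A(1) by (intro mult_right_mono) (auto simp: \<tau>_def)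
  also have "\<dots> \<le> 1" using A(1) by simp
  finally have \<tau>A: "\<tau> * A \<le> 1" .
  define c where "c m = ((\<lambda>c k. c k + of_real \<tau> * galerkin_rhs w \<alpha> K c k) ^^ m) c0" for m
  have cS: "c (Suc m) = (\<lambda>k. c m k + of_real \<tau> * galerkin_rhs w \<alpha> K (c m) k)" for m by (simp add: c_def)
  have H: "hermitian_seq K (c m)" for m
  proof (induction m)
    case 0
    then show ?case using c0 by (simp add: c_def)
  next
    case (Suc m)
    then show ?case unfolding cS by (rule hermitian_galerkin_rhs) (rule w(3))
  qed
  have E: "h * (\<Sum>k=-int K..int K. (norm (c m k))^2) + \<tau> * (\<Sum>l<m. h * (\<Sum>k=-int K..int K. w k * (norm (c l k))^2)) \<le> E0" for m
  proof (induction m)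
    case 0
    then show ?case using c0 by (simp add: c_def)
  next
    case (Suc m)
    have "0 \<le> \<tau> * (\<Sum>l<m. h * (\<Sum>k=-int K..int K. w k * (norm (c l k))^2))"
      using \<tau>(1) h w(1) by (intro mult_nonneg_nonneg sum_nonneg) auto
    then have le: "h * (\<Sum>k=-int K..int K. (norm (c m k))^2) \<le> E0" using Suc by linarith
    have "(\<Sum>k=-int K..int K. (norm (c (Suc m) k))^2) + \<tau> * (\<Sum>k=-int K..int K. w k * (norm (c m k))^2)
       \<le> (\<Sum>k=-int K..int K. (norm (c m k))^2)"
      unfolding cS by (rule galerkin_energy_step[OF H w(1) _ \<tau>A A(2)[rule_format, OF H le]]) (use \<tau> in simp)
    from mult_left_mono[OF this, of h] h
    have "h * (\<Sum>k=-int K..int K. (norm (c (Suc m) k))^2) + \<tau> * (h * (\<Sum>k=-int K..int K. w k * (norm (c m k))^2))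
       \<le> h * (\<Sum>k=-int K..int K. (norm (c m k))^2)" by (simp add: distrib_left mult.left_commute)
    then show ?case using Suc by (simp add: distrib_left)
  qed
  show thesis by (rule that[OF \<tau> _ _ H E]) (auto simp: c_def cS)
qed

section \<open>The multiplication formula\<close>

lemma fourier_mult_formula_L1:
  assumes f: "integrable lborel f" and g: "integrable lborel g"
  shows "(LBINT \<xi>. fourier f \<xi> * g \<xi>) = (LBINT x. f x * fourier g x)"
proof -
  have int: "integrable (lborel \<Otimes>\<^sub>M lborel) (\<lambda>(\<xi>, x). cis (- (x * \<xi>)) * (g \<xi> * f x))"
    by (rule lborel_pair_kernel_integrable[OF g f, where C=1]) (auto simp: split_beta')
  have "(LBINT \<xi>. fourier f \<xi> * g \<xi>) = (LBINT \<xi>. (LBINT x. cis (- (x * \<xi>)) * (g \<xi> * f x)))"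
  proof (rule Bochner_Integration.integral_cong[OF refl])
    fix \<xi>
    have "fourier f \<xi> * g \<xi> = (LBINT x. g \<xi> * (cis (- (x * \<xi>)) * f x))"
      unfolding fourier_def integral_mult_right_zero by (rule mult.commute)
    then show "fourier f \<xi> * g \<xi> = (LBINT x. cis (- (x * \<xi>)) * (g \<xi> * f x))" by (simp only: mult_ac)
  qed
  also have "\<dots> = (LBINT x. (LBINT \<xi>. cis (- (x * \<xi>)) * (g \<xi> * f x)))"
    by (rule lborel_pair.Fubini_integral[symmetric]) (use int in simp)
  also have "\<dots> = (LBINT x. f x * fourier g x)"
  proof (rule Bochner_Integration.integral_cong[OF refl])
    fix x
    have "f x * fourier g x = (LBINT \<xi>. f x * (cis (- (\<xi> * x)) * g \<xi>))"
      unfolding fourier_def integral_mult_right_zero by (rule refl)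
    then show "(LBINT \<xi>. cis (- (x * \<xi>)) * (g \<xi> * f x)) = f x * fourier g x" by (simp only: mult_ac)
  qed
  finally show ?thesis .
qed

text \<open>For truncations this is Fubini; both sides are continuous in the two factors jointly, so
  the radius can be sent to infinity.\<close>

theorem L2_fourier_mult_formula:
  assumes f: "has_L2_fourier f F" and g: "has_L2_fourier g G"
  shows "(LBINT \<xi>. F \<xi> * g \<xi>) = (LBINT x. f x * G x)"
proof -
  note f' = f[unfolded has_L2_fourier_iff] and g' = g[unfolded has_L2_fourier_iff]
  have L: "L2_fun f" "L2_fun g" "L2_fun F" "L2_fun G" using f' g' by auto
  have "((\<lambda>R. (LBINT \<xi>. fourier (trunc R f) \<xi> * trunc R g \<xi>)) \<longlongrightarrow> (LBINT \<xi>. F \<xi> * g \<xi>)) at_top"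
    by (intro L2_integral_tendsto2 fourier_trunc_L2 trunc_L2 L trunc_tendsto) (use f' in auto)
  moreover have "((\<lambda>R. (LBINT \<xi>. trunc R f \<xi> * fourier (trunc R g) \<xi>)) \<longlongrightarrow> (LBINT \<xi>. f \<xi> * G \<xi>)) at_top"
    by (intro L2_integral_tendsto2 fourier_trunc_L2 trunc_L2 L trunc_tendsto) (use g' in auto)
  moreover have "(LBINT \<xi>. fourier (trunc R f) \<xi> * trunc R g \<xi>) = (LBINT \<xi>. trunc R f \<xi> * fourier (trunc R g) \<xi>)" for R
    by (rule fourier_mult_formula_L1[OF trunc_L1_bound(1)[OF L(1)] trunc_L1_bound(1)[OF L(2)]])
  ultimately show ?thesis by (simp add: tendsto_unique[OF trivial_limit_at_top_linorder])
qed

section \<open>Fourier inversion and multipliers\<close>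

text \<open>Fourier inversion needs no further computation: it is the combination of the isometry property with the
  symmetry \<open>\<integral> F g = \<integral> f G\<close>.\<close>

theorem L2_fourier_cnj:
  assumes f: "has_L2_fourier f F"
  shows "has_L2_fourier (\<lambda>\<xi>. cnj (F \<xi>)) (\<lambda>x. 2 * pi * cnj (f x))"
proof -
  note L = has_L2_fourier_L2[OF f]
  have c: "L2_fun (\<lambda>\<xi>. cnj (F \<xi>))" "L2_fun (\<lambda>\<xi>. cnj (f \<xi>))" by (intro L2_fun_cnj L)+
  obtain H where H: "has_L2_fourier (\<lambda>\<xi>. cnj (F \<xi>)) H" using L2_fourier_exists[OF c(1)] by blast
  \<comment> \<open>By symmetry and isometry the defect \<open>d\<close> is orthogonal to every
    square integrable function; testing it with its own conjugate gives \<open>0\<close>.\<close>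
  define d where "d x = H x - 2 * pi * cnj (f x)" for x
  have pf: "L2_fun (\<lambda>x. 2 * pi * cnj (f x))" by (rule L2_fun_cmult[OF c(2)])
  have d: "L2_fun d" unfolding d_def by (rule L2_fun_diff[OF has_L2_fourier_L2(2)[OF H] pf])
  have orth: "(LBINT x. d x * g x) = 0" if g: "L2_fun g" for g
  proof -
    obtain G where G: "has_L2_fourier g G" using L2_fourier_exists[OF g] by blast
    have "(LBINT x. H x * g x) = (LBINT \<xi>. cnj (F \<xi>) * G \<xi>)" by (rule L2_fourier_mult_formula[OF H G])
    also have "\<dots> = cnj (LBINT \<xi>. F \<xi> * cnj (G \<xi>))" by (simp flip: Bochner_Integration.integral_cnj)
    also have "\<dots> = cnj (2 * pi * (LBINT x. f x * cnj (g x)))" by (simp only: L2_fourier_inner[OF f G])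
    also have "\<dots> = 2 * pi * (LBINT x. cnj (f x) * g x)" by (simp flip: Bochner_Integration.integral_cnj)
    also have "\<dots> = (LBINT x. 2 * pi * cnj (f x) * g x)" by (simp add: mult.assoc)
    finally show ?thesis
      unfolding d_def left_diff_distrib
      using L2_mult_integrable[OF has_L2_fourier_L2(2)[OF H] g] L2_mult_integrable[OF pf g] by simp
  qed
  have "complex_of_real ((L2norm d)^2) = (LBINT x. d x * cnj (d x))"
    unfolding L2norm_sq by (subst integral_complex_of_real[symmetric])
      (intro Bochner_Integration.integral_cong refl, simp add: complex_norm_square[symmetric])
  then have "L2norm d = 0" using orth[OF L2_fun_cnj[OF d]] by simp
  from L2norm_0_AE[OF d this] have "AE x in lborel. H x = 2 * pi * cnj (f x)"
    by eventually_elim (simp add: d_def)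
  then show ?thesis
    by (intro has_L2_fourier_cong_AE[OF H]) (use pf c in \<open>auto simp: L2_fun_def\<close>)
qed

lemma has_L2_fourier_L1:
  assumes f: "integrable lborel f" "L2_fun f" shows "has_L2_fourier f (fourier f)"
proof -
  obtain F where F: "has_L2_fourier f F" using L2_fourier_exists[OF f(2)] by blast
  have fm[measurable]: "f \<in> borel_measurable lborel" using f by auto
  have lim: "((\<lambda>R. L2norm (\<lambda>\<xi>. fourier (trunc R f) \<xi> - F \<xi>)) \<longlongrightarrow> 0) at_top" using F by (simp add: has_L2_fourier_iff)
  have "(\<lambda>n. fourier (trunc (real n) f) \<xi>) \<longlonglongrightarrow> fourier f \<xi>" for \<xi>
    unfolding fourier_def
  proof (rule integral_dominated_convergence[where w="\<lambda>x. norm (f x)"])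
    show "AE x in lborel. (\<lambda>n. cis (- (x * \<xi>)) * trunc (real n) f x) \<longlonglongrightarrow> cis (- (x * \<xi>)) * f x"
      by (intro AE_I2 tendsto_intros tendsto_eventually eventually_compose_filterlim[OF trunc_eventually filterlim_real_sequentially])
  qed (use f in \<open>auto simp: norm_mult split: split_indicator\<close>)
  then have l: "AE \<xi> in lborel. (\<lambda>n. fourier (trunc (real n) f) \<xi>) \<longlonglongrightarrow> fourier f \<xi>" by simp
  have m: "fourier f \<in> borel_measurable lborel" by measurable
  have "AE \<xi> in lborel. F \<xi> = fourier f \<xi>"
    by (rule L2_limit_unique(2)[OF fourier_trunc_L2(1)[OF f(2)] has_L2_fourier_L2(2)[OF F] m filterlim_compose[OF lim filterlim_real_sequentially] l])
  then show ?thesis by (intro has_L2_fourier_cong_AE[OF F _ _ fm m]) auto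
qed

text \<open>Up to \<open>1 / (2 * pi)\<close> the inverse integral is the conjugate of the transform
  of the conjugate, so it inherits inversion from \<open>L2_fourier_cnj\<close>.\<close>

lemma has_L2_fourier_inverse_L1:
  assumes V: "integrable lborel V" "L2_fun V" shows "has_L2_fourier (inverse_fourier V) V"
proof -
  have c: "integrable lborel (\<lambda>x. cnj (V x))" "L2_fun (\<lambda>x. cnj (V x))" using V by (auto intro: L2_fun_cnj)
  have "(1 / (2 * pi)) * cnj (fourier (\<lambda>x. cnj (V x)) x) = inverse_fourier V x" for x
    unfolding fourier_def inverse_fourier_def by (simp add: cis_cnj mult.commute flip: Bochner_Integration.integral_cnj)
  then show ?thesis
    using has_L2_fourier_cmult[OF L2_fourier_cnj[OF has_L2_fourier_L1[OF c]], of "1 / (2 * pi)"] by simp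
qed

theorem L2_inverse_fourier_exists:
  assumes V: "L2_fun V" shows "\<exists>u. has_L2_fourier u V"
proof -
  obtain H where "has_L2_fourier (\<lambda>x. cnj (V x)) H" using L2_fourier_exists[OF L2_fun_cnj[OF V]] by blast
  from has_L2_fourier_cmult[OF L2_fourier_cnj[OF this], of "1 / (2 * pi)"] show ?thesis by auto
qed

section \<open>The dispersive symbol and the norm it defines\<close>

definition dsymbol :: "real \<Rightarrow> real" where
  "dsymbol \<xi> = frac_lap_symbol (1/2) \<xi> * m_symbol \<xi>"

text \<open>Without the case distinction at \<open>0\<close>, sign, evenness and continuity can be
  read off.\<close>

lemma dsymbol_eq: "dsymbol \<xi> = sqrt ((1 + \<xi>^2) * (\<xi> * tanh \<xi>))"
proof (cases "\<xi> = 0")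
  case False
  have "(1 + \<xi>^2) * (\<xi> * tanh \<xi>) = \<xi>^2 * ((1 + \<xi>^2) * (tanh \<xi> / \<xi>))" using False by (simp add: power2_eq_square field_simps)
  then have "sqrt ((1 + \<xi>^2) * (\<xi> * tanh \<xi>)) = \<bar>\<xi>\<bar> * sqrt ((1 + \<xi>^2) * (tanh \<xi> / \<xi>))"
    by (simp only: real_sqrt_mult real_sqrt_abs)
  then show ?thesis using False by (simp add: dsymbol_def frac_lap_symbol_def m_symbol_def)
qed (simp add: dsymbol_def frac_lap_symbol_def)

lemma x_tanh_nonneg: "0 \<le> x * tanh (x :: real)"
  by (cases "0 \<le> x") (auto simp: mult_nonneg_nonneg mult_nonpos_nonpos)

lemma dsymbol_nonneg [simp]: "0 \<le> dsymbol \<xi>"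
  by (simp add: dsymbol_eq x_tanh_nonneg)

lemma dsymbol_minus [simp]: "dsymbol (- \<xi>) = dsymbol \<xi>"
  by (simp add: dsymbol_eq)

lemma dsymbol_pos: "\<xi> \<noteq> 0 \<Longrightarrow> 0 < dsymbol \<xi>"
  by (cases "0 < \<xi>") (auto simp: dsymbol_eq mult_pos_pos mult_neg_neg add_pos_nonneg not_less)

lemma continuous_on_dsymbol [continuous_intros]: "continuous_on A dsymbol"
proof -
  have "continuous_on A (\<lambda>\<xi>. sqrt ((1 + \<xi>^2) * (\<xi> * tanh \<xi>)))" by (intro continuous_intros) auto
  then show ?thesis by (simp add: dsymbol_eq[abs_def])
qed

lemma dsymbol_measurable [measurable]: "dsymbol \<in> borel_measurable borel"
  by (rule borel_measurable_continuous_onI[OF continuous_on_dsymbol])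

text \<open>A crude bound, the true order being \<open>\<bar>\<xi>\<bar> powr (3/2)\<close>; it
  allows all later estimates to be stated in powers of \<open>1 + \<xi>\<^sup>2\<close>.\<close>

lemma dsymbol_le: "dsymbol \<xi> \<le> 1 + \<xi>^2"
  unfolding dsymbol_eq
proof (rule real_le_lsqrt)
  have "\<xi> * tanh \<xi> \<le> \<bar>\<xi> * tanh \<xi>\<bar>" by simp
  also have "\<dots> \<le> \<bar>\<xi>\<bar> * 1" unfolding abs_mult using tanh_real_lt_1[of \<xi>] tanh_real_gt_neg1[of \<xi>] by (intro mult_left_mono) auto
  also have "\<dots> \<le> 1 + \<xi>^2"
    using sum_squares_bound[of "\<bar>\<xi>\<bar>" 1] zero_le_power2[of \<xi>] by simp
  finally show "(1 + \<xi>^2) * (\<xi> * tanh \<xi>) \<le> (1 + \<xi>^2)^2" unfolding power2_eq_square[of "1 + \<xi>^2"] by (intro mult_left_mono) auto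
qed (auto simp: x_tanh_nonneg)

text \<open>For these \<xi> one has \<open>tanh \<bar>\<xi>\<bar> \<ge> tanh 1 \<ge> 1/2\<close>,
  and \<open>2 * \<bar>\<xi>\<bar> \<le> 1 + \<xi>\<^sup>2\<close> supplies the rest. This growth is
  the source of smallness of every high-frequency tail below.\<close>

lemma dsymbol_ge:
  assumes "1 \<le> \<bar>\<xi>\<bar>" shows "\<bar>\<xi>\<bar> \<le> dsymbol \<xi>"
  unfolding dsymbol_eq
proof (rule real_le_rsqrt)
  \<comment> \<open>The tangent bound \<open>1 + 2 \<le> exp 2\<close> is just enough for
    \<open>tanh 1 \<ge> 1/2\<close>.\<close>
  have "exp (2::real) \<ge> 3" using exp_ge_add_one_self[of 2] by simp
  then have "exp (- 2 :: real) \<le> 1/3" by (simp add: exp_minus field_simps)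
  moreover have "0 < 1 + exp (- 2 :: real)" by (simp add: add_pos_pos)
  ultimately have "1/2 \<le> (1 - exp (- 2)) / (1 + exp (- 2 :: real))" by (simp add: pos_le_divide_eq)
  then have "1/2 \<le> tanh (1::real)" by (simp add: tanh_real_altdef)
  also have "\<dots> \<le> tanh \<bar>\<xi>\<bar>" using assms by (simp only: tanh_real_le_iff)
  finally have t: "1/2 \<le> tanh \<bar>\<xi>\<bar>" .
  have "\<xi> * tanh \<xi> = \<bar>\<xi>\<bar> * tanh \<bar>\<xi>\<bar>" by (simp add: abs_if)
  have "\<xi>\<^sup>2 \<le> (1 + \<xi>^2) * (\<bar>\<xi>\<bar> * (1/2))"
  proof -
    have "2 * \<bar>\<xi>\<bar> \<le> 1 + \<xi>^2" using sum_squares_bound[of "\<bar>\<xi>\<bar>" 1] by simp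
    then have "\<bar>\<xi>\<bar> * (2 * \<bar>\<xi>\<bar>) \<le> \<bar>\<xi>\<bar> * (1 + \<xi>^2)" by (intro mult_left_mono) auto
    then show ?thesis by (simp add: power2_eq_square algebra_simps)
  qed
  also have "\<dots> \<le> (1 + \<xi>^2) * (\<bar>\<xi>\<bar> * tanh \<bar>\<xi>\<bar>)" using t by (intro mult_left_mono) auto
  also have "\<bar>\<xi>\<bar> * tanh \<bar>\<xi>\<bar> = \<xi> * tanh \<xi>" by (simp add: abs_if)
  finally show "\<bar>\<xi>\<bar>\<^sup>2 \<le> (1 + \<xi>^2) * (\<xi> * tanh \<xi>)" by simp
qed

abbreviation nsymbol :: "real \<Rightarrow> real" where
  "nsymbol \<equiv> (\<lambda>\<xi>. frac_lap_symbol (1/4) \<xi> * m_symbol \<xi> powr (1/2))"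

lemma nsymbol_sq: "(nsymbol \<xi>)\<^sup>2 = dsymbol \<xi>"
proof -
  have m: "0 < m_symbol \<xi>"
    by (cases "\<xi> > 0") (auto simp: m_symbol_def zero_less_divide_iff not_less add_pos_nonneg mult_less_0_iff intro!: mult_pos_pos)
  have sq: "(a powr (1/2))\<^sup>2 = a" if "0 \<le> a" for a :: real using that by (simp add: powr_half_sqrt)
  show ?thesis using sq[of "\<bar>\<xi>\<bar>"] sq[of "m_symbol \<xi>"] m
    by (simp add: power_mult_distrib dsymbol_def frac_lap_symbol_def)
qed

lemma nsymbol_measurable [measurable]: "nsymbol \<in> borel_measurable borel"
proof -
  have "nsymbol = (\<lambda>\<xi>. sqrt (dsymbol \<xi>))"
  proof
    fix \<xi>
    have "0 \<le> nsymbol \<xi>" by (simp add: frac_lap_symbol_def)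
    then show "nsymbol \<xi> = sqrt (dsymbol \<xi>)" by (simp add: real_sqrt_unique[OF nsymbol_sq])
  qed
  then show ?thesis by simp
qed

text \<open>By Plancherel every image under the multiplier has as squared norm the integral of
  \<open>dsymbol\<close> against the squared transform, divided by \<open>2 * pi\<close>. The set
  under the infimum is therefore a singleton if the integral is finite and empty otherwise, which
  accounts for \<open>top\<close>.\<close>

theorem N_norm_eq:
  assumes f: "has_L2_fourier (\<lambda>x. complex_of_real (f x)) F"
  shows "N_norm f = (if (\<integral>\<^sup>+\<xi>. ennreal (dsymbol \<xi> * (norm (F \<xi>))^2) \<partial>lborel) < \<infinity>
    then ennreal (sqrt (enn2real (\<integral>\<^sup>+\<xi>. ennreal (dsymbol \<xi> * (norm (F \<xi>))^2) \<partial>lborel) / (2 * pi))) else top)"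
proof -
  let ?I = "\<integral>\<^sup>+\<xi>. ennreal (dsymbol \<xi> * (norm (F \<xi>))^2) \<partial>lborel"
  let ?S = "{ennreal (L2norm g) | g. has_L2_multiplier nsymbol (\<lambda>x. complex_of_real (f x)) g}"
  have Fm[measurable]: "F \<in> borel_measurable lborel" using has_L2_fourier_L2(2)[OF f] by (simp add: L2_fun_def)
  have nn: "(\<integral>\<^sup>+\<xi>. ennreal ((norm (G \<xi>))^2) \<partial>lborel) = ?I" if "AE \<xi> in lborel. G \<xi> = nsymbol \<xi> *\<^sub>R F' \<xi>" "AE \<xi> in lborel. F' \<xi> = F \<xi>" for F' G
  proof (rule nn_integral_cong_AE)
    show "AE \<xi> in lborel. ennreal ((norm (G \<xi>))^2) = ennreal (dsymbol \<xi> * (norm (F \<xi>))^2)"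
      using that
    proof eventually_elim
      case (elim \<xi>)
      have "(norm (G \<xi>))\<^sup>2 = (nsymbol \<xi>)^2 * (norm (F \<xi>))^2"
        unfolding elim norm_scaleR power_mult_distrib power2_abs ..
      then show ?case by (simp only: nsymbol_sq)
    qed
  qed
  have mult: "?I = ennreal ((L2norm G)^2)" "L2norm g = sqrt ((L2norm G)^2 / (2 * pi))"
    if "has_L2_fourier g G" "AE \<xi> in lborel. G \<xi> = nsymbol \<xi> *\<^sub>R F' \<xi>" "has_L2_fourier (\<lambda>x. complex_of_real (f x)) F'" for g G F'
  proof -
    show "?I = ennreal ((L2norm G)^2)"
      using nn[OF that(2) has_L2_fourier_unique[OF that(3) f]] L2_fun_nn[OF has_L2_fourier_L2(2)[OF that(1)]] by simp
    show "L2norm g = sqrt ((L2norm G)^2 / (2 * pi))"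
      using L2_fourier_norm[OF that(1)] by (simp add: real_sqrt_divide)
  qed
  show ?thesis
  proof (cases "?I < \<infinity>")
    case True
    define G where "G \<xi> = nsymbol \<xi> *\<^sub>R F \<xi>" for \<xi>
    have Gm: "G \<in> borel_measurable lborel" unfolding G_def by measurable
    have "L2_fun G" by (rule L2_funI_nn[OF Gm]) (use nn[of G F] True in \<open>simp add: G_def\<close>)
    then obtain g where g: "has_L2_fourier g G" using L2_inverse_fourier_exists by blast
    have hm: "has_L2_multiplier nsymbol (\<lambda>x. complex_of_real (f x)) g"
      unfolding has_L2_multiplier_def using f g by (intro exI[of _ F] exI[of _ G]) (simp add: G_def)
    have "?S = {ennreal (sqrt (enn2real ?I / (2 * pi)))}"
    proof (intro equalityI subsetI)
      fix y assume "y \<in> ?S"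
      then obtain g' F' G' where "y = ennreal (L2norm g')" and h: "has_L2_fourier g' G'" "AE \<xi> in lborel. G' \<xi> = nsymbol \<xi> *\<^sub>R F' \<xi>" "has_L2_fourier (\<lambda>x. complex_of_real (f x)) F'"
        unfolding has_L2_multiplier_def by blast
      then show "y \<in> {ennreal (sqrt (enn2real ?I / (2 * pi)))}" using mult[OF h] by simp
    next
      fix y assume "y \<in> {ennreal (sqrt (enn2real ?I / (2 * pi)))}"
      moreover have "L2norm g = sqrt (enn2real ?I / (2 * pi))"
        using mult[OF g _ f] by (simp add: G_def)
      ultimately have "y = ennreal (L2norm g)" by (simp only: singleton_iff)
      then show "y \<in> ?S" using hm by blast
    qed
    then show ?thesis using True unfolding N_norm_def by simp
  next
    case False
    have "?S = {}"
    proof (rule ccontr)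
      assume "?S \<noteq> {}"
      then obtain g' F' G' where h: "has_L2_fourier g' G'" "AE \<xi> in lborel. G' \<xi> = nsymbol \<xi> *\<^sub>R F' \<xi>" "has_L2_fourier (\<lambda>x. complex_of_real (f x)) F'"
        unfolding has_L2_multiplier_def by blast
      then show False using mult(1)[OF h] False by simp
    qed
    then show ?thesis using False unfolding N_norm_def by simp
  qed
qed

section \<open>Dyadic frequency cells\<close>

text \<open>Half-open, so that the cells of one level partition the line and the floor of
  \<open>2 ^ j * \<xi>\<close> is the index of the cell of \<xi>.\<close>

definition dcell :: "nat \<Rightarrow> int \<Rightarrow> real set" where
  "dcell j i = {of_int i / 2 ^ j ..< (of_int i + 1) / 2 ^ j}"

lemma dcell_iff: "\<xi> \<in> dcell j i \<longleftrightarrow> \<lfloor>2 ^ j * \<xi>\<rfloor> = i"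
  by (auto simp: dcell_def floor_eq_iff field_simps)

lemma dcell_borel [measurable]: "dcell j i \<in> sets borel"
  by (simp add: dcell_def)

lemma dcell_emeasure: "emeasure lborel (dcell j i) = ennreal (1 / 2 ^ j)" "measure lborel (dcell j i) = 1 / 2 ^ j"
  by (simp_all add: dcell_def divide_right_mono diff_divide_distrib[symmetric])

lemma indicator_dcell_integrable: "integrable lborel (indicator (dcell j i) :: real \<Rightarrow> real)"
  by (intro integrable_real_indicator) (auto simp: dcell_emeasure)

lemma indicator_dcell_L2: "L2_fun (indicator (dcell j i) :: real \<Rightarrow> complex)"
proof -
  have "(norm (indicator (dcell j i) x :: complex))\<^sup>2 = indicator (dcell j i) x" for x by (simp split: split_indicator)
  then show ?thesis unfolding L2_fun_def using indicator_dcell_integrable by simp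
qed

lemma floor_dyadic_div: "j \<le> l \<Longrightarrow> \<lfloor>2 ^ j * \<xi>\<rfloor> = \<lfloor>2 ^ l * \<xi>\<rfloor> div 2 ^ (l - j)" for \<xi> :: real
proof -
  assume "j \<le> l"
  then have "(2::real) ^ l = 2 ^ (l - j) * 2 ^ j" by (simp flip: power_add)
  then have "2 ^ j * \<xi> = 2 ^ l * \<xi> / real_of_int (2 ^ (l - j))" by simp
  then show ?thesis using floor_divide_real_eq_div[of "2 ^ (l - j)" "2 ^ l * \<xi>"] by simp
qed

lemma div_power2_eq: "{k. k div 2 ^ d = i} = {i * 2 ^ d ..< (i + 1) * 2 ^ d}" for i :: int
proof (intro set_eqI iffI)
  fix k assume "k \<in> {k. k div 2 ^ d = i}"
  then have "k = i * 2 ^ d + k mod 2 ^ d" using div_mult_mod_eq[of k "2 ^ d"] by simp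
  moreover have "0 \<le> k mod 2 ^ d" "k mod 2 ^ d < 2 ^ d" by auto
  ultimately show "k \<in> {i * 2 ^ d ..< (i + 1) * 2 ^ d}"
    by (simp only: atLeastLessThan_iff distrib_right mult_1) linarith
next
  fix k assume k: "k \<in> {i * 2 ^ d ..< (i + 1) * 2 ^ d}"
  then have "(k - i * 2 ^ d) div 2 ^ d = 0" by (intro div_pos_pos_trivial) (auto simp: distrib_right)
  moreover have "k div 2 ^ d = i + (k - i * 2 ^ d) div 2 ^ d"
    using div_mult_self1[of "2 ^ d" "k - i * 2 ^ d" i] by simp
  ultimately show "k \<in> {k. k div 2 ^ d = i}" by simp
qed

lemma le_div_iff_mult_le: "0 < c \<Longrightarrow> a \<le> k div c \<longleftrightarrow> a * c \<le> k" for a k c :: int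
proof
  assume c: "0 < c" and "a \<le> k div c"
  then have "a * c \<le> (k div c) * c" by (intro mult_right_mono) auto
  also have "\<dots> \<le> k" using div_mult_mod_eq[of k c] pos_mod_sign[OF c, of k] by linarith
  finally show "a * c \<le> k" .
next
  assume c: "0 < c" and "a * c \<le> k"
  from zdiv_mono1[OF this(2,1)] c show "a \<le> k div c" by simp
qed

text \<open>For \<open>j \<le> n\<close> these are the indices of the lattice points
  \<open>k / 2 ^ n\<close> in \<open>dcell j i\<close>.\<close>

definition subcells :: "nat \<Rightarrow> nat \<Rightarrow> int \<Rightarrow> int set" where
  "subcells n j i = {i * 2 ^ (n - j) ..< (i + 1) * 2 ^ (n - j)}"

lemma subcells_iff: "k \<in> subcells n j i \<longleftrightarrow> k div 2 ^ (n - j) = i"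
  using div_power2_eq[of "n - j" i] unfolding subcells_def by blast

lemma finite_subcells [simp]: "finite (subcells n j i)" by (simp add: subcells_def)

lemma card_subcells: "card (subcells n j i) = 2 ^ (n - j)"
  by (simp add: subcells_def distrib_right nat_power_eq)

lemma subcells_scaled:
  assumes "j \<le> n" "k \<in> subcells n j i"
  shows "of_int k / 2 ^ n \<in> dcell j i"
  using assms floor_dyadic_div[of j n "of_int k / 2 ^ n"] by (simp add: dcell_iff subcells_iff)

lemma sum_subcells_cover:
  assumes "j \<le> n" "a \<le> b"
  shows "(\<Sum>i\<in>{a..<b}. \<Sum>k\<in>subcells n j i. f k) = (\<Sum>k\<in>{a * 2 ^ (n - j)..<b * 2 ^ (n - j)}. f k)"
proof -
  have "(\<Sum>i\<in>{a..<b}. \<Sum>k\<in>subcells n j i. f k) = (\<Sum>k\<in>(\<Union>i\<in>{a..<b}. subcells n j i). f k)"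
    by (rule sum.UNION_disjoint[symmetric]) (auto simp: subcells_iff)
  moreover have "(\<Union>i\<in>{a..<b}. subcells n j i) = {a * 2 ^ (n - j)..<b * 2 ^ (n - j)}"
  proof -
    have "k \<in> (\<Union>i\<in>{a..<b}. subcells n j i) \<longleftrightarrow> a \<le> k div 2 ^ (n - j) \<and> k div 2 ^ (n - j) < b" for k
      by (auto simp: subcells_iff)
    moreover have "a \<le> k div 2 ^ (n - j) \<longleftrightarrow> a * 2 ^ (n - j) \<le> k" for k
      by (rule le_div_iff_mult_le) simp
    moreover have "k div 2 ^ (n - j) < b \<longleftrightarrow> k < b * 2 ^ (n - j)" for k
      by (subst not_le[symmetric], subst le_div_iff_mult_le) auto
    ultimately show ?thesis by (intro set_eqI) (simp only: atLeastLessThan_iff)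
  qed
  ultimately show ?thesis by simp
qed

text \<open>A Riemann sum over \<open>dcell j i\<close> for the function with value
  \<open>a k\<close> at \<open>k / 2 ^ n\<close>. The level \<open>j\<close> stays fixed while
  \<open>n\<close> grows; weak convergence is expressed through these sums.\<close>

definition cellsum :: "nat \<Rightarrow> nat \<Rightarrow> int \<Rightarrow> (int \<Rightarrow> complex) \<Rightarrow> complex" where
  "cellsum n j i a = (\<Sum>k\<in>subcells n j i. a k) / 2 ^ n"

lemma cellsum_add:
  assumes "Suc j \<le> n" shows "cellsum n j i a = cellsum n (Suc j) (2 * i) a + cellsum n (Suc j) (2 * i + 1) a"
proof -
  have e: "(2::int) ^ (n - j) = 2 * 2 ^ (n - Suc j)" using assms by (simp flip: power_Suc add: Suc_diff_Suc)
  have "subcells n j i = subcells n (Suc j) (2 * i) \<union> subcells n (Suc j) (2 * i + 1)"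
    unfolding subcells_def e by (auto simp: algebra_simps)
  moreover have "subcells n (Suc j) (2 * i) \<inter> subcells n (Suc j) (2 * i + 1) = {}" by (auto simp: subcells_iff)
  ultimately show ?thesis by (simp add: cellsum_def sum.union_disjoint add_divide_distrib)
qed

lemma sum_norm_sq_le:
  "finite S \<Longrightarrow> (\<Sum>k\<in>S. norm (a k :: complex))^2 \<le> real (card S) * (\<Sum>k\<in>S. (norm (a k))^2)"
  using Cauchy_Schwarz_ineq_sum[of "\<lambda>_. 1" "\<lambda>k. norm (a k)" S] by simp

lemma cellsum_bound:
  assumes "j \<le> n" shows "2 ^ j * (norm (cellsum n j i a))^2 \<le> (\<Sum>k\<in>subcells n j i. (norm (a k))^2) / 2 ^ n"
proof -
  have "(norm (\<Sum>k\<in>subcells n j i. a k))\<^sup>2 \<le> (\<Sum>k\<in>subcells n j i. norm (a k))^2"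
    by (intro power_mono norm_sum) auto
  also have "\<dots> \<le> 2 ^ (n - j) * (\<Sum>k\<in>subcells n j i. (norm (a k))^2)"
    using sum_norm_sq_le[of "subcells n j i" a] by (simp add: card_subcells)
  finally have "2 ^ j * ((norm (\<Sum>k\<in>subcells n j i. a k))^2 / (2 ^ n)^2) \<le> 2 ^ j * (2 ^ (n - j) * (\<Sum>k\<in>subcells n j i. (norm (a k))^2) / (2 ^ n)^2)"
    by (intro mult_left_mono divide_right_mono) auto
  also have "\<dots> = (2 ^ j * 2 ^ (n - j)) * (\<Sum>k\<in>subcells n j i. (norm (a k))^2) / (2 ^ n)^2" by simp
  also have "(2::real) ^ j * 2 ^ (n - j) = 2 ^ n" using assms by (simp flip: power_add)
  finally show ?thesis by (simp add: cellsum_def norm_divide norm_power power_divide power2_eq_square)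
qed

text \<open>Cells are weighted by the infimum of the symbol, so that no weak limit of the weighted sequence is needed.\<close>

lemma cellsum_weighted_bound:
  assumes j: "j \<le> n" and fin: "finite A"
    and s: "\<And>i k. i \<in> A \<Longrightarrow> k \<in> subcells n j i \<Longrightarrow> s i \<le> w k" and s0: "\<And>i. i \<in> A \<Longrightarrow> 0 \<le> s i"
    and S: "finite S" "\<And>k. k \<notin> S \<Longrightarrow> a k = 0" and w0: "\<And>k. 0 \<le> w k"
  shows "(\<Sum>i\<in>A. s i * (2 ^ j * (norm (cellsum n j i a))^2)) \<le> (\<Sum>k\<in>S. w k * (norm (a k))^2) / 2 ^ n"
proof -
  have "(\<Sum>i\<in>A. s i * (2 ^ j * (norm (cellsum n j i a))^2)) \<le> (\<Sum>i\<in>A. (\<Sum>k\<in>subcells n j i. w k * (norm (a k))^2) / 2 ^ n)"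
  proof (rule sum_mono)
    fix i assume i: "i \<in> A"
    have "s i * (2 ^ j * (norm (cellsum n j i a))^2) \<le> s i * ((\<Sum>k\<in>subcells n j i. (norm (a k))^2) / 2 ^ n)"
      by (intro mult_left_mono cellsum_bound j s0 i)
    also have "\<dots> = (\<Sum>k\<in>subcells n j i. s i * (norm (a k))^2) / 2 ^ n" by (simp add: sum_distrib_left)
    also have "\<dots> \<le> (\<Sum>k\<in>subcells n j i. w k * (norm (a k))^2) / 2 ^ n"
      by (intro divide_right_mono sum_mono mult_right_mono s i) auto
    finally show "s i * (2 ^ j * (norm (cellsum n j i a))^2) \<le> (\<Sum>k\<in>subcells n j i. w k * (norm (a k))^2) / 2 ^ n" .
  qed
  also have "\<dots> = (\<Sum>k\<in>(\<Union>i\<in>A. subcells n j i). w k * (norm (a k))^2) / 2 ^ n"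
    unfolding sum_divide_distrib[symmetric]
    by (subst sum.UNION_disjoint) (use fin in \<open>auto simp: subcells_iff\<close>)
  also have "\<dots> \<le> (\<Sum>k\<in>S. w k * (norm (a k))^2) / 2 ^ n"
  proof (rule divide_right_mono)
    have "(\<Sum>k\<in>(\<Union>i\<in>A. subcells n j i). w k * (norm (a k))^2) = (\<Sum>k\<in>(\<Union>i\<in>A. subcells n j i) \<inter> S. w k * (norm (a k))^2)"
      by (rule sum.mono_neutral_right) (use fin S in auto)
    also have "\<dots> \<le> (\<Sum>k\<in>S. w k * (norm (a k))^2)"
      by (rule sum_mono2) (use S w0 in auto)
    finally show "(\<Sum>k\<in>(\<Union>i\<in>A. subcells n j i). w k * (norm (a k))^2) \<le> (\<Sum>k\<in>S. w k * (norm (a k))^2)" .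
  qed simp
  finally show ?thesis .
qed

text \<open>When \<open>g\<close> lists the averages of a function over the cells of level
  \<open>j\<close>, this is its conditional expectation, restricted to the cells in
  \<open>A\<close>.\<close>

definition dstep :: "nat \<Rightarrow> int set \<Rightarrow> (int \<Rightarrow> complex) \<Rightarrow> real \<Rightarrow> complex" where
  "dstep j A g \<xi> = (\<Sum>i\<in>A. g i * indicator (dcell j i) \<xi>)"

lemma dstep_eq: "finite A \<Longrightarrow> dstep j A g \<xi> = (if \<lfloor>2 ^ j * \<xi>\<rfloor> \<in> A then g \<lfloor>2 ^ j * \<xi>\<rfloor> else 0)"
proof -
  assume "finite A"
  have "dstep j A g \<xi> = (\<Sum>i\<in>A. if \<lfloor>2 ^ j * \<xi>\<rfloor> = i then g i else 0)"
    unfolding dstep_def by (intro sum.cong refl) (auto simp: indicator_def dcell_iff)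
  then show ?thesis using \<open>finite A\<close> by simp
qed

lemma dstep_L2: "finite A \<Longrightarrow> L2_fun (dstep j A g)"
  unfolding dstep_def by (intro L2_fun_sum L2_fun_cmult indicator_dcell_L2)

lemma dstep_norm:
  assumes "finite A" and that: "\<And>i. i \<in> A \<Longrightarrow> 0 \<le> s i"
  shows "(\<integral>\<^sup>+\<xi>. ennreal (s \<lfloor>2 ^ j * \<xi>\<rfloor> * (norm (dstep j A g \<xi>))^2) \<partial>lborel) = ennreal (\<Sum>i\<in>A. s i * (norm (g i))^2 / 2 ^ j)"
proof -
  have "(\<integral>\<^sup>+\<xi>. ennreal (s \<lfloor>2 ^ j * \<xi>\<rfloor> * (norm (dstep j A g \<xi>))^2) \<partial>lborel)
     = (\<integral>\<^sup>+\<xi>. (\<Sum>i\<in>A. ennreal (s i * (norm (g i))^2) * indicator (dcell j i) \<xi>) \<partial>lborel)"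
  proof (rule nn_integral_cong)
    fix \<xi>
    have "(\<Sum>i\<in>A. ennreal (s i * (norm (g i))^2) * indicator (dcell j i) \<xi>) = (\<Sum>i\<in>A. if \<lfloor>2 ^ j * \<xi>\<rfloor> = i then ennreal (s i * (norm (g i))^2) else 0)"
      by (intro sum.cong refl) (auto simp: indicator_def dcell_iff)
    then show "ennreal (s \<lfloor>2 ^ j * \<xi>\<rfloor> * (norm (dstep j A g \<xi>))^2) = (\<Sum>i\<in>A. ennreal (s i * (norm (g i))^2) * indicator (dcell j i) \<xi>)"
      using assms by (simp add: dstep_eq)
  qed
  also have "\<dots> = (\<Sum>i\<in>A. ennreal (s i * (norm (g i))^2) * ennreal (1 / 2 ^ j))"
    by (subst nn_integral_sum) (auto simp: nn_integral_cmult_indicator dcell_emeasure)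
  also have "\<dots> = (\<Sum>i\<in>A. ennreal (s i * (norm (g i))^2 / 2 ^ j))"
    by (intro sum.cong refl) (simp add: that flip: ennreal_mult)
  also have "\<dots> = ennreal (\<Sum>i\<in>A. s i * (norm (g i))^2 / 2 ^ j)"
    by (rule sum_ennreal) (use that in auto)
  finally show ?thesis .
qed

lemma dstep_L2norm: "finite A \<Longrightarrow> (L2norm (dstep j A g))^2 = (\<Sum>i\<in>A. (norm (g i))^2 / 2 ^ j)"
  using dstep_norm[of A "\<lambda>_. 1" j g] L2_fun_nn[OF dstep_L2, of A j g] by (simp add: sum_nonneg ennreal_inj)

lemma dstep_inner:
  assumes "finite A" "L2_fun f"
  shows "(LBINT \<xi>. f \<xi> * cnj (dstep j A g \<xi>)) = (\<Sum>i\<in>A. cnj (g i) * (LBINT \<xi>. f \<xi> * indicator (dcell j i) \<xi>))"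
proof -
  have "(LBINT \<xi>. f \<xi> * cnj (dstep j A g \<xi>)) = (LBINT \<xi>. (\<Sum>i\<in>A. cnj (g i) * (f \<xi> * indicator (dcell j i) \<xi>)))"
    unfolding dstep_def cnj_sum sum_distrib_left
    by (intro Bochner_Integration.integral_cong refl sum.cong) (auto simp: indicator_def)
  also have "\<dots> = (\<Sum>i\<in>A. (LBINT \<xi>. cnj (g i) * (f \<xi> * indicator (dcell j i) \<xi>)))"
    by (rule Bochner_Integration.integral_sum) (intro integrable_mult_right L2_mult_integrable assms indicator_dcell_L2)
  finally show ?thesis by (simp only: integral_mult_right_zero)
qed

lemma dstep_cell_integral:
  assumes "finite A" "j \<le> l" "subcells l j i \<subseteq> A"
  shows "(LBINT \<xi>. dstep l A g \<xi> * indicator (dcell j i) \<xi>) = (\<Sum>k\<in>subcells l j i. g k) / 2 ^ l"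
proof -
  have "dstep l A g \<xi> * indicator (dcell j i) \<xi> = dstep l (subcells l j i) g \<xi>" for \<xi>
    using assms floor_dyadic_div[OF assms(2), of \<xi>] by (auto simp: dstep_eq dcell_iff subcells_iff indicator_def)
  then have "(LBINT \<xi>. dstep l A g \<xi> * indicator (dcell j i) \<xi>) = (LBINT \<xi>. dstep l (subcells l j i) g \<xi>)" by simp
  also have "\<dots> = (\<Sum>k\<in>subcells l j i. (LBINT \<xi>. g k * indicator (dcell l k) \<xi>))"
    unfolding dstep_def
  proof (rule Bochner_Integration.integral_sum)
    fix k
    have "integrable lborel (\<lambda>\<xi>. complex_of_real (indicator (dcell l k) \<xi>))" using indicator_dcell_integrable by (rule integrable_of_real)
    then show "integrable lborel (\<lambda>\<xi>. g k * indicator (dcell l k) \<xi>)" by (intro integrable_mult_right) (simp only: complex_indicator)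
  qed
  also have "\<dots> = (\<Sum>k\<in>subcells l j i. g k / 2 ^ l)"
  proof (rule sum.cong[OF refl])
    fix k
    have "(LBINT \<xi>. (indicator (dcell l k) \<xi> :: complex)) = (LBINT \<xi>. complex_of_real (indicator (dcell l k) \<xi>))"
      by (simp only: complex_indicator)
    also have "\<dots> = complex_of_real (measure lborel (dcell l k))" by (simp only: integral_complex_of_real integral_indicator) simp
    finally show "(LBINT \<xi>. g k * indicator (dcell l k) \<xi>) = g k / 2 ^ l"
      by (simp only: integral_mult_right_zero dcell_emeasure) simp
  qed
  finally show ?thesis by (simp add: sum_divide_distrib)
qed

lemma cells_iff: "\<lfloor>2 ^ j * \<xi>\<rfloor> \<in> {-int R * 2 ^ j..<int R * 2 ^ j} \<longleftrightarrow> \<xi> \<in> {-real R..<real R}"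
proof -
  have p: "0 < (2::real) ^ j" by simp
  have "-int R * 2 ^ j \<le> \<lfloor>2 ^ j * \<xi>\<rfloor> \<longleftrightarrow> 2 ^ j * (- real R) \<le> 2 ^ j * \<xi>"
    by (simp add: le_floor_iff mult.commute)
  moreover have "\<lfloor>2 ^ j * \<xi>\<rfloor> < int R * 2 ^ j \<longleftrightarrow> 2 ^ j * \<xi> < 2 ^ j * real R"
    by (simp add: floor_less_iff mult.commute)
  ultimately show ?thesis by (simp only: atLeastLessThan_iff mult_le_cancel_left_pos[OF p] mult_less_cancel_left_pos[OF p])
qed

lemma uniform_cells:
  fixes \<gamma> :: "real \<Rightarrow> complex"
  assumes "continuous_on UNIV \<gamma>" "e > 0"
  obtains j where "\<And>i \<xi>. i \<in> {-int R * 2 ^ j..<int R * 2 ^ j} \<Longrightarrow> \<xi> \<in> dcell j i \<Longrightarrow> norm (\<gamma> \<xi> - \<gamma> (of_int i / 2 ^ j)) \<le> e"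
proof -
  have "uniformly_continuous_on {-real R..real R} \<gamma>"
    by (rule compact_uniformly_continuous[OF continuous_on_subset[OF assms(1)]]) auto
  then obtain d where d: "d > 0" "\<And>x y. x \<in> {-real R..real R} \<Longrightarrow> y \<in> {-real R..real R} \<Longrightarrow> dist y x < d \<Longrightarrow> dist (\<gamma> y) (\<gamma> x) < e"
    using \<open>e > 0\<close> unfolding uniformly_continuous_on_def by metis
  obtain j where j: "(1/2) ^ j < d" using real_arch_pow_inv[OF d(1), of "1/2"] by auto
  show ?thesis
  proof
    fix i \<xi> assume i: "i \<in> {-int R * 2 ^ j..<int R * 2 ^ j}" and \<xi>: "\<xi> \<in> dcell j i"
    have "-int R * 2 ^ j \<le> i" "i + 1 \<le> int R * 2 ^ j" using i by auto
    then have "real_of_int (-int R * 2 ^ j) \<le> of_int i" "real_of_int (i + 1) \<le> of_int (int R * 2 ^ j)"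
      by (simp_all only: of_int_le_iff)
    then have b: "- real R \<le> of_int i / 2 ^ j" "(of_int i + 1) / 2 ^ j \<le> real R"
      by (simp_all add: field_simps)
    have x: "of_int i / 2 ^ j \<le> \<xi>" "\<xi> < (of_int i + 1) / 2 ^ j" using \<xi> by (auto simp: dcell_def)
    have "\<xi> - of_int i / 2 ^ j < d" using x(2) j by (simp add: add_divide_distrib power_divide)
    then have "dist (\<gamma> \<xi>) (\<gamma> (of_int i / 2 ^ j)) < e"
      by (intro d(2)) (use b x in \<open>auto simp: dist_real_def\<close>)
    then show "norm (\<gamma> \<xi> - \<gamma> (of_int i / 2 ^ j)) \<le> e" by (simp add: dist_norm)
  qed
qed

text \<open>On \<open>[-R, R)\<close> the function \<gamma> is replaced by its values at the left
  ends of the cells of a fixed level. By uniform continuity, and Cauchy-Schwarz over the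
  \<open>2 * R * 2 ^ m n\<close> lattice points, this costs little uniformly in \<open>n\<close>.
  What remains is a finite combination of cell sums, whose limits are given.\<close>

lemma cell_linear_form_tendsto:
  fixes \<gamma> :: "real \<Rightarrow> complex" and a :: "nat \<Rightarrow> int \<Rightarrow> complex" and v :: "real \<Rightarrow> complex"
  assumes m: "filterlim m at_top sequentially"
    and E: "\<And>n S. finite S \<Longrightarrow> (\<Sum>k\<in>S. (norm (a n k))^2) / 2 ^ m n \<le> E0"
    and v: "L2_fun v"
    and lim: "\<And>j i. (\<lambda>n. cellsum (m n) j i (a n)) \<longlonglongrightarrow> (LBINT \<xi>. v \<xi> * indicator (dcell j i) \<xi>)"
    and \<gamma>: "continuous_on UNIV \<gamma>"
  shows "(\<lambda>n. (\<Sum>k\<in>{-int R * 2 ^ m n..<int R * 2 ^ m n}. a n k * \<gamma> (of_int k / 2 ^ m n)) / 2 ^ m n)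
     \<longlonglongrightarrow> (LBINT \<xi>. v \<xi> * (\<gamma> \<xi> * indicator {-real R..<real R} \<xi>))"
proof (rule LIMSEQ_I)
  fix e :: real assume e: "e > 0"
  have E0: "0 \<le> E0" using E[of "{}" 0] by simp
  let ?I = "indicator {-real R..<real R} :: real \<Rightarrow> complex"
  have I2: "L2_fun ?I"
    by (rule L2_fun_bound[OF L2_fun_indicator_Icc[of 1 "-real R" "real R"], where C=1]) (auto simp: indicator_def)
  \<comment> \<open>The three summands are the factors of \<open>e / (2 * C)\<close> in three
    errors: of the sum against its step form, of the limit against its step form, and of the
    convergence between the step forms. The total is \<open>e / 2\<close>.\<close>
  define C where "C = sqrt (2 * real R * E0) + L2norm v * L2norm ?I + 1"
  have C: "C > 0" unfolding C_def using E0 by (intro add_nonneg_pos add_nonneg_nonneg mult_nonneg_nonneg) auto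
  obtain j where j: "\<And>i \<xi>. i \<in> {-int R * 2 ^ j..<int R * 2 ^ j} \<Longrightarrow> \<xi> \<in> dcell j i \<Longrightarrow> norm (\<gamma> \<xi> - \<gamma> (of_int i / 2 ^ j)) \<le> e / (2 * C)"
    using uniform_cells[OF \<gamma>, of "e / (2 * C)" R] e C by auto
  let ?A = "{-int R * 2 ^ j..<int R * 2 ^ j}"
  define q where "q i = \<gamma> (of_int i / 2 ^ j)" for i :: int
  define X where "X n = (\<Sum>k\<in>{-int R * 2 ^ m n..<int R * 2 ^ m n}. a n k * \<gamma> (of_int k / 2 ^ m n)) / 2 ^ m n" for n
  define Y where "Y n = (\<Sum>i\<in>?A. q i * cellsum (m n) j i (a n))" for n
  define x where "x = (LBINT \<xi>. v \<xi> * (\<gamma> \<xi> * ?I \<xi>))"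
  define y where "y = (\<Sum>i\<in>?A. q i * (LBINT \<xi>. v \<xi> * indicator (dcell j i) \<xi>))"
  have "Y \<longlonglongrightarrow> y" unfolding Y_def y_def by (intro tendsto_intros lim)
  then have ev1: "eventually (\<lambda>n. norm (Y n - y) < e / (2 * C)) sequentially"
    using e C by (auto simp: dist_norm[symmetric] intro!: tendstoD)
  have ev2: "eventually (\<lambda>n. j \<le> m n) sequentially" using m by (simp add: filterlim_at_top)
  have XY: "norm (X n - Y n) \<le> e / (2 * C) * sqrt (2 * real R * E0)" if "j \<le> m n" for n
  proof -
    let ?d = "m n - j"
    have p: "(2::int) ^ j * 2 ^ ?d = 2 ^ m n" using that by (simp flip: power_add)
    let ?S = "{-int R * 2 ^ m n..<int R * 2 ^ m n}"
    have S: "?S = {-int R * 2 ^ j * 2 ^ ?d..<int R * 2 ^ j * 2 ^ ?d}" by (simp only: mult.assoc p)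
    have "X n = (\<Sum>i\<in>?A. \<Sum>k\<in>subcells (m n) j i. a n k * \<gamma> (of_int k / 2 ^ m n)) / 2 ^ m n"
      unfolding X_def S by (subst sum_subcells_cover[OF that]) auto
    moreover have "Y n = (\<Sum>i\<in>?A. \<Sum>k\<in>subcells (m n) j i. q i * a n k) / 2 ^ m n"
      unfolding Y_def cellsum_def by (simp add: sum_distrib_left sum_divide_distrib)
    ultimately have "X n - Y n = (\<Sum>i\<in>?A. \<Sum>k\<in>subcells (m n) j i. a n k * (\<gamma> (of_int k / 2 ^ m n) - q i)) / 2 ^ m n"
      by (simp add: sum_subtractf diff_divide_distrib right_diff_distrib mult.commute)
    also have "norm \<dots> \<le> (\<Sum>i\<in>?A. \<Sum>k\<in>subcells (m n) j i. e / (2 * C) * norm (a n k)) / 2 ^ m n"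
      unfolding norm_divide norm_power norm_numeral
    proof (intro divide_right_mono sum_norm_le)
      fix i k assume "i \<in> ?A" "k \<in> subcells (m n) j i"
      then have "norm (\<gamma> (of_int k / 2 ^ m n) - q i) \<le> e / (2 * C)" unfolding q_def by (intro j subcells_scaled that)
      then show "norm (a n k * (\<gamma> (of_int k / 2 ^ m n) - q i)) \<le> e / (2 * C) * norm (a n k)"
        unfolding norm_mult by (subst mult.commute) (rule mult_right_mono, auto)
    qed auto
    also have "\<dots> = (\<Sum>k\<in>?S. e / (2 * C) * norm (a n k)) / 2 ^ m n"
      unfolding S by (subst sum_subcells_cover[OF that]) auto
    also have "\<dots> = e / (2 * C) * ((\<Sum>k\<in>?S. norm (a n k)) / 2 ^ m n)" by (simp add: sum_distrib_left)
    also have "\<dots> \<le> e / (2 * C) * sqrt (2 * real R * E0)"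
    proof (intro mult_left_mono real_le_rsqrt)
      have "card ?S = 2 * R * 2 ^ m n" by (simp add: nat_mult_distrib nat_power_eq)
      then have cS: "real (card ?S) = 2 * real R * 2 ^ m n" by simp
      have "((\<Sum>k\<in>?S. norm (a n k)) / 2 ^ m n)\<^sup>2 \<le> (real (card ?S) * (\<Sum>k\<in>?S. (norm (a n k))^2)) / (2 ^ m n)^2"
        unfolding power_divide by (intro divide_right_mono sum_norm_sq_le) auto
      also have "\<dots> = 2 * real R * ((\<Sum>k\<in>?S. (norm (a n k))^2) / 2 ^ m n)"
        unfolding cS by (simp add: power2_eq_square)
      also have "\<dots> \<le> 2 * real R * E0" by (intro mult_left_mono E) auto
      finally show "((\<Sum>k\<in>?S. norm (a n k)) / 2 ^ m n)\<^sup>2 \<le> 2 * real R * E0" .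
    qed (use e C in auto)
    finally show ?thesis .
  qed
  have nC: "norm (complex_of_real (e / (2 * C))) = e / (2 * C)" using e C by (simp only: norm_of_real) simp
  have xy: "norm (x - y) \<le> e / (2 * C) * (L2norm v * L2norm ?I)"
  proof -
    have g2: "L2_fun (\<lambda>\<xi>. cnj (dstep j ?A (\<lambda>i. cnj (q i)) \<xi>))" by (intro L2_fun_cnj dstep_L2) simp
    have y: "y = (LBINT \<xi>. v \<xi> * cnj (dstep j ?A (\<lambda>i. cnj (q i)) \<xi>))"
      unfolding y_def by (subst dstep_inner) (auto simp: v)
    have d: "norm (\<gamma> \<xi> * ?I \<xi> - cnj (dstep j ?A (\<lambda>i. cnj (q i)) \<xi>)) \<le> norm (complex_of_real (e / (2 * C)) * ?I \<xi>)" for \<xi>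
    proof (cases "\<lfloor>2 ^ j * \<xi>\<rfloor> \<in> ?A")
      case True
      have "norm (\<gamma> \<xi> - q \<lfloor>2 ^ j * \<xi>\<rfloor>) \<le> e / (2 * C)" unfolding q_def by (rule j[OF True]) (simp add: dcell_iff)
      moreover have "\<xi> \<in> {-real R..<real R}"
      proof -
        show ?thesis using True unfolding cells_iff .
      qed
      ultimately show ?thesis using True e C by (simp add: dstep_eq norm_mult norm_divide)
    next
      case False
      then have "\<xi> \<notin> {-real R..<real R}" unfolding cells_iff .
      moreover have "dstep j ?A (\<lambda>i. cnj (q i)) \<xi> = 0" using False by (simp only: dstep_eq finite_atLeastLessThan_int if_False)
      ultimately show ?thesis by simp
    qed
    have eI: "L2_fun (\<lambda>\<xi>. complex_of_real (e / (2 * C)) * ?I \<xi>)" by (rule L2_fun_cmult[OF I2])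
    have \<gamma>m: "(\<lambda>\<xi>. \<gamma> \<xi> * ?I \<xi>) \<in> borel_measurable lborel"
      using borel_measurable_continuous_onI[OF \<gamma>] by simp
    have dm: "(\<lambda>\<xi>. \<gamma> \<xi> * ?I \<xi> - cnj (dstep j ?A (\<lambda>i. cnj (q i)) \<xi>)) \<in> borel_measurable lborel"
      using \<gamma>m g2 by (intro borel_measurable_diff) (auto simp: L2_fun_def)
    have d2: "L2_fun (\<lambda>\<xi>. \<gamma> \<xi> * ?I \<xi> - cnj (dstep j ?A (\<lambda>i. cnj (q i)) \<xi>))"
      by (rule L2_fun_bound[OF eI dm, where C=1]) (use d in auto)
    have \<gamma>2: "L2_fun (\<lambda>\<xi>. \<gamma> \<xi> * ?I \<xi>)" using L2_fun_add[OF d2 g2] by simp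
    have "x - y = (LBINT \<xi>. v \<xi> * (\<gamma> \<xi> * ?I \<xi> - cnj (dstep j ?A (\<lambda>i. cnj (q i)) \<xi>)))"
      unfolding x_def y right_diff_distrib
      using L2_mult_integrable[OF v \<gamma>2] L2_mult_integrable[OF v g2] by simp
    also have "norm \<dots> \<le> L2norm v * L2norm (\<lambda>\<xi>. \<gamma> \<xi> * ?I \<xi> - cnj (dstep j ?A (\<lambda>i. cnj (q i)) \<xi>))"
      by (rule L2_integral_mult_le[OF v d2])
    also have "\<dots> \<le> L2norm v * L2norm (\<lambda>\<xi>. complex_of_real (e / (2 * C)) * ?I \<xi>)"
      by (intro mult_left_mono L2norm_mono[OF eI dm d]) simp
    also have "\<dots> = e / (2 * C) * (L2norm v * L2norm ?I)"
      unfolding L2norm_cmult nC by simp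
    finally show ?thesis .
  qed
  have "eventually (\<lambda>n. norm (X n - x) < e) sequentially"
    using ev1 ev2
  proof eventually_elim
    case (elim n)
    have "norm (X n - x) = norm ((X n - Y n) + (Y n - y) - (x - y))" by simp
    also have "\<dots> \<le> norm ((X n - Y n) + (Y n - y)) + norm (x - y)" by (rule norm_triangle_ineq4)
    also have "\<dots> \<le> norm (X n - Y n) + norm (Y n - y) + norm (x - y)" by (intro add_right_mono norm_triangle_ineq)
    also have "\<dots> < e / (2 * C) * sqrt (2 * real R * E0) + e / (2 * C) + e / (2 * C) * (L2norm v * L2norm ?I)"
      using XY[OF elim(2)] xy elim(1) by linarith
    also have "\<dots> = e / (2 * C) * C" unfolding C_def by (simp only: distrib_left mult_1_right add.commute add.left_commute)
    also have "\<dots> \<le> e" using e C by simp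
    finally show ?case .
  qed
  then show "\<exists>no. \<forall>n\<ge>no. norm ((\<Sum>k\<in>{-int R * 2 ^ m n..<int R * 2 ^ m n}. a n k * \<gamma> (of_int k / 2 ^ m n)) / 2 ^ m n
      - (LBINT \<xi>. v \<xi> * (\<gamma> \<xi> * ?I \<xi>))) < e"
    unfolding eventually_sequentially X_def x_def .
qed

lemma L2norm_diff_sq:
  assumes a: "L2_fun a" and b: "L2_fun (b :: real \<Rightarrow> complex)"
  shows "(L2norm (\<lambda>x. a x - b x))\<^sup>2 = (L2norm a)^2 + (L2norm b)^2 - 2 * Re (LBINT x. a x * cnj (b x))"
proof -
  have i: "integrable lborel (\<lambda>x. a x * cnj (b x))" by (rule L2_mult_integrable[OF a L2_fun_cnj[OF b]])
  define g where "g x = a x * cnj (b x)" for x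
  have ig: "integrable lborel g" using i by (simp add: g_def[abs_def])
  have "(L2norm (\<lambda>x. a x - b x))\<^sup>2 = (LBINT x. (norm (a x))^2 + (norm (b x))^2 - 2 * Re (g x))"
    unfolding L2norm_sq g_def
    by (intro Bochner_Integration.integral_cong refl) (simp only: cmod_power2, simp add: power2_eq_square algebra_simps)
  also have "\<dots> = (L2norm a)^2 + (L2norm b)^2 - 2 * (LBINT x. Re (g x))"
    unfolding L2norm_sq using L2_fun_integrable[OF a] L2_fun_integrable[OF b] integrable_Re[OF ig] by simp
  also have "(LBINT x. Re (g x)) = Re (LBINT x. g x)" using ig by simp
  finally show ?thesis by (simp only: g_def)
qed

lemma nested_cellsum:
  fixes W :: "nat \<Rightarrow> int \<Rightarrow> complex"
  assumes add: "\<And>j i. W j i = W (Suc j) (2 * i) + W (Suc j) (2 * i + 1)" and "j \<le> l"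
  shows "W j i = (\<Sum>k\<in>subcells l j i. W l k)"
  using assms(2)
proof (induction l rule: dec_induct)
  case base
  have "subcells j j i = {i}" by (auto simp: subcells_def)
  then show ?case by simp
next
  case (step l)
  let ?d = "l - j"
  have e: "subcells l j i = {i * 2 ^ ?d..<(i + 1) * 2 ^ ?d}" "subcells (Suc l) j i = {i * 2 ^ ?d * 2 ^ (Suc l - l)..<(i + 1) * 2 ^ ?d * 2 ^ (Suc l - l)}"
    using step(1) by (simp_all add: subcells_def Suc_diff_le mult_ac)
  have le: "i * 2 ^ ?d \<le> (i + 1) * 2 ^ ?d" by (simp add: distrib_right)
  have two: "(\<Sum>k'\<in>subcells (Suc l) l k. W (Suc l) k') = W l k" for k
  proof -
    have "subcells (Suc l) l k = {2 * k, 2 * k + 1}" by (auto simp: subcells_def)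
    then show ?thesis by (simp add: add[of l k])
  qed
  have "(\<Sum>k\<in>subcells (Suc l) j i. W (Suc l) k) = (\<Sum>k\<in>subcells l j i. \<Sum>k'\<in>subcells (Suc l) l k. W (Suc l) k')"
    unfolding e by (rule sum_subcells_cover[symmetric]) (use le in auto)
  then show ?case using step.IH by (simp only: two)
qed

text \<open>Level and range grow together: the cells of width \<open>1 / 2 ^ j\<close> that cover
  \<open>[-j, j)\<close>, finitely many for each \<open>j\<close>.\<close>

definition window :: "nat \<Rightarrow> int set" where
  "window j = {-int j * 2 ^ j..<int j * 2 ^ j}"

lemma finite_window [simp]: "finite (window j)" by (simp add: window_def)

lemma subcells_window:
  assumes "j \<le> l" "- int l * 2 ^ j \<le> i" "i < int l * 2 ^ j"
  shows "subcells l j i \<subseteq> window l"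
proof
  fix k assume "k \<in> subcells l j i"
  then have k: "i * 2 ^ (l - j) \<le> k" "k < (i + 1) * 2 ^ (l - j)" by (auto simp: subcells_def)
  have p: "(2::int) ^ j * 2 ^ (l - j) = 2 ^ l" using assms(1) by (simp flip: power_add)
  have "(- int l * 2 ^ j) * 2 ^ (l - j) \<le> i * 2 ^ (l - j)" using assms(2) by (intro mult_right_mono) auto
  moreover have "(i + 1) * 2 ^ (l - j) \<le> (int l * 2 ^ j) * 2 ^ (l - j)" using assms(3) by (intro mult_right_mono) auto
  ultimately show "k \<in> window l" using k unfolding window_def mult.assoc p by auto
qed

text \<open>The averages over the dyadic cells of level \<open>j\<close> form a martingale bounded in \<open>L\<^sup>2\<close>, uniformly in \<open>t\<close>.
  The levels \<open>q k\<close> are chosen so that it converges rapidly after integration against \<open>exp (- t)\<close>; they do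
  not depend on \<open>t\<close>, which makes the limit jointly measurable.\<close>

theorem dyadic_martingale_limit:
  fixes W :: "real \<Rightarrow> nat \<Rightarrow> int \<Rightarrow> complex"
  assumes Wm [measurable]: "\<And>j i. (\<lambda>t. W t j i) \<in> borel_measurable borel"
    and add: "\<And>t j i. W t j i = W t (Suc j) (2 * i) + W t (Suc j) (2 * i + 1)"
    and bd: "\<And>t j A. finite A \<Longrightarrow> (\<Sum>i\<in>A. 2 ^ j * (norm (W t j i))^2) \<le> E0"
  obtains v q where "(\<lambda>(t, \<xi>). v t \<xi>) \<in> borel_measurable (lborel \<Otimes>\<^sub>M lborel)" "strict_mono (q :: nat \<Rightarrow> nat)"
    "AE t in lborel. 0 < t \<longrightarrow> L2_fun (v t) \<and>
       (\<lambda>k. L2norm (\<lambda>\<xi>. dstep (q k) (window (q k)) (\<lambda>i. 2 ^ q k * W t (q k) i) \<xi> - v t \<xi>)) \<longlonglongrightarrow> 0 \<and>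
       (AE \<xi> in lborel. (\<lambda>k. dstep (q k) (window (q k)) (\<lambda>i. 2 ^ q k * W t (q k) i) \<xi>) \<longlonglongrightarrow> v t \<xi>) \<and>
       (\<forall>j i. (LBINT \<xi>. v t \<xi> * indicator (dcell j i) \<xi>) = W t j i)"
proof -
  define s where "s j t = dstep j (window j) (\<lambda>i. 2 ^ j * W t j i)" for j t
  have s2: "L2_fun (s j t)" for j t unfolding s_def by (rule dstep_L2) simp
  define a where "a j t = (\<Sum>i\<in>window j. 2 ^ j * (norm (W t j i))^2)" for j t
  have a: "(L2norm (s j t))\<^sup>2 = a j t" for j t
    unfolding s_def a_def
    by (subst dstep_L2norm) (auto simp: norm_mult norm_power power_mult_distrib power2_eq_square intro!: sum.cong)
  have a0: "0 \<le> a j t" "a j t \<le> E0" for j t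
    unfolding a_def using bd[OF finite_window] by (auto intro!: sum_nonneg)
  have nest: "(\<Sum>k\<in>subcells l j i. W t l k) = W t j i" if "j \<le> l" for l j i t
    using nested_cellsum[of "W t" j l i, OF add that] by simp
  have cell: "(LBINT \<xi>. s l t \<xi> * indicator (dcell j i) \<xi>) = W t j i"
    if "j \<le> l" "- int l * 2 ^ j \<le> i" "i < int l * 2 ^ j" for l j i t
    unfolding s_def
    by (subst dstep_cell_integral[OF finite_window that(1) subcells_window[OF that]])
       (simp add: nest[OF that(1)] flip: sum_distrib_left)
  \<comment> \<open>The martingale property: averages of the finer step function over the coarser
    cells reproduce the coarser one. The squared norm of an increment is therefore a difference of
    two values of \<open>a\<close>.\<close>
  have inner: "(LBINT \<xi>. s l t \<xi> * cnj (s j t \<xi>)) = of_real (a j t)" if "j \<le> l" for l j t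
  proof -
    have "(LBINT \<xi>. s l t \<xi> * cnj (s j t \<xi>)) = (\<Sum>i\<in>window j. cnj (2 ^ j * W t j i) * (LBINT \<xi>. s l t \<xi> * indicator (dcell j i) \<xi>))"
      unfolding s_def[of j] by (rule dstep_inner[OF finite_window s2])
    also have "\<dots> = (\<Sum>i\<in>window j. of_real (2 ^ j * (norm (W t j i))^2))"
    proof (rule sum.cong[OF refl])
      fix i assume "i \<in> window j"
      then have i: "- int j * 2 ^ j \<le> i" "i < int j * 2 ^ j" by (auto simp: window_def)
      have le: "int j * 2 ^ j \<le> int l * 2 ^ j" using that by (intro mult_right_mono) auto
      have "- int l * 2 ^ j \<le> i" using i(1) le unfolding mult_minus_left by linarith
      moreover have "i < int l * 2 ^ j" using i(2) le by linarith
      ultimately have "- int l * 2 ^ j \<le> i" "i < int l * 2 ^ j" by blast+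
      from cell[OF that this] show "cnj (2 ^ j * W t j i) * (LBINT \<xi>. s l t \<xi> * indicator (dcell j i) \<xi>) = of_real (2 ^ j * (norm (W t j i))^2)"
        by (simp only: of_real_mult complex_norm_square complex_cnj_mult) (simp add: mult_ac)
    qed
    finally show ?thesis by (simp add: a_def)
  qed
  have diff: "(L2norm (\<lambda>\<xi>. s l t \<xi> - s j t \<xi>))\<^sup>2 = a l t - a j t" if "j \<le> l" for l j t
    unfolding L2norm_diff_sq[OF s2 s2] inner[OF that] a by simp
  have mono_a: "a j t \<le> a l t" if "j \<le> l" for j l t
    using diff[OF that, of t] zero_le_power2[of "L2norm (\<lambda>\<xi>. s l t \<xi> - s j t \<xi>)"] by linarith
  \<comment> \<open>With an integrable weight the integrals of \<open>a j\<close> are a bounded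
    increasing sequence of numbers. The levels are read off from its convergence, which is why they
    do not depend on \<open>t\<close>.\<close>
  define w where "w t = indicator {0<..} t * exp (- t)" for t :: real
  have wi: "integrable lborel w"
    using integrable_I0i_exp_mscale[of 1] unfolding w_def set_integrable_def by simp
  have w0: "0 \<le> w t" for t by (simp add: w_def)
  have am[measurable]: "a j \<in> borel_measurable borel" for j unfolding a_def by measurable
  have wa: "integrable lborel (\<lambda>t. w t * a j t)" for j
  proof (rule Bochner_Integration.integrable_bound[OF integrable_mult_right[OF wi, of E0]])
    show "(\<lambda>t. w t * a j t) \<in> borel_measurable lborel" unfolding w_def by measurable
    show "AE t in lborel. norm (w t * a j t) \<le> norm (E0 * w t)"
    proof (rule AE_I2)
      fix t
      have "norm (w t * a j t) = w t * a j t" by (simp add: a0 w0)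
      also have "\<dots> \<le> w t * E0" by (rule mult_left_mono[OF a0(2) w0])
      also have "\<dots> \<le> norm (E0 * w t)" unfolding mult.commute[of "w t" E0] real_norm_def by (rule abs_ge_self)
      finally show "norm (w t * a j t) \<le> norm (E0 * w t)" .
    qed
  qed
  define b where "b j = (LBINT t. w t * a j t)" for j
  have "incseq b" unfolding b_def incseq_def
    by (intro allI impI integral_mono wa mult_left_mono mono_a w0)
  moreover have "b j \<le> (LBINT t. w t * E0)" for j
    unfolding b_def by (intro integral_mono wa mult_left_mono a0 w0 integrable_mult_left wi)
  ultimately obtain B where B: "b \<longlonglongrightarrow> B" "\<And>j. b j \<le> B" using incseq_convergent[of b] by blast
  \<comment> \<open>The rate \<open>(1/8) ^ k\<close> leaves \<open>(1/4) ^ k\<close> after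
    multiplication by the weight \<open>2 ^ k\<close> of rapid convergence.\<close>
  have "\<exists>N. \<forall>n\<ge>N. \<bar>b n - B\<bar> < (1/8) ^ k" for k :: nat
    using LIMSEQ_D[OF B(1), of "(1/8) ^ k"] by simp
  then obtain N where N: "\<And>k n. N k \<le> n \<Longrightarrow> \<bar>b n - B\<bar> < (1/8) ^ k" by metis
  \<comment> \<open>Partial sums of \<open>Suc (N i)\<close> increase strictly and stay above
    \<open>N k\<close>.\<close>
  define q where "q k = (\<Sum>i\<le>k. Suc (N i))" for k
  have qS: "strict_mono q" by (rule strict_monoI_Suc) (simp add: q_def)
  have qN: "N k \<le> q k" for k
    unfolding q_def by (rule order_trans[OF _ member_le_sum[of k]]) auto
  have qmono: "q k \<le> q (Suc k)" for k by (simp add: q_def)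
  define S where "S t = (\<Sum>k. ennreal (2 ^ k * (a (q (Suc k)) t - a (q k) t)))" for t
  have Sm[measurable]: "S \<in> borel_measurable borel" unfolding S_def by measurable
  have "(\<integral>\<^sup>+t. ennreal (w t) * S t \<partial>lborel) = (\<Sum>k. \<integral>\<^sup>+t. ennreal (w t) * ennreal (2 ^ k * (a (q (Suc k)) t - a (q k) t)) \<partial>lborel)"
    unfolding S_def ennreal_suminf_cmult[symmetric] w_def by (rule nn_integral_suminf) measurable
  also have "\<dots> \<le> (\<Sum>k. ennreal ((1/4) ^ k))"
  proof (rule suminf_le)
    fix k
    have eq: "w t * (2 ^ k * (a (q (Suc k)) t - a (q k) t)) = 2 ^ k * (w t * a (q (Suc k)) t - w t * a (q k) t)" for t
      by (simp add: algebra_simps)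
    have "(\<integral>\<^sup>+t. ennreal (w t) * ennreal (2 ^ k * (a (q (Suc k)) t - a (q k) t)) \<partial>lborel)
      = (\<integral>\<^sup>+t. ennreal (w t * (2 ^ k * (a (q (Suc k)) t - a (q k) t))) \<partial>lborel)"
      by (intro nn_integral_cong ennreal_mult[symmetric] w0 mult_nonneg_nonneg) (auto simp: mono_a[OF qmono])
    also have "\<dots> = ennreal (LBINT t. w t * (2 ^ k * (a (q (Suc k)) t - a (q k) t)))"
    proof (rule nn_integral_eq_integral)
      show "integrable lborel (\<lambda>t. w t * (2 ^ k * (a (q (Suc k)) t - a (q k) t)))" unfolding eq using wa by simp
      show "AE t in lborel. 0 \<le> w t * (2 ^ k * (a (q (Suc k)) t - a (q k) t))"
        using w0 mono_a[OF qmono] by (intro AE_I2 mult_nonneg_nonneg) auto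
    qed
    also have "(LBINT t. w t * (2 ^ k * (a (q (Suc k)) t - a (q k) t))) = 2 ^ k * (b (q (Suc k)) - b (q k))"
      unfolding eq b_def using wa by simp
    also have "\<dots> \<le> 2 ^ k * (1/8) ^ k"
    proof (rule mult_left_mono)
      have "B - b (q k) < (1/8) ^ k" using N[OF qN[of k]] B(2)[of "q k"] by (simp add: abs_if split: if_splits)
      then show "b (q (Suc k)) - b (q k) \<le> (1/8) ^ k" using B(2)[of "q (Suc k)"] by linarith
    qed simp
    also have "2 ^ k * (1/8) ^ k = (1/4 :: real) ^ k" by (simp flip: power_mult_distrib)
    finally show "(\<integral>\<^sup>+t. ennreal (w t) * ennreal (2 ^ k * (a (q (Suc k)) t - a (q k) t)) \<partial>lborel) \<le> ennreal ((1/4) ^ k)"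
      by (simp add: ennreal_leI)
  qed auto
  also have "\<dots> = ennreal (\<Sum>k. (1/4) ^ k)" by (rule suminf_ennreal2) (auto intro: summable_geometric)
  finally have fin: "(\<integral>\<^sup>+t. ennreal (w t) * S t \<partial>lborel) \<noteq> \<infinity>" by (auto simp: top_unique)
  have "AE t in lborel. ennreal (w t) * S t \<noteq> \<infinity>"
    by (rule nn_integral_PInf_AE[OF _ fin]) (unfold w_def, measurable)
  then have good: "AE t in lborel. 0 < t \<longrightarrow> summable (\<lambda>k. 2 ^ k * (L2norm (\<lambda>\<xi>. s (q (Suc k)) t \<xi> - s (q k) t \<xi>))^2)"
  proof eventually_elim
    case (elim t)
    show ?case
    proof
      assume "0 < t"
      then have "S t \<noteq> top" using elim by (auto simp: w_def ennreal_mult_eq_top_iff)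
      then have "summable (\<lambda>k. 2 ^ k * (a (q (Suc k)) t - a (q k) t))"
        unfolding S_def by (intro summable_suminf_not_top) (auto simp: mono_a[OF qmono])
      then show "summable (\<lambda>k. 2 ^ k * (L2norm (\<lambda>\<xi>. s (q (Suc k)) t \<xi> - s (q k) t \<xi>))^2)"
        by (simp only: diff[OF qmono])
    qed
  qed
  \<comment> \<open>Where the sequence diverges, \<open>lim\<close> is an unspecified value; joint
    measurability holds all the same.\<close>
  define v where "v t \<xi> = lim (\<lambda>k. s (q k) t \<xi>)" for t \<xi>
  have sm[measurable]: "(\<lambda>(t, \<xi>). s j t \<xi>) \<in> borel_measurable (lborel \<Otimes>\<^sub>M lborel)" for j
    unfolding s_def dstep_def split_beta' by measurable
  have vm[measurable]: "(\<lambda>(t, \<xi>). v t \<xi>) \<in> borel_measurable (lborel \<Otimes>\<^sub>M lborel)"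
    unfolding v_def split_beta' using sm unfolding split_beta' by (rule borel_measurable_lim_metric)
  have "AE t in lborel. 0 < t \<longrightarrow> L2_fun (v t) \<and>
       (\<lambda>k. L2norm (\<lambda>\<xi>. s (q k) t \<xi> - v t \<xi>)) \<longlonglongrightarrow> 0 \<and>
       (AE \<xi> in lborel. (\<lambda>k. s (q k) t \<xi>) \<longlonglongrightarrow> v t \<xi>) \<and>
       (\<forall>j i. (LBINT \<xi>. v t \<xi> * indicator (dcell j i) \<xi>) = W t j i)"
    using good
  proof eventually_elim
    case (elim t)
    show ?case
    proof
      assume "0 < t"
      then have summ: "summable (\<lambda>k. 2 ^ k * (L2norm (\<lambda>\<xi>. s (q (Suc k)) t \<xi> - s (q k) t \<xi>))^2)" using elim by simp
      have vt: "v t \<in> borel_measurable lborel" using measurable_Pair2[OF vm, of t] by (simp add: space_lborel)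
      have conv: "AE \<xi> in lborel. (\<lambda>k. s (q k) t \<xi>) \<longlonglongrightarrow> v t \<xi>"
        using L2_rapid_limit(1)[of "\<lambda>k. s (q k) t", OF s2 summ] by eventually_elim (simp add: v_def convergent_LIMSEQ_iff)
      from L2_rapid_limit(2)[of "\<lambda>k. s (q k) t", OF s2 summ vt conv]
      have v2: "L2_fun (v t)" "(\<lambda>k. L2norm (\<lambda>\<xi>. s (q k) t \<xi> - v t \<xi>)) \<longlonglongrightarrow> 0" by auto
      have "(LBINT \<xi>. v t \<xi> * indicator (dcell j i) \<xi>) = W t j i" for j i
      proof (rule LIMSEQ_unique)
        show "(\<lambda>k. (LBINT \<xi>. s (q k) t \<xi> * indicator (dcell j i) \<xi>)) \<longlonglongrightarrow> (LBINT \<xi>. v t \<xi> * indicator (dcell j i) \<xi>)"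
          by (rule L2_integral_tendsto[OF s2 v2 indicator_dcell_L2])
        \<comment> \<open>Once the window of level \<open>q k\<close> contains the cell, the
          integral over it is exact and no longer changes.\<close>
        have "eventually (\<lambda>k. (LBINT \<xi>. s (q k) t \<xi> * indicator (dcell j i) \<xi>) = W t j i) sequentially"
          using eventually_ge_at_top[of "max j (nat \<bar>i\<bar> + 1)"]
        proof eventually_elim
          case (elim k)
          have k: "k \<le> q k" using seq_suble[OF qS] .
          have "int (q k) * 1 \<le> int (q k) * 2 ^ j" by (intro mult_left_mono) auto
          then have le: "int (q k) \<le> int (q k) * 2 ^ j" by simp
          have "\<bar>i\<bar> < int (q k)" using elim k by linarith
          then have "- int (q k) * 2 ^ j \<le> i" "i < int (q k) * 2 ^ j" using le unfolding mult_minus_left by linarith+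
          then show ?case using elim k by (intro cell) auto
        qed
        then show "(\<lambda>k. (LBINT \<xi>. s (q k) t \<xi> * indicator (dcell j i) \<xi>)) \<longlonglongrightarrow> W t j i" by (rule tendsto_eventually)
      qed
      then show "L2_fun (v t) \<and> (\<lambda>k. L2norm (\<lambda>\<xi>. s (q k) t \<xi> - v t \<xi>)) \<longlonglongrightarrow> 0 \<and>
         (AE \<xi> in lborel. (\<lambda>k. s (q k) t \<xi>) \<longlonglongrightarrow> v t \<xi>) \<and>
         (\<forall>j i. (LBINT \<xi>. v t \<xi> * indicator (dcell j i) \<xi>) = W t j i)"
        using v2 conv by blast
    qed
  qed
  then show thesis using that[OF vm qS] unfolding s_def by blast
qed

section \<open>Compactness in time and the family of approximations\<close>

text \<open>Arzela-Ascoli for countably many functions of time: a diagonal subsequence at the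
  rational times, extended to all times by equicontinuity. The term \<open>\<epsilon> n\<close>
  absorbs the jumps of functions that are piecewise constant in time, and the estimate is asked only
  for \<open>n \<ge> j\<close>, where the lattice resolves the cell.\<close>

lemma cell_extraction:
  fixes V :: "nat \<Rightarrow> real \<Rightarrow> nat \<Rightarrow> int \<Rightarrow> complex"
  assumes M: "\<And>n t j i. 0 \<le> t \<Longrightarrow> norm (V n t j i) \<le> M"
    and eqc: "\<And>j i. \<exists>L\<ge>0. \<forall>n\<ge>j. \<forall>s\<ge>0. \<forall>t\<ge>0. norm (V n t j i - V n s j i) \<le> L * (\<bar>t - s\<bar> + \<epsilon> n)"
    and \<epsilon>: "\<epsilon> \<longlonglongrightarrow> (0::real)"
  obtains r where "strict_mono (r :: nat \<Rightarrow> nat)" "\<And>t j i. 0 \<le> t \<Longrightarrow> convergent (\<lambda>n. V (r n) t j i)"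
proof -
  let ?S = "{(t, j, i). t \<in> \<rat> \<and> 0 \<le> t} :: (real \<times> nat \<times> int) set"
  have "countable (\<rat> \<times> (UNIV :: (nat \<times> int) set) :: (real \<times> nat \<times> int) set)" by (intro countable_SIGMA countable_rat) auto
  then have S: "countable ?S" by (rule countable_subset[rotated]) auto
  have "\<exists>r. strict_mono (r :: nat \<Rightarrow> nat) \<and> (\<forall>x\<in>?S. \<exists>l. (\<lambda>n. (\<lambda>(t, j, i). V (r n) t j i) x) \<longlonglongrightarrow> l)"
  proof (rule function_convergent_subsequence[OF S, where f="\<lambda>n (t, j, i). V n t j i" and M=M])
    show "norm (case x of (t, j, i) \<Rightarrow> V n t j i) \<le> M" if "x \<in> ?S" for n x using that M by auto
  qed blast
  then obtain r where r: "strict_mono (r :: nat \<Rightarrow> nat)" "\<And>x. x \<in> ?S \<Longrightarrow> \<exists>l. (\<lambda>n. (\<lambda>(t, j, i). V (r n) t j i) x) \<longlonglongrightarrow> l"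
    by blast
  have "Cauchy (\<lambda>n. V (r n) t j i)" if t: "0 \<le> t" for t j i
  proof (rule metric_CauchyI)
    fix e :: real assume e: "e > 0"
    obtain L where L: "L \<ge> 0" "\<And>n s t. j \<le> n \<Longrightarrow> 0 \<le> s \<Longrightarrow> 0 \<le> t \<Longrightarrow> norm (V n t j i - V n s j i) \<le> L * (\<bar>t - s\<bar> + \<epsilon> n)"
      using eqc[of j i] by blast
    \<comment> \<open>With both \<open>\<bar>t - p\<bar>\<close> and \<open>\<epsilon> (r n)\<close>
      below \<open>d\<close>, moving from \<open>t\<close> to the rational time \<open>p\<close>
      costs at most \<open>e / 4\<close>; it is done twice and added to less than
      \<open>e / 2\<close>. The summand \<open>1\<close> covers \<open>L = 0\<close>.\<close>
    define d where "d = e / (8 * (L + 1))"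
    have d: "d > 0" using e L by (simp add: d_def)
    obtain p where p: "p \<in> \<rat>" "t < p" "p < t + d" using Rats_dense_in_real[of t "t + d"] d by auto
    have "convergent (\<lambda>n. V (r n) p j i)" using r(2)[of "(p, j, i)"] p t by (auto simp: convergent_def)
    then have "Cauchy (\<lambda>n. V (r n) p j i)" by (rule convergent_Cauchy)
    then obtain N1 where N1: "\<And>m n. N1 \<le> m \<Longrightarrow> N1 \<le> n \<Longrightarrow> dist (V (r m) p j i) (V (r n) p j i) < e / 2"
      using metric_CauchyD[of _ "e / 2"] e by (metis half_gt_zero)
    have "(\<lambda>n. \<epsilon> (r n)) \<longlonglongrightarrow> 0" using LIMSEQ_subseq_LIMSEQ[OF \<epsilon> r(1)] by (simp add: o_def)
    then obtain N2 where N2: "\<And>n. N2 \<le> n \<Longrightarrow> \<epsilon> (r n) < d"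
      using LIMSEQ_D[of "\<lambda>n. \<epsilon> (r n)" 0 d] d by fastforce
    have near: "dist (V (r n) t j i) (V (r n) p j i) \<le> e / 4" if "N2 \<le> n" "j \<le> n" for n
    proof -
      have "j \<le> r n" using that(2) seq_suble[OF r(1), of n] by simp
      then have "norm (V (r n) t j i - V (r n) p j i) \<le> L * (\<bar>t - p\<bar> + \<epsilon> (r n))" using p t by (intro L(2)) auto
      also have "\<dots> \<le> L * (d + d)" using N2[OF that(1)] p L(1) by (intro mult_left_mono) auto
      also have "\<dots> \<le> (L + 1) * (d + d)" using d by (intro mult_right_mono) auto
      also have "\<dots> = d * (8 * (L + 1)) / 4" by simp
      also have "d * (8 * (L + 1)) = e" using L(1) by (simp add: d_def)
      finally show ?thesis by (simp add: dist_norm)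
    qed
    show "\<exists>M. \<forall>m\<ge>M. \<forall>n\<ge>M. dist (V (r m) t j i) (V (r n) t j i) < e"
    proof (intro exI allI impI)
      fix m n assume mn: "max N1 (max N2 j) \<le> m" "max N1 (max N2 j) \<le> n"
      have "dist (V (r m) t j i) (V (r n) t j i) \<le> dist (V (r m) t j i) (V (r m) p j i) + dist (V (r m) p j i) (V (r n) t j i)"
        by (rule dist_triangle)
      also have "dist (V (r m) p j i) (V (r n) t j i) \<le> dist (V (r m) p j i) (V (r n) p j i) + dist (V (r n) p j i) (V (r n) t j i)"
        by (rule dist_triangle)
      finally show "dist (V (r m) t j i) (V (r n) t j i) < e"
        using near[of m] near[of n] N1[of m n] mn by (simp add: dist_commute[of "V (r n) p j i"])
    qed
  qed
  then show thesis using that[OF r(1)] by (simp add: Cauchy_convergent_iff)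
qed

text \<open>Here \<open>c n m k\<close> stands for the transform at frequency
  \<open>k / 2 ^ n\<close> and time \<open>m * \<tau> n\<close>, and the cut-off
  \<open>4 ^ n\<close> of the index is the frequency \<open>2 ^ n\<close>. The initial value is an
  average over the cell of width \<open>1 / 2 ^ n\<close> centred at \<open>k / 2 ^ n\<close>: the
  translation by half a cell brings the half-open \<open>dcell n k\<close> there, and makes the data
  hermitian. \<open>E0\<close> is measured on the Fourier side and hence carries a factor
  \<open>2 * pi\<close>.\<close>

locale galerkin_family =
  fixes v0 :: "real \<Rightarrow> complex" and \<tau> :: "nat \<Rightarrow> real" and c :: "nat \<Rightarrow> nat \<Rightarrow> int \<Rightarrow> complex" and E0 :: real
  assumes v0: "L2_fun v0" and E0: "E0 = (L2norm v0)^2"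
    and tau: "\<And>n. 0 < \<tau> n" "\<And>n. \<tau> n \<le> (1/2) ^ n"
    and init: "\<And>n k. c n 0 k = (if \<bar>k\<bar> \<le> int (4 ^ n)
      then 2 ^ n * (LBINT \<xi>. v0 (\<xi> - 1 / 2 ^ Suc n) * indicator (dcell n k) \<xi>) else 0)"
    and step: "\<And>n m k. c n (Suc m) k = c n m k + of_real (\<tau> n) *
      galerkin_rhs (\<lambda>k. dsymbol (of_int k / 2 ^ n)) (1 / (4 * pi * 4 ^ n)) (4 ^ n) (c n m) k"
    and herm: "\<And>n m. hermitian_seq (4 ^ n) (c n m)"
    and energy: "\<And>n m. (\<Sum>k=-int (4 ^ n)..int (4 ^ n). (norm (c n m k))^2) / 2 ^ n
      + \<tau> n * (\<Sum>l<m. (\<Sum>k=-int (4 ^ n)..int (4 ^ n). dsymbol (of_int k / 2 ^ n) * (norm (c n l k))^2) / 2 ^ n) \<le> E0"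

lemma L2_translate:
  assumes "L2_fun f" shows "L2_fun (\<lambda>x. f (x - a) :: complex)" "L2norm (\<lambda>x. f (x - a)) = L2norm f"
proof -
  have [measurable]: "f \<in> borel_measurable lborel" using assms by (simp add: L2_fun_def)
  have "integrable lborel (\<lambda>x. (norm (f (- a + 1 * x)))^2)"
    using lborel_integrable_real_affine[of "\<lambda>x. (norm (f x))^2" 1 "-a"] assms by (simp add: L2_fun_def)
  then show "L2_fun (\<lambda>x. f (x - a))" unfolding L2_fun_def by simp
  have "(LBINT x. (norm (f x))^2) = (LBINT x. (norm (f (- a + 1 * x)))^2)"
    using lborel_integral_real_affine[of 1 "\<lambda>x. (norm (f x))^2" "-a"] by simp
  then show "L2norm (\<lambda>x. f (x - a)) = L2norm f" by (simp add: L2norm_def)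
qed

text \<open>Bessel's inequality: pairing \<open>f\<close> with the step function of its own averages
  gives the squared norm of that step function, and Cauchy-Schwarz concludes.\<close>

lemma cell_average_bound:
  fixes f :: "real \<Rightarrow> complex"
  assumes f: "L2_fun f" and A: "finite A"
  shows "(\<Sum>k\<in>A. (norm (2 ^ n * (LBINT \<xi>. f \<xi> * indicator (dcell n k) \<xi>)))^2) / 2 ^ n \<le> (L2norm f)^2"
proof -
  define g where "g k = 2 ^ n * (LBINT \<xi>. f \<xi> * indicator (dcell n k) \<xi>)" for k
  let ?s = "dstep n A g"
  have s2: "L2_fun ?s" by (rule dstep_L2[OF A])
  have S: "(L2norm ?s)\<^sup>2 = (\<Sum>k\<in>A. (norm (g k))^2) / 2 ^ n" by (simp add: dstep_L2norm[OF A] sum_divide_distrib)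
  have "(LBINT \<xi>. f \<xi> * cnj (?s \<xi>)) = (\<Sum>k\<in>A. of_real ((norm (g k))^2) / 2 ^ n)"
    unfolding dstep_inner[OF A f]
    by (intro sum.cong refl) (simp only: complex_norm_square, simp add: g_def)
  also have "\<dots> = of_real ((L2norm ?s)^2)" unfolding S by (simp add: sum_divide_distrib)
  finally have "norm (LBINT \<xi>. f \<xi> * cnj (?s \<xi>)) = (L2norm ?s)^2" by (simp only: norm_of_real) simp
  then have "(L2norm ?s)\<^sup>2 \<le> L2norm f * L2norm ?s"
    using L2_integral_mult_le[OF f L2_fun_cnj[OF s2]] by (simp add: L2norm_cnj)
  then have "L2norm ?s \<le> L2norm f" by (cases "L2norm ?s = 0") (auto simp: power2_eq_square less_le[of 0])
  then have "(L2norm ?s)\<^sup>2 \<le> (L2norm f)^2" by (rule power_mono) simp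
  then show ?thesis unfolding S g_def .
qed

text \<open>Replacing \<xi> by \<open>1 / 2 ^ n - \<xi>\<close> exchanges the cells \<open>k\<close>
  and \<open>- k\<close> up to end points, and changes the sign of the translated variable
  \<open>\<xi> - 1 / 2 ^ Suc n\<close>.\<close>

lemma cell_average_hermitian:
  fixes f :: "real \<Rightarrow> complex"
  assumes f: "L2_fun f" and h: "AE \<xi> in lborel. f (- \<xi>) = cnj (f \<xi>)"
  shows "(LBINT \<xi>. f (\<xi> - 1 / 2 ^ Suc n) * indicator (dcell n (- k)) \<xi>)
     = cnj (LBINT \<xi>. f (\<xi> - 1 / 2 ^ Suc n) * indicator (dcell n k) \<xi>)"
proof -
  have [measurable]: "f \<in> borel_measurable lborel" using f by (simp add: L2_fun_def)
  let ?d = "1 / 2 ^ Suc n :: real"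
  have "(LBINT \<xi>. f (\<xi> - ?d) * indicator (dcell n (- k)) \<xi>)
     = (LBINT \<xi>. f (1 / 2 ^ n + (-1) * \<xi> - ?d) * indicator (dcell n (- k)) (1 / 2 ^ n + (-1) * \<xi>))"
    by (subst lborel_integral_real_affine[of "-1" _ "1 / 2 ^ n"]) auto
  also have "\<dots> = (LBINT \<xi>. cnj (f (\<xi> - ?d) * indicator (dcell n k) \<xi>))"
  proof (rule integral_cong_AE)
    have "AE \<xi> in lborel. f (- (\<xi> - ?d)) = cnj (f (\<xi> - ?d))"
      using AE_borel_affine[of 1 "\<lambda>\<xi>. f (- \<xi>) = cnj (f \<xi>)" "- ?d"] h by simp
    then show "AE \<xi> in lborel. f (1 / 2 ^ n + (-1) * \<xi> - ?d) * indicator (dcell n (- k)) (1 / 2 ^ n + (-1) * \<xi>) = cnj (f (\<xi> - ?d) * indicator (dcell n k) \<xi>)"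
      using AE_lborel_singleton[of "of_int k / 2 ^ n"] AE_lborel_singleton[of "(of_int k + 1) / 2 ^ n"]
    proof eventually_elim
      case (elim \<xi>)
      have "1 / 2 ^ n + (-1) * \<xi> - ?d = - (\<xi> - ?d)" by (simp add: field_simps)
      moreover have "1 / 2 ^ n + (-1) * \<xi> \<in> dcell n (- k) \<longleftrightarrow> \<xi> \<in> dcell n k"
        using elim(2,3) by (auto simp: dcell_def field_simps)
      ultimately show ?case using elim(1) by (simp add: indicator_def)
    qed
  qed measurable
  finally show ?thesis by (simp only: Bochner_Integration.integral_cnj)
qed

theorem galerkin_family_exists:
  assumes v0: "L2_fun v0" and h: "AE \<xi> in lborel. v0 (- \<xi>) = cnj (v0 \<xi>)"
  shows "\<exists>\<tau> c. galerkin_family v0 \<tau> c ((L2norm v0)^2)"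
proof -
  define c0 where "c0 n k = (if \<bar>k\<bar> \<le> int (4 ^ n)
      then 2 ^ n * (LBINT \<xi>. v0 (\<xi> - 1 / 2 ^ Suc n) * indicator (dcell n k) \<xi>) else 0)" for n k
  let ?w = "\<lambda>n k. dsymbol (real_of_int k / 2 ^ n)"
  define P where "P n \<tau> c \<longleftrightarrow> 0 < \<tau> \<and> \<tau> \<le> (1/2) ^ n \<and> c 0 = c0 n \<and>
    (\<forall>m k. c (Suc m) k = c m k + of_real \<tau> * galerkin_rhs (?w n) (1 / (4 * pi * 4 ^ n)) (4 ^ n) (c m) k) \<and>
    (\<forall>m. hermitian_seq (4 ^ n) (c m)) \<and>
    (\<forall>m. (1 / 2 ^ n) * (\<Sum>k=-int (4 ^ n)..int (4 ^ n). (norm (c m k))^2)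
      + \<tau> * (\<Sum>l<m. (1 / 2 ^ n) * (\<Sum>k=-int (4 ^ n)..int (4 ^ n). ?w n k * (norm (c l k))^2)) \<le> (L2norm v0)^2)"
    for n and \<tau> :: real and c :: "nat \<Rightarrow> int \<Rightarrow> complex"
  have "\<exists>\<tau> c. P n \<tau> c" for n
  proof (rule galerkin_scheme_exists[where h="1 / 2 ^ n" and w="?w n" and \<alpha>="1 / (4 * pi * 4 ^ n)" and K="4 ^ n" and ?c0.0="c0 n"
        and ?E0.0="(L2norm v0)\<^sup>2" and \<delta>="(1/2) ^ n"])
    show "hermitian_seq (4 ^ n) (c0 n)"
      unfolding hermitian_seq_def c0_def using cell_average_hermitian[OF v0 h] by simp
    have "(\<Sum>k=-int (4 ^ n)..int (4 ^ n). (norm (c0 n k))^2)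
      = (\<Sum>k=-int (4 ^ n)..int (4 ^ n). (norm (2 ^ n * (LBINT \<xi>. v0 (\<xi> - 1 / 2 ^ Suc n) * indicator (dcell n k) \<xi>)))^2)"
      by (intro sum.cong refl) (auto simp: c0_def)
    then show "1 / 2 ^ n * (\<Sum>k=-int (4 ^ n)..int (4 ^ n). (norm (c0 n k))^2) \<le> (L2norm v0)^2"
      using cell_average_bound[OF L2_translate(1)[OF v0], of "{-int (4 ^ n)..int (4 ^ n)}" n "1 / 2 ^ Suc n"] L2_translate(2)[OF v0, of "1 / 2 ^ Suc n"] by simp
    show "0 < ?w n k" if "k \<noteq> 0" for k using that by (intro dsymbol_pos) auto
    show "?w n (- k) = ?w n k" for k using dsymbol_minus[of "of_int k / 2 ^ n"] by simp
  next
    fix \<tau> c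
    assume a: "0 < \<tau>" "\<tau> \<le> (1/2) ^ n" "c 0 = c0 n"
      "\<And>m k. c (Suc m) k = c m k + of_real \<tau> * galerkin_rhs (?w n) (1 / (4 * pi * 4 ^ n)) (4 ^ n) (c m) k"
      "\<And>m. hermitian_seq (4 ^ n) (c m)"
      "\<And>m. (1 / 2 ^ n) * (\<Sum>k=-int (4 ^ n)..int (4 ^ n). (norm (c m k))^2)
      + \<tau> * (\<Sum>l<m. (1 / 2 ^ n) * (\<Sum>k=-int (4 ^ n)..int (4 ^ n). ?w n k * (norm (c l k))^2)) \<le> (L2norm v0)^2"
    show "\<exists>\<tau> c. P n \<tau> c" unfolding P_def
      by (intro exI[of _ \<tau>] exI[of _ c] conjI allI; rule a)
  qed auto
  then obtain \<tau> c where Pc: "\<And>n. P n (\<tau> n) (c n)" by metis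
  have "galerkin_family v0 \<tau> c ((L2norm v0)^2)"
  proof
    fix n m k
    note p = Pc[of n, unfolded P_def]
    show "0 < \<tau> n" "\<tau> n \<le> (1/2) ^ n" "hermitian_seq (4 ^ n) (c n m)" using p by auto
    have "c n 0 = c0 n" using p by blast
    then show "c n 0 k = (if \<bar>k\<bar> \<le> int (4 ^ n)
      then 2 ^ n * (LBINT \<xi>. v0 (\<xi> - 1 / 2 ^ Suc n) * indicator (dcell n k) \<xi>) else 0)" by (simp only: c0_def)
    show "c n (Suc m) k = c n m k + of_real (\<tau> n) *
      galerkin_rhs (\<lambda>k. dsymbol (of_int k / 2 ^ n)) (1 / (4 * pi * 4 ^ n)) (4 ^ n) (c n m) k" using p by blast
    have "(1 / 2 ^ n) * (\<Sum>k=-int (4 ^ n)..int (4 ^ n). (norm (c n m k))^2)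
      + \<tau> n * (\<Sum>l<m. (1 / 2 ^ n) * (\<Sum>k=-int (4 ^ n)..int (4 ^ n). ?w n k * (norm (c n l k))^2)) \<le> (L2norm v0)^2"
      using p by blast
    then show "(\<Sum>k=-int (4 ^ n)..int (4 ^ n). (norm (c n m k))^2) / 2 ^ n
      + \<tau> n * (\<Sum>l<m. (\<Sum>k=-int (4 ^ n)..int (4 ^ n). dsymbol (of_int k / 2 ^ n) * (norm (c n l k))^2) / 2 ^ n) \<le> (L2norm v0)^2"
      by simp
  qed (use v0 in auto)
  then show ?thesis by blast
qed

context galerkin_family
begin

abbreviation Z :: "nat \<Rightarrow> int set" where "Z n \<equiv> {-int (4 ^ n)..int (4 ^ n)}"

abbreviation w :: "nat \<Rightarrow> int \<Rightarrow> real" where "w n k \<equiv> dsymbol (of_int k / 2 ^ n)"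

lemma supp: "k \<notin> Z n \<Longrightarrow> c n m k = 0"
  using herm[of n m] by (auto simp: hermitian_seq_def)

lemma E0_nonneg: "0 \<le> E0" by (simp add: E0)

lemma energy_dissip_nonneg: "0 \<le> \<tau> n * (\<Sum>l<m. (\<Sum>k\<in>Z n. w n k * (norm (c n l k))^2) / 2 ^ n)"
  using tau(1)[of n] by (intro mult_nonneg_nonneg sum_nonneg divide_nonneg_nonneg) auto

lemma energy_finite:
  assumes "finite S" shows "(\<Sum>k\<in>S. (norm (c n m k))^2) / 2 ^ n \<le> E0"
proof -
  have "(\<Sum>k\<in>S. (norm (c n m k))^2) = (\<Sum>k\<in>S \<inter> Z n. (norm (c n m k))^2)"
    by (rule sum.mono_neutral_right) (use assms supp in auto)
  also have "\<dots> \<le> (\<Sum>k\<in>Z n. (norm (c n m k))^2)" by (rule sum_mono2) auto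
  finally have "(\<Sum>k\<in>S. (norm (c n m k))^2) / 2 ^ n \<le> (\<Sum>k\<in>Z n. (norm (c n m k))^2) / 2 ^ n"
    by (rule divide_right_mono) simp
  then show ?thesis using energy[of n m] energy_dissip_nonneg[of n m] by linarith
qed

lemma convolution_bound: "(\<Sum>j\<in>Z n. norm (c n m j) * norm (c n m (k - j))) \<le> 2 ^ n * E0"
proof -
  have "(\<Sum>j\<in>Z n. (norm (c n m (k - j)))^2) = (\<Sum>j\<in>(\<lambda>j. k - j) ` Z n. (norm (c n m j))^2)"
    by (subst sum.reindex) (auto simp: inj_on_def)
  then have b: "(\<Sum>j\<in>Z n. (norm (c n m (k - j)))^2) \<le> 2 ^ n * E0"
    using energy_finite[of "(\<lambda>j. k - j) ` Z n" n m] by (simp add: pos_divide_le_eq mult.commute)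
  have a: "(\<Sum>j\<in>Z n. (norm (c n m j))^2) \<le> 2 ^ n * E0"
    using energy_finite[of "Z n" n m] by (simp add: pos_divide_le_eq mult.commute)
  have "2 * (\<Sum>j\<in>Z n. norm (c n m j) * norm (c n m (k - j))) = (\<Sum>j\<in>Z n. 2 * norm (c n m j) * norm (c n m (k - j)))"
    by (simp add: sum_distrib_left mult.assoc)
  also have "\<dots> \<le> (\<Sum>j\<in>Z n. (norm (c n m j))^2 + (norm (c n m (k - j)))^2)" by (intro sum_mono sum_squares_bound)
  also have "\<dots> \<le> 2 ^ n * E0 + 2 ^ n * E0" unfolding sum.distrib using a b by linarith
  finally show ?thesis by (simp add: mult.commute)
qed

text \<open>In contrast to the bound behind the time step, this one is uniform in \<open>n\<close>.
  The convolution is at most \<open>2 ^ n * E0\<close>, which consumes one of the two factors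
  \<open>1 / 2 ^ n\<close>; the other turns \<open>k\<close> into the frequency. Polynomial growth
  in the frequency is harmless on a cell or against a rapidly decreasing function.\<close>

lemma rhs_bound:
  "norm (galerkin_rhs (w n) (1 / (4 * pi * 4 ^ n)) (4 ^ n) (c n m) k)
    \<le> (1 + (of_int k / 2 ^ n)^2) * norm (c n m k) + \<bar>of_int k / 2 ^ n\<bar> * E0"
proof (cases "k \<in> Z n")
  case True
  have "norm (galerkin_rhs (w n) (1 / (4 * pi * 4 ^ n)) (4 ^ n) (c n m) k)
     \<le> norm (- (of_real (w n k) * c n m k)) + norm (\<i> * of_real (1 / (4 * pi * 4 ^ n)) * of_int k * (\<Sum>j\<in>Z n. c n m j * c n m (k - j)))"
    using True unfolding galerkin_rhs_def by (simp only: norm_triangle_ineq split: if_splits) auto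
  also have "norm (- (of_real (w n k) * c n m k)) \<le> (1 + (of_int k / 2 ^ n)^2) * norm (c n m k)"
    using dsymbol_le[of "of_int k / 2 ^ n"] by (simp add: norm_mult mult_right_mono)
  also have "norm (\<i> * of_real (1 / (4 * pi * 4 ^ n)) * of_int k * (\<Sum>j\<in>Z n. c n m j * c n m (k - j)))
     = (1 / (4 * pi * 4 ^ n)) * \<bar>of_int k\<bar> * norm (\<Sum>j\<in>Z n. c n m j * c n m (k - j))"
    by (simp add: norm_mult norm_divide norm_power)
  also have "\<dots> \<le> (1 / (1 * 4 ^ n)) * \<bar>of_int k\<bar> * (2 ^ n * E0)"
  proof -
    have "1 \<le> 4 * pi" using pi_gt3 by simp
    then have "(1::real) * 4 ^ n \<le> 4 * pi * 4 ^ n" by (intro mult_right_mono) auto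
    then have "1 / (4 * pi * 4 ^ n) \<le> 1 / (1 * 4 ^ n)" by (intro divide_left_mono) auto
    moreover have "norm (\<Sum>j\<in>Z n. c n m j * c n m (k - j)) \<le> 2 ^ n * E0"
      by (rule order_trans[OF norm_sum]) (simp only: norm_mult convolution_bound)
    ultimately show ?thesis by (intro mult_mono[of "1 / (4 * pi * 4 ^ n) * \<bar>of_int k\<bar>"] mult_right_mono) auto
  qed
  also have "\<dots> = \<bar>of_int k / 2 ^ n\<bar> * E0"
  proof -
    have "(4::real) ^ n = 2 ^ n * 2 ^ n" by (simp flip: power_mult_distrib)
    then show ?thesis by simp
  qed
  finally show ?thesis by simp
next
  case False
  then have "\<not> \<bar>k\<bar> \<le> int (4 ^ n)" by auto
  then show ?thesis using E0_nonneg by (simp add: galerkin_rhs_def)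
qed

lemma sum_affine_divide:
  fixes A B d t :: real
  shows "(\<Sum>k\<in>S. t * (A * x k + B)) / d = t * (A * ((\<Sum>k\<in>S. x k) / d) + B * (real (card S) / d))"
proof -
  have "(\<Sum>k\<in>S. t * (A * x k + B)) = t * (A * (\<Sum>k\<in>S. x k) + B * real (card S))"
    by (simp add: sum.distrib mult.commute[of B] flip: sum_distrib_left)
  then show ?thesis by (simp add: add_divide_distrib distrib_left)
qed

text \<open>At every level the cell of index \<open>i\<close> lies in
  \<open>\<bar>\<xi>\<bar> \<le> 1 + \<bar>i\<bar>\<close>, which turns the polynomial weights into
  constants of the cell. The mean of the moduli is bounded by \<open>1 + E0\<close> through
  \<open>x \<le> 1 + x\<^sup>2\<close>.\<close>

lemma cellsum_step:
  assumes "j \<le> n"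
  shows "norm (cellsum n j i (c n (Suc m)) - cellsum n j i (c n m))
     \<le> \<tau> n * ((1 + (1 + of_int \<bar>i\<bar>)^2) * (1 + E0) + (1 + of_int \<bar>i\<bar>) * E0)"
proof -
  let ?M = "1 + of_int \<bar>i\<bar> :: real"
  let ?D = "galerkin_rhs (w n) (1 / (4 * pi * 4 ^ n)) (4 ^ n) (c n m)"
  have k: "\<bar>of_int k / 2 ^ n\<bar> \<le> ?M" if "k \<in> subcells n j i" for k
  proof -
    have "of_int k / 2 ^ n \<in> dcell j i" by (rule subcells_scaled[OF assms that])
    then have b: "of_int i / 2 ^ j \<le> of_int k / (2 ^ n :: real)" "of_int k / 2 ^ n < (of_int i + 1) / (2 ^ j :: real)" by (auto simp: dcell_def)
    have le: "\<bar>x / 2 ^ j\<bar> \<le> \<bar>x\<bar>" for x :: real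
      unfolding abs_divide by (simp add: divide_le_eq mult_le_cancel_left1 abs_ge_zero)
    have "- \<bar>of_int i\<bar> \<le> of_int i / (2 ^ j :: real)" using le[of "of_int i"] by linarith
    moreover have "(of_int i + 1) / 2 ^ j \<le> \<bar>of_int i + 1 :: real\<bar>" using le[of "of_int i + 1"] by linarith
    ultimately show ?thesis using b unfolding of_int_abs by linarith
  qed
  have card1: "real (card (subcells n j i)) / 2 ^ n \<le> 1"
    by (simp add: card_subcells divide_le_eq power_increasing)
  have "cellsum n j i (c n (Suc m)) - cellsum n j i (c n m) = (\<Sum>k\<in>subcells n j i. of_real (\<tau> n) * ?D k) / 2 ^ n"
    unfolding cellsum_def step by (simp add: sum.distrib add_divide_distrib)
  also have "norm \<dots> \<le> (\<Sum>k\<in>subcells n j i. \<tau> n * ((1 + ?M\<^sup>2) * norm (c n m k) + ?M * E0)) / 2 ^ n"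
    unfolding norm_divide norm_power norm_numeral
  proof (intro divide_right_mono sum_norm_le)
    fix k assume "k \<in> subcells n j i"
    from k[OF this] have "(of_int k / 2 ^ n)\<^sup>2 \<le> ?M\<^sup>2" by (subst power2_abs[symmetric], intro power_mono) auto
    then have "norm (?D k) \<le> (1 + ?M\<^sup>2) * norm (c n m k) + ?M * E0"
      using k[OF \<open>k \<in> subcells n j i\<close>] E0_nonneg
      by (intro order_trans[OF rhs_bound] add_mono mult_right_mono) auto
    then show "norm (of_real (\<tau> n) * ?D k) \<le> \<tau> n * ((1 + ?M\<^sup>2) * norm (c n m k) + ?M * E0)"
      using tau(1)[of n] by (simp add: norm_mult)
  qed auto
  also have "\<dots> = \<tau> n * ((1 + ?M\<^sup>2) * ((\<Sum>k\<in>subcells n j i. norm (c n m k)) / 2 ^ n) + ?M * E0 * (real (card (subcells n j i)) / 2 ^ n))"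
    by (rule sum_affine_divide)
  also have "\<dots> \<le> \<tau> n * ((1 + ?M\<^sup>2) * (1 + E0) + ?M * E0 * 1)"
  proof (intro mult_left_mono add_mono card1)
    have "(\<Sum>k\<in>subcells n j i. norm (c n m k)) \<le> (\<Sum>k\<in>subcells n j i. 1 + (norm (c n m k))^2)"
    proof (rule sum_mono)
      fix k show "norm (c n m k) \<le> 1 + (norm (c n m k))^2"
        using sum_squares_bound[of 1 "norm (c n m k)"] norm_ge_zero[of "c n m k"] unfolding power_one mult_1_right by linarith
    qed
    then have "(\<Sum>k\<in>subcells n j i. norm (c n m k)) / 2 ^ n \<le> real (card (subcells n j i)) / 2 ^ n + (\<Sum>k\<in>subcells n j i. (norm (c n m k))^2) / 2 ^ n"
      by (simp add: sum.distrib divide_right_mono flip: add_divide_distrib)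
    then show "(\<Sum>k\<in>subcells n j i. norm (c n m k)) / 2 ^ n \<le> 1 + E0"
      using card1 energy_finite[OF finite_subcells, of n m n j i] by linarith
  qed (use tau(1)[of n] E0_nonneg in auto)
  finally show ?thesis by simp
qed

text \<open>Piecewise constant interpolation: the coefficients at the last time step before or at
  \<open>t\<close>. Negative times give the initial value through \<open>nat\<close>.\<close>

definition U :: "nat \<Rightarrow> real \<Rightarrow> int \<Rightarrow> complex" where
  "U n t = c n (nat \<lfloor>t / \<tau> n\<rfloor>)"

lemma U_measurable [measurable]: "(\<lambda>t. U n t k) \<in> borel_measurable borel"
  unfolding U_def by measurable

text \<open>Between \<open>s\<close> and \<open>t\<close> there are at most
  \<open>\<bar>t - s\<bar> / \<tau> n + 1\<close> steps; the additional one is the jump that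
  \<open>(1/2) ^ n\<close> accounts for.\<close>

lemma cellsum_equicontinuous:
  "\<exists>L\<ge>0. \<forall>n\<ge>j. \<forall>s\<ge>0. \<forall>t\<ge>0. norm (cellsum n j i (U n t) - cellsum n j i (U n s)) \<le> L * (\<bar>t - s\<bar> + (1/2) ^ n)"
proof (intro exI[of _ "(1 + (1 + of_int \<bar>i\<bar>)^2) * (1 + E0) + (1 + of_int \<bar>i\<bar>) * E0"] conjI allI impI)
  let ?L = "(1 + (1 + of_int \<bar>i\<bar>)^2) * (1 + E0) + (1 + of_int \<bar>i\<bar>) * E0"
  show L0: "0 \<le> ?L" using E0_nonneg by (intro add_nonneg_nonneg mult_nonneg_nonneg) auto
  fix n :: nat and s t :: real
  assume n: "j \<le> n" and st: "0 \<le> s" "0 \<le> (t::real)"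
  have tele: "norm (cellsum n j i (c n (m + p)) - cellsum n j i (c n m)) \<le> real p * (\<tau> n * ?L)" for m p
  proof (induction p)
    case (Suc p)
    have "norm (cellsum n j i (c n (m + Suc p)) - cellsum n j i (c n m))
       \<le> norm (cellsum n j i (c n (Suc (m + p))) - cellsum n j i (c n (m + p))) + norm (cellsum n j i (c n (m + p)) - cellsum n j i (c n m))"
      using norm_triangle_ineq[of "cellsum n j i (c n (Suc (m + p))) - cellsum n j i (c n (m + p))" "cellsum n j i (c n (m + p)) - cellsum n j i (c n m)"] by simp
    also have "\<dots> \<le> \<tau> n * ?L + real p * (\<tau> n * ?L)" using Suc cellsum_step[OF n, of i "m + p"] by linarith
    finally show ?case by (simp add: distrib_right)
  qed simp
  have main: "norm (cellsum n j i (U n b) - cellsum n j i (U n a)) \<le> ?L * (\<bar>b - a\<bar> + (1/2) ^ n)" if ab: "0 \<le> a" "a \<le> b" for a b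
  proof -
    define p where "p = nat \<lfloor>b / \<tau> n\<rfloor> - nat \<lfloor>a / \<tau> n\<rfloor>"
    have tn: "0 < \<tau> n" by (rule tau)
    have le: "\<lfloor>a / \<tau> n\<rfloor> \<le> \<lfloor>b / \<tau> n\<rfloor>" using ab tn by (intro floor_mono divide_right_mono) auto
    have a0: "0 \<le> \<lfloor>a / \<tau> n\<rfloor>" using ab tn by simp
    have "real p = of_int \<lfloor>b / \<tau> n\<rfloor> - of_int \<lfloor>a / \<tau> n\<rfloor>" 
    proof -
      have "0 \<le> \<lfloor>b / \<tau> n\<rfloor>" using a0 le by linarith
      then show ?thesis unfolding p_def using nat_mono[OF le] a0 by (simp add: of_nat_diff)
    qed
    also have "\<dots> \<le> b / \<tau> n - a / \<tau> n + 1" by linarith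
    finally have "real p * \<tau> n \<le> (b / \<tau> n - a / \<tau> n + 1) * \<tau> n" using tn by (intro mult_right_mono) auto
    also have "\<dots> = (b - a) + \<tau> n" using tn by (simp add: field_simps)
    also have "\<dots> \<le> \<bar>b - a\<bar> + (1/2) ^ n" using tau(2)[of n] ab by linarith
    finally have p: "real p * \<tau> n \<le> \<bar>b - a\<bar> + (1/2) ^ n" .
    have "nat \<lfloor>b / \<tau> n\<rfloor> = nat \<lfloor>a / \<tau> n\<rfloor> + p" unfolding p_def using nat_mono[OF le] by simp
    then have "norm (cellsum n j i (U n b) - cellsum n j i (U n a)) \<le> real p * \<tau> n * ?L"
      unfolding U_def using tele[of "nat \<lfloor>a / \<tau> n\<rfloor>" p] by (simp only: mult.assoc)
    also have "\<dots> \<le> (\<bar>b - a\<bar> + (1/2) ^ n) * ?L" by (rule mult_right_mono[OF p L0])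
    finally show ?thesis by (simp only: mult.commute)
  qed
  show "norm (cellsum n j i (U n t) - cellsum n j i (U n s)) \<le> ?L * (\<bar>t - s\<bar> + (1/2) ^ n)"
    using main[of s t] main[of t s] st by (cases "s \<le> t") (auto simp: norm_minus_commute abs_minus_commute)
qed

end

section \<open>The energy inequality in the limit\<close>

definition cell_inf :: "nat \<Rightarrow> int \<Rightarrow> real" where
  "cell_inf j i = Inf (dsymbol ` {of_int i / 2 ^ j..(of_int i + 1) / 2 ^ j})"

lemma cell_inf_le: "\<xi> \<in> dcell j i \<Longrightarrow> cell_inf j i \<le> dsymbol \<xi>"
  unfolding cell_inf_def by (intro cINF_lower bdd_belowI[of _ 0]) (auto simp: dcell_def)

lemma cell_inf_ge: "(\<And>\<eta>. \<eta> \<in> {of_int i / 2 ^ j..(of_int i + 1) / 2 ^ j} \<Longrightarrow> b \<le> dsymbol \<eta>) \<Longrightarrow> b \<le> cell_inf j i"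
  unfolding cell_inf_def by (intro cINF_greatest) (auto simp: divide_right_mono)

lemma cell_inf_nonneg: "0 \<le> cell_inf j i"
  by (rule cell_inf_ge) simp

text \<open>The cells around \<xi> shrink to it and the symbol is continuous. This restores the true
  weight when Fatou's lemma is applied to the weights by infima.\<close>

lemma cell_inf_tendsto:
  fixes \<xi> :: real
  shows "(\<lambda>j. cell_inf j \<lfloor>2 ^ j * \<xi>\<rfloor>) \<longlonglongrightarrow> dsymbol \<xi>"
proof (rule LIMSEQ_I)
  fix e :: real assume e: "e > 0"
  have "isCont dsymbol \<xi>" using continuous_on_dsymbol[of UNIV] by (simp add: continuous_on_eq_continuous_at)
  then obtain d where d: "d > 0" "\<And>\<eta>. \<bar>\<eta> - \<xi>\<bar> < d \<Longrightarrow> \<bar>dsymbol \<eta> - dsymbol \<xi>\<bar> < e / 2"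
    using e unfolding continuous_at_eps_delta dist_real_def by (meson half_gt_zero)
  obtain N where N: "(1/2) ^ N < d" using real_arch_pow_inv[OF d(1), of "1/2"] by auto
  show "\<exists>no. \<forall>j\<ge>no. norm (cell_inf j \<lfloor>2 ^ j * \<xi>\<rfloor> - dsymbol \<xi>) < e"
  proof (intro exI allI impI)
    fix j assume j: "N \<le> j"
    have jd: "1 / 2 ^ j < d"
    proof -
      have "(1/2 :: real) ^ j \<le> (1/2) ^ N" using j by (intro power_decreasing) auto
      then show ?thesis using N by (simp add: power_divide)
    qed
    let ?i = "\<lfloor>2 ^ j * \<xi>\<rfloor>"
    have cell: "\<xi> \<in> dcell j ?i" by (simp add: dcell_iff)
    then have up: "cell_inf j ?i \<le> dsymbol \<xi>" by (rule cell_inf_le)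
    have "dsymbol \<xi> - e / 2 \<le> cell_inf j ?i"
    proof (rule cell_inf_ge)
      fix \<eta> :: real
      assume "\<eta> \<in> {of_int ?i / 2 ^ j..(of_int ?i + 1) / 2 ^ j}"
      moreover have "of_int ?i / 2 ^ j \<le> \<xi>" "\<xi> < (of_int ?i + 1) / 2 ^ j" using cell by (auto simp: dcell_def)
      ultimately have "\<bar>\<eta> - \<xi>\<bar> \<le> 1 / 2 ^ j" by (auto simp: add_divide_distrib abs_le_iff)
      then have "\<bar>dsymbol \<eta> - dsymbol \<xi>\<bar> < e / 2" using jd by (intro d(2)) linarith
      then show "dsymbol \<xi> - e / 2 \<le> dsymbol \<eta>" by linarith
    qed
    then show "norm (cell_inf j ?i - dsymbol \<xi>) < e" using up e by simp
  qed
qed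

lemma nn_integral_time_steps:
  fixes f :: "nat \<Rightarrow> real"
  assumes f: "\<And>l. 0 \<le> f l" and \<tau>: "0 < \<tau>"
  shows "(\<integral>\<^sup>+t. indicator {0..<real m * \<tau>} t * ennreal (f (nat \<lfloor>t / \<tau>\<rfloor>)) \<partial>lborel) = ennreal (\<tau> * (\<Sum>l<m. f l))"
proof (induction m)
  case (Suc m)
  have fm: "(\<lambda>t. ennreal (f (nat \<lfloor>t / \<tau>\<rfloor>))) \<in> borel_measurable lborel" by measurable
  have "indicator {0..<real (Suc m) * \<tau>} t * ennreal (f (nat \<lfloor>t / \<tau>\<rfloor>))
     = indicator {0..<real m * \<tau>} t * ennreal (f (nat \<lfloor>t / \<tau>\<rfloor>)) + ennreal (f m) * indicator {real m * \<tau>..<real (Suc m) * \<tau>} t" for t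
  proof (cases "t \<in> {real m * \<tau>..<real (Suc m) * \<tau>}")
    case True
    then have "\<lfloor>t / \<tau>\<rfloor> = int m" using \<tau> by (simp add: floor_eq_iff pos_le_divide_eq pos_divide_less_eq distrib_right)
    moreover have "0 \<le> real m * \<tau>" using \<tau> by simp
    then have "t \<in> {0..<real (Suc m) * \<tau>}" "t \<notin> {0..<real m * \<tau>}"
      using True unfolding atLeastLessThan_iff by linarith+
    ultimately show ?thesis using True by simp
  next
    case False
    have "real m * \<tau> \<le> real (Suc m) * \<tau>" using \<tau> by (intro mult_right_mono) auto
    then have "t \<in> {0..<real (Suc m) * \<tau>} \<longleftrightarrow> t \<in> {0..<real m * \<tau>}" using False by auto
    then show ?thesis using False by (simp add: indicator_def)
  qed
  then have "(\<integral>\<^sup>+t. indicator {0..<real (Suc m) * \<tau>} t * ennreal (f (nat \<lfloor>t / \<tau>\<rfloor>)) \<partial>lborel)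
     = ennreal (\<tau> * (\<Sum>l<m. f l)) + ennreal (f m) * emeasure lborel {real m * \<tau>..<real (Suc m) * \<tau>}"
    using fm by (simp only:) (subst nn_integral_add, auto simp: nn_integral_cmult_indicator Suc.IH)
  also have "emeasure lborel {real m * \<tau>..<real (Suc m) * \<tau>} = ennreal \<tau>" using \<tau> by (simp add: distrib_right)
  also have "ennreal (\<tau> * (\<Sum>l<m. f l)) + ennreal (f m) * ennreal \<tau> = ennreal (\<tau> * (\<Sum>l<m. f l) + f m * \<tau>)"
    using f \<tau> by (simp add: ennreal_plus ennreal_mult mult_nonneg_nonneg sum_nonneg)
  also have "\<tau> * (\<Sum>l<m. f l) + f m * \<tau> = \<tau> * (\<Sum>l<Suc m. f l)" by (simp add: algebra_simps)
  finally show ?case .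
qed simp

context galerkin_family
begin

definition N_energy :: "nat \<Rightarrow> real \<Rightarrow> real" where
  "N_energy n t = (\<Sum>k\<in>Z n. w n k * (norm (U n t k))^2) / 2 ^ n"

lemma N_energy_nonneg: "0 \<le> N_energy n t"
  unfolding N_energy_def by (intro divide_nonneg_nonneg sum_nonneg mult_nonneg_nonneg) auto

lemma N_energy_measurable [measurable]: "N_energy n \<in> borel_measurable borel"
  unfolding N_energy_def by measurable

lemma U_energy: "finite S \<Longrightarrow> (\<Sum>k\<in>S. (norm (U n t k))^2) / 2 ^ n \<le> E0"
  unfolding U_def by (rule energy_finite)

lemma U_supp: "k \<notin> Z n \<Longrightarrow> U n t k = 0"
  unfolding U_def by (rule supp)

text \<open>The discrete inequality covers completed steps only. At time \<open>t\<close> they reach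
  at least \<open>t - \<tau> n\<close>, a loss that disappears as \<open>n\<close> grows.\<close>

lemma U_energy_inequality:
  assumes "0 \<le> t"
  shows "(\<integral>\<^sup>+s. indicator {0<..<t - \<tau> n} s * ennreal (N_energy n s) \<partial>lborel)
    \<le> ennreal (E0 - (\<Sum>k\<in>Z n. (norm (U n t k))^2) / 2 ^ n)"
proof -
  define m where "m = nat \<lfloor>t / \<tau> n\<rfloor>"
  have tn: "0 < \<tau> n" by (rule tau)
  have "t / \<tau> n - 1 \<le> real m" using assms tn unfolding m_def by (simp add: of_nat_nat)
  then have "(t / \<tau> n - 1) * \<tau> n \<le> real m * \<tau> n" using tn by (intro mult_right_mono) auto
  moreover have "(t / \<tau> n - 1) * \<tau> n = t - \<tau> n" using tn by (simp add: left_diff_distrib)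
  ultimately have m: "t - \<tau> n \<le> real m * \<tau> n" by simp
  define f where "f l = (\<Sum>k\<in>Z n. w n k * (norm (c n l k))^2) / 2 ^ n" for l
  have f0: "0 \<le> f l" for l unfolding f_def by (intro divide_nonneg_nonneg sum_nonneg mult_nonneg_nonneg) auto
  have "(\<integral>\<^sup>+s. indicator {0<..<t - \<tau> n} s * ennreal (N_energy n s) \<partial>lborel)
     \<le> (\<integral>\<^sup>+s. indicator {0..<real m * \<tau> n} s * ennreal (f (nat \<lfloor>s / \<tau> n\<rfloor>)) \<partial>lborel)"
    using m by (intro nn_integral_mono) (auto simp: N_energy_def U_def f_def indicator_def)
  also have "\<dots> = ennreal (\<tau> n * (\<Sum>l<m. f l))" by (rule nn_integral_time_steps[OF f0 tn])
  also have "\<dots> \<le> ennreal (E0 - (\<Sum>k\<in>Z n. (norm (U n t k))^2) / 2 ^ n)"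
    using energy[of n m] unfolding f_def U_def m_def[symmetric] by (intro ennreal_leI) linarith
  finally show ?thesis .
qed

text \<open>Weaker than the inequality for \<open>N_energy\<close>, but formed from finitely many
  cell sums of a fixed level, each of which converges at every time along the subsequence.\<close>

lemma cellsum_energy_inequality:
  assumes "0 \<le> t" "j \<le> n"
  shows "(\<integral>\<^sup>+s. indicator {0<..<t - \<tau> n} s * ennreal (\<Sum>i\<in>window j. cell_inf j i * (2 ^ j * (norm (cellsum n j i (U n s)))^2)) \<partial>lborel)
    \<le> ennreal (E0 - (\<Sum>i\<in>window j. 2 ^ j * (norm (cellsum n j i (U n t)))^2))"
proof -
  have "(\<Sum>i\<in>window j. cell_inf j i * (2 ^ j * (norm (cellsum n j i (U n s)))^2)) \<le> N_energy n s" for s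
    unfolding N_energy_def
    by (rule cellsum_weighted_bound[OF assms(2)])
       (auto simp: cell_inf_nonneg U_supp intro!: cell_inf_le subcells_scaled assms(2))
  then have "(\<integral>\<^sup>+s. indicator {0<..<t - \<tau> n} s * ennreal (\<Sum>i\<in>window j. cell_inf j i * (2 ^ j * (norm (cellsum n j i (U n s)))^2)) \<partial>lborel)
    \<le> (\<integral>\<^sup>+s. indicator {0<..<t - \<tau> n} s * ennreal (N_energy n s) \<partial>lborel)"
    by (intro nn_integral_mono mult_left_mono ennreal_leI) auto
  also have "\<dots> \<le> ennreal (E0 - (\<Sum>k\<in>Z n. (norm (U n t k))^2) / 2 ^ n)" by (rule U_energy_inequality[OF assms(1)])
  also have "\<dots> \<le> ennreal (E0 - (\<Sum>i\<in>window j. 2 ^ j * (norm (cellsum n j i (U n t)))^2))"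
    using cellsum_weighted_bound[OF assms(2) finite_window, where s="\<lambda>_. 1" and w="\<lambda>_. 1" and S="Z n" and a="U n t"]
    by (intro ennreal_leI) (simp add: U_supp)
  finally show ?thesis .
qed

lemma subsequence_limit_exists:
  obtains r W where "strict_mono (r :: nat \<Rightarrow> nat)" "\<And>j i. (\<lambda>t. W t j i) \<in> borel_measurable borel"
    "\<And>t j i. 0 \<le> t \<Longrightarrow> (\<lambda>n. cellsum (r n) j i (U (r n) t)) \<longlonglongrightarrow> W t j i"
    "\<And>t j i. W t j i = W t (Suc j) (2 * i) + W t (Suc j) (2 * i + 1)"
    "\<And>t j A. finite A \<Longrightarrow> (\<Sum>i\<in>A. 2 ^ j * (norm (W t j i))^2) \<le> E0"
proof -
  \<comment> \<open>For \<open>n < j\<close> the lattice does not resolve the cell and the energy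
    bound may fail; the value \<open>0\<close> keeps all bounds uniform in \<open>n\<close>.\<close>
  define V where "V n t j i = (if j \<le> n then cellsum n j i (U n t) else 0)" for n t j i
  have sum_bd: "(\<Sum>i\<in>A. 2 ^ j * (norm (V n t j i))^2) \<le> E0" if "finite A" for A n t j
  proof (cases "j \<le> n")
    case True
    have "(\<Sum>i\<in>A. 1 * (2 ^ j * (norm (cellsum n j i (U n t)))^2)) \<le> (\<Sum>k\<in>Z n. 1 * (norm (U n t k))^2) / 2 ^ n"
      by (rule cellsum_weighted_bound[OF True that]) (auto simp: U_supp)
    then show ?thesis using True U_energy[of "Z n" n t] by (simp add: V_def)
  qed (simp add: V_def E0_nonneg)
  have V_norm: "norm (V n t j i) \<le> sqrt E0" for n t j i
  proof (rule real_le_rsqrt)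
    have "1 * (norm (V n t j i))^2 \<le> 2 ^ j * (norm (V n t j i))^2" by (intro mult_right_mono) auto
    also have "\<dots> \<le> E0" using sum_bd[of "{i}" j n t] by simp
    finally show "(norm (V n t j i))\<^sup>2 \<le> E0" by simp
  qed
  have eqc: "\<exists>L\<ge>0. \<forall>n\<ge>j. \<forall>s\<ge>0. \<forall>t\<ge>0. norm (V n t j i - V n s j i) \<le> L * (\<bar>t - s\<bar> + (1/2) ^ n)" for j i
    using cellsum_equicontinuous[of j i] unfolding V_def by auto
  have half: "(\<lambda>n. (1/2 :: real) ^ n) \<longlonglongrightarrow> 0" by (rule LIMSEQ_realpow_zero) auto
  obtain r where r: "strict_mono (r :: nat \<Rightarrow> nat)" "\<And>t j i. 0 \<le> t \<Longrightarrow> convergent (\<lambda>n. V (r n) t j i)"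
    using cell_extraction[of V "sqrt E0" "\<lambda>n. (1/2) ^ n", OF V_norm eqc half] by metis
  \<comment> \<open>Negative times are moved to \<open>0\<close>, so that the limit exists and is
    measurable on the whole line.\<close>
  define W where "W t j i = lim (\<lambda>n. V (r n) (max t 0) j i)" for t j i
  have lim: "(\<lambda>n. V (r n) (max t 0) j i) \<longlonglongrightarrow> W t j i" for t j i
    using r(2)[of "max t 0" j i] by (simp add: W_def convergent_LIMSEQ_iff)
  have ev: "eventually (\<lambda>n. j \<le> r n) sequentially" for j
    using eventually_ge_at_top[of j] by eventually_elim (use seq_suble[OF r(1)] order_trans in blast)
  show thesis
  proof (rule that[OF r(1), of W])
    fix t j i
    have Vm: "(\<lambda>t. V n t j i) \<in> borel_measurable borel" for n unfolding V_def cellsum_def by measurable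
    have "(\<lambda>t. V n (max t 0) j i) \<in> borel_measurable borel" for n
      by (rule measurable_compose[OF _ Vm]) measurable
    then show "(\<lambda>t. W t j i) \<in> borel_measurable borel" unfolding W_def by (rule borel_measurable_lim_metric)
    show "(\<lambda>n. cellsum (r n) j i (U (r n) t)) \<longlonglongrightarrow> W t j i" if "0 \<le> t"
    proof (rule Lim_transform_eventually[OF lim])
      show "\<forall>\<^sub>F n in sequentially. V (r n) (max t 0) j i = cellsum (r n) j i (U (r n) t)"
        using ev[of j] by eventually_elim (use that in \<open>simp add: V_def\<close>)
    qed
    show "W t j i = W t (Suc j) (2 * i) + W t (Suc j) (2 * i + 1)"
    proof (rule LIMSEQ_unique[OF lim])
      show "(\<lambda>n. V (r n) (max t 0) j i) \<longlonglongrightarrow> W t (Suc j) (2 * i) + W t (Suc j) (2 * i + 1)"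
      proof (rule Lim_transform_eventually[OF tendsto_add[OF lim lim]])
        show "\<forall>\<^sub>F n in sequentially. V (r n) (max t 0) (Suc j) (2 * i) + V (r n) (max t 0) (Suc j) (2 * i + 1) = V (r n) (max t 0) j i"
          using ev[of "Suc j"] by eventually_elim (simp add: V_def cellsum_add)
      qed
    qed
  next
    fix t j and A :: "int set" assume A: "finite A"
    show "(\<Sum>i\<in>A. 2 ^ j * (norm (W t j i))^2) \<le> E0"
    proof (rule LIMSEQ_le_const2)
      show "(\<lambda>n. \<Sum>i\<in>A. 2 ^ j * (norm (V (r n) (max t 0) j i))^2) \<longlonglongrightarrow> (\<Sum>i\<in>A. 2 ^ j * (norm (W t j i))^2)"
        by (intro tendsto_intros lim)
    qed (use sum_bd[OF A] in blast)
  qed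
qed

text \<open>Two limits in turn: the approximation parameter along \<open>r\<close> at a fixed level,
  then the level along \<open>q\<close>. In both, the dissipation is only lower semicontinuous, by
  Fatou's lemma, whereas the energy of the cell averages at time \<open>t\<close> converges.\<close>

theorem weak_limit_exists:
  "\<exists>r v. strict_mono (r :: nat \<Rightarrow> nat) \<and> (\<lambda>(t, \<xi>). v t \<xi>) \<in> borel_measurable (lborel \<Otimes>\<^sub>M lborel) \<and>
    (AE t in lborel. 0 < t \<longrightarrow> L2_fun (v t) \<and>
      (\<forall>j i. (\<lambda>n. cellsum (r n) j i (U (r n) t)) \<longlonglongrightarrow> (LBINT \<xi>. v t \<xi> * indicator (dcell j i) \<xi>)) \<and>
      ennreal ((L2norm (v t))^2) + (\<integral>\<^sup>+s. indicator {0<..<t} s * (\<integral>\<^sup>+\<xi>. ennreal (dsymbol \<xi> * (norm (v s \<xi>))^2) \<partial>lborel) \<partial>lborel)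
        \<le> ennreal E0)"
proof -
  obtain r W where r: "strict_mono (r :: nat \<Rightarrow> nat)" and Wm[measurable]: "\<And>j i. (\<lambda>t. W t j i) \<in> borel_measurable borel"
    and lim: "\<And>t j i. 0 \<le> t \<Longrightarrow> (\<lambda>n. cellsum (r n) j i (U (r n) t)) \<longlonglongrightarrow> W t j i"
    and add: "\<And>t j i. W t j i = W t (Suc j) (2 * i) + W t (Suc j) (2 * i + 1)"
    and bd: "\<And>t j A. finite A \<Longrightarrow> (\<Sum>i\<in>A. 2 ^ j * (norm (W t j i))^2) \<le> E0"
    using subsequence_limit_exists by blast
  obtain v q where v: "(\<lambda>(t, \<xi>). v t \<xi>) \<in> borel_measurable (lborel \<Otimes>\<^sub>M lborel)" and q: "strict_mono (q :: nat \<Rightarrow> nat)"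
    and good: "AE t in lborel. 0 < t \<longrightarrow> L2_fun (v t) \<and>
       (\<lambda>k. L2norm (\<lambda>\<xi>. dstep (q k) (window (q k)) (\<lambda>i. 2 ^ q k * W t (q k) i) \<xi> - v t \<xi>)) \<longlonglongrightarrow> 0 \<and>
       (AE \<xi> in lborel. (\<lambda>k. dstep (q k) (window (q k)) (\<lambda>i. 2 ^ q k * W t (q k) i) \<xi>) \<longlonglongrightarrow> v t \<xi>) \<and>
       (\<forall>j i. (LBINT \<xi>. v t \<xi> * indicator (dcell j i) \<xi>) = W t j i)"
    using dyadic_martingale_limit[of W E0, OF Wm add bd] by blast
  note v[measurable]
  define S where "S j t = dstep j (window j) (\<lambda>i. 2 ^ j * W t j i)" for j t
  have S2: "L2_fun (S j t)" for j t unfolding S_def by (rule dstep_L2) simp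
  define F where "F j t = (\<Sum>i\<in>window j. cell_inf j i * (2 ^ j * (norm (W t j i))^2))" for j t
  define G where "G j t = (\<Sum>i\<in>window j. 2 ^ j * (norm (W t j i))^2)" for j t
  have Fm[measurable]: "F j \<in> borel_measurable borel" for j unfolding F_def by measurable
  have sq: "(norm (2 ^ j * W t j i))\<^sup>2 / 2 ^ j = 2 ^ j * (norm (W t j i))^2" for j t i
    by (simp add: norm_mult norm_power power_mult_distrib power2_eq_square)
  have SF: "(\<integral>\<^sup>+\<xi>. ennreal (cell_inf j \<lfloor>2 ^ j * \<xi>\<rfloor> * (norm (S j t \<xi>))^2) \<partial>lborel) = ennreal (F j t)" for j t
    unfolding S_def F_def using dstep_norm[of "window j" "cell_inf j" j "\<lambda>i. 2 ^ j * W t j i"]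
    by (simp only: finite_window cell_inf_nonneg sq times_divide_eq_right[symmetric])
  have SG: "(L2norm (S j t))\<^sup>2 = G j t" for j t
    unfolding S_def G_def by (subst dstep_L2norm) (auto simp only: finite_window sq)
  have step1: "(\<integral>\<^sup>+s. indicator {0<..<t} s * ennreal (F j s) \<partial>lborel) \<le> ennreal (E0 - G j t)" if t: "0 < t" for t j
  proof -
    let ?Fn = "\<lambda>n s. \<Sum>i\<in>window j. cell_inf j i * (2 ^ j * (norm (cellsum (r n) j i (U (r n) s)))^2)"
    let ?Gn = "\<lambda>n. \<Sum>i\<in>window j. 2 ^ j * (norm (cellsum (r n) j i (U (r n) t)))^2"
    have tau0: "(\<lambda>n. \<tau> (r n)) \<longlonglongrightarrow> 0"
    proof (rule Lim_null_comparison)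
      have "norm (\<tau> (r n)) \<le> (1/2) ^ r n" for n using tau[of "r n"] by (simp add: less_imp_le)
      then show "\<forall>\<^sub>F n in sequentially. norm (\<tau> (r n)) \<le> (1/2) ^ r n" by simp
      have "(\<lambda>n. (1/2 :: real) ^ n) \<longlonglongrightarrow> 0" by (rule LIMSEQ_realpow_zero) auto
      from LIMSEQ_subseq_LIMSEQ[OF this r] show "(\<lambda>n. (1/2 :: real) ^ r n) \<longlonglongrightarrow> 0" by (simp add: o_def)
    qed
    have "(\<integral>\<^sup>+s. indicator {0<..<t} s * ennreal (F j s) \<partial>lborel)
      \<le> (\<integral>\<^sup>+s. liminf (\<lambda>n. indicator {0<..<t - \<tau> (r n)} s * ennreal (?Fn n s)) \<partial>lborel)"
    proof (rule nn_integral_mono)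
      fix s
      show "indicator {0<..<t} s * ennreal (F j s) \<le> liminf (\<lambda>n. indicator {0<..<t - \<tau> (r n)} s * ennreal (?Fn n s))"
      proof (cases "s \<in> {0<..<t}")
        case True
        have "(\<lambda>n. ?Fn n s) \<longlonglongrightarrow> F j s" unfolding F_def by (intro tendsto_intros lim) (use True in auto)
        then have l: "(\<lambda>n. ennreal (?Fn n s)) \<longlonglongrightarrow> ennreal (F j s)" by (rule tendsto_ennrealI)
        \<comment> \<open>A fixed time \<open>s < t\<close> belongs to the shortened interval from
          some \<open>n\<close> on.\<close>
        have "eventually (\<lambda>n. \<tau> (r n) < t - s) sequentially" using order_tendstoD(2)[OF tau0, of "t - s"] True by simp
        then have "eventually (\<lambda>n. ennreal (?Fn n s) = indicator {0<..<t - \<tau> (r n)} s * ennreal (?Fn n s)) sequentially"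
          by eventually_elim (use True in \<open>simp add: indicator_def\<close>)
        from lim_imp_Liminf[OF sequentially_bot Lim_transform_eventually[OF l this]] True show ?thesis by simp
      qed simp
    qed
    also have "\<dots> \<le> liminf (\<lambda>n. \<integral>\<^sup>+s. indicator {0<..<t - \<tau> (r n)} s * ennreal (?Fn n s) \<partial>lborel)"
      by (rule nn_integral_liminf) (unfold cellsum_def, measurable)
    also have "\<dots> \<le> liminf (\<lambda>n. ennreal (E0 - ?Gn n))"
    proof (rule Liminf_mono)
      show "\<forall>\<^sub>F n in sequentially. (\<integral>\<^sup>+s. indicator {0<..<t - \<tau> (r n)} s * ennreal (?Fn n s) \<partial>lborel) \<le> ennreal (E0 - ?Gn n)"
        using eventually_ge_at_top[of j]
      proof eventually_elim
        case (elim n)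
        then have "j \<le> r n" using seq_suble[OF r, of n] by simp
        then show ?case using t by (intro cellsum_energy_inequality) auto
      qed
    qed
    also have "\<dots> = ennreal (E0 - G j t)"
      unfolding G_def by (intro lim_imp_Liminf tendsto_ennrealI tendsto_intros lim) (use t in auto)
    finally show ?thesis .
  qed
  have inner: "AE s in lborel. 0 < s \<longrightarrow> (\<integral>\<^sup>+\<xi>. ennreal (dsymbol \<xi> * (norm (v s \<xi>))^2) \<partial>lborel) \<le> liminf (\<lambda>k. ennreal (F (q k) s))"
    using good
  proof eventually_elim
    case (elim s)
    show ?case
    proof
      assume "0 < s"
      then have ae: "AE \<xi> in lborel. (\<lambda>k. S (q k) s \<xi>) \<longlonglongrightarrow> v s \<xi>" using elim unfolding S_def by blast
      have Sm[measurable]: "S j s \<in> borel_measurable lborel" for j using S2 by (simp add: L2_fun_def)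
      have "(\<integral>\<^sup>+\<xi>. ennreal (dsymbol \<xi> * (norm (v s \<xi>))^2) \<partial>lborel)
        \<le> (\<integral>\<^sup>+\<xi>. liminf (\<lambda>k. ennreal (cell_inf (q k) \<lfloor>2 ^ q k * \<xi>\<rfloor> * (norm (S (q k) s \<xi>))^2)) \<partial>lborel)"
      proof (rule nn_integral_mono_AE)
        show "AE \<xi> in lborel. ennreal (dsymbol \<xi> * (norm (v s \<xi>))^2) \<le> liminf (\<lambda>k. ennreal (cell_inf (q k) \<lfloor>2 ^ q k * \<xi>\<rfloor> * (norm (S (q k) s \<xi>))^2))"
          using ae
        proof eventually_elim
          case (elim \<xi>)
          have "(\<lambda>k. cell_inf (q k) \<lfloor>2 ^ q k * \<xi>\<rfloor>) \<longlonglongrightarrow> dsymbol \<xi>"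
            using LIMSEQ_subseq_LIMSEQ[OF cell_inf_tendsto q, of \<xi>] by (simp add: o_def)
          then have "(\<lambda>k. ennreal (cell_inf (q k) \<lfloor>2 ^ q k * \<xi>\<rfloor> * (norm (S (q k) s \<xi>))^2)) \<longlonglongrightarrow> ennreal (dsymbol \<xi> * (norm (v s \<xi>))^2)"
            by (intro tendsto_ennrealI tendsto_intros elim)
          from lim_imp_Liminf[OF sequentially_bot this] show ?case by simp
        qed
      qed
      also have "\<dots> \<le> liminf (\<lambda>k. \<integral>\<^sup>+\<xi>. ennreal (cell_inf (q k) \<lfloor>2 ^ q k * \<xi>\<rfloor> * (norm (S (q k) s \<xi>))^2) \<partial>lborel)"
        by (rule nn_integral_liminf) measurable
      finally show "(\<integral>\<^sup>+\<xi>. ennreal (dsymbol \<xi> * (norm (v s \<xi>))^2) \<partial>lborel) \<le> liminf (\<lambda>k. ennreal (F (q k) s))"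
        by (simp only: SF)
    qed
  qed
  have "AE t in lborel. 0 < t \<longrightarrow> L2_fun (v t) \<and>
      (\<forall>j i. (\<lambda>n. cellsum (r n) j i (U (r n) t)) \<longlonglongrightarrow> (LBINT \<xi>. v t \<xi> * indicator (dcell j i) \<xi>)) \<and>
      ennreal ((L2norm (v t))^2) + (\<integral>\<^sup>+s. indicator {0<..<t} s * (\<integral>\<^sup>+\<xi>. ennreal (dsymbol \<xi> * (norm (v s \<xi>))^2) \<partial>lborel) \<partial>lborel)
        \<le> ennreal E0"
    using good
  proof eventually_elim
    case (elim t)
    show ?case
    proof
      assume t: "0 < t"
      have v2: "L2_fun (v t)" and conv: "(\<lambda>k. L2norm (\<lambda>\<xi>. S (q k) t \<xi> - v t \<xi>)) \<longlonglongrightarrow> 0"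
        and cell: "\<And>j i. (LBINT \<xi>. v t \<xi> * indicator (dcell j i) \<xi>) = W t j i"
        using elim t unfolding S_def by blast+
      have "(\<lambda>k. (L2norm (S (q k) t))^2) \<longlonglongrightarrow> (L2norm (v t))^2"
        by (intro tendsto_power L2norm_tendsto S2 v2 conv)
      then have Gl: "(\<lambda>k. G (q k) t) \<longlonglongrightarrow> (L2norm (v t))^2" by (simp only: SG)
      \<comment> \<open>\<open>ennreal\<close> sends negative numbers to \<open>0\<close>; the
        difference from \<open>E0\<close> below can be added back only because it is
        nonnegative.\<close>
      have le: "(L2norm (v t))\<^sup>2 \<le> E0"
        by (rule LIMSEQ_le_const2[OF Gl]) (use bd[OF finite_window] in \<open>auto simp: G_def\<close>)
      have "(\<integral>\<^sup>+s. indicator {0<..<t} s * (\<integral>\<^sup>+\<xi>. ennreal (dsymbol \<xi> * (norm (v s \<xi>))^2) \<partial>lborel) \<partial>lborel)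
        \<le> (\<integral>\<^sup>+s. liminf (\<lambda>k. indicator {0<..<t} s * ennreal (F (q k) s)) \<partial>lborel)"
      proof (rule nn_integral_mono_AE)
        show "AE s in lborel. indicator {0<..<t} s * (\<integral>\<^sup>+\<xi>. ennreal (dsymbol \<xi> * (norm (v s \<xi>))^2) \<partial>lborel)
          \<le> liminf (\<lambda>k. indicator {0<..<t} s * ennreal (F (q k) s))"
          using inner by eventually_elim (auto simp: indicator_def)
      qed
      also have "\<dots> \<le> liminf (\<lambda>k. \<integral>\<^sup>+s. indicator {0<..<t} s * ennreal (F (q k) s) \<partial>lborel)"
        by (rule nn_integral_liminf) measurable
      also have "\<dots> \<le> liminf (\<lambda>k. ennreal (E0 - G (q k) t))"
        by (rule Liminf_mono) (simp add: step1[OF t])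
      also have "\<dots> = ennreal (E0 - (L2norm (v t))\<^sup>2)"
        by (intro lim_imp_Liminf tendsto_ennrealI tendsto_intros Gl) simp
      finally have "ennreal ((L2norm (v t))^2) + (\<integral>\<^sup>+s. indicator {0<..<t} s * (\<integral>\<^sup>+\<xi>. ennreal (dsymbol \<xi> * (norm (v s \<xi>))^2) \<partial>lborel) \<partial>lborel)
        \<le> ennreal ((L2norm (v t))^2) + ennreal (E0 - (L2norm (v t))\<^sup>2)" by (rule add_left_mono)
      also have "\<dots> = ennreal E0" using le by (simp flip: ennreal_plus)
      finally show "L2_fun (v t) \<and>
        (\<forall>j i. (\<lambda>n. cellsum (r n) j i (U (r n) t)) \<longlonglongrightarrow> (LBINT \<xi>. v t \<xi> * indicator (dcell j i) \<xi>)) \<and>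
        ennreal ((L2norm (v t))^2) + (\<integral>\<^sup>+s. indicator {0<..<t} s * (\<integral>\<^sup>+\<xi>. ennreal (dsymbol \<xi> * (norm (v s \<xi>))^2) \<partial>lborel) \<partial>lborel)
          \<le> ennreal E0"
        using v2 cell lim t by auto
    qed
  qed
  then show ?thesis using r v by blast
qed

end

section \<open>Test functions\<close>

lemma test_fun_C_k: "test_fun \<phi> \<Longrightarrow> C_k k \<phi>"
  by (simp add: test_fun_def)

lemma test_fun_continuous: "test_fun \<phi> \<Longrightarrow> continuous_on UNIV (\<lambda>(t, x). \<phi> t x)"
  using test_fun_C_k[of \<phi> 0] by simp

lemma test_fun_DERIV:
  assumes "test_fun \<phi>"
  shows "(\<phi> t has_real_derivative partial_x \<phi> t x) (at x)" "((\<lambda>s. \<phi> s x) has_real_derivative partial_t \<phi> t x) (at t)"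
  using test_fun_C_k[OF assms, of 1] unfolding partial_x_def partial_t_def
  by (auto simp: DERIV_deriv_iff_real_differentiable)

lemma test_fun_support:
  assumes "test_fun \<phi>" "(t, x) \<notin> closure {(t, x). \<phi> t x \<noteq> 0}"
  shows "partial_x \<phi> t x = 0" "partial_t \<phi> t x = 0"
proof -
  let ?S = "closure {(t, x). \<phi> t x \<noteq> 0}"
  have z: "\<phi> s y = 0" if "(s, y) \<notin> ?S" for s y using that closure_subset[of "{(t, x). \<phi> t x \<noteq> 0}"] by auto
  have "open (- ?S)" by (rule open_Compl[OF closed_closure])
  then obtain e where e: "e > 0" "ball (t, x) e \<subseteq> - ?S" using assms(2) unfolding open_contains_ball by blast
  have 1: "\<phi> t y = 0" if "dist y x < e" for y
  proof (rule z)
    have "(t, y) \<in> ball (t, x) e" using that by (simp add: dist_Pair_Pair dist_commute)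
    then show "(t, y) \<notin> ?S" using e(2) by blast
  qed
  have 2: "\<phi> s x = 0" if "dist s t < e" for s
  proof (rule z)
    have "(s, x) \<in> ball (t, x) e" using that by (simp add: dist_Pair_Pair dist_commute)
    then show "(s, x) \<notin> ?S" using e(2) by blast
  qed
  have "((\<lambda>_. 0) has_real_derivative partial_x \<phi> t x) (at x)"
    by (rule has_field_derivative_transform_within_open[OF test_fun_DERIV(1)[OF assms(1)], of "ball x e"])
       (use e(1) 1 in \<open>auto simp: dist_commute\<close>)
  then show "partial_x \<phi> t x = 0" using DERIV_unique[OF _ DERIV_const] by blast
  have "((\<lambda>_. 0) has_real_derivative partial_t \<phi> t x) (at t)"
    by (rule has_field_derivative_transform_within_open[OF test_fun_DERIV(2)[OF assms(1)], of "ball t e"])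
       (use e(1) 2 in \<open>auto simp: dist_commute\<close>)
  then show "partial_t \<phi> t x = 0" using DERIV_unique[OF _ DERIV_const] by blast
qed

lemma test_fun_partial:
  assumes "test_fun \<phi>" shows "test_fun (partial_x \<phi>)" "test_fun (partial_t \<phi>)"
proof -
  let ?S = "closure {(t, x). \<phi> t x \<noteq> 0}"
  have S: "compact ?S" using assms by (simp add: test_fun_def)
  have C: "C_k k (partial_x \<phi>)" "C_k k (partial_t \<phi>)" for k using test_fun_C_k[OF assms, of "Suc k"] by auto
  have "{(t, x). partial_x \<phi> t x \<noteq> 0} \<subseteq> ?S" "{(t, x). partial_t \<phi> t x \<noteq> 0} \<subseteq> ?S"
    using test_fun_support[OF assms] by auto
  then have "closure {(t, x). partial_x \<phi> t x \<noteq> 0} \<subseteq> ?S" "closure {(t, x). partial_t \<phi> t x \<noteq> 0} \<subseteq> ?S"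
    by (auto intro: closure_minimal[THEN subsetD])
  then have "compact (closure {(t, x). partial_x \<phi> t x \<noteq> 0})" "compact (closure {(t, x). partial_t \<phi> t x \<noteq> 0})"
    using compact_Int_closed[OF S closed_closure] by (metis inf.absorb_iff2)+
  then show "test_fun (partial_x \<phi>)" "test_fun (partial_t \<phi>)" using C by (auto simp: test_fun_def)
qed

lemma test_fun_bounds:
  assumes "test_fun \<phi>"
  obtains T B where "0 < T" "0 \<le> B" "\<And>t x. \<bar>\<phi> t x\<bar> \<le> B" "\<And>t x. T \<le> \<bar>t\<bar> \<or> T \<le> \<bar>x\<bar> \<Longrightarrow> \<phi> t x = 0"
proof -
  let ?S = "closure {(t, x). \<phi> t x \<noteq> 0}"
  have S: "compact ?S" using assms by (simp add: test_fun_def)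
  have z: "\<phi> s y = 0" if "(s, y) \<notin> ?S" for s y using that closure_subset[of "{(t, x). \<phi> t x \<noteq> 0}"] by auto
  obtain T where T: "\<And>p. p \<in> ?S \<Longrightarrow> norm p < T" "0 < T"
    using compact_imp_bounded[OF S] unfolding bounded_pos_less by blast
  have im: "compact ((\<lambda>(t, x). \<phi> t x) ` ?S)"
    by (rule compact_continuous_image[OF continuous_on_subset[OF test_fun_continuous[OF assms]] S]) auto
  then obtain B where B: "\<And>y. y \<in> (\<lambda>(t, x). \<phi> t x) ` ?S \<Longrightarrow> norm y \<le> B" "0 < B"
    using compact_imp_bounded[OF im] unfolding bounded_pos by metis
  show thesis
  proof
    show "0 < T" by (rule T(2))
    show "0 \<le> B" using B(2) by simp
    show "\<bar>\<phi> t x\<bar> \<le> B" for t x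
    proof (cases "(t, x) \<in> ?S")
      case True
      then have "\<phi> t x \<in> (\<lambda>(t, x). \<phi> t x) ` ?S" by force
      from B(1)[OF this] show ?thesis by simp
    next
      case False
      from z[OF this] B(2) show ?thesis by simp
    qed
    show "\<phi> t x = 0" if "T \<le> \<bar>t\<bar> \<or> T \<le> \<bar>x\<bar>" for t x
    proof (rule z)
      have "\<bar>t\<bar> \<le> norm (t, x)" "\<bar>x\<bar> \<le> norm (t, x)"
        using norm_fst_le[of t x] norm_snd_le[of x t] by simp_all
      then have "\<not> norm (t, x) < T" using that by linarith
      then show "(t, x) \<notin> ?S" using T(1)[of "(t, x)"] by blast
    qed
  qed
qed

lemma notin_Icc_abs: "x \<notin> {-T..T} \<Longrightarrow> T \<le> \<bar>x\<bar>" for x T :: real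
  by (cases "x \<ge> 0") auto

lemma test_fun_cutoff_bound:
  fixes \<phi> :: "real \<Rightarrow> real \<Rightarrow> real"
  assumes "0 \<le> B" "\<And>t x. \<bar>\<phi> t x\<bar> \<le> B" "\<And>t x. T \<le> \<bar>t\<bar> \<or> T \<le> \<bar>x\<bar> \<Longrightarrow> \<phi> t x = 0"
  shows "norm (complex_of_real (\<phi> t x)) \<le> B * indicator {-T..T} x"
proof (cases "x \<in> {-T..T}")
  case True
  then show ?thesis using assms(2)[of t x] by simp
next
  case False
  then have "T \<le> \<bar>x\<bar>" by (cases "x \<ge> 0") auto
  then have "\<phi> t x = 0" by (intro assms(3)) simp
  then show ?thesis using assms(1) by simp
qed

lemma test_fun_measurable:
  assumes "test_fun \<phi>"
  shows "(\<lambda>(t, x). \<phi> t x) \<in> borel_measurable (lborel \<Otimes>\<^sub>M lborel)" "\<phi> t \<in> borel_measurable borel" "(\<lambda>s. \<phi> s x) \<in> borel_measurable borel"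
proof -
  have c: "continuous_on UNIV (\<lambda>(t, x). \<phi> t x)" by (rule test_fun_continuous[OF assms])
  have "(\<lambda>(t, x). \<phi> t x) \<in> borel_measurable borel" by (rule borel_measurable_continuous_onI[OF c])
  then show "(\<lambda>(t, x). \<phi> t x) \<in> borel_measurable (lborel \<Otimes>\<^sub>M lborel)"
    unfolding lborel_prod by simp
  have "continuous_on UNIV (\<lambda>x. case (t, x) of (t, x) \<Rightarrow> \<phi> t x)"
    by (rule continuous_on_compose2[OF c]) (auto intro!: continuous_intros)
  then show "\<phi> t \<in> borel_measurable borel" by (intro borel_measurable_continuous_onI) simp
  have "continuous_on UNIV (\<lambda>s. case (s, x) of (t, x) \<Rightarrow> \<phi> t x)"
    by (rule continuous_on_compose2[OF c]) (auto intro!: continuous_intros)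
  then show "(\<lambda>s. \<phi> s x) \<in> borel_measurable borel" by (intro borel_measurable_continuous_onI) simp
qed

lemma test_fun_slices_continuous:
  assumes "test_fun \<phi>" shows "continuous_on A (\<phi> t)" "continuous_on A (\<lambda>s. \<phi> s x)"
  by (intro continuous_at_imp_continuous_on ballI DERIV_isCont[OF test_fun_DERIV(1)[OF assms]] DERIV_isCont[OF test_fun_DERIV(2)[OF assms]])+

lemma test_fun_x_integrable:
  assumes "test_fun \<phi>" shows "integrable lborel (\<lambda>x. complex_of_real (\<phi> t x))" "L2_fun (\<lambda>x. complex_of_real (\<phi> t x))"
proof -
  obtain T B where TB: "0 < T" "0 \<le> B" "\<And>t x. \<bar>\<phi> t x\<bar> \<le> B" "\<And>t x. T \<le> \<bar>t\<bar> \<or> T \<le> \<bar>x\<bar> \<Longrightarrow> \<phi> t x = 0"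
    using test_fun_bounds[OF assms] by blast
  have [measurable]: "\<phi> t \<in> borel_measurable borel" by (rule test_fun_measurable(2)[OF assms])
  have m: "(\<lambda>x. complex_of_real (\<phi> t x)) \<in> borel_measurable lborel" by measurable
  have b: "norm (complex_of_real (\<phi> t x)) \<le> norm (complex_of_real B * indicator {-T..T} x)" for x
    using test_fun_cutoff_bound[of B \<phi> T t x, OF TB(2-4)] TB(2) by (cases "x \<in> {-T..T}") (auto simp: norm_mult)
  show "integrable lborel (\<lambda>x. complex_of_real (\<phi> t x))"
    by (rule Bochner_Integration.integrable_bound[OF integrable_mult_right[OF integrable_indicator_Icc, of B "-T" T] m]) (use b in auto)
  show "L2_fun (\<lambda>x. complex_of_real (\<phi> t x))"
    by (rule L2_fun_bound[OF L2_fun_indicator_Icc[of B "-T" T] m, where C=1]) (use b in auto)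
qed

section \<open>Transforms of test functions\<close>

text \<open>Evaluated at \<open>- \<xi>\<close>: for real \<phi> this is the conjugate of the
  transform, so the pairing with the transform of \<open>u\<close> in Plancherel's identity becomes
  bilinear.\<close>

definition tf :: "(real \<Rightarrow> real \<Rightarrow> real) \<Rightarrow> real \<Rightarrow> real \<Rightarrow> complex" where
  "tf \<phi> t \<xi> = fourier (\<lambda>x. complex_of_real (\<phi> t x)) (- \<xi>)"

lemma tf_eq: "tf \<phi> t \<xi> = (LBINT x. cis (x * \<xi>) * complex_of_real (\<phi> t x))"
  by (simp add: tf_def fourier_def)

lemma tf_cnj: "tf \<phi> t \<xi> = cnj (fourier (\<lambda>x. complex_of_real (\<phi> t x)) \<xi>)"
  unfolding tf_eq fourier_def by (simp add: cis_cnj flip: Bochner_Integration.integral_cnj)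

lemma fourier_continuous:
  assumes "integrable lborel f" shows "continuous_on A (fourier f)"
proof -
  have [measurable]: "f \<in> borel_measurable lborel" using assms by auto
  have "isCont (fourier f) \<xi>" for \<xi>
    unfolding continuous_at_sequentially
  proof (intro allI impI)
    fix X :: "nat \<Rightarrow> real" assume X: "X \<longlonglongrightarrow> \<xi>"
    have "(\<lambda>n. (LBINT x. cis (- (x * X n)) * f x)) \<longlonglongrightarrow> (LBINT x. cis (- (x * \<xi>)) * f x)"
    proof (rule integral_dominated_convergence[where w="\<lambda>x. norm (f x)"])
      show "AE x in lborel. (\<lambda>n. cis (- (x * X n)) * f x) \<longlonglongrightarrow> cis (- (x * \<xi>)) * f x"
      proof (rule AE_I2)
        fix x
        have "isCont cis (- (x * \<xi>))" using continuous_on_cis[OF continuous_on_id, of UNIV] by (simp add: continuous_on_eq_continuous_at)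
        then show "(\<lambda>n. cis (- (x * X n)) * f x) \<longlonglongrightarrow> cis (- (x * \<xi>)) * f x"
          by (intro tendsto_intros isCont_tendsto_compose[of _ cis] X)
      qed
    qed (use assms in \<open>auto simp: norm_mult\<close>)
    then show "(fourier f \<circ> X) \<longlonglongrightarrow> fourier f \<xi>" by (simp add: fourier_def o_def)
  qed
  then show ?thesis by (simp add: continuous_at_imp_continuous_on)
qed

lemma tf_continuous: "test_fun \<phi> \<Longrightarrow> continuous_on A (tf \<phi> t)"
  unfolding tf_cnj[abs_def] by (intro continuous_intros fourier_continuous test_fun_x_integrable)

lemma tf_measurable:
  assumes "test_fun \<phi>" shows "(\<lambda>(t, \<xi>). tf \<phi> t \<xi>) \<in> borel_measurable (lborel \<Otimes>\<^sub>M lborel)"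
proof -
  note [measurable] = test_fun_measurable(1)[OF assms]
  have "(\<lambda>p. (LBINT x. cis (x * snd p) * complex_of_real (case (fst p, x) of (t, x) \<Rightarrow> \<phi> t x))) \<in> borel_measurable (lborel \<Otimes>\<^sub>M lborel)"
    by measurable
  then show ?thesis by (simp add: tf_eq split_beta')
qed

lemma tf_t_measurable:
  assumes "test_fun \<phi>" shows "(\<lambda>t. tf \<phi> t \<xi>) \<in> borel_measurable borel"
  using measurable_Pair1[OF tf_measurable[OF assms], of \<xi>] by (simp add: space_lborel)

lemma cis_has_vector_derivative:
  fixes x \<xi> :: real
  shows "((\<lambda>x. cis (x * \<xi>)) has_vector_derivative (\<i> * \<xi> * cis (x * \<xi>))) (at x)"
proof -
  have "((\<lambda>x::real. x * \<xi>) has_derivative (\<lambda>t. t * \<xi>)) (at x)" by (auto intro!: derivative_eq_intros)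
  then have "((\<lambda>x. cis (x * \<xi>)) has_derivative (\<lambda>t. (t * \<xi>) *\<^sub>R (\<i> * cis (x * \<xi>)))) (at x)"
    by (rule has_derivative_cis)
  moreover have "(\<lambda>t. (t * \<xi>) *\<^sub>R (\<i> * cis (x * \<xi>))) = (\<lambda>t. t *\<^sub>R (\<i> * \<xi> * cis (x * \<xi>)))"
    by (rule ext) (simp add: scaleR_conv_of_real)
  ultimately show ?thesis unfolding has_vector_derivative_def by (simp only:)
qed

lemma test_fun_x_vector_derivative:
  assumes "test_fun \<phi>"
  shows "((\<lambda>x. complex_of_real (\<phi> t x)) has_vector_derivative complex_of_real (partial_x \<phi> t x)) (at x)"
  using test_fun_DERIV(1)[OF assms, of t x]
  by (intro has_vector_derivative_of_real) (simp only: has_real_derivative_iff_has_vector_derivative)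

lemma test_fun_t_vector_derivative:
  assumes "test_fun \<phi>"
  shows "((\<lambda>s. \<phi> s x) has_vector_derivative partial_t \<phi> t x) (at t)"
  using test_fun_DERIV(2)[OF assms, of x t] by (simp only: has_real_derivative_iff_has_vector_derivative)

text \<open>Integration by parts, in the form that the derivative of
  \<open>cis (x * \<xi>) * \<phi> t x\<close> has integral \<open>0\<close> over an interval that
  contains the support.\<close>

lemma tf_partial_x:
  assumes \<phi>: "test_fun \<phi>" shows "tf (partial_x \<phi>) t \<xi> = - (\<i> * \<xi>) * tf \<phi> t \<xi>"
proof -
  obtain T B where TB: "0 < T" "\<And>t x. T \<le> \<bar>t\<bar> \<or> T \<le> \<bar>x\<bar> \<Longrightarrow> \<phi> t x = 0" using test_fun_bounds[OF \<phi>] by metis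
  note \<phi>x = test_fun_partial(1)[OF \<phi>]
  let ?F = "\<lambda>x. cis (x * \<xi>) * complex_of_real (\<phi> t x)"
  let ?f = "\<lambda>x. cis (x * \<xi>) * complex_of_real (partial_x \<phi> t x) + \<i> * \<xi> * cis (x * \<xi>) * complex_of_real (\<phi> t x)"
  have "(LBINT x. indicator {-T..T} x *\<^sub>R ?f x) = ?F T - ?F (- T)"
  proof (rule integral_FTC_atLeastAtMost)
    fix x
    show "(?F has_vector_derivative ?f x) (at x within {-T..T})"
      using has_vector_derivative_mult[OF cis_has_vector_derivative test_fun_x_vector_derivative[OF \<phi>]]
      by (rule has_vector_derivative_at_within)
  next
    show "continuous_on {-T..T} ?f"
      by (intro continuous_intros test_fun_slices_continuous \<phi> \<phi>x)
  qed (use TB in auto)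
  moreover have "?F T = 0" "?F (- T) = 0" using TB by auto
  moreover have "indicator {-T..T} x *\<^sub>R ?f x = ?f x" for x
  proof (cases "x \<in> {-T..T}")
    case False
    have "\<phi> t x = 0" using notin_Icc_abs[OF False] by (intro TB(2)) auto
    moreover have "partial_x \<phi> t x = 0"
    proof -
      have "((\<lambda>_. 0) has_real_derivative partial_x \<phi> t x) (at x)"
      proof (rule has_field_derivative_transform_within_open[OF test_fun_DERIV(1)[OF \<phi>], of "- {-T..T}"])
        show "\<phi> t y = 0" if "y \<in> - {-T..T}" for y using notin_Icc_abs[of y T] that by (intro TB(2)) auto
      qed (use False in auto)
      then show ?thesis using DERIV_unique[OF _ DERIV_const] by blast
    qed
    ultimately show ?thesis by simp
  qed simp
  ultimately have "(LBINT x. ?f x) = 0" by (simp only: diff_self)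
  moreover have "integrable lborel (\<lambda>x. cis (x * \<xi>) * complex_of_real (partial_x \<phi> t x))" "integrable lborel (\<lambda>x. cis (x * \<xi>) * complex_of_real (\<phi> t x))"
    using cis_mult_integrable[OF test_fun_x_integrable(1)[OF \<phi>x], of \<xi> t] cis_mult_integrable[OF test_fun_x_integrable(1)[OF \<phi>], of \<xi> t]
    by (simp_all only: mult.commute[of \<xi>])
  ultimately have "tf (partial_x \<phi>) t \<xi> + \<i> * \<xi> * tf \<phi> t \<xi> = 0" unfolding tf_eq by (simp add: mult.assoc)
  then show ?thesis by (simp add: eq_neg_iff_add_eq_0)
qed

lemma tf_bounded:
  assumes "test_fun \<phi>" obtains C where "0 \<le> C" "\<And>t \<xi>. norm (tf \<phi> t \<xi>) \<le> C"
proof -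
  obtain T B where TB: "0 < T" "0 \<le> B" "\<And>t x. \<bar>\<phi> t x\<bar> \<le> B" "\<And>t x. T \<le> \<bar>t\<bar> \<or> T \<le> \<bar>x\<bar> \<Longrightarrow> \<phi> t x = 0"
    using test_fun_bounds[OF assms] by blast
  have "norm (tf \<phi> t \<xi>) \<le> B * (2 * T)" for t \<xi>
  proof -
    have "norm (tf \<phi> t \<xi>) \<le> (LBINT x. norm (complex_of_real (\<phi> t x)))" unfolding tf_def by (rule fourier_bound)
    also have "\<dots> \<le> (LBINT x. B * indicator {-T..T} x)"
    proof (rule integral_mono)
      show "integrable lborel (\<lambda>x. B * indicator {-T..T} x :: real)" by (intro integrable_mult_right integrable_real_indicator) (auto simp: emeasure_lborel_Icc_eq)
      show "norm (complex_of_real (\<phi> t x)) \<le> B * indicator {-T..T} x" for x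
        by (rule test_fun_cutoff_bound[of B \<phi> T t x, OF TB(2-4)])
      show "integrable lborel (\<lambda>x. norm (complex_of_real (\<phi> t x)))"
        by (rule integrable_norm[OF test_fun_x_integrable(1)[OF assms]])
    qed
    also have "\<dots> = B * (2 * T)" using TB(1) by simp
    finally show ?thesis .
  qed
  then show thesis using that[of "B * (2 * T)"] TB by simp
qed

text \<open>Order four is chosen because the symbol may cost one factor
  \<open>1 + \<xi>\<^sup>2\<close>, and a second one must remain for sums and integrals over all
  frequencies to converge. The constant comes from expanding
  \<open>(1 + \<xi>\<^sup>2)\<^sup>2\<close>.\<close>

lemma tf_decay:
  assumes \<phi>: "test_fun \<phi>" obtains C where "0 \<le> C" "\<And>t \<xi>. norm (tf \<phi> t \<xi>) \<le> C / (1 + \<xi>^2)^2"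
proof -
  let ?d = partial_x
  note p1 = test_fun_partial(1)[OF \<phi>]
  note p2 = test_fun_partial(1)[OF p1]
  note p3 = test_fun_partial(1)[OF p2]
  note p4 = test_fun_partial(1)[OF p3]
  obtain C0 where C0: "0 \<le> C0" "\<And>t \<xi>. norm (tf \<phi> t \<xi>) \<le> C0" using tf_bounded[OF \<phi>] by blast
  obtain C2 where C2: "0 \<le> C2" "\<And>t \<xi>. norm (tf (?d (?d \<phi>)) t \<xi>) \<le> C2" using tf_bounded[OF p2] by blast
  obtain C4 where C4: "0 \<le> C4" "\<And>t \<xi>. norm (tf (?d (?d (?d (?d \<phi>)))) t \<xi>) \<le> C4" using tf_bounded[OF p4] by blast
  have "norm (tf \<phi> t \<xi>) \<le> (C0 + 2 * C2 + C4) / (1 + \<xi>^2)^2" for t \<xi>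
  proof -
    have e2: "norm (tf (?d (?d \<phi>)) t \<xi>) = \<xi>^2 * norm (tf \<phi> t \<xi>)"
      unfolding tf_partial_x[OF p1] tf_partial_x[OF \<phi>] by (simp add: norm_mult power2_eq_square)
    have e4: "norm (tf (?d (?d (?d (?d \<phi>)))) t \<xi>) = \<xi>^2 * (\<xi>^2 * norm (tf \<phi> t \<xi>))"
      unfolding tf_partial_x[OF p3] tf_partial_x[OF p2] e2[symmetric] by (simp add: norm_mult power2_eq_square)
    have "(1 + \<xi>^2)\<^sup>2 * norm (tf \<phi> t \<xi>) = norm (tf \<phi> t \<xi>) + 2 * (\<xi>^2 * norm (tf \<phi> t \<xi>)) + \<xi>^2 * (\<xi>^2 * norm (tf \<phi> t \<xi>))"
      by (simp add: power2_sum algebra_simps power2_eq_square)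
    also have "\<dots> \<le> C0 + 2 * C2 + C4"
      using C0(2)[of t \<xi>] C2(2)[of t \<xi>] C4(2)[of t \<xi>] unfolding e2 e4 by linarith
    finally have "(1 + \<xi>^2)\<^sup>2 * norm (tf \<phi> t \<xi>) \<le> C0 + 2 * C2 + C4" .
    moreover have p: "0 < (1 + \<xi>^2)^2" by (intro zero_less_power add_pos_nonneg) auto
    ultimately show ?thesis by (simp only: pos_le_divide_eq[OF p] mult.commute)
  qed
  then show thesis using that[of "C0 + 2 * C2 + C4"] C0 C2 C4 by simp
qed

text \<open>Fubini together with the fundamental theorem at each \<open>x\<close> replaces
  differentiation under the integral sign; the integrated form is the one that a time step
  requires.\<close>

lemma tf_FTC:
  assumes \<phi>: "test_fun \<phi>" and "a \<le> b"
  shows "(LBINT s. indicator {a..b} s *\<^sub>R tf (partial_t \<phi>) s \<xi>) = tf \<phi> b \<xi> - tf \<phi> a \<xi>"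
proof -
  note \<phi>t = test_fun_partial(2)[OF \<phi>]
  note [measurable] = test_fun_measurable(1)[OF \<phi>t]
  obtain T B where TB: "0 < T" "0 \<le> B" "\<And>t x. \<bar>partial_t \<phi> t x\<bar> \<le> B" "\<And>t x. T \<le> \<bar>t\<bar> \<or> T \<le> \<bar>x\<bar> \<Longrightarrow> partial_t \<phi> t x = 0"
    using test_fun_bounds[OF \<phi>t] by blast
  let ?k = "\<lambda>s x. cis (x * \<xi>) * complex_of_real (partial_t \<phi> s x)"
  have int: "integrable (lborel \<Otimes>\<^sub>M lborel) (\<lambda>(s, x). ?k s x * (indicator {a..b} s * indicator {-T..T} x))"
  proof (rule lborel_pair_kernel_integrable[OF integrable_indicator_Icc integrable_indicator_Icc])
    have "(\<lambda>p. cis (snd p * \<xi>) * complex_of_real (case p of (t, x) \<Rightarrow> partial_t \<phi> t x)) \<in> borel_measurable (lborel \<Otimes>\<^sub>M lborel)" by measurable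
    then show "(\<lambda>(s, x). ?k s x) \<in> borel_measurable (lborel \<Otimes>\<^sub>M lborel)" by (simp add: split_beta')
    show "norm (?k s x) \<le> B" for s x using TB(3)[of s x] by (simp add: norm_mult)
  qed
  have cut: "?k s x * (indicator {a..b} s * indicator {-T..T} x) = indicator {a..b} s *\<^sub>R ?k s x" for s x
  proof (cases "x \<in> {-T..T}")
    case False
    then have "T \<le> \<bar>x\<bar>" by (cases "x \<ge> 0") auto
    then have "partial_t \<phi> s x = 0" by (intro TB(4)) simp
    then show ?thesis by simp
  qed (simp add: indicator_def)
  have "(LBINT s. indicator {a..b} s *\<^sub>R tf (partial_t \<phi>) s \<xi>) = (LBINT s. (LBINT x. ?k s x * (indicator {a..b} s * indicator {-T..T} x)))"
    unfolding cut tf_eq by simp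
  also have "\<dots> = (LBINT x. (LBINT s. ?k s x * (indicator {a..b} s * indicator {-T..T} x)))"
    by (rule lborel_pair.Fubini_integral[symmetric]) (use int in simp)
  also have "\<dots> = (LBINT x. cis (x * \<xi>) * complex_of_real (\<phi> b x) - cis (x * \<xi>) * complex_of_real (\<phi> a x))"
  proof (rule Bochner_Integration.integral_cong[OF refl])
    fix x
    have "(LBINT s. ?k s x * (indicator {a..b} s * indicator {-T..T} x)) = (LBINT s. cis (x * \<xi>) * complex_of_real (indicator {a..b} s *\<^sub>R partial_t \<phi> s x))"
      unfolding cut by (intro Bochner_Integration.integral_cong refl) (auto simp: indicator_def)
    also have "\<dots> = cis (x * \<xi>) * complex_of_real (LBINT s. indicator {a..b} s *\<^sub>R partial_t \<phi> s x)"
      by (simp only: integral_mult_right_zero integral_complex_of_real)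
    also have "(LBINT s. indicator {a..b} s *\<^sub>R partial_t \<phi> s x) = \<phi> b x - \<phi> a x"
    proof (rule integral_FTC_atLeastAtMost[OF assms(2)])
      show "((\<lambda>s. \<phi> s x) has_vector_derivative partial_t \<phi> s x) (at s within {a..b})" for s
        by (rule has_vector_derivative_at_within[OF test_fun_t_vector_derivative[OF \<phi>]])
    qed (rule test_fun_slices_continuous[OF \<phi>t])
    finally show "(LBINT s. ?k s x * (indicator {a..b} s * indicator {-T..T} x)) = cis (x * \<xi>) * complex_of_real (\<phi> b x) - cis (x * \<xi>) * complex_of_real (\<phi> a x)"
      by (simp add: right_diff_distrib)
  qed
  also have "\<dots> = tf \<phi> b \<xi> - tf \<phi> a \<xi>"
    using cis_mult_integrable[OF test_fun_x_integrable(1)[OF \<phi>], of \<xi> b] cis_mult_integrable[OF test_fun_x_integrable(1)[OF \<phi>], of \<xi> a]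
    unfolding tf_eq by (simp add: mult.commute[of \<xi>])
  finally show ?thesis .
qed

lemma tf_lipschitz:
  assumes \<phi>: "test_fun \<phi>" and C: "\<And>s. norm (tf (partial_t \<phi>) s \<xi>) \<le> C"
  shows "norm (tf \<phi> b \<xi> - tf \<phi> a \<xi>) \<le> \<bar>b - a\<bar> * C"
proof -
  have C0: "0 \<le> C" using C[of 0] norm_ge_zero order_trans by blast
  note m = tf_t_measurable[OF test_fun_partial(2)[OF \<phi>]]
  have main: "norm (tf \<phi> b \<xi> - tf \<phi> a \<xi>) \<le> (b - a) * C" if "a \<le> b" for a b
  proof -
    have "norm (tf \<phi> b \<xi> - tf \<phi> a \<xi>) \<le> (LBINT s. norm (indicator {a..b} s *\<^sub>R tf (partial_t \<phi>) s \<xi>))"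
      unfolding tf_FTC[OF \<phi> that, symmetric] by (rule integral_norm_bound)
    also have "\<dots> \<le> (LBINT s. C * indicator {a..b} s)"
    proof (rule integral_mono)
      show i: "integrable lborel (\<lambda>s. C * indicator {a..b} s :: real)"
        by (intro integrable_mult_right integrable_real_indicator) (auto simp: emeasure_lborel_Icc_eq)
      show le: "norm (indicator {a..b} s *\<^sub>R tf (partial_t \<phi>) s \<xi>) \<le> C * indicator {a..b} s" for s
        using C[of s] by (simp add: indicator_def)
      show "integrable lborel (\<lambda>s. norm (indicator {a..b} s *\<^sub>R tf (partial_t \<phi>) s \<xi>))"
        by (rule Bochner_Integration.integrable_bound[OF i]) (use m le C0 in \<open>auto simp: abs_mult indicator_def\<close>)
    qed
    also have "\<dots> = (b - a) * C" using that by simp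
    finally show ?thesis .
  qed
  show ?thesis
  proof (cases "a \<le> b")
    case True
    then show ?thesis using main[OF True] by simp
  next
    case False
    then show ?thesis using main[of b a] by (simp add: norm_minus_commute[of "tf \<phi> b \<xi>"])
  qed
qed

section \<open>Passage to the limit\<close>

lemma integrable_inverse_square: "integrable lborel (\<lambda>x::real. inverse (1 + x^2))" "(LBINT x. inverse (1 + x^2)) = pi"
  using integrable_inverse_1_plus_square LBINT_inverse_1_plus_square
  by (auto simp: set_integrable_def interval_lebesgue_integral_def set_lebesgue_integral_def)

text \<open>Comparison with the integral of \<open>3 / (1 + x\<^sup>2)\<close>: on a cell of width
  at most \<open>1\<close>, moving away from the left end raises \<open>1 + x\<^sup>2\<close> at
  most threefold. The integral is \<open>3 * pi\<close>, rounded up to \<open>10\<close>.\<close>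

lemma riemann_sum_bound:
  assumes "finite S" shows "(\<Sum>k\<in>S. 1 / (1 + (real_of_int k / 2 ^ n)^2)) / 2 ^ n \<le> 10"
proof -
  let ?g = "\<lambda>x::real. inverse (1 + x^2)"
  have gi: "integrable lborel (\<lambda>\<xi>. 3 * ?g \<xi> * indicator (dcell n k) \<xi>)" for k
    by (rule Bochner_Integration.integrable_bound[OF integrable_mult_right[OF integrable_inverse_square(1), of 3]])
       (auto simp: indicator_def)
  have "(\<Sum>k\<in>S. 1 / (1 + (real_of_int k / 2 ^ n)^2)) / 2 ^ n = (\<Sum>k\<in>S. (LBINT \<xi>. 1 / (1 + (real_of_int k / 2 ^ n)^2) * indicator (dcell n k) \<xi>))"
    by (simp add: dcell_emeasure sum_divide_distrib mult.commute)
  also have "\<dots> \<le> (\<Sum>k\<in>S. (LBINT \<xi>. 3 * ?g \<xi> * indicator (dcell n k) \<xi>))"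
  proof (intro sum_mono integral_mono gi integrable_mult_right indicator_dcell_integrable)
    fix k \<xi>
    show "1 / (1 + (real_of_int k / 2 ^ n)^2) * indicator (dcell n k) \<xi> \<le> 3 * ?g \<xi> * indicator (dcell n k) \<xi>"
    proof (cases "\<xi> \<in> dcell n k")
      case True
      define y where "y = (of_int k / 2 ^ n :: real)"
      have "y \<le> \<xi>" "\<xi> < y + 1 / 2 ^ n" using True by (auto simp: dcell_def y_def add_divide_distrib)
      moreover have "1 / 2 ^ n \<le> (1::real)" by (simp add: divide_le_eq)
      ultimately have "\<bar>\<xi>\<bar> \<le> \<bar>y\<bar> + 1" by linarith
      then have "\<bar>\<xi>\<bar>\<^sup>2 \<le> (\<bar>y\<bar> + 1)^2" by (intro power_mono) auto
      also have "\<dots> \<le> 2 * y^2 + 2" using sum_squares_bound[of "\<bar>y\<bar>" 1] by (simp add: power2_sum)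
      finally have le: "1 + \<xi>^2 \<le> 3 * (1 + y^2)" using zero_le_power2[of y] by (simp only: power2_abs distrib_left)
      have p: "0 < 1 + \<xi>^2" "0 < 1 + y^2" by (auto intro: add_pos_nonneg)
      have "1 / (1 + y^2) \<le> 3 * ?g \<xi>" using le p by (simp add: field_simps)
      then show ?thesis using True by (simp add: y_def)
    qed simp
  qed
  also have "\<dots> = (LBINT \<xi>. (\<Sum>k\<in>S. 3 * ?g \<xi> * indicator (dcell n k) \<xi>))"
    by (rule Bochner_Integration.integral_sum[symmetric]) (rule gi)
  also have "\<dots> \<le> (LBINT \<xi>. 3 * ?g \<xi>)"
  proof (intro integral_mono Bochner_Integration.integrable_sum gi integrable_mult_right integrable_inverse_square)
    fix \<xi>
    have "(\<Sum>k\<in>S. 3 * ?g \<xi> * indicator (dcell n k) \<xi>) = (\<Sum>k\<in>S. if \<lfloor>2 ^ n * \<xi>\<rfloor> = k then 3 * ?g \<xi> else 0)"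
      by (intro sum.cong refl) (auto simp: indicator_def dcell_iff)
    also have "\<dots> \<le> 3 * ?g \<xi>" using assms by simp
    finally show "(\<Sum>k\<in>S. 3 * ?g \<xi> * indicator (dcell n k) \<xi>) \<le> 3 * ?g \<xi>" .
  qed
  also have "\<dots> = 3 * pi" by (simp add: integrable_inverse_square)
  also have "\<dots> \<le> 10" using pi_less_4 pi_approx by simp
  finally show ?thesis .
qed

lemma inv_sq_le: "y / (1 + \<xi>^2)^2 \<le> y / (1 + \<xi>^2)" if "0 \<le> y" for y \<xi> :: real
proof -
  have "1 + \<xi>^2 \<le> (1 + \<xi>^2)^2" unfolding power2_eq_square[of "1 + \<xi>^2"]
    using mult_left_mono[of 1 "1 + \<xi>^2" "1 + \<xi>^2"] by simp
  moreover have "0 < 1 + \<xi>^2" by (intro add_pos_nonneg) auto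
  ultimately show ?thesis using that by (intro divide_left_mono mult_pos_pos zero_less_power) auto
qed

lemma tf_bounded_slice_integrable:
  assumes \<phi>: "test_fun \<phi>"
  shows "integrable lborel (\<lambda>s. indicator {a..<b} s *\<^sub>R tf \<phi> s \<xi>)"
proof -
  obtain C where C: "0 \<le> C" "\<And>t \<xi>. norm (tf \<phi> t \<xi>) \<le> C" using tf_bounded[OF \<phi>] by blast
  note m = tf_t_measurable[OF \<phi>]
  show ?thesis
    by (rule Bochner_Integration.integrable_bound[OF integrable_mult_right[OF integrable_indicator_Icc, of C a b]])
       (use C m in \<open>auto simp: norm_mult indicator_def\<close>)
qed

lemma sum_affine_divide2:
  fixes C F d :: real
  shows "(\<Sum>k\<in>S. C * (x k + F * y k)) / d = C * ((\<Sum>k\<in>S. x k) / d + F * ((\<Sum>k\<in>S. y k) / d))"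
proof -
  have "(\<Sum>k\<in>S. C * (x k + F * y k)) = C * ((\<Sum>k\<in>S. x k) + F * (\<Sum>k\<in>S. y k))"
    by (simp add: sum.distrib flip: sum_distrib_left)
  then show ?thesis by (simp add: add_divide_distrib distrib_left)
qed

lemma diff_telescope: "a + b - (p - q) = (a - (r - q)) + (b - (p - r))" for a b p q r :: complex
  by simp

context galerkin_family
begin

section \<open>The discrete weak formulation\<close>

text \<open>Riemann sum of the bilinear pairing that becomes the integral of
  \<open>v * \<gamma>\<close> in the limit.\<close>

definition pair :: "nat \<Rightarrow> (int \<Rightarrow> complex) \<Rightarrow> (real \<Rightarrow> complex) \<Rightarrow> complex" where
  "pair n a \<gamma> = (\<Sum>k\<in>Z n. a k * \<gamma> (of_int k / 2 ^ n)) / 2 ^ n"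

abbreviation D :: "nat \<Rightarrow> (int \<Rightarrow> complex) \<Rightarrow> int \<Rightarrow> complex" where
  "D n a \<equiv> galerkin_rhs (w n) (1 / (4 * pi * 4 ^ n)) (4 ^ n) a"

text \<open>The right-hand side grows at most quadratically in the frequency, so decay of order four
  suffices, uniformly in \<open>n\<close> and \<open>m\<close>. The inequality of the means
  separates the energy from a Riemann sum of at most \<open>10\<close>; thus
  \<open>11 * E0 + 10\<close> is \<open>E0 + (1 + E0) * 10\<close>.\<close>

lemma pair_rhs_bound:
  assumes C: "0 \<le> C" and \<gamma>: "\<And>\<xi>. norm (\<gamma> \<xi>) \<le> C / (1 + \<xi>^2)^2"
  shows "norm (pair n (D n (c n m)) \<gamma>) \<le> C * (11 * E0 + 10)"
proof -
  let ?x = "\<lambda>k. real_of_int k / 2 ^ n"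
  have "norm (pair n (D n (c n m)) \<gamma>) \<le> (\<Sum>k\<in>Z n. C * ((norm (c n m k))^2 + (1 + E0) * (1 / (1 + (?x k)^2)))) / 2 ^ n"
    unfolding pair_def norm_divide norm_power norm_numeral
  proof (intro divide_right_mono sum_norm_le)
    fix k
    define y where "y = 1 + (?x k)^2"
    have y: "1 \<le> y" by (simp add: y_def)
    have xy: "\<bar>?x k\<bar> \<le> y"
      using sum_squares_bound[of "\<bar>?x k\<bar>" 1] zero_le_power2[of "?x k"] unfolding y_def by (simp only: power2_abs power_one mult_1_right)
    have "norm (D n (c n m) k * \<gamma> (?x k)) \<le> (y * norm (c n m k) + \<bar>?x k\<bar> * E0) * (C / y^2)"
      unfolding norm_mult y_def by (intro mult_mono rhs_bound \<gamma>) (auto intro!: add_nonneg_nonneg mult_nonneg_nonneg divide_nonneg_nonneg E0_nonneg)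
    also have "\<dots> \<le> (y * norm (c n m k) + y * E0) * (C / y^2)"
      using xy E0_nonneg C by (intro mult_right_mono add_left_mono) auto
    also have "\<dots> = C * (norm (c n m k) * (1 / y) + E0 * (1 / y))"
      using y by (simp add: power2_eq_square field_simps)
    also have "\<dots> \<le> C * ((norm (c n m k))^2 + (1 + E0) * (1 / y))"
    proof (intro mult_left_mono C)
      have "2 * norm (c n m k) * (1 / y) \<le> (norm (c n m k))^2 + (1 / y)^2" by (rule sum_squares_bound)
      moreover have "(1 / y)\<^sup>2 \<le> 1 / y" using y by (simp add: power2_eq_square divide_le_eq mult_le_cancel_left1)
      moreover have "0 \<le> norm (c n m k) * (1 / y)" using y by simp
      ultimately show "norm (c n m k) * (1 / y) + E0 * (1 / y) \<le> (norm (c n m k))^2 + (1 + E0) * (1 / y)"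
        unfolding distrib_right by linarith
    qed
    finally show "norm (D n (c n m) k * \<gamma> (?x k)) \<le> C * ((norm (c n m k))^2 + (1 + E0) * (1 / (1 + (?x k)^2)))" by (simp only: y_def)
  qed auto
  also have "\<dots> = C * ((\<Sum>k\<in>Z n. (norm (c n m k))^2) / 2 ^ n + (1 + E0) * ((\<Sum>k\<in>Z n. 1 / (1 + (?x k)^2)) / 2 ^ n))"
    by (rule sum_affine_divide2)
  also have "\<dots> \<le> C * (E0 + (1 + E0) * 10)"
    using E0_nonneg by (intro mult_left_mono add_mono energy_finite riemann_sum_bound C) auto
  finally show ?thesis by (simp add: algebra_simps)
qed

lemma pair_diff: "pair n a (\<lambda>\<xi>. f \<xi> - g \<xi>) = pair n a f - pair n a g"
  by (simp add: pair_def right_diff_distrib sum_subtractf diff_divide_distrib)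

lemma pair_step: "pair n (c n (Suc m)) \<gamma> = pair n (c n m) \<gamma> + of_real (\<tau> n) * pair n (D n (c n m)) \<gamma>"
  unfolding pair_def step by (simp add: distrib_right sum.distrib add_divide_distrib sum_distrib_left mult.assoc)

lemma pair_scaleR: "x *\<^sub>R pair n a \<gamma> = (\<Sum>k\<in>Z n. (a k / 2 ^ n) * (x *\<^sub>R \<gamma> (of_int k / 2 ^ n)))"
  by (simp add: pair_def scaleR_conv_of_real sum_distrib_left sum_divide_distrib mult_ac)

lemma pair_integral:
  assumes "\<And>\<xi>. integrable lborel (\<lambda>s. x s *\<^sub>R \<gamma> s \<xi>)"
  shows "integrable lborel (\<lambda>s. x s *\<^sub>R pair n a (\<gamma> s))"
    "(LBINT s. x s *\<^sub>R pair n a (\<gamma> s)) = pair n a (\<lambda>\<xi>. (LBINT s. x s *\<^sub>R \<gamma> s \<xi>))"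
proof -
  show "integrable lborel (\<lambda>s. x s *\<^sub>R pair n a (\<gamma> s))"
    unfolding pair_scaleR by (intro Bochner_Integration.integrable_sum integrable_mult_right assms)
  have "(LBINT s. x s *\<^sub>R pair n a (\<gamma> s)) = (\<Sum>k\<in>Z n. (LBINT s. (a k / 2 ^ n) * (x s *\<^sub>R \<gamma> s (of_int k / 2 ^ n))))"
    unfolding pair_scaleR by (rule Bochner_Integration.integral_sum) (intro integrable_mult_right assms)
  also have "\<dots> = (\<Sum>k\<in>Z n. (a k / 2 ^ n) * (LBINT s. x s *\<^sub>R \<gamma> s (of_int k / 2 ^ n)))"
    by (simp only: integral_mult_right_zero)
  also have "\<dots> = pair n a (\<lambda>\<xi>. (LBINT s. x s *\<^sub>R \<gamma> s \<xi>))" by (simp add: pair_def sum_divide_distrib)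
  finally show "(LBINT s. x s *\<^sub>R pair n a (\<gamma> s)) = pair n a (\<lambda>\<xi>. (LBINT s. x s *\<^sub>R \<gamma> s \<xi>))" .
qed

text \<open>The rate of change of \<open>pair n (U n s) (tf \<phi> s)\<close>, with the slope of the
  Euler scheme in place of the derivative of \<open>U\<close>.\<close>

definition weak_rate :: "(real \<Rightarrow> real \<Rightarrow> real) \<Rightarrow> nat \<Rightarrow> real \<Rightarrow> complex" where
  "weak_rate \<phi> n s = pair n (D n (U n s)) (tf \<phi> s) + pair n (U n s) (tf (partial_t \<phi>) s)"

lemma U_on_step: "s \<in> {real m * \<tau> n..<real (Suc m) * \<tau> n} \<Longrightarrow> U n s = c n m"
proof -
  assume s: "s \<in> {real m * \<tau> n..<real (Suc m) * \<tau> n}"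
  have "\<lfloor>s / \<tau> n\<rfloor> = int m" using s tau(1)[of n] by (simp add: floor_eq_iff pos_le_divide_eq pos_divide_less_eq distrib_right)
  then show ?thesis by (simp add: U_def)
qed

text \<open>A discrete product rule with the test function at the right end \<open>b\<close>: new
  coefficients against \<open>tf \<phi> b\<close> minus old ones against \<open>tf \<phi> a\<close>
  equals \<tau> times the slope against \<open>tf \<phi> b\<close>, plus the old coefficients
  against the increment of \<open>tf \<phi>\<close>. The second part is matched exactly. In the
  first, \<open>tf \<phi> s\<close> is replaced by \<open>tf \<phi> b\<close>, a Lipschitz error of
  order \<tau> over an interval of length \<tau>.\<close>

lemma weak_rate_step:
  assumes \<phi>: "test_fun \<phi>" and C: "0 \<le> C" "\<And>s \<xi>. norm (tf (partial_t \<phi>) s \<xi>) \<le> C / (1 + \<xi>^2)^2"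
  shows "integrable lborel (\<lambda>s. indicator {real m * \<tau> n..<real (Suc m) * \<tau> n} s *\<^sub>R weak_rate \<phi> n s)"
    and "norm ((LBINT s. indicator {real m * \<tau> n..<real (Suc m) * \<tau> n} s *\<^sub>R weak_rate \<phi> n s)
      - (pair n (c n (Suc m)) (tf \<phi> (real (Suc m) * \<tau> n)) - pair n (c n m) (tf \<phi> (real m * \<tau> n)))) \<le> \<tau> n * (\<tau> n * (C * (11 * E0 + 10)))"
proof -
  define a b where "a = real m * \<tau> n" and "b = real (Suc m) * \<tau> n"
  have ab: "b - a = \<tau> n" "a \<le> b" using tau(1)[of n] by (auto simp: a_def b_def distrib_right)
  note \<phi>t = test_fun_partial(2)[OF \<phi>]
  let ?I = "indicator {a..<b} :: real \<Rightarrow> real"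
  have Ii: "integrable lborel (\<lambda>s. ?I s *\<^sub>R z)" for z :: complex
    by (intro integrable_scaleR_left integrable_real_indicator) (use ab in auto)
  have i1: "integrable lborel (\<lambda>s. ?I s *\<^sub>R tf \<phi> s \<xi>)" "integrable lborel (\<lambda>s. ?I s *\<^sub>R tf (partial_t \<phi>) s \<xi>)" for \<xi>
    by (intro tf_bounded_slice_integrable \<phi> \<phi>t)+
  note p1 = pair_integral[of ?I "tf \<phi>", OF i1(1)] and p2 = pair_integral[of ?I "tf (partial_t \<phi>)", OF i1(2)]
  have X: "?I s *\<^sub>R weak_rate \<phi> n s = ?I s *\<^sub>R pair n (D n (c n m)) (tf \<phi> s) + ?I s *\<^sub>R pair n (c n m) (tf (partial_t \<phi>) s)" for s
    using U_on_step[of s m n] unfolding weak_rate_def a_def b_def by (cases "s \<in> {real m * \<tau> n..<real (Suc m) * \<tau> n}") (auto simp: scaleR_add_right)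
  have "integrable lborel (\<lambda>s. ?I s *\<^sub>R weak_rate \<phi> n s)" unfolding X by (intro Bochner_Integration.integrable_add p1 p2)
  then show "integrable lborel (\<lambda>s. indicator {real m * \<tau> n..<real (Suc m) * \<tau> n} s *\<^sub>R weak_rate \<phi> n s)" by (simp only: a_def b_def)
  have FTC: "(LBINT s. ?I s *\<^sub>R tf (partial_t \<phi>) s \<xi>) = tf \<phi> b \<xi> - tf \<phi> a \<xi>" for \<xi>
  proof -
    have "(LBINT s. ?I s *\<^sub>R tf (partial_t \<phi>) s \<xi>) = (LBINT s. indicator {a..b} s *\<^sub>R tf (partial_t \<phi>) s \<xi>)"
    proof (rule integral_cong_AE)
      show "AE s in lborel. ?I s *\<^sub>R tf (partial_t \<phi>) s \<xi> = indicator {a..b} s *\<^sub>R tf (partial_t \<phi>) s \<xi>"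
        using AE_lborel_singleton[of b] by eventually_elim (auto simp: indicator_def)
    qed (use tf_t_measurable[OF \<phi>t] in auto)
    then show ?thesis using tf_FTC[OF \<phi> ab(2)] by simp
  qed
  let ?g = "\<lambda>s. pair n (D n (c n m)) (tf \<phi> s)"
  have one: "(LBINT s. ?I s *\<^sub>R z) = of_real (\<tau> n) * z" for z :: complex
    using ab by (simp add: scaleR_conv_of_real)
  have "(LBINT s. ?I s *\<^sub>R weak_rate \<phi> n s) = (LBINT s. ?I s *\<^sub>R ?g s) + pair n (c n m) (\<lambda>\<xi>. tf \<phi> b \<xi> - tf \<phi> a \<xi>)"
    unfolding X by (subst Bochner_Integration.integral_add[OF p1(1) p2(1)]) (simp add: p2(2) FTC)
  also have "(LBINT s. ?I s *\<^sub>R ?g s) = of_real (\<tau> n) * ?g b + (LBINT s. ?I s *\<^sub>R (?g s - ?g b))"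
  proof -
    have "x = y + (x - y)" for x y :: complex by simp
    then show ?thesis unfolding scaleR_diff_right Bochner_Integration.integral_diff[OF p1(1) Ii] one .
  qed
  finally have eq: "(LBINT s. ?I s *\<^sub>R weak_rate \<phi> n s)
     = of_real (\<tau> n) * ?g b + (LBINT s. ?I s *\<^sub>R (?g s - ?g b)) + pair n (c n m) (\<lambda>\<xi>. tf \<phi> b \<xi> - tf \<phi> a \<xi>)" .
  have "t + r + (p - q) - (p + t - q) = r" for t r p q :: complex by simp
  then have e2: "(LBINT s. ?I s *\<^sub>R weak_rate \<phi> n s) - (pair n (c n (Suc m)) (tf \<phi> b) - pair n (c n m) (tf \<phi> a)) = (LBINT s. ?I s *\<^sub>R (?g s - ?g b))"
    unfolding eq pair_diff pair_step .
  have "norm (LBINT s. ?I s *\<^sub>R (?g s - ?g b)) \<le> (LBINT s. norm (?I s *\<^sub>R (?g s - ?g b)))" by (rule integral_norm_bound)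
  also have "\<dots> \<le> (LBINT s. ?I s * (\<tau> n * (C * (11 * E0 + 10))))"
  proof (rule integral_mono)
    show "integrable lborel (\<lambda>s. norm (?I s *\<^sub>R (?g s - ?g b)))"
      unfolding scaleR_diff_right by (intro integrable_norm Bochner_Integration.integrable_diff p1(1) Ii)
    show "integrable lborel (\<lambda>s. ?I s * (\<tau> n * (C * (11 * E0 + 10))))"
      by (intro integrable_mult_left integrable_real_indicator) (use ab in auto)
    fix s
    show "norm (?I s *\<^sub>R (?g s - ?g b)) \<le> ?I s * (\<tau> n * (C * (11 * E0 + 10)))"
    proof (cases "s \<in> {a..<b}")
      case True
      have "norm (?g s - ?g b) \<le> (\<tau> n * C) * (11 * E0 + 10)"
        unfolding pair_diff[symmetric]
      proof (rule pair_rhs_bound)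
        show "0 \<le> \<tau> n * C" using tau(1)[of n] C by simp
        fix \<xi>
        have "norm (tf \<phi> s \<xi> - tf \<phi> b \<xi>) \<le> \<bar>s - b\<bar> * (C / (1 + \<xi>^2)^2)" by (rule tf_lipschitz[OF \<phi> C(2)])
        also have "\<dots> \<le> \<tau> n * (C / (1 + \<xi>^2)^2)" using True ab C by (intro mult_right_mono) auto
        finally show "norm (tf \<phi> s \<xi> - tf \<phi> b \<xi>) \<le> \<tau> n * C / (1 + \<xi>^2)^2" by simp
      qed
      then show ?thesis using True by (simp add: mult.assoc)
    qed simp
  qed
  also have "\<dots> = \<tau> n * (\<tau> n * (C * (11 * E0 + 10)))" using ab by simp
  finally have "norm ((LBINT s. ?I s *\<^sub>R weak_rate \<phi> n s) - (pair n (c n (Suc m)) (tf \<phi> b) - pair n (c n m) (tf \<phi> a))) \<le> \<tau> n * (\<tau> n * (C * (11 * E0 + 10)))"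
    unfolding e2 .
  then show "norm ((LBINT s. indicator {real m * \<tau> n..<real (Suc m) * \<tau> n} s *\<^sub>R weak_rate \<phi> n s)
      - (pair n (c n (Suc m)) (tf \<phi> (real (Suc m) * \<tau> n)) - pair n (c n m) (tf \<phi> (real m * \<tau> n)))) \<le> \<tau> n * (\<tau> n * (C * (11 * E0 + 10)))"
    by (simp only: a_def b_def)
qed

text \<open>About \<open>T / \<tau> n\<close> steps with errors of order
  \<open>(\<tau> n)\<^sup>2\<close> add up to order \<open>\<tau> n\<close>, hence to
  \<open>(1/2) ^ n\<close>. The steps are continued past the support of \<phi>, so that no term is
  left at the final time.\<close>

theorem discrete_weak_form:
  assumes \<phi>: "test_fun \<phi>"
  obtains C T where "0 < T" "\<And>s \<xi>. T \<le> s \<Longrightarrow> tf \<phi> s \<xi> = 0 \<and> tf (partial_t \<phi>) s \<xi> = 0"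
    "\<And>n. integrable lborel (\<lambda>s. indicator {0<..<T} s *\<^sub>R weak_rate \<phi> n s)"
    "\<And>n. norm ((LBINT s. indicator {0<..<T} s *\<^sub>R weak_rate \<phi> n s) + pair n (c n 0) (tf \<phi> 0)) \<le> C * (1/2) ^ n"
proof -
  note \<phi>t = test_fun_partial(2)[OF \<phi>]
  obtain T1 where T1: "0 < T1" "\<And>t x. T1 \<le> \<bar>t\<bar> \<or> T1 \<le> \<bar>x\<bar> \<Longrightarrow> \<phi> t x = 0" using test_fun_bounds[OF \<phi>] by metis
  obtain T2 where T2: "0 < T2" "\<And>t x. T2 \<le> \<bar>t\<bar> \<or> T2 \<le> \<bar>x\<bar> \<Longrightarrow> partial_t \<phi> t x = 0" using test_fun_bounds[OF \<phi>t] by metis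
  obtain C where C: "0 \<le> C" "\<And>t \<xi>. norm (tf (partial_t \<phi>) t \<xi>) \<le> C / (1 + \<xi>^2)^2" using tf_decay[OF \<phi>t] by blast
  define T where "T = max T1 T2"
  have T0: "0 < T" using T1 by (simp add: T_def)
  have z: "tf \<phi> s \<xi> = 0 \<and> tf (partial_t \<phi>) s \<xi> = 0" if "T \<le> s" for s \<xi>
  proof -
    have "\<phi> s x = 0" "partial_t \<phi> s x = 0" for x using that T0 by (auto intro!: T1(2) T2(2) simp: T_def)
    then show ?thesis by (simp add: tf_eq)
  qed
  let ?L = "C * (11 * E0 + 10)"
  have L0: "0 \<le> ?L" using C(1) E0_nonneg by simp
  have ind: "integrable lborel (\<lambda>s. indicator {0..<real m * \<tau> n} s *\<^sub>R weak_rate \<phi> n s) \<and>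
    norm ((LBINT s. indicator {0..<real m * \<tau> n} s *\<^sub>R weak_rate \<phi> n s) - (pair n (c n m) (tf \<phi> (real m * \<tau> n)) - pair n (c n 0) (tf \<phi> 0)))
      \<le> real m * (\<tau> n * (\<tau> n * ?L))" for m n
  proof (induction m)
    case (Suc m)
    let ?A = "\<lambda>s. indicator {0..<real m * \<tau> n} s *\<^sub>R weak_rate \<phi> n s"
    let ?B = "\<lambda>s. indicator {real m * \<tau> n..<real (Suc m) * \<tau> n} s *\<^sub>R weak_rate \<phi> n s"
    have le: "0 \<le> real m * \<tau> n" "real m * \<tau> n \<le> real (Suc m) * \<tau> n" using tau(1)[of n] by (auto intro: mult_right_mono)
    have split: "indicator {0..<real (Suc m) * \<tau> n} s *\<^sub>R weak_rate \<phi> n s = ?A s + ?B s" for s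
      using le by (cases "s < real m * \<tau> n"; cases "s < real (Suc m) * \<tau> n"; cases "0 \<le> s") (simp_all add: indicator_def)
    note B = weak_rate_step[OF \<phi> C, where m=m and n=n]
    have A: "integrable lborel ?A" using Suc.IH by blast
    have e3: "(LBINT s. ?A s + ?B s) - (pair n (c n (Suc m)) (tf \<phi> (real (Suc m) * \<tau> n)) - pair n (c n 0) (tf \<phi> 0))
       = ((LBINT s. ?A s) - (pair n (c n m) (tf \<phi> (real m * \<tau> n)) - pair n (c n 0) (tf \<phi> 0)))
        + ((LBINT s. ?B s) - (pair n (c n (Suc m)) (tf \<phi> (real (Suc m) * \<tau> n)) - pair n (c n m) (tf \<phi> (real m * \<tau> n))))"
      by (subst Bochner_Integration.integral_add[OF A B(1)]) (rule diff_telescope)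
    have "norm ((LBINT s. ?A s + ?B s) - (pair n (c n (Suc m)) (tf \<phi> (real (Suc m) * \<tau> n)) - pair n (c n 0) (tf \<phi> 0)))
       \<le> real m * (\<tau> n * (\<tau> n * ?L)) + \<tau> n * (\<tau> n * ?L)"
      unfolding e3 by (rule norm_triangle_mono[OF conjunct2[OF Suc.IH] B(2)])
    also have "\<dots> = real (Suc m) * (\<tau> n * (\<tau> n * ?L))" by (simp add: distrib_right)
    finally show ?case unfolding split using Bochner_Integration.integrable_add[OF A B(1)] by blast
  qed simp
  show thesis
  proof (rule that[OF T0 z])
    fix n
    have tn: "0 < \<tau> n" "\<tau> n \<le> 1" using tau[of n] order_trans[OF tau(2)[of n], of 1] by (auto simp: power_le_one)
    define m where "m = nat \<lceil>T / \<tau> n\<rceil>"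
    have "0 < T / \<tau> n" using T0 tn by simp
    then have m: "T / \<tau> n \<le> real m" "real m < T / \<tau> n + 1" unfolding m_def by linarith+
    have m1: "T \<le> real m * \<tau> n" using m(1) tn by (simp add: pos_divide_le_eq)
    have "real m * \<tau> n \<le> (T / \<tau> n + 1) * \<tau> n" using m(2) tn by (intro mult_right_mono) auto
    also have "\<dots> = T + \<tau> n" using tn by (simp add: distrib_right)
    finally have m2: "real m * \<tau> n \<le> T + 1" using tn by linarith
    have wz: "weak_rate \<phi> n s = 0" if "T \<le> s" for s
      using z[OF that] by (simp add: weak_rate_def pair_def)
    have ae: "AE s in lborel. indicator {0..<real m * \<tau> n} s *\<^sub>R weak_rate \<phi> n s = indicator {0<..<T} s *\<^sub>R weak_rate \<phi> n s"
      using AE_lborel_singleton[of 0]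
    proof eventually_elim
      case (elim s)
      then show ?case using m1 wz[of s] by (cases "T \<le> s") (auto simp: indicator_def)
    qed
    have Im: "integrable lborel (\<lambda>s. indicator {0..<real m * \<tau> n} s *\<^sub>R weak_rate \<phi> n s)" using ind[of m n] by blast
    have meas: "(\<lambda>s. indicator {0<..<T} s *\<^sub>R weak_rate \<phi> n s) \<in> borel_measurable lborel"
    proof -
      have "(\<lambda>s. indicator {0<..<T} s *\<^sub>R (indicator {0..<real m * \<tau> n} s *\<^sub>R weak_rate \<phi> n s)) \<in> borel_measurable lborel"
        using Im by measurable
      moreover have "indicator {0<..<T} s *\<^sub>R (indicator {0..<real m * \<tau> n} s *\<^sub>R weak_rate \<phi> n s) = indicator {0<..<T} s *\<^sub>R weak_rate \<phi> n s" for s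
        using m1 by (auto simp: indicator_def)
      ultimately show ?thesis by (simp only:)
    qed
    have Imm: "(\<lambda>s. indicator {0..<real m * \<tau> n} s *\<^sub>R weak_rate \<phi> n s) \<in> borel_measurable lborel" using Im by auto
    show "integrable lborel (\<lambda>s. indicator {0<..<T} s *\<^sub>R weak_rate \<phi> n s)"
      using integrable_cong_AE[OF Imm meas ae] Im by simp
    have eq: "(LBINT s. indicator {0<..<T} s *\<^sub>R weak_rate \<phi> n s) = (LBINT s. indicator {0..<real m * \<tau> n} s *\<^sub>R weak_rate \<phi> n s)"
      by (rule integral_cong_AE[OF Imm meas ae, symmetric])
    have pz: "pair n (c n m) (tf \<phi> (real m * \<tau> n)) = 0" using z[OF m1] by (simp add: pair_def)
    have "norm ((LBINT s. indicator {0<..<T} s *\<^sub>R weak_rate \<phi> n s) + pair n (c n 0) (tf \<phi> 0)) \<le> real m * (\<tau> n * (\<tau> n * ?L))"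
      using ind[of m n] unfolding eq pz by simp
    also have "\<dots> = (real m * \<tau> n) * (\<tau> n * ?L)" by simp
    also have "\<dots> \<le> (T + 1) * ((1/2) ^ n * ?L)" using m2 T0 tn L0 tau(2)[of n] by (intro mult_mono mult_right_mono) auto
    finally show "norm ((LBINT s. indicator {0<..<T} s *\<^sub>R weak_rate \<phi> n s) + pair n (c n 0) (tf \<phi> 0)) \<le> ((T + 1) * ?L) * (1/2) ^ n"
      by (simp only: mult_ac)
  qed
qed

end

section \<open>Splitting at the frequency \<open>R\<close>\<close>

text \<open>Exchanges the limits in \<open>n\<close> and \<open>R\<close>: the same null sequence
  \<open>e\<close> bounds the cut-off error of the approximations for large \<open>n\<close> and of
  the limits.\<close>

lemma tendsto_by_approximation:
  fixes X :: "nat \<Rightarrow> complex"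
  assumes A: "\<And>R::nat. 1 \<le> R \<Longrightarrow> A R \<longlonglongrightarrow> Y R"
    and XA: "\<And>R. 1 \<le> R \<Longrightarrow> eventually (\<lambda>n. norm (X n - A R n) \<le> e R) sequentially"
    and Y: "\<And>R. 1 \<le> R \<Longrightarrow> norm (Y R - y) \<le> e R" and e: "e \<longlonglongrightarrow> 0"
  shows "X \<longlonglongrightarrow> y"
proof (rule tendstoI)
  fix d :: real assume d: "d > 0"
  obtain R where R: "1 \<le> R" "e R < d / 3"
    using eventually_conj[OF order_tendstoD(2)[OF e, of "d / 3"] eventually_ge_at_top[of 1]] d
    by (auto simp: eventually_sequentially)
  have "eventually (\<lambda>n. dist (A R n) (Y R) < d / 3) sequentially" using tendstoD[OF A[OF R(1)], of "d / 3"] d by simp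
  with XA[OF R(1)] show "eventually (\<lambda>n. dist (X n) y < d) sequentially"
  proof eventually_elim
    case (elim n)
    have "dist (X n) y \<le> dist (X n) (A R n) + dist (A R n) y" by (rule dist_triangle)
    also have "dist (A R n) y \<le> dist (A R n) (Y R) + dist (Y R) y" by (rule dist_triangle)
    finally show ?case using elim Y[OF R(1)] R(2) by (simp add: dist_norm)
  qed
qed

text \<open>Used with \<open>s = sqrt R\<close>, which balances a tail energy of order
  \<open>1 / R\<close> against a factor without smallness; both then contribute order
  \<open>1 / sqrt R\<close>.\<close>

lemma weighted_AM_GM: "x * y \<le> s * x^2 + y^2 / s" if "0 < s" "0 \<le> x" "0 \<le> y" for x y s :: real
proof -
  have "2 * (sqrt s * x) * (y / sqrt s) \<le> (sqrt s * x)^2 + (y / sqrt s)^2" by (rule sum_squares_bound)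
  then have "2 * (x * y) \<le> s * x^2 + y^2 / s" using that by (simp add: power_mult_distrib power_divide)
  moreover have "0 \<le> x * y" using that by simp
  ultimately show ?thesis by linarith
qed

lemma inverse_sqrt_tendsto: "(\<lambda>R::nat. C / sqrt (real R)) \<longlonglongrightarrow> 0"
  by (intro real_tendsto_divide_at_top[OF tendsto_const] filterlim_compose[OF sqrt_at_top filterlim_real_sequentially])

text \<open>The linear part of the weak formulation moved to the test function: the reflected
  transform of \<open>partial_t \<phi>\<close> minus the dispersive operator applied to
  \<phi>.\<close>

definition lam :: "(real \<Rightarrow> real \<Rightarrow> real) \<Rightarrow> real \<Rightarrow> real \<Rightarrow> complex" where
  "lam \<phi> s \<xi> = tf (partial_t \<phi>) s \<xi> - of_real (dsymbol \<xi>) * tf \<phi> s \<xi>"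

lemma lam_continuous: "test_fun \<phi> \<Longrightarrow> continuous_on A (lam \<phi> s)"
  unfolding lam_def by (intro continuous_intros tf_continuous test_fun_partial) auto

lemma lam_measurable:
  assumes \<phi>: "test_fun \<phi>" shows "(\<lambda>(s, \<xi>). lam \<phi> s \<xi>) \<in> borel_measurable (lborel \<Otimes>\<^sub>M lborel)"
proof -
  have "(\<lambda>p. (case p of (t, x) \<Rightarrow> tf (partial_t \<phi>) t x) - of_real (dsymbol (snd p)) * (case p of (t, x) \<Rightarrow> tf \<phi> t x)) \<in> borel_measurable (lborel \<Otimes>\<^sub>M lborel)"
    using tf_measurable[OF \<phi>] tf_measurable[OF test_fun_partial(2)[OF \<phi>]] by measurable
  then show ?thesis by (simp add: lam_def split_beta')
qed

lemma rate_symbol_bounds: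
  assumes \<phi>: "test_fun \<phi>"
  obtains C where "0 \<le> C" "\<And>s \<xi>. norm (lam \<phi> s \<xi>) \<le> C / (1 + \<xi>^2)"
    "\<And>s \<xi>. norm (tf (partial_x \<phi>) s \<xi>) \<le> C / (1 + \<xi>^2)"
proof -
  obtain C1 where C1: "0 \<le> C1" "\<And>t \<xi>. norm (tf \<phi> t \<xi>) \<le> C1 / (1 + \<xi>^2)^2" using tf_decay[OF \<phi>] by blast
  obtain C2 where C2: "0 \<le> C2" "\<And>t \<xi>. norm (tf (partial_t \<phi>) t \<xi>) \<le> C2 / (1 + \<xi>^2)^2" using tf_decay[OF test_fun_partial(2)[OF \<phi>]] by blast
  obtain C3 where C3: "0 \<le> C3" "\<And>t \<xi>. norm (tf (partial_x \<phi>) t \<xi>) \<le> C3 / (1 + \<xi>^2)^2" using tf_decay[OF test_fun_partial(1)[OF \<phi>]] by blast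
  have p: "0 < 1 + \<xi>^2" for \<xi> :: real by (intro add_pos_nonneg) auto
  show thesis
  proof (rule that[of "C1 + C2 + C3"])
    fix s \<xi>
    have "norm (lam \<phi> s \<xi>) \<le> norm (tf (partial_t \<phi>) s \<xi>) + norm (of_real (dsymbol \<xi>) * tf \<phi> s \<xi>)"
      unfolding lam_def by (rule norm_triangle_ineq4)
    also have "norm (of_real (dsymbol \<xi>) * tf \<phi> s \<xi>) \<le> (1 + \<xi>^2) * (C1 / (1 + \<xi>^2)^2)"
      unfolding norm_mult using dsymbol_le[of \<xi>] C1 by (intro mult_mono) auto
    also have "\<dots> = C1 / (1 + \<xi>^2)" using p[of \<xi>] by (simp add: power2_eq_square[of "1 + \<xi>^2"])
    also have "norm (tf (partial_t \<phi>) s \<xi>) \<le> C2 / (1 + \<xi>^2)" by (rule order_trans[OF C2(2) inv_sq_le[OF C2(1)]])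
    also have "C2 / (1 + \<xi>^2) + C1 / (1 + \<xi>^2) \<le> (C1 + C2 + C3) / (1 + \<xi>^2)"
      unfolding add_divide_distrib[symmetric] using p[of \<xi>] C3(1) by (intro divide_right_mono) auto
    finally show "norm (lam \<phi> s \<xi>) \<le> (C1 + C2 + C3) / (1 + \<xi>^2)" by simp
    have "norm (tf (partial_x \<phi>) s \<xi>) \<le> C3 / (1 + \<xi>^2)" by (rule order_trans[OF C3(2) inv_sq_le[OF C3(1)]])
    also have "\<dots> \<le> (C1 + C2 + C3) / (1 + \<xi>^2)" using p[of \<xi>] C1(1) C2(1) by (intro divide_right_mono) auto
    finally show "norm (tf (partial_x \<phi>) s \<xi>) \<le> (C1 + C2 + C3) / (1 + \<xi>^2)" .
  qed (use C1 C2 C3 in simp)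
qed

lemma four_power: "(4::'a::comm_semiring_1) ^ n = 2 ^ n * 2 ^ n"
  by (simp flip: power_mult_distrib)

lemma sum_quarter_power:
  fixes C E s :: real
  shows "(\<Sum>k\<in>S. (C / y k) / 4 ^ n * (2 * 2 ^ n * E / s)) = (2 * C * E / s) * ((\<Sum>k\<in>S. 1 / y k) / 2 ^ n)"
proof -
  note four_power[of n, where 'a=real]
  moreover have "(C / z) / (p * p) * (2 * p * E / s) = (2 * C * E / s) * (1 / z / p)" if "p \<noteq> 0" for p z :: real
    using that by (simp add: mult_ac)
  ultimately have "(C / z) / 4 ^ n * (2 * 2 ^ n * E / s) = (2 * C * E / s) * (1 / z / 2 ^ n)" for z by simp
  then show ?thesis by (simp only: sum_divide_distrib sum_distrib_left)
qed

context galerkin_family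
begin

abbreviation I :: "nat \<Rightarrow> nat \<Rightarrow> int set" where "I n R \<equiv> {-int R * 2 ^ n..<int R * 2 ^ n}"

text \<open>The quadratic term tested with \<kappa>, each of its two sums with weight
  \<open>1 / 2 ^ n\<close>. In use \<kappa> belongs to \<open>partial_x \<phi>\<close> and so
  contains the factor \<open>k\<close> of \<open>galerkin_rhs\<close>.\<close>

definition NL :: "nat \<Rightarrow> (int \<Rightarrow> complex) \<Rightarrow> (real \<Rightarrow> complex) \<Rightarrow> complex" where
  "NL n a \<kappa> = (\<Sum>k\<in>Z n. \<Sum>j\<in>Z n. a j * a (k - j) * \<kappa> (of_int k / 2 ^ n) / 4 ^ n)"

lemma pair_rhs:
  "pair n (D n a) \<gamma> = - pair n a (\<lambda>\<xi>. of_real (dsymbol \<xi>) * \<gamma> \<xi>) - NL n a (\<lambda>\<xi>. - (\<i> * \<xi>) * \<gamma> \<xi>) / (4 * pi)"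
proof -
  let ?x = "\<lambda>k. real_of_int k / 2 ^ n"
  have "pair n (D n a) \<gamma> = (\<Sum>k\<in>Z n. D n a k * \<gamma> (?x k) / 2 ^ n)" by (simp only: pair_def sum_divide_distrib)
  also have "\<dots> = (\<Sum>k\<in>Z n. - (a k * (of_real (dsymbol (?x k)) * \<gamma> (?x k))) / 2 ^ n
     - (\<Sum>j\<in>Z n. a j * a (k - j) * (- (\<i> * ?x k) * \<gamma> (?x k)) / 4 ^ n) / (4 * pi))"
  proof (rule sum.cong[OF refl])
    fix k assume "k \<in> Z n"
    then have D: "D n a k = - (of_real (w n k) * a k) + \<i> * of_real (1 / (4 * pi * 4 ^ n)) * of_int k * (\<Sum>j\<in>Z n. a j * a (k - j))"
      by (auto simp: galerkin_rhs_def)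
    define T where "T = (\<Sum>j\<in>Z n. a j * a (k - j))"
    have N: "(\<Sum>j\<in>Z n. a j * a (k - j) * (- (\<i> * ?x k) * \<gamma> (?x k)) / 4 ^ n) = T * (- (\<i> * ?x k) * \<gamma> (?x k)) / 4 ^ n"
      unfolding T_def by (simp only: sum_distrib_right sum_divide_distrib)
    show "D n a k * \<gamma> (?x k) / 2 ^ n = - (a k * (of_real (dsymbol (?x k)) * \<gamma> (?x k))) / 2 ^ n
      - (\<Sum>j\<in>Z n. a j * a (k - j) * (- (\<i> * ?x k) * \<gamma> (?x k)) / 4 ^ n) / (4 * pi)"
      unfolding N D T_def[symmetric] by (simp add: field_simps)
  qed
  finally show ?thesis by (simp add: pair_def NL_def sum_subtractf sum_negf sum_divide_distrib)
qed

lemma weak_rate_eq: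
  assumes \<phi>: "test_fun \<phi>"
  shows "weak_rate \<phi> n s = pair n (U n s) (lam \<phi> s) - NL n (U n s) (tf (partial_x \<phi>) s) / (4 * pi)"
proof -
  have "pair n (U n s) (lam \<phi> s) = pair n (U n s) (tf (partial_t \<phi>) s) - pair n (U n s) (\<lambda>\<xi>. of_real (dsymbol \<xi>) * tf \<phi> s \<xi>)"
    unfolding lam_def by (rule pair_diff)
  moreover have "(\<lambda>\<xi>. - (\<i> * \<xi>) * tf \<phi> s \<xi>) = tf (partial_x \<phi>) s" by (rule ext) (simp add: tf_partial_x[OF \<phi>])
  ultimately show ?thesis unfolding weak_rate_def pair_rhs by simp
qed

lemma I_subset_Z: "R \<le> 2 ^ n \<Longrightarrow> I n R \<subseteq> Z n"
proof -
  assume "R \<le> 2 ^ n"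
  then have "int R \<le> 2 ^ n" by (metis of_nat_le_iff of_nat_numeral of_nat_power)
  then have "int R * 2 ^ n \<le> 2 ^ n * 2 ^ n" by (intro mult_right_mono) auto
  then have "int R * 2 ^ n \<le> int (4 ^ n)" by (simp add: four_power)
  then show ?thesis unfolding mult_minus_left by auto
qed

lemma outside_I:
  assumes "k \<notin> I n R" shows "real R \<le> \<bar>of_int k / 2 ^ n\<bar>"
proof -
  have "int R * 2 ^ n \<le> \<bar>k\<bar>" using assms unfolding mult_minus_left by auto
  then have "real_of_int (int R * 2 ^ n) \<le> of_int \<bar>k\<bar>" by (simp only: of_int_le_iff)
  then show ?thesis by (simp add: pos_le_divide_eq)
qed

text \<open>Outside \<open>I n R\<close> the weight is at least \<open>R\<close>, by the linear
  lower bound on the symbol.\<close>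

lemma tail_energy:
  assumes R: "1 \<le> R" shows "(\<Sum>k\<in>Z n - I n R. (norm (U n s k))^2) / 2 ^ n \<le> N_energy n s / real R"
proof -
  have "real R * (\<Sum>k\<in>Z n - I n R. (norm (U n s k))^2) = (\<Sum>k\<in>Z n - I n R. real R * (norm (U n s k))^2)" by (rule sum_distrib_left)
  also have "\<dots> \<le> (\<Sum>k\<in>Z n - I n R. w n k * (norm (U n s k))^2)"
  proof (intro sum_mono mult_right_mono)
    fix k assume "k \<in> Z n - I n R"
    then have k: "real R \<le> \<bar>of_int k / 2 ^ n\<bar>" by (intro outside_I) auto
    moreover have "\<bar>of_int k / 2 ^ n\<bar> \<le> w n k" by (rule dsymbol_ge) (use k R in linarith)
    ultimately show "real R \<le> w n k" by linarith
  qed auto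
  also have "\<dots> \<le> (\<Sum>k\<in>Z n. w n k * (norm (U n s k))^2)" by (rule sum_mono2) auto
  finally have "real R * (\<Sum>k\<in>Z n - I n R. (norm (U n s k))^2) / 2 ^ n \<le> N_energy n s"
    unfolding N_energy_def by (rule divide_right_mono) simp
  then show ?thesis using R by (simp add: pos_le_divide_eq mult.commute)
qed

text \<open>The weight \<open>sqrt R\<close> turns the tail energy and the Riemann sum of the decay
  into terms of order \<open>1 / sqrt R\<close>. The bound is not uniform in \<open>s\<close>, but
  its time integral is controlled by the energy inequality.\<close>

lemma linear_tail:
  assumes C: "0 \<le> C" "\<And>\<xi>. norm (\<gamma> \<xi>) \<le> C / (1 + \<xi>^2)" and R: "1 \<le> R" "R \<le> 2 ^ n"
  shows "norm (pair n (U n s) \<gamma> - (\<Sum>k\<in>I n R. U n s k * \<gamma> (of_int k / 2 ^ n)) / 2 ^ n) \<le> C * (N_energy n s + 10) / sqrt (real R)"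
proof -
  let ?x = "\<lambda>k. real_of_int k / 2 ^ n" and ?s = "sqrt (real R)"
  have s: "0 < ?s" using R by simp
  have "pair n (U n s) \<gamma> - (\<Sum>k\<in>I n R. U n s k * \<gamma> (?x k)) / 2 ^ n = (\<Sum>k\<in>Z n - I n R. U n s k * \<gamma> (?x k)) / 2 ^ n"
    unfolding pair_def by (subst sum_diff[OF _ I_subset_Z[OF R(2)]]) (auto simp: diff_divide_distrib)
  then have "norm (pair n (U n s) \<gamma> - (\<Sum>k\<in>I n R. U n s k * \<gamma> (?x k)) / 2 ^ n) = norm (\<Sum>k\<in>Z n - I n R. U n s k * \<gamma> (?x k)) / 2 ^ n"
    by (simp add: norm_divide norm_power)
  also have "\<dots> \<le> (\<Sum>k\<in>Z n - I n R. (C * ?s) * ((norm (U n s k))^2 + (1 / real R) * (1 / (1 + (?x k)^2)))) / 2 ^ n"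
  proof (intro divide_right_mono sum_norm_le)
    fix k
    define y where "y = 1 / (1 + (?x k)^2)"
    have y: "0 \<le> y" "y \<le> 1" unfolding y_def by (auto simp: divide_le_eq add_pos_nonneg)
    have "norm (U n s k * \<gamma> (?x k)) \<le> norm (U n s k) * (C * y)"
      unfolding norm_mult y_def using C(2)[of "?x k"] by (intro mult_left_mono) auto
    also have "\<dots> = C * (norm (U n s k) * y)" by simp
    also have "\<dots> \<le> C * (?s * (norm (U n s k))^2 + y^2 / ?s)" by (intro mult_left_mono weighted_AM_GM C s y) auto
    also have "\<dots> \<le> C * (?s * (norm (U n s k))^2 + y / ?s)"
    proof (intro mult_left_mono add_left_mono divide_right_mono C)
      show "y\<^sup>2 \<le> y" using y mult_left_mono[of y 1 y] by (simp add: power2_eq_square)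
    qed (use s in auto)
    also have "y / ?s = ?s * ((1 / real R) * y)"
    proof -
      have "?s * ?s = real R" by simp
      then show ?thesis using s R by (simp add: field_simps)
    qed
    finally show "norm (U n s k * \<gamma> (?x k)) \<le> (C * ?s) * ((norm (U n s k))^2 + (1 / real R) * (1 / (1 + (?x k)^2)))"
      by (simp only: y_def distrib_left mult.assoc)
  qed auto
  also have "\<dots> = (C * ?s) * ((\<Sum>k\<in>Z n - I n R. (norm (U n s k))^2) / 2 ^ n + (1 / real R) * ((\<Sum>k\<in>Z n - I n R. 1 / (1 + (?x k)^2)) / 2 ^ n))"
    by (rule sum_affine_divide2)
  also have "\<dots> \<le> (C * ?s) * (N_energy n s / real R + (1 / real R) * 10)"
    using C(1) by (intro mult_left_mono add_mono tail_energy R riemann_sum_bound) auto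
  also have "\<dots> = C * (N_energy n s + 10) * (?s / real R)" by (simp add: algebra_simps add_divide_distrib)
  also have "?s / real R = 1 / ?s" using s R by (simp add: real_sqrt_pow2 field_simps)
  finally show ?thesis by simp
qed

definition nl_low :: "nat \<Rightarrow> nat \<Rightarrow> (int \<Rightarrow> complex) \<Rightarrow> (real \<Rightarrow> complex) \<Rightarrow> complex" where
  "nl_low n R a \<kappa> = (\<Sum>j\<in>I n R. \<Sum>l\<in>I n R. a j * a l * \<kappa> (of_int (j + l) / 2 ^ n) / 4 ^ n)"

text \<open>Two frequencies below \<open>R\<close> have a sum below the cut-off
  \<open>2 ^ n\<close>, by \<open>2 * R \<le> 2 ^ n\<close>. The Galerkin truncation thus leaves the
  low part untouched, and reindexing by \<open>k = j + l\<close> is exact.\<close>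

lemma nl_low_eq:
  assumes "2 * R \<le> 2 ^ n"
  shows "nl_low n R a \<kappa> = (\<Sum>k\<in>Z n. \<Sum>j\<in>Z n. if j \<in> I n R \<and> k - j \<in> I n R then a j * a (k - j) * \<kappa> (of_int k / 2 ^ n) / 4 ^ n else 0)"
proof -
  let ?F = "\<lambda>j l. a j * a l * \<kappa> (of_int (j + l) / 2 ^ n) / 4 ^ n"
  have IZ: "I n R \<subseteq> Z n" using assms by (intro I_subset_Z) simp
  have inner: "(\<Sum>l\<in>I n R. ?F j l) = (\<Sum>k\<in>Z n. if k - j \<in> I n R then ?F j (k - j) else 0)" if j: "j \<in> I n R" for j
  proof -
    have "(\<Sum>k\<in>Z n. if k - j \<in> I n R then ?F j (k - j) else 0) = (\<Sum>k\<in>{k \<in> Z n. k - j \<in> I n R}. ?F j (k - j))"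
      by (rule sum.inter_filter[symmetric]) simp
    also have "\<dots> = (\<Sum>l\<in>I n R. ?F j l)"
    proof (rule sum.reindex_bij_witness[where i="\<lambda>l. j + l" and j="\<lambda>k. k - j"])
      fix l assume l: "l \<in> I n R"
      have "int (2 * R) \<le> int (2 ^ n)" using assms by (simp only: of_nat_le_iff)
      then have "int (2 * R) * 2 ^ n \<le> 2 ^ n * 2 ^ n" by (intro mult_right_mono) auto
      then have b: "2 * (int R * 2 ^ n) \<le> int (4 ^ n)" by (simp add: four_power)
      have "j + l \<in> Z n" using b j l unfolding mult_minus_left atLeastLessThan_iff atLeastAtMost_iff by linarith
      then show "j + l \<in> {k \<in> Z n. k - j \<in> I n R}" using l by simp
    qed auto
    finally show ?thesis by simp
  qed
  have "nl_low n R a \<kappa> = (\<Sum>j\<in>I n R. \<Sum>k\<in>Z n. if k - j \<in> I n R then ?F j (k - j) else 0)"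
    unfolding nl_low_def by (intro sum.cong refl inner)
  also have "\<dots> = (\<Sum>j\<in>Z n. \<Sum>k\<in>Z n. if j \<in> I n R \<and> k - j \<in> I n R then ?F j (k - j) else 0)"
    by (rule sum.mono_neutral_cong_left) (use IZ in auto)
  also have "\<dots> = (\<Sum>k\<in>Z n. \<Sum>j\<in>Z n. if j \<in> I n R \<and> k - j \<in> I n R then ?F j (k - j) else 0)" by (rule sum.swap)
  finally have "nl_low n R a \<kappa> = (\<Sum>k\<in>Z n. \<Sum>j\<in>Z n. if j \<in> I n R \<and> k - j \<in> I n R then ?F j (k - j) else 0)" .
  moreover have "j + (k - j) = k" for j k :: int by simp
  ultimately show ?thesis by (simp only:)
qed

text \<open>In each remaining product one of the two frequencies is at least \<open>R\<close> in
  modulus. Its tail energy is small, that of the other factor is only bounded by \<open>E0\<close>,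
  and the weight \<open>sqrt R\<close> distributes the smallness. The decay of \<kappa> handles the
  sum over \<open>k\<close>; \<open>20\<close> is \<open>2\<close> for the two cases times the
  Riemann bound \<open>10\<close>.\<close>

lemma nonlinear_tail:
  assumes C: "0 \<le> C" "\<And>\<xi>. norm (\<kappa> \<xi>) \<le> C / (1 + \<xi>^2)" and R: "1 \<le> R" "2 * R \<le> 2 ^ n"
  shows "norm (NL n (U n s) \<kappa> - nl_low n R (U n s) \<kappa>) \<le> 20 * C * (N_energy n s + E0) / sqrt (real R)"
proof -
  let ?x = "\<lambda>k. real_of_int k / 2 ^ n" and ?s = "sqrt (real R)" and ?u = "\<lambda>k. norm (U n s k)"
  let ?o = "\<lambda>j. if j \<in> I n R then 0 else (?u j)\<^sup>2"
  have s: "0 < ?s" using R by simp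
  have IZ: "I n R \<subseteq> Z n" using R(2) by (intro I_subset_Z) simp
  have tail: "(\<Sum>j\<in>Z n. ?o j) \<le> 2 ^ n * (N_energy n s / real R)"
  proof -
    have "(\<Sum>j\<in>Z n. ?o j) = (\<Sum>j\<in>Z n - I n R. (?u j)^2)"
      by (rule sum.mono_neutral_cong_right) auto
    then show ?thesis using tail_energy[OF R(1), of n s] by (simp add: pos_divide_le_eq mult.commute)
  qed
  \<comment> \<open>As \<open>j\<close> runs over \<open>Z n\<close>, \<open>k - j\<close> runs over
    a shifted range, but coefficients outside \<open>Z n\<close> vanish.\<close>
  have shift: "(\<Sum>j\<in>Z n. g (U n s (k - j)) (k - j)) \<le> (\<Sum>j\<in>Z n. g (U n s j) j)"
    if g: "\<And>z j. (0::real) \<le> g z j" "\<And>j. g 0 j = 0" for g :: "complex \<Rightarrow> int \<Rightarrow> real" and k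
  proof -
    have "(\<Sum>j\<in>Z n. g (U n s (k - j)) (k - j)) = (\<Sum>j\<in>(\<lambda>j. k - j) ` Z n. g (U n s j) j)"
      by (subst sum.reindex) (auto simp: inj_on_def)
    also have "\<dots> = (\<Sum>j\<in>(\<lambda>j. k - j) ` Z n \<inter> Z n. g (U n s j) j)"
      by (rule sum.mono_neutral_right) (use U_supp g in auto)
    also have "\<dots> \<le> (\<Sum>j\<in>Z n. g (U n s j) j)" by (rule sum_mono2) (use g in auto)
    finally show ?thesis .
  qed
  have tail': "(\<Sum>j\<in>Z n. ?o (k - j)) \<le> 2 ^ n * (N_energy n s / real R)" for k
  proof (rule order_trans[OF _ tail])
    show "(\<Sum>j\<in>Z n. ?o (k - j)) \<le> (\<Sum>j\<in>Z n. ?o j)"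
      by (rule shift[of "\<lambda>z j. if j \<in> I n R then 0 else (norm z)\<^sup>2" k]) simp_all
  qed
  have full: "(\<Sum>j\<in>Z n. (?u j)^2) \<le> 2 ^ n * E0"
    using U_energy[of "Z n" n s] by (simp add: pos_divide_le_eq mult.commute)
  have full': "(\<Sum>j\<in>Z n. (?u (k - j))^2) \<le> 2 ^ n * E0" for k
    using shift[of "\<lambda>z j. (norm z)^2" k] full by simp
  have conv: "(\<Sum>j\<in>Z n. if j \<in> I n R \<and> k - j \<in> I n R then 0 else ?u j * ?u (k - j)) \<le> 2 * 2 ^ n * (N_energy n s + E0) / ?s" for k
  proof -
    have "(\<Sum>j\<in>Z n. if j \<in> I n R \<and> k - j \<in> I n R then 0 else ?u j * ?u (k - j))
      \<le> (\<Sum>j\<in>Z n. (?s * ?o j + (?u (k - j))^2 / ?s) + (?s * ?o (k - j) + (?u j)^2 / ?s))"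
    proof (rule sum_mono)
      fix j
      have 1: "?u j * ?u (k - j) \<le> ?s * (?u j)^2 + (?u (k - j))^2 / ?s" by (rule weighted_AM_GM[OF s]) auto
      have 2: "?u (k - j) * ?u j \<le> ?s * (?u (k - j))^2 + (?u j)^2 / ?s" by (rule weighted_AM_GM[OF s]) auto
      have p: "0 \<le> ?s * (?u j)^2" "0 \<le> (?u j)^2 / ?s" "0 \<le> ?s * (?u (k - j))^2" "0 \<le> (?u (k - j))^2 / ?s" using s by auto
      show "(if j \<in> I n R \<and> k - j \<in> I n R then 0 else ?u j * ?u (k - j)) \<le> (?s * ?o j + (?u (k - j))^2 / ?s) + (?s * ?o (k - j) + (?u j)^2 / ?s)"
      proof (cases "j \<in> I n R")
        case True
        show ?thesis
        proof (cases "k - j \<in> I n R")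
          case True
          then show ?thesis using \<open>j \<in> I n R\<close> p by (simp only: if_True simp_thms)
        next
          case False
          then show ?thesis using \<open>j \<in> I n R\<close> p 2 unfolding mult.commute[of "?u (k - j)" "?u j"] by (simp only: if_True if_False simp_thms mult_zero_right add_0)
        qed
      next
        case False
        have o: "0 \<le> ?s * ?o (k - j)" using s by simp
        show ?thesis using False 1 p o by (simp only: if_False simp_thms)
      qed
    qed
    also have "\<dots> = (?s * (\<Sum>j\<in>Z n. ?o j) + (\<Sum>j\<in>Z n. (?u (k - j))^2) / ?s) + (?s * (\<Sum>j\<in>Z n. ?o (k - j)) + (\<Sum>j\<in>Z n. (?u j)^2) / ?s)"
      unfolding sum.distrib by (simp only: sum_distrib_left sum_divide_distrib)
    also have "\<dots> \<le> (?s * (2 ^ n * (N_energy n s / real R)) + 2 ^ n * E0 / ?s) + (?s * (2 ^ n * (N_energy n s / real R)) + 2 ^ n * E0 / ?s)"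
      using s by (intro add_mono mult_left_mono divide_right_mono tail tail' full full') auto
    also have "?s * (2 ^ n * (N_energy n s / real R)) = 2 ^ n * N_energy n s * (?s / real R)" by simp
    also have "?s / real R = 1 / ?s" using s R by (simp add: field_simps)
    also have "(2 ^ n * N_energy n s * (1 / ?s) + 2 ^ n * E0 / ?s) + (2 ^ n * N_energy n s * (1 / ?s) + 2 ^ n * E0 / ?s) = 2 * 2 ^ n * (N_energy n s + E0) / ?s"
      by (simp add: add_divide_distrib distrib_left mult_ac)
    finally show ?thesis .
  qed
  define d where "d k = (\<Sum>j\<in>Z n. if j \<in> I n R \<and> k - j \<in> I n R then 0 else U n s j * U n s (k - j) * \<kappa> (?x k) / 4 ^ n)" for k
  have e: "NL n (U n s) \<kappa> - nl_low n R (U n s) \<kappa> = (\<Sum>k\<in>Z n. d k)"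
    unfolding d_def NL_def nl_low_eq[OF R(2)] sum_subtractf[symmetric] by (intro sum.cong refl) simp
  have "norm (\<Sum>k\<in>Z n. d k) \<le> (\<Sum>k\<in>Z n. (C / (1 + (?x k)^2)) / 4 ^ n * (2 * 2 ^ n * (N_energy n s + E0) / ?s))"
  proof (rule sum_norm_le)
    fix k
    have "norm (d k) \<le> (\<Sum>j\<in>Z n. norm (\<kappa> (?x k)) / 4 ^ n * (if j \<in> I n R \<and> k - j \<in> I n R then 0 else ?u j * ?u (k - j)))"
      unfolding d_def by (rule sum_norm_le) (simp add: norm_mult norm_divide norm_power mult.commute)
    also have "\<dots> = norm (\<kappa> (?x k)) / 4 ^ n * (\<Sum>j\<in>Z n. if j \<in> I n R \<and> k - j \<in> I n R then 0 else ?u j * ?u (k - j))"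
      by (rule sum_distrib_left[symmetric])
    also have "\<dots> \<le> (C / (1 + (?x k)^2)) / 4 ^ n * (2 * 2 ^ n * (N_energy n s + E0) / ?s)"
      by (intro mult_mono conv divide_right_mono C sum_nonneg) (auto intro!: divide_nonneg_nonneg C add_nonneg_nonneg)
    finally show "norm (d k) \<le> (C / (1 + (?x k)^2)) / 4 ^ n * (2 * 2 ^ n * (N_energy n s + E0) / ?s)" .
  qed
  also have "\<dots> = (2 * C * (N_energy n s + E0) / ?s) * ((\<Sum>k\<in>Z n. 1 / (1 + (?x k)^2)) / 2 ^ n)"
    by (rule sum_quarter_power)
  also have "\<dots> \<le> (2 * C * (N_energy n s + E0) / ?s) * 10"
    using C(1) N_energy_nonneg[of n s] E0_nonneg s by (intro mult_left_mono riemann_sum_bound) auto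
  finally have "norm (\<Sum>k\<in>Z n. d k) \<le> (2 * C * (N_energy n s + E0) / ?s) * 10" .
  also have "\<dots> = 20 * C * (N_energy n s + E0) / ?s" by simp
  finally show ?thesis unfolding e .
qed

text \<open>Weak convergence says nothing about a double sum. In physical space it becomes the
  integral of the square of a trigonometric sum, and at each \<open>x\<close> that sum is a linear
  form in the coefficients.\<close>

lemma nl_low_physical:
  assumes \<phi>: "test_fun \<phi>"
  shows "nl_low n R a (tf \<phi> s) = (LBINT x. of_real (\<phi> s x) * ((\<Sum>k\<in>I n R. a k * cis (x * (of_int k / 2 ^ n))) / 2 ^ n)^2)"
proof -
  let ?x = "\<lambda>k. real_of_int k / 2 ^ n"
  have i: "integrable lborel (\<lambda>x. cis (x * \<xi>) * complex_of_real (\<phi> s x))" for \<xi>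
    using cis_mult_integrable[OF test_fun_x_integrable(1)[OF \<phi>], of \<xi> s] by (simp only: mult.commute[of \<xi>])
  have "nl_low n R a (tf \<phi> s) = (\<Sum>j\<in>I n R. \<Sum>l\<in>I n R. (LBINT x. (a j * a l / 4 ^ n) * (cis (x * ?x (j + l)) * of_real (\<phi> s x))))"
    unfolding nl_low_def tf_eq by (intro sum.cong refl) (subst integral_mult_right_zero, simp)
  also have "\<dots> = (LBINT x. (\<Sum>j\<in>I n R. \<Sum>l\<in>I n R. (a j * a l / 4 ^ n) * (cis (x * ?x (j + l)) * of_real (\<phi> s x))))"
    by (subst Bochner_Integration.integral_sum, intro Bochner_Integration.integrable_sum integrable_mult_right i,
        subst Bochner_Integration.integral_sum, intro integrable_mult_right i, rule refl)
  also have "\<dots> = (LBINT x. of_real (\<phi> s x) * ((\<Sum>k\<in>I n R. a k * cis (x * ?x k)) / 2 ^ n)^2)"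
  proof (rule Bochner_Integration.integral_cong[OF refl])
    fix x
    have "((\<Sum>k\<in>I n R. a k * cis (x * ?x k)) / 2 ^ n)\<^sup>2 = (\<Sum>j\<in>I n R. \<Sum>l\<in>I n R. (a j * cis (x * ?x j)) * (a l * cis (x * ?x l))) / 4 ^ n"
      by (simp add: power_divide power2_eq_square sum_product four_power)
    moreover have "cis (x * ?x j) * cis (x * ?x l) = cis (x * ?x (j + l))" for j l
      by (simp add: cis_mult add_divide_distrib distrib_left)
    ultimately show "(\<Sum>j\<in>I n R. \<Sum>l\<in>I n R. (a j * a l / 4 ^ n) * (cis (x * ?x (j + l)) * of_real (\<phi> s x))) = of_real (\<phi> s x) * ((\<Sum>k\<in>I n R. a k * cis (x * ?x k)) / 2 ^ n)^2"
      by (simp add: sum_divide_distrib sum_distrib_left flip: \<open>\<And>j l. cis (x * ?x j) * cis (x * ?x l) = cis (x * ?x (j + l))\<close>)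
         (simp add: mult_ac)
  qed
  finally show ?thesis .
qed

end

lemma norm_div_4pi: "norm (z / complex_of_real (4 * pi)) \<le> norm z"
proof -
  have "1 \<le> 4 * pi" using pi_ge_two by simp
  then show ?thesis by (simp add: norm_divide norm_mult divide_le_eq mult_le_cancel_left1)
qed

lemma inverse_square_L2: "L2_fun (\<lambda>\<xi>. complex_of_real (C * inverse (1 + \<xi>^2)))"
  unfolding L2_fun_of_real_iff L2_fun_def
proof (intro conjI)
  show "integrable lborel (\<lambda>\<xi>. (norm (C * inverse (1 + \<xi>^2)))^2)"
  proof (rule Bochner_Integration.integrable_bound[OF integrable_mult_right[OF integrable_inverse_square(1), of "C\<^sup>2"]])
    show "AE \<xi> in lborel. norm ((norm (C * inverse (1 + \<xi>^2)))^2) \<le> norm (C^2 * inverse (1 + \<xi>^2))"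
    proof (rule AE_I2)
      fix \<xi> :: real
      define y where "y = inverse (1 + \<xi>^2)"
      have "0 \<le> y" "y \<le> 1" by (auto simp: y_def inverse_eq_divide divide_le_eq add_pos_nonneg)
      then have "y * y \<le> 1 * y" by (intro mult_right_mono) auto
      then have "C\<^sup>2 * y^2 \<le> C^2 * y" unfolding power2_eq_square[of y] by (intro mult_left_mono) auto
      then show "norm ((norm (C * inverse (1 + \<xi>^2)))^2) \<le> norm (C^2 * inverse (1 + \<xi>^2))"
        using \<open>0 \<le> y\<close> by (simp add: y_def[symmetric] power_mult_distrib abs_mult)
    qed
  qed auto
qed auto

text \<open>The limit of \<open>low_rate\<close> at fixed \<open>R\<close>. The inner integral is
  \<open>2 * pi\<close> times the synthesis of the band, whence the factor \<open>pi\<close> after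
  division by \<open>4 * pi\<close>.\<close>

definition cut_rate :: "(real \<Rightarrow> real \<Rightarrow> real) \<Rightarrow> real \<Rightarrow> nat \<Rightarrow> (real \<Rightarrow> complex) \<Rightarrow> complex" where
  "cut_rate \<phi> s R v = (LBINT \<xi>. v \<xi> * (lam \<phi> s \<xi> * indicator {-real R..<real R} \<xi>))
    - (LBINT x. of_real (partial_x \<phi> s x) * (LBINT \<xi>. v \<xi> * (cis (x * \<xi>) * indicator {-real R..<real R} \<xi>))^2) / (4 * pi)"

lemma cut_rate_measurable:
  assumes [measurable]: "(\<lambda>(t, \<xi>). v t \<xi>) \<in> borel_measurable (lborel \<Otimes>\<^sub>M lborel)" and \<phi>: "test_fun \<phi>"
  shows "(\<lambda>s. cut_rate \<phi> s R (v s)) \<in> borel_measurable lborel"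
proof -
  note [measurable] = lam_measurable[OF \<phi>] test_fun_measurable(1)[OF test_fun_partial(1)[OF \<phi>]]
  have [measurable]: "(\<lambda>(s, x). (LBINT \<xi>. v s \<xi> * (cis (x * \<xi>) * indicator {-real R..<real R} \<xi>))) \<in> borel_measurable (lborel \<Otimes>\<^sub>M lborel)"
    by measurable
  show ?thesis unfolding cut_rate_def by measurable
qed

context galerkin_family
begin

definition low_rate :: "(real \<Rightarrow> real \<Rightarrow> real) \<Rightarrow> nat \<Rightarrow> nat \<Rightarrow> real \<Rightarrow> complex" where
  "low_rate \<phi> R n s = (\<Sum>k\<in>I n R. U n s k * lam \<phi> s (of_int k / 2 ^ n)) / 2 ^ n
    - nl_low n R (U n s) (tf (partial_x \<phi>) s) / (4 * pi)"

lemma low_rate_error: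
  assumes \<phi>: "test_fun \<phi>"
  obtains C where "0 \<le> C" "\<And>n R s. 1 \<le> R \<Longrightarrow> 2 * R \<le> 2 ^ n \<Longrightarrow>
    norm (weak_rate \<phi> n s - low_rate \<phi> R n s) \<le> C * (N_energy n s + (E0 + 10)) / sqrt (real R)"
proof -
  obtain C where C: "0 \<le> C" "\<And>s \<xi>. norm (lam \<phi> s \<xi>) \<le> C / (1 + \<xi>^2)"
    "\<And>s \<xi>. norm (tf (partial_x \<phi>) s \<xi>) \<le> C / (1 + \<xi>^2)" using rate_symbol_bounds[OF \<phi>] by blast
  show thesis
  proof (rule that[of "21 * C"])
    show "0 \<le> 21 * C" using C(1) by simp
    fix n R :: nat and s :: real assume R: "1 \<le> R" "2 * R \<le> 2 ^ n"
    let ?N = "N_energy n s"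
    have R1: "R \<le> 2 ^ n" using R(2) by simp
    define p where "p = pair n (U n s) (lam \<phi> s) - (\<Sum>k\<in>I n R. U n s k * lam \<phi> s (of_int k / 2 ^ n)) / 2 ^ n"
    define q where "q = NL n (U n s) (tf (partial_x \<phi>) s) - nl_low n R (U n s) (tf (partial_x \<phi>) s)"
    have e: "weak_rate \<phi> n s - low_rate \<phi> R n s = p - q / (4 * pi)"
      unfolding weak_rate_eq[OF \<phi>] low_rate_def p_def q_def diff_divide_distrib by simp
    have p: "norm p \<le> C * (?N + 10) / sqrt (real R)" unfolding p_def by (rule linear_tail[OF C(1,2) R(1) R1])
    have q: "norm q \<le> 20 * C * (?N + E0) / sqrt (real R)" unfolding q_def by (rule nonlinear_tail[OF C(1,3) R])
    have "norm (p - q / (4 * pi)) \<le> norm p + norm (q / (4 * pi))" by (rule norm_triangle_ineq4)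
    also have "\<dots> \<le> C * (?N + 10) / sqrt (real R) + 20 * C * (?N + E0) / sqrt (real R)"
      by (intro add_mono p order_trans[OF norm_div_4pi q])
    also have "\<dots> = C * ((?N + 10) + 20 * (?N + E0)) / sqrt (real R)" by (simp add: add_divide_distrib algebra_simps)
    also have "\<dots> \<le> C * (21 * (?N + (E0 + 10))) / sqrt (real R)"
      using C(1) E0_nonneg by (intro divide_right_mono mult_left_mono) auto
    finally show "norm (weak_rate \<phi> n s - low_rate \<phi> R n s) \<le> 21 * C * (?N + (E0 + 10)) / sqrt (real R)"
      unfolding e by (simp only: mult_ac)
  qed
qed

lemma cell_sum_L1: "(\<Sum>k\<in>I n R. norm (U n s k)) / 2 ^ n \<le> 2 * real R + E0"
proof -
  have "(\<Sum>k\<in>I n R. norm (U n s k)) \<le> (\<Sum>k\<in>I n R. 1 + (norm (U n s k))^2)"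
  proof (rule sum_mono)
    fix k
    have "0 \<le> norm (U n s k)" by simp
    then show "norm (U n s k) \<le> 1 + (norm (U n s k))^2"
      using sum_squares_bound[of "norm (U n s k)" 1] unfolding power2_eq_square by linarith
  qed
  also have "\<dots> = real (card (I n R)) + (\<Sum>k\<in>I n R. (norm (U n s k))^2)" by (simp add: sum.distrib)
  also have "card (I n R) = 2 * R * 2 ^ n" by (simp add: nat_mult_distrib nat_add_distrib nat_power_eq flip: mult_2)
  finally have "(\<Sum>k\<in>I n R. norm (U n s k)) / 2 ^ n \<le> (real (2 * R * 2 ^ n) + (\<Sum>k\<in>I n R. (norm (U n s k))^2)) / 2 ^ n"
    by (rule divide_right_mono) simp
  also have "\<dots> = 2 * real R + (\<Sum>k\<in>I n R. (norm (U n s k))^2) / 2 ^ n" by (simp add: add_divide_distrib)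
  finally show ?thesis using U_energy[of "I n R" n s] by simp
qed

lemma low_linear_bound:
  assumes "0 \<le> C" "\<And>\<xi>. norm (\<gamma> \<xi>) \<le> C"
  shows "norm ((\<Sum>k\<in>I n R. U n s k * \<gamma> (of_int k / 2 ^ n)) / 2 ^ n) \<le> C * (2 * real R + E0)"
proof -
  have "norm (\<Sum>k\<in>I n R. U n s k * \<gamma> (of_int k / 2 ^ n)) \<le> (\<Sum>k\<in>I n R. norm (U n s k) * C)"
    by (rule sum_norm_le) (simp add: norm_mult mult_left_mono assms)
  also have "\<dots> = C * (\<Sum>k\<in>I n R. norm (U n s k))" by (simp add: sum_distrib_left mult.commute)
  finally have "norm ((\<Sum>k\<in>I n R. U n s k * \<gamma> (of_int k / 2 ^ n)) / 2 ^ n) \<le> C * (\<Sum>k\<in>I n R. norm (U n s k)) / 2 ^ n"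
    unfolding norm_divide norm_power norm_numeral by (rule divide_right_mono) simp
  also have "\<dots> = C * ((\<Sum>k\<in>I n R. norm (U n s k)) / 2 ^ n)" by simp
  also have "\<dots> \<le> C * (2 * real R + E0)" by (intro mult_left_mono cell_sum_L1 assms(1))
  finally show ?thesis .
qed

text \<open>The bound may depend on \<open>R\<close>, but on neither \<open>n\<close> nor
  \<open>s\<close>: it is the dominating constant for the limit under the time integral.\<close>

lemma low_rate_bounded:
  assumes \<phi>: "test_fun \<phi>"
  obtains B where "0 \<le> B" "\<And>n s. norm (low_rate \<phi> R n s) \<le> B"
proof -
  obtain C where C: "0 \<le> C" "\<And>s \<xi>. norm (lam \<phi> s \<xi>) \<le> C / (1 + \<xi>^2)"
    "\<And>s \<xi>. norm (tf (partial_x \<phi>) s \<xi>) \<le> C / (1 + \<xi>^2)" using rate_symbol_bounds[OF \<phi>] by blast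
  have "C / (1 + \<xi>^2) \<le> C" for \<xi> :: real
    using C(1) mult_left_mono[of 1 "1 + \<xi>^2" C] by (simp add: pos_divide_le_eq add_pos_nonneg)
  then have b: "norm (lam \<phi> s \<xi>) \<le> C" "norm (tf (partial_x \<phi>) s \<xi>) \<le> C" for s \<xi>
    using C(2,3)[of s \<xi>] by (meson order_trans)+
  let ?M = "2 * real R + E0"
  have M: "0 \<le> ?M" using E0_nonneg by simp
  have nl: "norm (nl_low n R (U n s) (tf (partial_x \<phi>) s)) \<le> C * (?M * ?M)" for n s
  proof -
    let ?u = "\<lambda>k. norm (U n s k)"
    have "norm (nl_low n R (U n s) (tf (partial_x \<phi>) s)) \<le> (\<Sum>j\<in>I n R. \<Sum>l\<in>I n R. C * ((?u j / 2 ^ n) * (?u l / 2 ^ n)))"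
      unfolding nl_low_def
    proof (intro sum_norm_le)
      fix j l
      have "norm (U n s j * U n s l * tf (partial_x \<phi>) s (real_of_int (j + l) / 2 ^ n) / 4 ^ n)
        = norm (tf (partial_x \<phi>) s (real_of_int (j + l) / 2 ^ n)) * ((?u j / 2 ^ n) * (?u l / 2 ^ n))"
        by (simp add: norm_mult norm_divide norm_power four_power)
      also have "\<dots> \<le> C * ((?u j / 2 ^ n) * (?u l / 2 ^ n))" by (intro mult_right_mono b) auto
      finally show "norm (U n s j * U n s l * tf (partial_x \<phi>) s (real_of_int (j + l) / 2 ^ n) / 4 ^ n) \<le> C * ((?u j / 2 ^ n) * (?u l / 2 ^ n))" .
    qed
    also have "\<dots> = C * (((\<Sum>k\<in>I n R. ?u k) / 2 ^ n) * ((\<Sum>k\<in>I n R. ?u k) / 2 ^ n))"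
      by (simp only: sum_divide_distrib sum_product) (simp only: sum_distrib_left)
    also have "\<dots> \<le> C * (?M * ?M)" by (intro mult_left_mono mult_mono cell_sum_L1 M C(1)) (auto intro!: sum_nonneg divide_nonneg_nonneg)
    finally show ?thesis .
  qed
  show thesis
  proof (rule that[of "C * ?M + C * (?M * ?M)"])
    show "0 \<le> C * ?M + C * (?M * ?M)" using C(1) M by simp
    fix n s
    show "norm (low_rate \<phi> R n s) \<le> C * ?M + C * (?M * ?M)" unfolding low_rate_def
      by (intro order_trans[OF norm_triangle_ineq4] add_mono low_linear_bound C(1) b order_trans[OF norm_div_4pi nl])
  qed
qed

lemma low_rate_measurable:
  assumes \<phi>: "test_fun \<phi>" shows "low_rate \<phi> R n \<in> borel_measurable borel"
proof -
  have [measurable]: "(\<lambda>s. lam \<phi> s \<xi>) \<in> borel_measurable borel" "(\<lambda>s. tf (partial_x \<phi>) s \<xi>) \<in> borel_measurable borel" for \<xi>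
    unfolding lam_def using tf_t_measurable[OF \<phi>] tf_t_measurable[OF test_fun_partial(1)[OF \<phi>]] tf_t_measurable[OF test_fun_partial(2)[OF \<phi>]] by measurable
  show ?thesis unfolding low_rate_def[abs_def] nl_low_def by measurable
qed

lemma low_rate_tendsto:
  assumes \<phi>: "test_fun \<phi>" and r: "strict_mono r" and v: "L2_fun v"
    and lim: "\<And>j i. (\<lambda>n. cellsum (r n) j i (U (r n) s)) \<longlonglongrightarrow> (LBINT \<xi>. v \<xi> * indicator (dcell j i) \<xi>)"
  shows "(\<lambda>n. low_rate \<phi> R (r n) s) \<longlonglongrightarrow> cut_rate \<phi> s R v"
proof -
  note rt = filterlim_subseq[OF r]
  have lin: "(\<lambda>n. (\<Sum>k\<in>I (r n) R. U (r n) s k * \<gamma> (of_int k / 2 ^ r n)) / 2 ^ r n) \<longlonglongrightarrow> (LBINT \<xi>. v \<xi> * (\<gamma> \<xi> * indicator {-real R..<real R} \<xi>))"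
    if "continuous_on UNIV \<gamma>" for \<gamma>
    by (rule cell_linear_form_tendsto[OF rt U_energy v lim that])
  note \<phi>x = test_fun_partial(1)[OF \<phi>]
  obtain T B where B: "0 < T" "0 \<le> B" "\<And>t x. \<bar>partial_x \<phi> t x\<bar> \<le> B" "\<And>t x. T \<le> \<bar>t\<bar> \<or> T \<le> \<bar>x\<bar> \<Longrightarrow> partial_x \<phi> t x = 0"
    using test_fun_bounds[OF \<phi>x] by metis
  define M where "M = 1 * (2 * real R + E0)"
  have M: "norm ((\<Sum>k\<in>I n R. U n s k * cis (x * (of_int k / 2 ^ n))) / 2 ^ n) \<le> M" for n x
    unfolding M_def by (rule low_linear_bound[where \<gamma>="\<lambda>\<xi>. cis (x * \<xi>)"]) auto
  have "(\<lambda>n. (LBINT x. of_real (partial_x \<phi> s x) * ((\<Sum>k\<in>I (r n) R. U (r n) s k * cis (x * (of_int k / 2 ^ r n))) / 2 ^ r n)^2))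
     \<longlonglongrightarrow> (LBINT x. of_real (partial_x \<phi> s x) * (LBINT \<xi>. v \<xi> * (cis (x * \<xi>) * indicator {-real R..<real R} \<xi>))^2)"
  proof (rule integral_dominated_convergence[where w="\<lambda>x. (B * indicator {-T..T} x) * M^2"])
    have [measurable]: "partial_x \<phi> s \<in> borel_measurable borel" "v \<in> borel_measurable lborel"
      using test_fun_measurable(2)[OF \<phi>x] v by (auto simp: L2_fun_def)
    show "(\<lambda>x. of_real (partial_x \<phi> s x) * (LBINT \<xi>. v \<xi> * (cis (x * \<xi>) * indicator {-real R..<real R} \<xi>))^2) \<in> borel_measurable lborel" by measurable
    show "(\<lambda>x. of_real (partial_x \<phi> s x) * ((\<Sum>k\<in>I (r n) R. U (r n) s k * cis (x * (of_int k / 2 ^ r n))) / 2 ^ r n)^2) \<in> borel_measurable lborel" for n by measurable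
    show "integrable lborel (\<lambda>x. (B * indicator {-T..T} x) * M^2)"
      by (intro integrable_mult_left integrable_mult_right integrable_real_indicator) (use B(1) in auto)
    show "AE x in lborel. (\<lambda>n. of_real (partial_x \<phi> s x) * ((\<Sum>k\<in>I (r n) R. U (r n) s k * cis (x * (of_int k / 2 ^ r n))) / 2 ^ r n)^2)
      \<longlonglongrightarrow> of_real (partial_x \<phi> s x) * (LBINT \<xi>. v \<xi> * (cis (x * \<xi>) * indicator {-real R..<real R} \<xi>))^2"
      by (intro AE_I2 tendsto_mult tendsto_const tendsto_power lin continuous_intros)
    show "AE x in lborel. norm (of_real (partial_x \<phi> s x) * ((\<Sum>k\<in>I (r n) R. U (r n) s k * cis (x * (of_int k / 2 ^ r n))) / 2 ^ r n)^2) \<le> (B * indicator {-T..T} x) * M^2" for n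
    proof (rule AE_I2)
      fix x
      show "norm (of_real (partial_x \<phi> s x) * ((\<Sum>k\<in>I (r n) R. U (r n) s k * cis (x * (of_int k / 2 ^ r n))) / 2 ^ r n)^2) \<le> (B * indicator {-T..T} x) * M^2"
        unfolding norm_mult norm_power[of "_ / _"] using B(2)
        by (intro mult_mono power_mono M test_fun_cutoff_bound[OF B(2,3,4)]) auto
    qed
  qed
  then show ?thesis unfolding low_rate_def cut_rate_def nl_low_physical[OF \<phi>x]
    by (intro tendsto_diff tendsto_divide tendsto_const lin lam_continuous \<phi>) auto
qed

text \<open>The averaging is moved from the data to the test function: the pairing is the integral
  of \<open>v0\<close> against \<gamma> sampled at the nearest lattice point. The samples converge
  in \<open>L2norm\<close> by domination, and this is enough for a merely square integrable
  \<open>v0\<close>.\<close>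

lemma initial_term_tendsto:
  assumes \<gamma>: "continuous_on UNIV \<gamma>" and C: "0 \<le> C" "\<And>\<xi>. norm (\<gamma> \<xi>) \<le> C / (1 + \<xi>^2)"
  shows "(\<lambda>n. pair n (c n 0) \<gamma>) \<longlonglongrightarrow> (LBINT \<xi>. v0 \<xi> * \<gamma> \<xi>)"
proof -
  define d where "d n = (1 / 2 ^ Suc n :: real)" for n
  \<comment> \<open>Rounding to the nearest lattice point; the half cell added before the floor
    matches the translation in \<open>init\<close>.\<close>
  define y where "y n \<xi> = (of_int \<lfloor>2 ^ n * (\<xi> + d n)\<rfloor> / 2 ^ n :: real)" for n \<xi>
  define g where "g n \<xi> = (if \<lfloor>2 ^ n * (\<xi> + d n)\<rfloor> \<in> Z n then \<gamma> (y n \<xi>) else 0)" for n \<xi>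
  have yd: "\<bar>y n \<xi> - \<xi>\<bar> \<le> (1/2) ^ n" for n \<xi>
  proof -
    define z where "z = 2 ^ n * (\<xi> + d n)"
    have "of_int \<lfloor>z\<rfloor> \<le> z" "z < of_int \<lfloor>z\<rfloor> + 1" by linarith+
    then have "of_int \<lfloor>z\<rfloor> / 2 ^ n \<le> z / 2 ^ n" "z / 2 ^ n \<le> (of_int \<lfloor>z\<rfloor> + 1) / 2 ^ n" by (intro divide_right_mono; simp)+
    moreover have "z / 2 ^ n = \<xi> + d n" by (simp add: z_def)
    moreover have "d n = (1/2) ^ n / 2" "1 / 2 ^ n = ((1/2) ^ n :: real)" by (simp_all add: d_def power_one_over)
    moreover have "0 \<le> (1/2 :: real) ^ n" by simp
    ultimately show ?thesis unfolding y_def z_def[symmetric] add_divide_distrib abs_le_iff by linarith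
  qed
  have fm: "(\<lambda>\<xi>. real_of_int \<lfloor>2 ^ n * (\<xi> + d n)\<rfloor>) \<in> borel_measurable borel" for n
    by (rule measurable_compose[where g="\<lambda>z. real_of_int \<lfloor>z\<rfloor>", OF _ borel_measurable_real_floor]) measurable
  have ym[measurable]: "y n \<in> borel_measurable borel" for n unfolding y_def using fm[of n] by measurable
  have \<gamma>m[measurable]: "\<gamma> \<in> borel_measurable borel" by (rule borel_measurable_continuous_onI[OF \<gamma>])
  have gm[measurable]: "g n \<in> borel_measurable lborel" for n
  proof -
    have "(\<lambda>\<xi>. \<lfloor>2 ^ n * (\<xi> + d n)\<rfloor>) \<in> measurable borel (count_space UNIV)"
      by (rule measurable_compose[where g=floor, OF _ measurable_real_floor]) measurable
    from measurable_compose[OF this, of "\<lambda>k. k \<in> Z n" "count_space UNIV"]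
    have [measurable]: "Measurable.pred borel (\<lambda>\<xi>. \<lfloor>2 ^ n * (\<xi> + d n)\<rfloor> \<in> Z n)" by simp
    show ?thesis unfolding g_def by (rule measurable_If) simp_all
  qed
  have pw: "(\<lambda>n. g n \<xi>) \<longlonglongrightarrow> \<gamma> \<xi>" for \<xi>
  proof -
    have "(\<lambda>n. y n \<xi> - \<xi>) \<longlonglongrightarrow> 0"
      by (rule Lim_null_comparison[OF always_eventually LIMSEQ_realpow_zero[of "1/2"]]) (use yd in auto)
    then have "(\<lambda>n. y n \<xi>) \<longlonglongrightarrow> \<xi>" by (rule LIM_zero_cancel)
    moreover have "isCont \<gamma> \<xi>" using \<gamma> by (simp add: continuous_on_eq_continuous_at)
    ultimately have "(\<lambda>n. \<gamma> (y n \<xi>)) \<longlonglongrightarrow> \<gamma> \<xi>" by (rule isCont_tendsto_compose[rotated])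
    moreover have "eventually (\<lambda>n. \<gamma> (y n \<xi>) = g n \<xi>) sequentially"
    proof -
      obtain N :: nat where N: "\<bar>\<xi>\<bar> + 1 \<le> real N" using real_arch_simple by blast
      have "\<gamma> (y n \<xi>) = g n \<xi>" if "N \<le> n" for n
      proof -
        have "(1/2 :: real) ^ n \<le> 1" by (simp add: power_le_one)
        then have "\<bar>y n \<xi>\<bar> \<le> real N" using yd[of n \<xi>] N by (auto simp: abs_le_iff)
        also have "\<dots> \<le> 2 ^ n" using that of_nat_less_two_power[of n, where 'a=real] by linarith
        finally have "\<bar>of_int \<lfloor>2 ^ n * (\<xi> + d n)\<rfloor>\<bar> \<le> (2 ^ n * 2 ^ n :: real)" by (simp add: y_def pos_divide_le_eq)
        then have "\<bar>real_of_int \<lfloor>2 ^ n * (\<xi> + d n)\<rfloor>\<bar> \<le> real_of_int (int (4 ^ n))" by (simp add: four_power)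
        then have "\<bar>\<lfloor>2 ^ n * (\<xi> + d n)\<rfloor>\<bar> \<le> int (4 ^ n)" unfolding of_int_abs[symmetric] of_int_le_iff .
        then have "\<lfloor>2 ^ n * (\<xi> + d n)\<rfloor> \<in> Z n" unfolding abs_le_iff atLeastAtMost_iff by linarith
        then show ?thesis by (simp only: g_def if_True)
      qed
      then show ?thesis by (auto simp: eventually_sequentially)
    qed
    ultimately show ?thesis by (rule Lim_transform_eventually)
  qed
  have dom: "norm (g n \<xi>) \<le> norm (complex_of_real (3 * C * inverse (1 + \<xi>^2)))" for n \<xi>
  proof -
    have "(1/2 :: real) ^ n \<le> 1" by (simp add: power_le_one)
    then have "\<bar>\<xi>\<bar> \<le> \<bar>y n \<xi>\<bar> + 1" using yd[of n \<xi>] by linarith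
    then have "\<bar>\<xi>\<bar>\<^sup>2 \<le> (\<bar>y n \<xi>\<bar> + 1)^2" by (intro power_mono) auto
    also have "\<dots> \<le> 2 * (y n \<xi>)^2 + 2" using sum_squares_bound[of "\<bar>y n \<xi>\<bar>" 1] by (simp add: power2_sum)
    finally have le: "1 + \<xi>^2 \<le> 3 * (1 + (y n \<xi>)^2)" using zero_le_power2[of "y n \<xi>"] by (simp only: power2_abs distrib_left)
    have p: "0 < 1 + \<xi>^2" "0 < 1 + (y n \<xi>)^2" by (auto intro: add_pos_nonneg)
    have "norm (g n \<xi>) \<le> C / (1 + (y n \<xi>)^2)" using C p by (auto simp: g_def)
    also have "\<dots> \<le> 3 * C * inverse (1 + \<xi>^2)" using mult_left_mono[OF le C(1)] p by (simp add: field_simps)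
    finally show ?thesis unfolding norm_of_real by (rule order_trans[OF _ abs_ge_self])
  qed
  note lim = L2_dominated_tendsto[OF gm _ inverse_square_L2 dom pw]
  have gL2: "L2_fun (g n)" for n
    by (rule L2_fun_bound[OF inverse_square_L2[of "3 * C"] gm, where C=1]) (use dom in auto)
  have v0m[measurable]: "v0 \<in> borel_measurable lborel" using v0 by (simp add: L2_fun_def)
  have eq: "pair n (c n 0) \<gamma> = (LBINT \<xi>. g n \<xi> * v0 \<xi>)" for n
  proof -
    have i: "integrable lborel (\<lambda>\<xi>. v0 (\<xi> - d n) * indicator (dcell n k) \<xi>)" for k
      by (rule L2_mult_integrable[OF L2_translate(1)[OF v0] indicator_dcell_L2])
    have "pair n (c n 0) \<gamma> = (\<Sum>k\<in>Z n. \<gamma> (of_int k / 2 ^ n) * (LBINT \<xi>. v0 (\<xi> - d n) * indicator (dcell n k) \<xi>))"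
      unfolding pair_def sum_divide_distrib by (intro sum.cong refl) (auto simp: init d_def abs_le_iff)
    also have "\<dots> = (LBINT \<xi>. (\<Sum>k\<in>Z n. \<gamma> (of_int k / 2 ^ n) * (v0 (\<xi> - d n) * indicator (dcell n k) \<xi>)))"
      by (subst Bochner_Integration.integral_sum) (intro integrable_mult_right i, simp only: integral_mult_right_zero)
    also have "\<dots> = (LBINT \<xi>. g n (\<xi> - d n) * v0 (\<xi> - d n))"
    proof (rule Bochner_Integration.integral_cong[OF refl])
      fix \<xi>
      have "(\<Sum>k\<in>Z n. \<gamma> (of_int k / 2 ^ n) * (v0 (\<xi> - d n) * indicator (dcell n k) \<xi>))
        = (\<Sum>k\<in>Z n. if \<lfloor>2 ^ n * \<xi>\<rfloor> = k then \<gamma> (of_int k / 2 ^ n) * v0 (\<xi> - d n) else 0)"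
        by (intro sum.cong refl) (auto simp: indicator_def dcell_iff)
      also have "\<dots> = (if \<lfloor>2 ^ n * \<xi>\<rfloor> \<in> Z n then \<gamma> (of_int \<lfloor>2 ^ n * \<xi>\<rfloor> / 2 ^ n) * v0 (\<xi> - d n) else 0)"
        by (rule sum.delta') simp
      finally show "(\<Sum>k\<in>Z n. \<gamma> (of_int k / 2 ^ n) * (v0 (\<xi> - d n) * indicator (dcell n k) \<xi>)) = g n (\<xi> - d n) * v0 (\<xi> - d n)"
        by (simp add: g_def y_def)
    qed
    also have "\<dots> = (LBINT \<xi>. g n \<xi> * v0 \<xi>)"
      using lborel_integral_real_affine[of 1 "\<lambda>\<xi>. g n \<xi> * v0 \<xi>" "- d n"] by simp
    finally show ?thesis .
  qed
  show ?thesis unfolding eq mult.commute[of "v0 _"]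
    by (rule L2_integral_tendsto[OF gL2 lim v0]) auto
qed

lemma N_energy_time_bound:
  assumes "0 \<le> T"
  shows "integrable lborel (\<lambda>s. indicator {0<..<T} s * N_energy n s)" "(LBINT s. indicator {0<..<T} s * N_energy n s) \<le> E0"
proof -
  \<comment> \<open>This lets the energy inequality at time \<open>T + 1\<close> cover all of
    \<open>{0<..<T}\<close> despite its shortened interval.\<close>
  have t: "\<tau> n \<le> 1" using order_trans[OF tau(2)[of n], of 1] by (simp add: power_le_one)
  have "(\<integral>\<^sup>+s. ennreal (indicator {0<..<T} s * N_energy n s) \<partial>lborel) \<le> (\<integral>\<^sup>+s. indicator {0<..<(T + 1) - \<tau> n} s * ennreal (N_energy n s) \<partial>lborel)"
    by (rule nn_integral_mono) (use t in \<open>auto simp: indicator_def\<close>)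
  also have "\<dots> \<le> ennreal (E0 - (\<Sum>k\<in>Z n. (norm (U n (T + 1) k))^2) / 2 ^ n)"
    using assms by (intro U_energy_inequality) simp
  also have "\<dots> \<le> ennreal E0" by (intro ennreal_leI) (simp add: sum_nonneg)
  finally have le: "(\<integral>\<^sup>+s. ennreal (indicator {0<..<T} s * N_energy n s) \<partial>lborel) \<le> ennreal E0" .
  have nn: "AE s in lborel. 0 \<le> indicator {0<..<T} s * N_energy n s" using N_energy_nonneg by simp
  show i: "integrable lborel (\<lambda>s. indicator {0<..<T} s * N_energy n s)"
  proof (rule integrableI_nonneg[OF _ nn])
    show "(\<integral>\<^sup>+s. ennreal (indicator {0<..<T} s * N_energy n s) \<partial>lborel) < \<infinity>" by (rule le_less_trans[OF le]) simp
  qed measurable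
  show "(LBINT s. indicator {0<..<T} s * N_energy n s) \<le> E0"
    using le unfolding nn_integral_eq_integral[OF i nn] using E0_nonneg by simp
qed

text \<open>Stated for an abstract \<open>L\<close> that the cut-off rates approach at the speed
  \<open>1 / sqrt R\<close>; its expression through \<open>u\<close> is supplied later. The cut-off
  errors of the approximations and of the limit depend on time, and become uniform only after
  integration against the dissipation and \<open>g\<close>.\<close>

theorem limit_weak_form:
  assumes \<phi>: "test_fun \<phi>" and r: "strict_mono r" and vm: "(\<lambda>(t, \<xi>). v t \<xi>) \<in> borel_measurable (lborel \<Otimes>\<^sub>M lborel)"
    and lim: "AE s in lborel. 0 < s \<longrightarrow> L2_fun (v s) \<and>
      (\<forall>j i. (\<lambda>n. cellsum (r n) j i (U (r n) s)) \<longlonglongrightarrow> (LBINT \<xi>. v s \<xi> * indicator (dcell j i) \<xi>))"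
    and L: "L \<in> borel_measurable lborel"
    and g: "\<And>T. integrable lborel (\<lambda>s. indicator {0<..<T} s * g s)"
    and Lg: "AE s in lborel. 0 < s \<longrightarrow> (\<forall>R\<ge>1. norm (cut_rate \<phi> s R (v s) - L s) \<le> g s / sqrt (real R))"
  shows "integrable lborel (\<lambda>s. indicator {0<..} s *\<^sub>R L s)"
    and "(LBINT s. indicator {0<..} s *\<^sub>R L s) + (LBINT \<xi>. v0 \<xi> * tf \<phi> 0 \<xi>) = 0"
proof -
  note \<phi>x = test_fun_partial(1)[OF \<phi>] and \<phi>t = test_fun_partial(2)[OF \<phi>]
  note [measurable] = L cut_rate_measurable[OF vm \<phi>]
  obtain C0 T0 where T0: "0 < T0" "\<And>s \<xi>. T0 \<le> s \<Longrightarrow> tf \<phi> s \<xi> = 0 \<and> tf (partial_t \<phi>) s \<xi> = 0"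
    and wi0: "\<And>n. integrable lborel (\<lambda>s. indicator {0<..<T0} s *\<^sub>R weak_rate \<phi> n s)"
    and w0: "\<And>n. norm ((LBINT s. indicator {0<..<T0} s *\<^sub>R weak_rate \<phi> n s) + pair n (c n 0) (tf \<phi> 0)) \<le> C0 * (1/2) ^ n"
    by (rule discrete_weak_form[OF \<phi>]) (blast intro: that)
  obtain T1 where T1: "\<And>t x. T1 \<le> \<bar>t\<bar> \<or> T1 \<le> \<bar>x\<bar> \<Longrightarrow> partial_x \<phi> t x = 0" using test_fun_bounds[OF \<phi>x] by metis
  define T where "T = max T0 T1"
  have Tp: "0 < T" using T0(1) by (simp add: T_def)
  have wz: "weak_rate \<phi> n s = 0" if "T0 \<le> s" for n s
    using T0(2)[OF that] by (simp add: weak_rate_def pair_def)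
  have wT: "indicator {0<..<T0} s *\<^sub>R weak_rate \<phi> n s = indicator {0<..<T} s *\<^sub>R weak_rate \<phi> n s" for n s
    using wz[of s n] by (cases "T0 \<le> s") (auto simp: indicator_def T_def)
  have cz: "cut_rate \<phi> s R u = 0" if "T \<le> s" for s R u
  proof -
    have "lam \<phi> s \<xi> = 0" for \<xi> using T0(2)[of s \<xi>] that by (simp add: lam_def T_def)
    moreover have "partial_x \<phi> s x = 0" for x using that T0(1) by (intro T1) (simp add: T_def)
    ultimately show ?thesis by (simp add: cut_rate_def)
  qed
  obtain C where C: "0 \<le> C" "\<And>n R s. 1 \<le> R \<Longrightarrow> 2 * R \<le> 2 ^ n \<Longrightarrow>
    norm (weak_rate \<phi> n s - low_rate \<phi> R n s) \<le> C * (N_energy n s + (E0 + 10)) / sqrt (real R)"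
    using low_rate_error[OF \<phi>] by blast
  let ?J = "\<lambda>f::real \<Rightarrow> complex. (LBINT s. indicator {0<..<T} s *\<^sub>R f s)"
  have const: "integrable lborel (\<lambda>s. indicator {0<..<T} s * b)" for b :: real
    by (intro integrable_mult_left integrable_real_indicator) (use Tp in auto)
  have wi: "integrable lborel (\<lambda>s. indicator {0<..<T} s *\<^sub>R weak_rate \<phi> n s)" for n using wi0[of n] unfolding wT .
  have low: "integrable lborel (\<lambda>s. indicator {0<..<T} s *\<^sub>R low_rate \<phi> R n s)
      \<and> integrable lborel (\<lambda>s. indicator {0<..<T} s *\<^sub>R cut_rate \<phi> s R (v s))
      \<and> (\<lambda>n. ?J (low_rate \<phi> R (r n))) \<longlonglongrightarrow> ?J (\<lambda>s. cut_rate \<phi> s R (v s))" for R n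
  proof -
    obtain B where B: "0 \<le> B" "\<And>n s. norm (low_rate \<phi> R n s) \<le> B" using low_rate_bounded[OF \<phi>] by blast
    have lm: "(\<lambda>s. indicator {0<..<T} s *\<^sub>R low_rate \<phi> R n s) \<in> borel_measurable lborel" for n
      using low_rate_measurable[OF \<phi>, of R n] by measurable
    have cm: "(\<lambda>s. indicator {0<..<T} s *\<^sub>R cut_rate \<phi> s R (v s)) \<in> borel_measurable lborel" by measurable
    have dom: "AE s in lborel. norm (indicator {0<..<T} s *\<^sub>R low_rate \<phi> R n s) \<le> indicator {0<..<T} s * B" for n
      using B by (auto simp: indicator_def)
    have pw: "AE s in lborel. (\<lambda>n. indicator {0<..<T} s *\<^sub>R low_rate \<phi> R (r n) s) \<longlonglongrightarrow> indicator {0<..<T} s *\<^sub>R cut_rate \<phi> s R (v s)"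
      using lim
    proof eventually_elim
      case (elim s)
      show ?case
      proof (cases "0 < s")
        case True
        with elim have "L2_fun (v s)" and l: "\<And>j i. (\<lambda>n. cellsum (r n) j i (U (r n) s)) \<longlonglongrightarrow> (LBINT \<xi>. v s \<xi> * indicator (dcell j i) \<xi>)" by auto
        then show ?thesis by (intro tendsto_scaleR tendsto_const low_rate_tendsto[OF \<phi> r])
      qed simp
    qed
    show ?thesis
      using Bochner_Integration.integrable_bound[OF const[of B] lm, of n] dom[of n] B(1)
        integrable_dominated_convergence[OF cm lm const[of B] pw dom]
        integral_dominated_convergence[OF cm lm const[of B] pw dom]
      by (auto simp: indicator_def)
  qed
  have g0: "AE s in lborel. 0 < s \<longrightarrow> 0 \<le> g s"
    using Lg by eventually_elim (metis norm_ge_zero order_trans of_nat_1 real_sqrt_one div_by_1 order_refl)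
  have gT: "integrable lborel (\<lambda>s. indicator {0<..<T} s * g s)" by (rule g)
  \<comment> \<open>Comparison with the bounded cut-off rate at \<open>R = 1\<close>.\<close>
  have LJ: "integrable lborel (\<lambda>s. indicator {0<..<T} s *\<^sub>R L s)"
  proof (rule Bochner_Integration.integrable_bound[OF Bochner_Integration.integrable_add[OF integrable_norm[OF conjunct1[OF conjunct2[OF low[of 1]]]] gT]])
    show "AE s in lborel. norm (indicator {0<..<T} s *\<^sub>R L s) \<le> norm (norm (indicator {0<..<T} s *\<^sub>R cut_rate \<phi> s 1 (v s)) + indicator {0<..<T} s * g s)"
      using Lg
    proof eventually_elim
      case (elim s)
      show ?case
      proof (cases "s \<in> {0<..<T}")
        case True
        then have "norm (cut_rate \<phi> s 1 (v s) - L s) \<le> g s" using elim by (metis greaterThanLessThan_iff order_refl of_nat_1 real_sqrt_one div_by_1)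
        moreover have "norm (L s) \<le> norm (cut_rate \<phi> s 1 (v s)) + norm (cut_rate \<phi> s 1 (v s) - L s)"
          by (rule norm_triangle_sub[of "L s" "cut_rate \<phi> s 1 (v s)", unfolded norm_minus_commute[of "L s"]])
        ultimately show ?thesis using True by simp
      qed simp
    qed
  qed measurable
  \<comment> \<open>Nothing is known about \<open>L\<close> beyond its approximation property; after
    the support of \<phi> it vanishes as a limit of cut-off rates that do.\<close>
  have tail0: "AE s in lborel. T \<le> s \<longrightarrow> L s = 0"
    using Lg
  proof eventually_elim
    case (elim s)
    show ?case
    proof
      assume s: "T \<le> s"
      have "norm (L s) \<le> g s / sqrt (real R)" if "1 \<le> R" for R :: nat using elim cz[OF s] s Tp that by simp
      then have "eventually (\<lambda>R. norm (L s) \<le> g s / sqrt (real R)) sequentially" by (auto simp: eventually_sequentially)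
      from tendsto_lowerbound[OF inverse_sqrt_tendsto this] show "L s = 0" by simp
    qed
  qed
  have LT: "AE s in lborel. indicator {0<..<T} s *\<^sub>R L s = indicator {0<..} s *\<^sub>R L s"
    using tail0 by eventually_elim (auto simp: indicator_def)
  have m1: "(\<lambda>s. indicator {0<..<T} s *\<^sub>R L s) \<in> borel_measurable lborel" "(\<lambda>s. indicator {0<..} s *\<^sub>R L s) \<in> borel_measurable lborel" by measurable
  show "integrable lborel (\<lambda>s. indicator {0<..} s *\<^sub>R L s)" using integrable_cong_AE[OF m1 LT] LJ by simp
  have eqL: "(LBINT s. indicator {0<..} s *\<^sub>R L s) = ?J L" by (rule integral_cong_AE[OF m1 LT, symmetric])
  define G where "G = (LBINT s. indicator {0<..<T} s * g s)"
  define K where "K = C * (E0 + T * (E0 + 10)) + G"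
  have G0: "0 \<le> G" unfolding G_def by (rule integral_nonneg_AE, use g0 in eventually_elim) (auto simp: indicator_def)
  have K1: "0 \<le> C * (E0 + T * (E0 + 10))" using C(1) E0_nonneg Tp by simp
  have "(\<lambda>n. ?J (weak_rate \<phi> (r n))) \<longlonglongrightarrow> ?J L"
  proof (rule tendsto_by_approximation)
    show "(\<lambda>n. ?J (low_rate \<phi> R (r n))) \<longlonglongrightarrow> ?J (\<lambda>s. cut_rate \<phi> s R (v s))" for R using low by blast
    show "(\<lambda>R::nat. K / sqrt (real R)) \<longlonglongrightarrow> 0" by (rule inverse_sqrt_tendsto)
  next
    fix R :: nat assume R: "1 \<le> R"
    have "norm (?J (weak_rate \<phi> m) - ?J (low_rate \<phi> R m)) \<le> K / sqrt (real R)" if m: "2 * R \<le> m" for m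
    proof -
      have "2 * R \<le> 2 ^ m" using m less_exp[of m] by linarith
      note e = C(2)[OF R this]
      have N: "integrable lborel (\<lambda>s. C / sqrt (real R) * (indicator {0<..<T} s * N_energy m s + indicator {0<..<T} s * (E0 + 10)))"
        by (intro integrable_mult_right Bochner_Integration.integrable_add N_energy_time_bound const) (use Tp in auto)
      have e1: "?J (weak_rate \<phi> m) - ?J (low_rate \<phi> R m) = ?J (\<lambda>s. weak_rate \<phi> m s - low_rate \<phi> R m s)"
        unfolding scaleR_diff_right using wi low by (intro Bochner_Integration.integral_diff[symmetric]) auto
      have "norm (?J (\<lambda>s. weak_rate \<phi> m s - low_rate \<phi> R m s)) \<le> (LBINT s. norm (indicator {0<..<T} s *\<^sub>R (weak_rate \<phi> m s - low_rate \<phi> R m s)))"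
        by (rule integral_norm_bound)
      also have "\<dots> \<le> (LBINT s. C / sqrt (real R) * (indicator {0<..<T} s * N_energy m s + indicator {0<..<T} s * (E0 + 10)))"
      proof (rule integral_mono[OF _ N])
        show "integrable lborel (\<lambda>s. norm (indicator {0<..<T} s *\<^sub>R (weak_rate \<phi> m s - low_rate \<phi> R m s)))"
          unfolding scaleR_diff_right using wi low by (intro integrable_norm Bochner_Integration.integrable_diff) auto
        show "norm (indicator {0<..<T} s *\<^sub>R (weak_rate \<phi> m s - low_rate \<phi> R m s)) \<le> C / sqrt (real R) * (indicator {0<..<T} s * N_energy m s + indicator {0<..<T} s * (E0 + 10))" for s
          using e[of s] by (cases "s \<in> {0<..<T}") auto
      qed
      also have "\<dots> = C / sqrt (real R) * ((LBINT s. indicator {0<..<T} s * N_energy m s) + T * (E0 + 10))"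
        using Tp by (subst integral_mult_right_zero, subst Bochner_Integration.integral_add) (auto intro: N_energy_time_bound const)
      also have "\<dots> \<le> C / sqrt (real R) * (E0 + T * (E0 + 10))"
        using C(1) Tp by (intro mult_left_mono add_right_mono N_energy_time_bound) auto
      also have "\<dots> = C * (E0 + T * (E0 + 10)) / sqrt (real R)" by simp
      also have "\<dots> \<le> K / sqrt (real R)" unfolding K_def using G0 by (intro divide_right_mono) auto
      finally show ?thesis unfolding e1 .
    qed
    moreover have "eventually (\<lambda>n. 2 * R \<le> r n) sequentially"
      using filterlim_subseq[OF r] by (simp add: filterlim_at_top)
    ultimately show "eventually (\<lambda>n. norm (?J (weak_rate \<phi> (r n)) - ?J (low_rate \<phi> R (r n))) \<le> K / sqrt (real R)) sequentially"
      by (auto elim: eventually_mono)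
    have ci: "integrable lborel (\<lambda>s. indicator {0<..<T} s *\<^sub>R cut_rate \<phi> s R (v s))" using low by blast
    have e2: "?J (\<lambda>s. cut_rate \<phi> s R (v s)) - ?J L = ?J (\<lambda>s. cut_rate \<phi> s R (v s) - L s)"
      unfolding scaleR_diff_right by (rule Bochner_Integration.integral_diff[OF ci LJ, symmetric])
    have "norm (?J (\<lambda>s. cut_rate \<phi> s R (v s) - L s)) \<le> (LBINT s. norm (indicator {0<..<T} s *\<^sub>R (cut_rate \<phi> s R (v s) - L s)))"
      by (rule integral_norm_bound)
    also have "\<dots> \<le> (LBINT s. 1 / sqrt (real R) * (indicator {0<..<T} s * g s))"
    proof (rule integral_mono_AE[OF _ integrable_mult_right[OF gT]])
      show "integrable lborel (\<lambda>s. norm (indicator {0<..<T} s *\<^sub>R (cut_rate \<phi> s R (v s) - L s)))"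
        unfolding scaleR_diff_right by (intro integrable_norm Bochner_Integration.integrable_diff ci LJ)
      show "AE s in lborel. norm (indicator {0<..<T} s *\<^sub>R (cut_rate \<phi> s R (v s) - L s)) \<le> 1 / sqrt (real R) * (indicator {0<..<T} s * g s)"
        using Lg by eventually_elim (use R in \<open>auto simp: indicator_def\<close>)
    qed
    also have "\<dots> = G / sqrt (real R)" by (simp add: G_def)
    also have "\<dots> \<le> K / sqrt (real R)" unfolding K_def using K1 by (intro divide_right_mono) auto
    finally show "norm (?J (\<lambda>s. cut_rate \<phi> s R (v s)) - ?J L) \<le> K / sqrt (real R)" unfolding e2 .
  qed
  moreover have "(\<lambda>n. pair (r n) (c (r n) 0) (tf \<phi> 0)) \<longlonglongrightarrow> (LBINT \<xi>. v0 \<xi> * tf \<phi> 0 \<xi>)"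
  proof -
    obtain D where D: "0 \<le> D" "\<And>t \<xi>. norm (tf \<phi> t \<xi>) \<le> D / (1 + \<xi>^2)^2" using tf_decay[OF \<phi>] by blast
    have "norm (tf \<phi> 0 \<xi>) \<le> D / (1 + \<xi>^2)" for \<xi> by (rule order_trans[OF D(2) inv_sq_le[OF D(1)]])
    from LIMSEQ_subseq_LIMSEQ[OF initial_term_tendsto[OF tf_continuous[OF \<phi>] D(1) this] r]
    show ?thesis by (simp add: o_def)
  qed
  ultimately have "(\<lambda>n. ?J (weak_rate \<phi> (r n)) + pair (r n) (c (r n) 0) (tf \<phi> 0)) \<longlonglongrightarrow> ?J L + (LBINT \<xi>. v0 \<xi> * tf \<phi> 0 \<xi>)"
    by (rule tendsto_add)
  moreover have "(\<lambda>n. ?J (weak_rate \<phi> (r n)) + pair (r n) (c (r n) 0) (tf \<phi> 0)) \<longlonglongrightarrow> 0"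
  proof (rule Lim_null_comparison)
    show "eventually (\<lambda>n. norm (?J (weak_rate \<phi> (r n)) + pair (r n) (c (r n) 0) (tf \<phi> 0)) \<le> C0 * (1/2) ^ r n) sequentially"
      using w0 unfolding wT by simp
    have "(\<lambda>n. C0 * (1/2) ^ n) \<longlonglongrightarrow> 0" by (intro tendsto_mult_right_zero LIMSEQ_realpow_zero) auto
    from LIMSEQ_subseq_LIMSEQ[OF this r] show "(\<lambda>n. C0 * (1/2) ^ r n) \<longlonglongrightarrow> 0" by (simp add: o_def)
  qed
  ultimately show "(LBINT s. indicator {0<..} s *\<^sub>R L s) + (LBINT \<xi>. v0 \<xi> * tf \<phi> 0 \<xi>) = 0"
    unfolding eqL by (rule LIMSEQ_unique)
qed

end

section \<open>Synthesis of the solution\<close>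

lemma L2_reflect:
  assumes "L2_fun f" shows "L2_fun (\<lambda>x. f (- x) :: complex)" "L2norm (\<lambda>x. f (- x)) = L2norm f"
proof -
  have [measurable]: "f \<in> borel_measurable lborel" using assms by (simp add: L2_fun_def)
  have "integrable lborel (\<lambda>x. (norm (f (0 + (-1) * x)))^2)"
    using lborel_integrable_real_affine[of "\<lambda>x. (norm (f x))^2" "-1" 0] assms by (simp add: L2_fun_def)
  then show "L2_fun (\<lambda>x. f (- x))" unfolding L2_fun_def by simp
  have "(LBINT x. (norm (f x))^2) = (LBINT x. (norm (f (0 + (-1) * x)))^2)"
    using lborel_integral_real_affine[of "-1" "\<lambda>x. (norm (f x))^2" 0] by simp
  then show "L2norm (\<lambda>x. f (- x)) = L2norm f" by (simp add: L2norm_def)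
qed

lemma has_L2_fourier_reflect:
  assumes f: "has_L2_fourier f F" shows "has_L2_fourier (\<lambda>x. cnj (f x)) (\<lambda>\<xi>. cnj (F (- \<xi>)))"
proof -
  note L = has_L2_fourier_L2[OF f]
  have eq: "fourier (trunc R (\<lambda>x. cnj (f x))) \<xi> = cnj (fourier (trunc R f) (- \<xi>))" for R \<xi>
    unfolding fourier_def by (simp add: cis_cnj scaleR_conv_of_real flip: Bochner_Integration.integral_cnj)
  have "L2norm (\<lambda>\<xi>. fourier (trunc R (\<lambda>x. cnj (f x))) \<xi> - cnj (F (- \<xi>))) = L2norm (\<lambda>\<xi>. fourier (trunc R f) \<xi> - F \<xi>)" for R
  proof -
    have d: "L2_fun (\<lambda>\<xi>. fourier (trunc R f) \<xi> - F \<xi>)" by (intro L2_fun_diff fourier_trunc_L2 L)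
    have "L2norm (\<lambda>\<xi>. fourier (trunc R (\<lambda>x. cnj (f x))) \<xi> - cnj (F (- \<xi>))) = L2norm (\<lambda>\<xi>. cnj (fourier (trunc R f) (- \<xi>) - F (- \<xi>)))"
      unfolding eq by simp
    also have "\<dots> = L2norm (\<lambda>\<xi>. fourier (trunc R f) (- \<xi>) - F (- \<xi>))" by (rule L2norm_cnj)
    also have "\<dots> = L2norm (\<lambda>\<xi>. fourier (trunc R f) \<xi> - F \<xi>)" by (rule L2_reflect(2)[OF d])
    finally show ?thesis .
  qed
  then show ?thesis using f unfolding has_L2_fourier_iff by (auto intro: L2_fun_cnj L2_reflect)
qed

lemma fourier_of_real_hermitian:
  assumes f: "has_L2_fourier (\<lambda>x. complex_of_real (f x)) F" shows "AE \<xi> in lborel. F (- \<xi>) = cnj (F \<xi>)"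
proof -
  have "AE \<xi> in lborel. F \<xi> = cnj (F (- \<xi>))"
    using has_L2_fourier_unique[OF f, of "\<lambda>\<xi>. cnj (F (- \<xi>))"] has_L2_fourier_reflect[OF f] by simp
  then show ?thesis by eventually_elim (metis complex_cnj_cnj)
qed

lemma has_L2_fourier_diff:
  assumes "has_L2_fourier f F" "has_L2_fourier g G"
  shows "has_L2_fourier (\<lambda>x. f x - g x) (\<lambda>\<xi>. F \<xi> - G \<xi>)"
  using has_L2_fourier_add[OF assms, of "-1"] by simp

lemma L2norm_le_fourier: "has_L2_fourier f F \<Longrightarrow> L2norm f \<le> L2norm F"
proof -
  assume "has_L2_fourier f F"
  moreover have "1 \<le> sqrt (2 * pi)" using pi_ge_two by simp
  ultimately show ?thesis using mult_right_mono[of 1 "sqrt (2 * pi)" "L2norm f"] by (simp add: L2_fourier_norm)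
qed

lemma has_L2_fourier_limit:
  assumes fk: "\<And>k. has_L2_fourier (f k) (F k)" and u: "L2_fun u" and v: "L2_fun v"
    and f: "(\<lambda>k. L2norm (\<lambda>x. f k x - u x)) \<longlonglongrightarrow> 0" and F: "(\<lambda>k. L2norm (\<lambda>\<xi>. F k \<xi> - v \<xi>)) \<longlonglongrightarrow> 0"
  shows "has_L2_fourier u v"
proof -
  obtain V where V: "has_L2_fourier u V" using L2_fourier_exists[OF u] by blast
  note VL = has_L2_fourier_L2[OF V] and FL = has_L2_fourier_L2[OF fk]
  have "L2norm (\<lambda>\<xi>. V \<xi> - v \<xi>) \<le> sqrt (2 * pi) * L2norm (\<lambda>x. f k x - u x) + L2norm (\<lambda>\<xi>. F k \<xi> - v \<xi>)" for k
    using L2norm_triangle_diff[OF VL(2) FL(2)[of k] v] L2_fourier_norm[OF has_L2_fourier_diff[OF fk[of k] V]]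
    by (simp add: L2norm_minus_commute[of V])
  moreover have "(\<lambda>k. sqrt (2 * pi) * L2norm (\<lambda>x. f k x - u x) + L2norm (\<lambda>\<xi>. F k \<xi> - v \<xi>)) \<longlonglongrightarrow> sqrt (2 * pi) * 0 + 0"
    by (intro tendsto_add tendsto_mult tendsto_const f F)
  ultimately have "L2norm (\<lambda>\<xi>. V \<xi> - v \<xi>) \<le> sqrt (2 * pi) * 0 + 0" by (intro LIMSEQ_le_const) auto
  then have "L2norm (\<lambda>\<xi>. V \<xi> - v \<xi>) = 0" using L2norm_nonneg[of "\<lambda>\<xi>. V \<xi> - v \<xi>"] by linarith
  from L2norm_0_AE[OF L2_fun_diff[OF VL(2) v] this] have "AE \<xi> in lborel. V \<xi> = v \<xi>" by simp
  then show ?thesis by (rule has_L2_fourier_cong_AE[OF V AE_I2[OF refl]]) (use u v in \<open>auto simp: L2_fun_def\<close>)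
qed

section \<open>Synthesis from bands and the limiting rate\<close>

definition dissip :: "(real \<Rightarrow> complex) \<Rightarrow> ennreal" where
  "dissip v = (\<integral>\<^sup>+\<xi>. ennreal (dsymbol \<xi> * (norm (v \<xi>))^2) \<partial>lborel)"

text \<open>Half-open like the cells, so that a band with integer cut-off is a union of
  cells.\<close>

definition band :: "real \<Rightarrow> (real \<Rightarrow> complex) \<Rightarrow> real \<Rightarrow> complex" where
  "band R v \<xi> = v \<xi> * indicator {-R..<R} \<xi>"

lemma norm_band_le: "norm (band R v \<xi>) \<le> norm (v \<xi>)"
  by (simp add: band_def indicator_def)

lemma band_L2:
  assumes v: "L2_fun v" shows "L2_fun (band R v)"
proof (rule L2_fun_bound[OF v, where C=1])
  have [measurable]: "v \<in> borel_measurable lborel" using v by (simp add: L2_fun_def)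
  show "band R v \<in> borel_measurable lborel" unfolding band_def[abs_def] by measurable
qed (simp add: norm_band_le)

lemma band_L1:
  assumes v: "L2_fun v" shows "integrable lborel (band R v)"
proof -
  have "L2_fun (indicator {-R..<R} :: real \<Rightarrow> complex)"
    by (rule L2_fun_bound[OF L2_fun_indicator_Icc[of 1 "-R" R], where C=1]) (auto simp: indicator_def)
  from L2_mult_integrable[OF v this] show ?thesis by (simp add: band_def[abs_def])
qed

lemma band_fourier: "L2_fun v \<Longrightarrow> has_L2_fourier (inverse_fourier (band R v)) (band R v)"
  by (intro has_L2_fourier_inverse_L1 band_L1 band_L2)

text \<open>Outside the band the symbol is at least \<open>R\<close>, so finite dissipation turns
  convergence of the bands into convergence at the rate \<open>1 / sqrt R\<close>.\<close>

lemma band_tail: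
  assumes v: "L2_fun v" and N: "dissip v < \<infinity>" and R: "1 \<le> R"
  shows "L2norm (\<lambda>\<xi>. band R v \<xi> - v \<xi>) \<le> sqrt (enn2real (dissip v)) / sqrt R"
proof -
  have m[measurable]: "v \<in> borel_measurable lborel" using v by (simp add: L2_fun_def)
  have "(\<integral>\<^sup>+\<xi>. ennreal ((norm (band R v \<xi> - v \<xi>))^2) \<partial>lborel) \<le> (\<integral>\<^sup>+\<xi>. ennreal (1 / R) * ennreal (dsymbol \<xi> * (norm (v \<xi>))^2) \<partial>lborel)"
  proof (rule nn_integral_mono)
    fix \<xi>
    have "(norm (band R v \<xi> - v \<xi>))\<^sup>2 \<le> (1 / R) * (dsymbol \<xi> * (norm (v \<xi>))^2)"
    proof (cases "\<xi> \<in> {-R..<R}")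
      case False
      then have "R \<le> \<bar>\<xi>\<bar>" by auto
      moreover from this have "\<bar>\<xi>\<bar> \<le> dsymbol \<xi>" by (intro dsymbol_ge) (use R in linarith)
      ultimately have "R * (norm (v \<xi>))^2 \<le> dsymbol \<xi> * (norm (v \<xi>))^2" by (intro mult_right_mono) auto
      then show ?thesis using R False by (simp add: band_def pos_le_divide_eq mult.commute)
    qed (use R in \<open>simp add: band_def\<close>)
    then show "ennreal ((norm (band R v \<xi> - v \<xi>))^2) \<le> ennreal (1 / R) * ennreal (dsymbol \<xi> * (norm (v \<xi>))^2)"
      using R by (simp add: ennreal_leI flip: ennreal_mult)
  qed
  also have "\<dots> = ennreal (1 / R) * dissip v" unfolding dissip_def by (rule nn_integral_cmult) measurable
  also have "\<dots> = ennreal (1 / R) * ennreal (enn2real (dissip v))" using N by simp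
  also have "\<dots> = ennreal (enn2real (dissip v) / R)" using R by (simp flip: ennreal_mult)
  finally have "(L2norm (\<lambda>\<xi>. band R v \<xi> - v \<xi>))\<^sup>2 \<le> enn2real (dissip v) / R"
    using band_L2[OF v, of R] R by (intro L2norm_le_nn(2)) (auto simp: L2_fun_def)
  then show ?thesis by (simp add: real_le_rsqrt flip: real_sqrt_divide)
qed

text \<open>The bands \<open>4 ^ k\<close> have tails of order \<open>1 / 2 ^ k\<close>, and squared
  increments of order \<open>1 / 4 ^ k\<close> beat the weight \<open>2 ^ k\<close> of rapid
  convergence. The inverse transform is thus an almost everywhere limit along a sequence that does
  not depend on \<open>v\<close>, which makes the solution jointly measurable.\<close>

lemma band_synthesis:
  assumes v: "L2_fun v" and N: "dissip v < \<infinity>"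
  shows "AE x in lborel. convergent (\<lambda>k. inverse_fourier (band (4 ^ k) v) x)"
    and "u \<in> borel_measurable lborel \<Longrightarrow> AE x in lborel. (\<lambda>k. inverse_fourier (band (4 ^ k) v) x) \<longlonglongrightarrow> u x \<Longrightarrow> has_L2_fourier u v"
proof -
  let ?f = "\<lambda>k. inverse_fourier (band (4 ^ k) v)" and ?N = "enn2real (dissip v)"
  note bf = band_fourier[OF v]
  note fL = has_L2_fourier_L2(1)[OF bf]
  have vm: "v \<in> borel_measurable lborel" using v by (simp add: L2_fun_def)
  have s4: "sqrt (4 ^ k) = 2 ^ k" for k
    using real_sqrt_power[of 4 k] by simp
  have t: "L2norm (\<lambda>\<xi>. band (4 ^ k) v \<xi> - v \<xi>) \<le> sqrt ?N / 2 ^ k" for k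
    using band_tail[OF v N, of "4 ^ k"] by (simp add: s4)
  have d: "(L2norm (\<lambda>x. ?f (Suc k) x - ?f k x))\<^sup>2 \<le> ?N * (1/4) ^ k" for k
  proof -
    have "L2norm (\<lambda>x. ?f (Suc k) x - ?f k x) \<le> L2norm (\<lambda>\<xi>. band (4 ^ Suc k) v \<xi> - band (4 ^ k) v \<xi>)"
      by (intro L2norm_le_fourier has_L2_fourier_diff bf)
    also have "\<dots> \<le> L2norm (\<lambda>\<xi>. band (4 ^ k) v \<xi> - v \<xi>)"
    proof (rule L2norm_mono)
      show "norm (band (4 ^ Suc k) v \<xi> - band (4 ^ k) v \<xi>) \<le> norm (band (4 ^ k) v \<xi> - v \<xi>)" for \<xi>
        by (cases "\<xi> \<in> {-(4 ^ k)..<4 ^ k}") (auto simp: band_def indicator_def)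
    qed (intro L2_fun_measurable L2_fun_diff band_L2 v)+
    also note t
    finally have "(L2norm (\<lambda>x. ?f (Suc k) x - ?f k x))\<^sup>2 \<le> (sqrt ?N / 2 ^ k)^2" by (intro power_mono) auto
    also have "\<dots> = ?N / (2 ^ k)^2" by (simp add: power_divide)
    also have "\<dots> = ?N * (1/4) ^ k" unfolding power2_eq_square four_power[symmetric] by (simp add: power_one_over)
    finally show ?thesis .
  qed
  have summ: "summable (\<lambda>k. 2 ^ k * (L2norm (\<lambda>x. ?f (Suc k) x - ?f k x))^2)"
  proof (rule summable_comparison_test')
    show "summable (\<lambda>k. ?N * (1/2) ^ k)" by (intro summable_mult summable_geometric) auto
    fix k
    have "2 ^ k * (L2norm (\<lambda>x. ?f (Suc k) x - ?f k x))^2 \<le> 2 ^ k * (?N * (1/4) ^ k)" by (intro mult_left_mono d) auto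
    also have "\<dots> = ?N * (1/2) ^ k" by (simp add: power_one_over four_power)
    finally show "norm (2 ^ k * (L2norm (\<lambda>x. ?f (Suc k) x - ?f k x))^2) \<le> ?N * (1/2) ^ k" by simp
  qed
  show "AE x in lborel. convergent (\<lambda>k. ?f k x)" by (rule L2_rapid_limit(1)[OF fL summ])
  assume "u \<in> borel_measurable lborel" "AE x in lborel. (\<lambda>k. ?f k x) \<longlonglongrightarrow> u x"
  from L2_rapid_limit(2)[OF fL summ this] have u: "L2_fun u" "(\<lambda>k. L2norm (\<lambda>x. ?f k x - u x)) \<longlonglongrightarrow> 0" by auto
  show "has_L2_fourier u v"
  proof (rule has_L2_fourier_limit[OF bf u(1) v u(2)])
    show "(\<lambda>k. L2norm (\<lambda>\<xi>. band (4 ^ k) v \<xi> - v \<xi>)) \<longlonglongrightarrow> 0"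
    proof (rule Lim_null_comparison)
      show "eventually (\<lambda>k. norm (L2norm (\<lambda>\<xi>. band (4 ^ k) v \<xi> - v \<xi>)) \<le> sqrt ?N * (1/2) ^ k) sequentially"
        using t by (simp add: power_one_over)
    qed (intro tendsto_mult_right_zero LIMSEQ_realpow_zero, auto)
  qed
qed

text \<open>The factor \<open>pi\<close> is \<open>(2 * pi)\<^sup>2 / (4 * pi)\<close>, since
  \<open>u\<close> is \<open>1 / (2 * pi)\<close> times the integral that \<open>cut_rate\<close>
  squares.\<close>

definition limit_rate :: "(real \<Rightarrow> real \<Rightarrow> real) \<Rightarrow> real \<Rightarrow> (real \<Rightarrow> complex) \<Rightarrow> (real \<Rightarrow> real) \<Rightarrow> complex" where
  "limit_rate \<phi> s v u = (LBINT \<xi>. v \<xi> * lam \<phi> s \<xi>) - pi * (LBINT x. complex_of_real (partial_x \<phi> s x) * (complex_of_real (u x))^2)"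

lemma cut_rate_band:
  "cut_rate \<phi> s R v = (LBINT \<xi>. band (real R) v \<xi> * lam \<phi> s \<xi>)
    - pi * (LBINT x. of_real (partial_x \<phi> s x) * (inverse_fourier (band (real R) v) x)^2)"
proof -
  have e: "(LBINT \<xi>. v \<xi> * (cis (x * \<xi>) * indicator {-real R..<real R} \<xi>)) = 2 * pi * inverse_fourier (band (real R) v) x" for x
    by (simp add: inverse_fourier_def band_def mult_ac)
  have "(LBINT x. of_real (partial_x \<phi> s x) * (2 * pi * inverse_fourier (band (real R) v) x)^2)
      = (LBINT x. (4 * pi^2) * (of_real (partial_x \<phi> s x) * (inverse_fourier (band (real R) v) x)^2))"
    by (intro Bochner_Integration.integral_cong) (auto simp: power_mult_distrib)
  also have "\<dots> = (4 * pi^2) * (LBINT x. of_real (partial_x \<phi> s x) * (inverse_fourier (band (real R) v) x)^2)"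
    by (rule integral_mult_right_zero)
  finally show ?thesis unfolding cut_rate_def e by (simp add: band_def mult_ac power2_eq_square)
qed

lemma lam_L2:
  assumes \<phi>: "test_fun \<phi>" and C: "\<And>s \<xi>. norm (lam \<phi> s \<xi>) \<le> C / (1 + \<xi>^2)"
  shows "L2_fun (lam \<phi> s)" "L2norm (lam \<phi> s) \<le> L2norm (\<lambda>\<xi>. complex_of_real (C * inverse (1 + \<xi>^2)))"
proof -
  have m: "lam \<phi> s \<in> borel_measurable lborel" using borel_measurable_continuous_onI[OF lam_continuous[OF \<phi>]] by simp
  have b: "norm (lam \<phi> s \<xi>) \<le> norm (complex_of_real (C * inverse (1 + \<xi>^2)))" for \<xi>
    unfolding norm_of_real using C[of s \<xi>] by (intro order_trans[OF _ abs_ge_self]) (simp add: divide_inverse)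
  show "L2_fun (lam \<phi> s)" by (rule L2_fun_bound[OF inverse_square_L2 m, where C=1]) (use b in auto)
  show "L2norm (lam \<phi> s) \<le> L2norm (\<lambda>\<xi>. complex_of_real (C * inverse (1 + \<xi>^2)))"
    by (rule L2norm_mono[OF inverse_square_L2 m b])
qed

lemma quadratic_integral_diff:
  fixes p :: "real \<Rightarrow> real" and f g :: "real \<Rightarrow> complex"
  assumes p: "p \<in> borel_measurable lborel" "\<And>x. \<bar>p x\<bar> \<le> B" and f: "L2_fun f" and g: "L2_fun g"
  shows "integrable lborel (\<lambda>x. of_real (p x) * (f x)^2)"
    "norm ((LBINT x. of_real (p x) * (f x)^2) - (LBINT x. of_real (p x) * (g x)^2)) \<le> B * L2norm (\<lambda>x. f x - g x) * (L2norm f + L2norm g)"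
proof -
  have B: "0 \<le> B" using order_trans[OF abs_ge_zero p(2)] by blast
  have pL: "L2_fun (\<lambda>x. of_real (p x) * h x)" "L2norm (\<lambda>x. of_real (p x) * h x) \<le> B * L2norm h" if h: "L2_fun h" for h :: "real \<Rightarrow> complex"
  proof -
    have m: "(\<lambda>x. of_real (p x) * h x) \<in> borel_measurable lborel" using p(1) h by (auto simp: L2_fun_def)
    have b: "norm (of_real (p x) * h x) \<le> norm (of_real B * h x)" for x
      using p(2)[of x] B by (simp add: norm_mult mult_right_mono)
    show "L2_fun (\<lambda>x. of_real (p x) * h x)"
      by (rule L2_fun_bound[OF L2_fun_cmult[OF h, of "of_real B"] m, where C=1]) (use b in auto)
    have "L2norm (\<lambda>x. of_real (p x) * h x) \<le> L2norm (\<lambda>x. of_real B * h x)" by (rule L2norm_mono[OF L2_fun_cmult[OF h] m b])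
    then show "L2norm (\<lambda>x. of_real (p x) * h x) \<le> B * L2norm h" using B by (simp add: L2norm_cmult)
  qed
  have i: "integrable lborel (\<lambda>x. of_real (p x) * (h x)^2)" if h: "L2_fun h" for h :: "real \<Rightarrow> complex"
    using L2_mult_integrable[OF pL(1)[OF h] h] by (simp add: power2_eq_square mult.assoc)
  show "integrable lborel (\<lambda>x. of_real (p x) * (f x)^2)" by (rule i[OF f])
  have e: "(LBINT x. of_real (p x) * (f x)^2) - (LBINT x. of_real (p x) * (g x)^2)
    = (LBINT x. (of_real (p x) * (f x - g x)) * (f x + g x))"
    unfolding Bochner_Integration.integral_diff[OF i[OF f] i[OF g], symmetric]
    by (intro Bochner_Integration.integral_cong refl) (simp add: power2_eq_square algebra_simps)
  have "norm (LBINT x. (of_real (p x) * (f x - g x)) * (f x + g x)) \<le> L2norm (\<lambda>x. of_real (p x) * (f x - g x)) * L2norm (\<lambda>x. f x + g x)"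
    by (intro L2_integral_mult_le pL L2_fun_diff L2_fun_add f g)
  also have "\<dots> \<le> (B * L2norm (\<lambda>x. f x - g x)) * (L2norm f + L2norm g)"
    using B by (intro mult_mono pL L2norm_triangle L2_fun_diff f g) auto
  finally show "norm ((LBINT x. of_real (p x) * (f x)^2) - (LBINT x. of_real (p x) * (g x)^2)) \<le> B * L2norm (\<lambda>x. f x - g x) * (L2norm f + L2norm g)"
    unfolding e .
qed

text \<open>Both differences reduce to the tail of one band: the linear one by Cauchy-Schwarz
  against \<open>lam\<close>, the quadratic one through the factorisation
  \<open>(f - g) * (f + g)\<close>. The dissipation enters the final bound linearly, which keeps it
  integrable in time.\<close>

lemma cut_rate_error:
  assumes \<phi>: "test_fun \<phi>"
  obtains K where "0 \<le> K" "\<And>s v u R. has_L2_fourier (\<lambda>x. complex_of_real (u x)) v \<Longrightarrow> dissip v < \<infinity> \<Longrightarrow> 1 \<le> R \<Longrightarrow>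
    norm (cut_rate \<phi> s R v - limit_rate \<phi> s v u) \<le> K * (enn2real (dissip v) + (L2norm v)^2 + 1) / sqrt (real R)"
proof -
  obtain C where C: "0 \<le> C" "\<And>s \<xi>. norm (lam \<phi> s \<xi>) \<le> C / (1 + \<xi>^2)"
    and "\<And>s \<xi>. norm (tf (partial_x \<phi>) s \<xi>) \<le> C / (1 + \<xi>^2)"
    using rate_symbol_bounds[OF \<phi>] by blast
  define \<Lambda> where "\<Lambda> = L2norm (\<lambda>\<xi>. complex_of_real (C * inverse (1 + \<xi>^2)))"
  note l = lam_L2[OF \<phi> C(2), folded \<Lambda>_def]
  note \<phi>x = test_fun_partial(1)[OF \<phi>]
  obtain T B where "0 < T" and B: "0 \<le> B" "\<And>t x. \<bar>partial_x \<phi> t x\<bar> \<le> B"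
    and "\<And>t x. T \<le> \<bar>t\<bar> \<or> T \<le> \<bar>x\<bar> \<Longrightarrow> partial_x \<phi> t x = 0" using test_fun_bounds[OF \<phi>x] by metis
  have \<Lambda>0: "0 \<le> \<Lambda>" by (simp add: \<Lambda>_def)
  show thesis
  proof (rule that[of "\<Lambda> + pi * (B * 2)"])
    show "0 \<le> \<Lambda> + pi * (B * 2)" using \<Lambda>0 B(1) by simp
    fix s v u and R :: nat
    assume uv: "has_L2_fourier (\<lambda>x. complex_of_real (u x)) v" and N: "dissip v < \<infinity>" and R: "1 \<le> R"
    note L = has_L2_fourier_L2[OF uv]
    let ?b = "band (real R) v" and ?N = "enn2real (dissip v)"
    let ?W = "inverse_fourier ?b" and ?u = "\<lambda>x. complex_of_real (u x)"
    note bf = band_fourier[OF L(2), of "real R"]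
    define h where "h = L2norm (\<lambda>\<xi>. ?b \<xi> - v \<xi>)"
    have h: "0 \<le> h" "h \<le> sqrt ?N / sqrt (real R)" unfolding h_def using band_tail[OF L(2) N, of "real R"] R by auto
    define X where "X = (LBINT \<xi>. ?b \<xi> * lam \<phi> s \<xi>) - (LBINT \<xi>. v \<xi> * lam \<phi> s \<xi>)"
    define Y where "Y = (LBINT x. of_real (partial_x \<phi> s x) * (?W x)^2) - (LBINT x. of_real (partial_x \<phi> s x) * (?u x)^2)"
    have alg: "(a - p * x) - (b - p * y) = (a - b) - p * (x - y)" for a b p x y :: complex by (simp add: algebra_simps)
    have e: "cut_rate \<phi> s R v - limit_rate \<phi> s v u = X - pi * Y"
      unfolding cut_rate_band limit_rate_def X_def Y_def by (rule alg)
    have "X = (LBINT \<xi>. (?b \<xi> - v \<xi>) * lam \<phi> s \<xi>)"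
      unfolding X_def left_diff_distrib
      by (intro Bochner_Integration.integral_diff[symmetric] L2_mult_integrable band_L2 L l)
    then have "norm X \<le> h * L2norm (lam \<phi> s)" unfolding h_def
      by (simp only:) (intro L2_integral_mult_le L2_fun_diff band_L2 L l)
    also have "\<dots> \<le> h * \<Lambda>" by (intro mult_left_mono l h)
    finally have X: "norm X \<le> h * \<Lambda>" .
    have "norm Y \<le> B * L2norm (\<lambda>x. ?W x - ?u x) * (L2norm ?W + L2norm ?u)" unfolding Y_def
      by (rule quadratic_integral_diff) (use test_fun_measurable(2)[OF \<phi>x] B has_L2_fourier_L2[OF bf] L in auto)
    also have "\<dots> \<le> B * h * (L2norm v + L2norm v)"
    proof (intro mult_mono add_mono)
      show "L2norm (\<lambda>x. ?W x - ?u x) \<le> h" unfolding h_def by (intro L2norm_le_fourier has_L2_fourier_diff bf uv)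
      show "L2norm ?u \<le> L2norm v" by (rule L2norm_le_fourier[OF uv])
      have "L2norm ?b \<le> L2norm v" using band_L2[OF L(2)] by (intro L2norm_mono L norm_band_le) (auto simp: L2_fun_def)
      then show "L2norm ?W \<le> L2norm v" using L2norm_le_fourier[OF bf] by linarith
    qed (use B h in auto)
    finally have Y: "norm Y \<le> B * h * (L2norm v + L2norm v)" .
    have "norm (X - pi * Y) \<le> norm X + norm (pi * Y)" by (rule norm_triangle_ineq4)
    also have "norm (pi * Y) = pi * norm Y" by (simp add: norm_mult)
    also have "norm X + pi * norm Y \<le> h * \<Lambda> + pi * (B * h * (L2norm v + L2norm v))" by (intro add_mono mult_left_mono X Y) auto
    also have "\<dots> = h * (\<Lambda> + pi * (B * 2) * L2norm v)" by (simp add: algebra_simps)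
    also have "\<dots> \<le> (sqrt ?N / sqrt (real R)) * (\<Lambda> + pi * (B * 2) * L2norm v)"
      using \<Lambda>0 B(1) by (intro mult_right_mono h) auto
    also have "\<dots> = (\<Lambda> * (sqrt ?N * 1) + pi * (B * 2) * (sqrt ?N * L2norm v)) / sqrt (real R)" by (simp add: add_divide_distrib algebra_simps)
    also have "\<dots> \<le> (\<Lambda> * (?N + (L2norm v)^2 + 1) + pi * (B * 2) * (?N + (L2norm v)^2 + 1)) / sqrt (real R)"
    proof (intro divide_right_mono add_mono mult_left_mono)
      have am: "sqrt ?N * y \<le> ?N + y^2" if "0 \<le> y" for y :: real
        using weighted_AM_GM[of 1 "sqrt ?N" y] that by simp
      show "sqrt ?N * 1 \<le> ?N + (L2norm v)^2 + 1" using am[of 1] zero_le_power2[of "L2norm v"] unfolding power_one by linarith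
      show "sqrt ?N * L2norm v \<le> ?N + (L2norm v)^2 + 1" using am[OF L2norm_nonneg, of v] by linarith
    qed (use \<Lambda>0 B(1) in auto)
    finally show "norm (cut_rate \<phi> s R v - limit_rate \<phi> s v u) \<le> (\<Lambda> + pi * (B * 2)) * (?N + (L2norm v)^2 + 1) / sqrt (real R)"
      unfolding e distrib_right .
  qed
qed

section \<open>Return to the weak formulation in \<open>x\<close>\<close>

text \<open>The transform of the dispersive operator applied to \<phi>; the conjugate undoes the
  reflection in \<open>tf\<close>.\<close>

definition disp_transform :: "(real \<Rightarrow> real \<Rightarrow> real) \<Rightarrow> real \<Rightarrow> real \<Rightarrow> complex" where
  "disp_transform \<phi> t \<xi> = of_real (dsymbol \<xi>) * cnj (tf \<phi> t \<xi>)"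

lemma multiplier_eq:
  "multiplier (\<lambda>\<xi>. frac_lap_symbol (1/2) \<xi> * m_symbol \<xi>) (\<phi> t) x = Re (inverse_fourier (disp_transform \<phi> t) x)"
  by (simp add: multiplier_def disp_transform_def[abs_def] dsymbol_def tf_cnj scaleR_conv_of_real)

lemma disp_transform_measurable:
  assumes \<phi>: "test_fun \<phi>"
  shows "(\<lambda>(t, \<xi>). disp_transform \<phi> t \<xi>) \<in> borel_measurable (lborel \<Otimes>\<^sub>M lborel)" "disp_transform \<phi> t \<in> borel_measurable lborel"
proof -
  note [measurable] = tf_measurable[OF \<phi>] dsymbol_measurable
  have "(\<lambda>p. of_real (dsymbol (snd p)) * cnj (case p of (t, \<xi>) \<Rightarrow> tf \<phi> t \<xi>)) \<in> borel_measurable (lborel \<Otimes>\<^sub>M lborel)" by measurable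
  then show "(\<lambda>(t, \<xi>). disp_transform \<phi> t \<xi>) \<in> borel_measurable (lborel \<Otimes>\<^sub>M lborel)" by (simp add: disp_transform_def split_beta')
  have [measurable]: "tf \<phi> t \<in> borel_measurable borel" by (rule borel_measurable_continuous_onI[OF tf_continuous[OF \<phi>]])
  show "disp_transform \<phi> t \<in> borel_measurable lborel" unfolding disp_transform_def[abs_def] by measurable
qed

lemma multiplier_measurable:
  assumes \<phi>: "test_fun \<phi>"
  shows "(\<lambda>(t, x). multiplier (\<lambda>\<xi>. frac_lap_symbol (1/2) \<xi> * m_symbol \<xi>) (\<phi> t) x) \<in> borel_measurable (lborel \<Otimes>\<^sub>M lborel)"
proof -
  note [measurable] = disp_transform_measurable(1)[OF \<phi>]
  have [measurable]: "(\<lambda>(t, x). (LBINT \<xi>. cis (x * \<xi>) * disp_transform \<phi> t \<xi>)) \<in> borel_measurable (lborel \<Otimes>\<^sub>M lborel)" by measurable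
  have "(\<lambda>(t, x). Re ((LBINT \<xi>. cis (x * \<xi>) * disp_transform \<phi> t \<xi>) / (2 * pi))) \<in> borel_measurable (lborel \<Otimes>\<^sub>M lborel)" by measurable
  then show ?thesis unfolding multiplier_eq inverse_fourier_def .
qed

lemma weak_integrand_measurable:
  assumes \<phi>: "test_fun \<phi>" and [measurable]: "(\<lambda>(t, x). u t x) \<in> borel_measurable (lborel \<Otimes>\<^sub>M lborel)"
  shows "(\<lambda>(t, x). weak_integrand u \<phi> t x) \<in> borel_measurable (lborel \<Otimes>\<^sub>M lborel)"
proof -
  note [measurable] = multiplier_measurable[OF \<phi>] test_fun_measurable(1)[OF test_fun_partial(1)[OF \<phi>]] test_fun_measurable(1)[OF test_fun_partial(2)[OF \<phi>]]
  show ?thesis unfolding weak_integrand_def by measurable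
qed

lemma disp_transform_fourier:
  assumes \<phi>: "test_fun \<phi>"
  obtains \<Lambda> where "\<And>t. has_L2_fourier (inverse_fourier (disp_transform \<phi> t)) (disp_transform \<phi> t)" "\<And>t. L2norm (disp_transform \<phi> t) \<le> \<Lambda>"
proof -
  obtain C where C: "0 \<le> C" "\<And>t \<xi>. norm (tf \<phi> t \<xi>) \<le> C / (1 + \<xi>^2)^2" using tf_decay[OF \<phi>] by blast
  note m = disp_transform_measurable(2)[OF \<phi>]
  have b: "norm (disp_transform \<phi> t \<xi>) \<le> C * inverse (1 + \<xi>^2)" for t \<xi>
  proof -
    have p: "0 < 1 + \<xi>^2" by (intro add_pos_nonneg) auto
    have frac: "y * (D / y^2) = D * inverse y" if "0 < y" for y D :: real
      using that by (simp add: power2_eq_square inverse_eq_divide)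
    have "norm (disp_transform \<phi> t \<xi>) = dsymbol \<xi> * norm (tf \<phi> t \<xi>)" by (simp add: disp_transform_def norm_mult)
    also have "\<dots> \<le> (1 + \<xi>^2) * (C / (1 + \<xi>^2)^2)" by (intro mult_mono dsymbol_le C) auto
    also have "\<dots> = C * inverse (1 + \<xi>^2)" using frac[of "1 + \<xi>^2" C] p by linarith
    finally show ?thesis .
  qed
  have b2: "norm (disp_transform \<phi> t \<xi>) \<le> norm (complex_of_real (C * inverse (1 + \<xi>^2)))" for t \<xi>
    unfolding norm_of_real by (rule order_trans[OF b abs_ge_self])
  have L2: "L2_fun (disp_transform \<phi> t)" for t by (rule L2_fun_bound[OF inverse_square_L2 m, where C=1]) (use b2 in auto)
  have L1: "integrable lborel (disp_transform \<phi> t)" for t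
    by (rule Bochner_Integration.integrable_bound[OF integrable_mult_right[OF integrable_inverse_square(1), of C] m])
       (use b C(1) in \<open>auto simp: abs_mult\<close>)
  show thesis
    by (rule that[of "L2norm (\<lambda>\<xi>. complex_of_real (C * inverse (1 + \<xi>^2)))"])
       (rule has_L2_fourier_inverse_L1[OF L1 L2], rule L2norm_mono[OF inverse_square_L2 m b2])
qed

lemma L2_product_abs:
  fixes f g :: "real \<Rightarrow> real"
  assumes f: "L2_fun f" and g: "L2_fun g"
  shows "integrable lborel (\<lambda>x. f x * g x)" "(LBINT x. \<bar>f x * g x\<bar>) \<le> L2norm f * L2norm g"
proof -
  have m[measurable]: "f \<in> borel_measurable lborel" "g \<in> borel_measurable lborel" using f g by (auto simp: L2_fun_def)
  show "integrable lborel (\<lambda>x. f x * g x)"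
    by (rule Bochner_Integration.integrable_bound[OF L2_norm_mult_integrable[OF f g]]) (auto simp: abs_mult)
  show "(LBINT x. \<bar>f x * g x\<bar>) \<le> L2norm f * L2norm g"
    using L2_Cauchy_Schwarz[OF f g] by (simp add: abs_mult)
qed

text \<open>Plancherel's identity term by term. The factor \<open>2 * pi\<close> comes from the
  inner product in the linear terms, and in the quadratic one from \<open>pi\<close> and the
  division of the square by \<open>2\<close>. Real parts are compared because
  \<open>multiplier\<close> is defined through \<open>Re\<close>.\<close>

lemma weak_pairing:
  assumes \<phi>: "test_fun \<phi>" and uv: "has_L2_fourier (\<lambda>x. complex_of_real (u t x)) v"
  shows "integrable lborel (weak_integrand u \<phi> t)" "2 * pi * (LBINT x. weak_integrand u \<phi> t x) = Re (limit_rate \<phi> t v (u t))"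
proof -
  note \<phi>x = test_fun_partial(1)[OF \<phi>] and \<phi>t = test_fun_partial(2)[OF \<phi>]
  let ?u = "\<lambda>x. complex_of_real (u t x)" and ?W = "inverse_fourier (disp_transform \<phi> t)"
  obtain \<Lambda> where df: "\<And>t. has_L2_fourier (inverse_fourier (disp_transform \<phi> t)) (disp_transform \<phi> t)"
    and "\<And>t. L2norm (disp_transform \<phi> t) \<le> \<Lambda>" using disp_transform_fourier[OF \<phi>] by blast
  note L = has_L2_fourier_L2[OF uv] and WL = has_L2_fourier_L2[OF df[of t]]
  have uL: "L2_fun (u t)" using L(1) by (simp add: L2_fun_of_real_iff)
  obtain T B where "0 < T" and B: "0 \<le> B" "\<And>t x. \<bar>partial_x \<phi> t x\<bar> \<le> B"
    and "\<And>t x. T \<le> \<bar>t\<bar> \<or> T \<le> \<bar>x\<bar> \<Longrightarrow> partial_x \<phi> t x = 0" using test_fun_bounds[OF \<phi>x] by metis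
  have tL: "L2_fun (partial_t \<phi> t)" using test_fun_x_integrable(2)[OF \<phi>t] by (simp add: L2_fun_of_real_iff)
  have RW: "L2_fun (\<lambda>x. Re (?W x))"
    by (rule L2_fun_bound[OF WL(1), where C=1]) (use WL(1) in \<open>auto simp: L2_fun_def abs_Re_le_cmod\<close>)
  have i1: "integrable lborel (\<lambda>x. u t x * partial_t \<phi> t x)" by (rule L2_product_abs[OF uL tL])
  have i2: "integrable lborel (\<lambda>x. u t x * Re (?W x))" by (rule L2_product_abs[OF uL RW])
  have pm: "partial_x \<phi> t \<in> borel_measurable lborel" using test_fun_measurable(2)[OF \<phi>x] by simp
  have ic: "integrable lborel (\<lambda>x. complex_of_real (partial_x \<phi> t x) * (?u x)^2)"
    by (rule quadratic_integral_diff(1)[OF pm B(2) L(1) L(1)])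
  then have "integrable lborel (\<lambda>x. complex_of_real (partial_x \<phi> t x * (u t x)^2))" by simp
  then have i3': "integrable lborel (\<lambda>x. partial_x \<phi> t x * (u t x)^2)" by (simp only: complex_of_real_integrable_eq)
  then have i3: "integrable lborel (\<lambda>x. (u t x)^2 / 2 * partial_x \<phi> t x)"
    using integrable_mult_right[OF i3', of "1/2"] by (simp add: mult_ac)
  have w: "weak_integrand u \<phi> t = (\<lambda>x. u t x * partial_t \<phi> t x - u t x * Re (?W x) - (u t x)\<^sup>2 / 2 * partial_x \<phi> t x)"
    by (rule ext) (simp add: weak_integrand_def multiplier_eq)
  show "integrable lborel (weak_integrand u \<phi> t)" unfolding w by (intro Bochner_Integration.integrable_diff i1 i2 i3)
  have I: "(LBINT x. weak_integrand u \<phi> t x) = (LBINT x. u t x * partial_t \<phi> t x) - (LBINT x. u t x * Re (?W x)) - (LBINT x. (u t x)^2 / 2 * partial_x \<phi> t x)"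
    unfolding w by (simp only: Bochner_Integration.integral_diff Bochner_Integration.integrable_diff i1 i2 i3)
  have "(LBINT \<xi>. v \<xi> * cnj (fourier (\<lambda>x. complex_of_real (partial_t \<phi> t x)) \<xi>)) = 2 * pi * (LBINT x. ?u x * cnj (complex_of_real (partial_t \<phi> t x)))"
    by (rule L2_fourier_inner[OF uv has_L2_fourier_L1[OF test_fun_x_integrable[OF \<phi>t]]])
  then have 1: "(LBINT \<xi>. v \<xi> * tf (partial_t \<phi>) t \<xi>) = 2 * pi * of_real (LBINT x. u t x * partial_t \<phi> t x)"
    by (simp add: tf_cnj flip: integral_complex_of_real)
  have "(LBINT \<xi>. v \<xi> * cnj (disp_transform \<phi> t \<xi>)) = 2 * pi * (LBINT x. ?u x * cnj (?W x))"
    by (rule L2_fourier_inner[OF uv df])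
  moreover have "Re (LBINT x. ?u x * cnj (?W x)) = (LBINT x. Re (?u x * cnj (?W x)))"
    by (rule integral_Re[symmetric]) (intro L2_mult_integrable L2_fun_cnj L WL)
  ultimately have 2: "Re (LBINT \<xi>. v \<xi> * cnj (disp_transform \<phi> t \<xi>)) = 2 * pi * (LBINT x. u t x * Re (?W x))" by simp
  have 3: "(LBINT x. complex_of_real (partial_x \<phi> t x) * (?u x)^2) = of_real (2 * (LBINT x. (u t x)^2 / 2 * partial_x \<phi> t x))"
  proof -
    have "(LBINT x. complex_of_real (partial_x \<phi> t x) * (?u x)^2) = (LBINT x. complex_of_real (2 * ((u t x)^2 / 2 * partial_x \<phi> t x)))"
      by (intro Bochner_Integration.integral_cong refl) simp
    also have "\<dots> = of_real (LBINT x. 2 * ((u t x)^2 / 2 * partial_x \<phi> t x))" by (rule integral_complex_of_real)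
    also have "(LBINT x. 2 * ((u t x)^2 / 2 * partial_x \<phi> t x)) = 2 * (LBINT x. (u t x)^2 / 2 * partial_x \<phi> t x)"
      by (rule integral_mult_right_zero)
    finally show ?thesis .
  qed
  have tfL: "L2_fun (tf (partial_t \<phi>) t)"
    using L2_fun_cnj[OF has_L2_fourier_L2(2)[OF has_L2_fourier_L1[OF test_fun_x_integrable[OF \<phi>t, of t]]]] by (simp add: tf_cnj[abs_def])
  have 4: "(LBINT \<xi>. v \<xi> * lam \<phi> t \<xi>) = (LBINT \<xi>. v \<xi> * tf (partial_t \<phi>) t \<xi>) - (LBINT \<xi>. v \<xi> * cnj (disp_transform \<phi> t \<xi>))"
  proof -
    have "v \<xi> * lam \<phi> t \<xi> = v \<xi> * tf (partial_t \<phi>) t \<xi> - v \<xi> * cnj (disp_transform \<phi> t \<xi>)" for \<xi>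
      by (simp add: lam_def disp_transform_def right_diff_distrib)
    then show ?thesis by (simp only:) (intro Bochner_Integration.integral_diff L2_mult_integrable L2_fun_cnj L WL tfL)
  qed
  have "Re (limit_rate \<phi> t v (u t)) = Re (LBINT \<xi>. v \<xi> * tf (partial_t \<phi>) t \<xi>) - Re (LBINT \<xi>. v \<xi> * cnj (disp_transform \<phi> t \<xi>))
      - pi * (2 * (LBINT x. (u t x)^2 / 2 * partial_x \<phi> t x))"
    unfolding limit_rate_def 4 3 by simp
  also have "\<dots> = 2 * pi * (LBINT x. weak_integrand u \<phi> t x)" unfolding 1 2 I by (simp add: algebra_simps)
  finally show "2 * pi * (LBINT x. weak_integrand u \<phi> t x) = Re (limit_rate \<phi> t v (u t))" by simp
qed

text \<open>Prepares integrability in time and space jointly: the bound in \<open>x\<close> depends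
  on \<open>t\<close> through the energy only, and the integrand vanishes after
  \<open>T\<close>.\<close>

lemma weak_integrand_L1_bound:
  assumes \<phi>: "test_fun \<phi>"
  obtains K T where "0 \<le> K" "0 < T" "\<And>u t x. T \<le> t \<Longrightarrow> weak_integrand u \<phi> t x = 0"
    "\<And>u t. L2_fun (u t) \<Longrightarrow> (LBINT x. \<bar>weak_integrand u \<phi> t x\<bar>) \<le> K * (1 + (L2norm (u t))^2)"
proof -
  note \<phi>x = test_fun_partial(1)[OF \<phi>] and \<phi>t = test_fun_partial(2)[OF \<phi>]
  obtain \<Lambda> where df: "\<And>t. has_L2_fourier (inverse_fourier (disp_transform \<phi> t)) (disp_transform \<phi> t)"
    and \<Lambda>: "\<And>t. L2norm (disp_transform \<phi> t) \<le> \<Lambda>" using disp_transform_fourier[OF \<phi>] by blast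
  obtain T0 B0 where T0: "0 < T0" "0 \<le> B0" "\<And>t x. \<bar>\<phi> t x\<bar> \<le> B0" "\<And>t x. T0 \<le> \<bar>t\<bar> \<or> T0 \<le> \<bar>x\<bar> \<Longrightarrow> \<phi> t x = 0" using test_fun_bounds[OF \<phi>] by metis
  obtain T1 B1 where T1: "0 < T1" "0 \<le> B1" "\<And>t x. \<bar>partial_t \<phi> t x\<bar> \<le> B1" "\<And>t x. T1 \<le> \<bar>t\<bar> \<or> T1 \<le> \<bar>x\<bar> \<Longrightarrow> partial_t \<phi> t x = 0" using test_fun_bounds[OF \<phi>t] by metis
  obtain T2 B2 where T2: "0 < T2" "0 \<le> B2" "\<And>t x. \<bar>partial_x \<phi> t x\<bar> \<le> B2" "\<And>t x. T2 \<le> \<bar>t\<bar> \<or> T2 \<le> \<bar>x\<bar> \<Longrightarrow> partial_x \<phi> t x = 0" using test_fun_bounds[OF \<phi>x] by metis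
  define A where "A = L2norm (\<lambda>x. complex_of_real B1 * indicator {-T1..T1} x)"
  have A: "L2norm (partial_t \<phi> t) \<le> A" for t
  proof -
    have "L2norm (\<lambda>x. complex_of_real (partial_t \<phi> t x)) \<le> A" unfolding A_def
    proof (rule L2norm_mono[OF L2_fun_indicator_Icc])
      fix x
      have "norm (complex_of_real (partial_t \<phi> t x)) \<le> B1 * indicator {-T1..T1} x" by (rule test_fun_cutoff_bound[OF T1(2,3,4)])
      then show "norm (complex_of_real (partial_t \<phi> t x)) \<le> norm (complex_of_real B1 * indicator {-T1..T1} x)"
        using T1(2) by (cases "x \<in> {-T1..T1}") (simp_all add: norm_mult)
    qed (use test_fun_measurable(2)[OF \<phi>t] in auto)
    then show ?thesis by (simp add: L2norm_of_real)
  qed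
  have A0: "0 \<le> A" by (simp add: A_def)
  have \<Lambda>0: "0 \<le> \<Lambda>" using order_trans[OF L2norm_nonneg \<Lambda>] .
  define T where "T = max T0 (max T1 T2)"
  show thesis
  proof (rule that[of "A + \<Lambda> + B2" T])
    show "0 \<le> A + \<Lambda> + B2" using A0 \<Lambda>0 T2(2) by simp
    show "0 < T" using T0(1) by (simp add: T_def)
    show "weak_integrand u \<phi> t x = 0" if "T \<le> t" for u t x
    proof -
      have "\<phi> t y = 0" "partial_t \<phi> t y = 0" "partial_x \<phi> t y = 0" for y
        using that T0(1) by (auto intro!: T0(4) T1(4) T2(4) simp: T_def)
      then show ?thesis by (simp add: weak_integrand_def multiplier_def fourier_def inverse_fourier_def)
    qed
    fix u :: "real \<Rightarrow> real \<Rightarrow> real" and t assume uL: "L2_fun (u t)"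
    let ?W = "inverse_fourier (disp_transform \<phi> t)" and ?n = "L2norm (u t)"
    note WL = has_L2_fourier_L2[OF df[of t]]
    have tL: "L2_fun (partial_t \<phi> t)" using test_fun_x_integrable(2)[OF \<phi>t] by (simp add: L2_fun_of_real_iff)
    have Wm: "(\<lambda>x. Re (?W x)) \<in> borel_measurable lborel" using WL(1) by (auto simp: L2_fun_def)
    have RW: "L2_fun (\<lambda>x. Re (?W x))"
      by (rule L2_fun_bound[OF WL(1) Wm, where C=1]) (simp add: abs_Re_le_cmod)
    have RWn: "L2norm (\<lambda>x. Re (?W x)) \<le> \<Lambda>"
    proof -
      have "L2norm (\<lambda>x. complex_of_real (Re (?W x))) \<le> L2norm ?W"
        by (rule L2norm_mono[OF WL(1)]) (use Wm in \<open>auto simp: abs_Re_le_cmod\<close>)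
      also have "\<dots> \<le> L2norm (disp_transform \<phi> t)" by (rule L2norm_le_fourier[OF df])
      also have "\<dots> \<le> \<Lambda>" by (rule \<Lambda>)
      finally show ?thesis by (simp add: L2norm_of_real)
    qed
    have u2: "integrable lborel (\<lambda>x. (u t x)^2)" using uL by (simp add: L2_fun_def)
    have "(LBINT x. \<bar>weak_integrand u \<phi> t x\<bar>) \<le> (LBINT x. \<bar>u t x * partial_t \<phi> t x\<bar> + \<bar>u t x * Re (?W x)\<bar> + B2 * (u t x)^2)"
    proof (rule integral_mono')
      show "integrable lborel (\<lambda>x. \<bar>u t x * partial_t \<phi> t x\<bar> + \<bar>u t x * Re (?W x)\<bar> + B2 * (u t x)^2)"
        by (intro Bochner_Integration.integrable_add integrable_abs integrable_mult_right L2_product_abs uL tL RW u2)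
      fix x
      have "\<bar>(u t x)\<^sup>2 / 2 * partial_x \<phi> t x\<bar> = ((u t x)^2 / 2) * \<bar>partial_x \<phi> t x\<bar>" by (simp add: abs_mult)
      also have "\<dots> \<le> (u t x)^2 * B2" by (intro mult_mono T2) auto
      finally have "\<bar>(u t x)\<^sup>2 / 2 * partial_x \<phi> t x\<bar> \<le> B2 * (u t x)^2" by (simp add: mult.commute)
      moreover have "\<bar>a - b - c\<bar> \<le> \<bar>a\<bar> + \<bar>b\<bar> + \<bar>c\<bar>" for a b c :: real by linarith
      ultimately show "\<bar>weak_integrand u \<phi> t x\<bar> \<le> \<bar>u t x * partial_t \<phi> t x\<bar> + \<bar>u t x * Re (?W x)\<bar> + B2 * (u t x)^2"
        unfolding weak_integrand_def multiplier_eq by (rule order_trans[rotated, OF add_left_mono])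
      show "0 \<le> \<bar>u t x * partial_t \<phi> t x\<bar> + \<bar>u t x * Re (?W x)\<bar> + B2 * (u t x)^2" using T2(2) by simp
    qed
    also have "\<dots> = (LBINT x. \<bar>u t x * partial_t \<phi> t x\<bar>) + (LBINT x. \<bar>u t x * Re (?W x)\<bar>) + B2 * (LBINT x. (u t x)^2)"
      using L2_product_abs(1)[OF uL tL] L2_product_abs(1)[OF uL RW] u2
      by (simp only: Bochner_Integration.integral_add Bochner_Integration.integrable_add integrable_abs integrable_mult_right integral_mult_right_zero)
    also have "\<dots> \<le> ?n * L2norm (partial_t \<phi> t) + ?n * L2norm (\<lambda>x. Re (?W x)) + B2 * ?n\<^sup>2"
      using L2_product_abs(2)[OF uL tL] L2_product_abs(2)[OF uL RW] by (simp add: L2norm_sq)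
    also have "\<dots> \<le> ?n * A + ?n * \<Lambda> + B2 * ?n\<^sup>2" using T2(2) by (intro add_mono mult_left_mono A RWn) auto
    also have "\<dots> = (A + \<Lambda>) * ?n + B2 * ?n\<^sup>2" by (simp add: algebra_simps)
    also have "\<dots> \<le> (A + \<Lambda>) * (1 + ?n\<^sup>2) + B2 * (1 + ?n\<^sup>2)"
    proof (intro add_mono mult_left_mono)
      show "?n \<le> 1 + ?n\<^sup>2" using weighted_AM_GM[of 1 1 ?n] by simp
    qed (use A0 \<Lambda>0 T2(2) in auto)
    finally show "(LBINT x. \<bar>weak_integrand u \<phi> t x\<bar>) \<le> (A + \<Lambda> + B2) * (1 + ?n\<^sup>2)" unfolding distrib_right .
  qed
qed

context galerkin_family
begin

text \<open>The coefficients are hermitian, but the half-open range contains the index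
  \<open>- M\<close> without its partner \<open>M\<close>. The imaginary part of the trigonometric
  sum comes from these two boundary coefficients alone; divided by \<open>2 ^ n\<close>, each is at
  most \<open>sqrt (E0 / 2 ^ n)\<close>.\<close>

lemma band_synthesis_real:
  assumes r: "strict_mono r" and v: "L2_fun v"
    and lim: "\<And>j i. (\<lambda>n. cellsum (r n) j i (U (r n) s)) \<longlonglongrightarrow> (LBINT \<xi>. v \<xi> * indicator (dcell j i) \<xi>)"
  shows "Im (inverse_fourier (band (real R) v) x) = 0"
proof -
  define S where "S n = (\<Sum>k\<in>I n R. U n s k * cis (x * (of_int k / 2 ^ n))) / 2 ^ n" for n
  have "continuous_on UNIV (\<lambda>\<xi>. cis (x * \<xi>))" by (intro continuous_intros)
  from cell_linear_form_tendsto[OF filterlim_subseq[OF r] U_energy v lim this]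
  have S: "(\<lambda>n. S (r n)) \<longlonglongrightarrow> (LBINT \<xi>. v \<xi> * (cis (x * \<xi>) * indicator {-real R..<real R} \<xi>))" unfolding S_def .
  have Un: "norm (U n s k) / 2 ^ n \<le> sqrt (E0 * (1/2) ^ n)" for n k
  proof (rule real_le_rsqrt)
    have "(norm (U n s k))\<^sup>2 / 2 ^ n \<le> E0" using U_energy[of "{k}" n s] by simp
    then have "(norm (U n s k))\<^sup>2 / 2 ^ n / 2 ^ n \<le> E0 / 2 ^ n" by (rule divide_right_mono) simp
    then show "(norm (U n s k) / 2 ^ n)\<^sup>2 \<le> E0 * (1/2) ^ n" by (simp add: power_divide power2_eq_square power_one_over)
  qed
  have bound: "norm (S n - cnj (S n)) \<le> 2 * sqrt (E0 * (1/2) ^ n)" for n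
  proof -
    define f where "f k = U n s k * cis (x * (of_int k / 2 ^ n))" for k
    define M where "M = int R * 2 ^ n"
    have M0: "0 \<le> M" by (simp add: M_def)
    have fc: "cnj (f k) = f (- k)" for k
      using herm[of n "nat \<lfloor>s / \<tau> n\<rfloor>"] by (simp add: f_def U_def hermitian_seq_def cis_cnj)
    have Sf: "S n = (\<Sum>k\<in>{-M..<M}. f k) / 2 ^ n" by (simp add: S_def f_def M_def)
    have "(\<Sum>k\<in>{-M..<M}. cnj (f k)) = (\<Sum>k\<in>{-M<..M}. f k)"
      by (rule sum.reindex_bij_witness[where i=uminus and j=uminus]) (auto simp: fc)
    moreover have "(\<Sum>k\<in>{-M..<M}. f k) + f M = (\<Sum>k\<in>{-M..M}. f k)"
    proof -
      have "{-M..M} = insert M {-M..<M}" using M0 by auto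
      then show ?thesis by (simp add: add.commute)
    qed
    moreover have "(\<Sum>k\<in>{-M<..M}. f k) + f (- M) = (\<Sum>k\<in>{-M..M}. f k)"
    proof -
      have "{-M..M} = insert (-M) {-M<..M}" using M0 by auto
      then show ?thesis by (simp add: add.commute)
    qed
    ultimately have "(\<Sum>k\<in>{-M..<M}. f k) - (\<Sum>k\<in>{-M..<M}. cnj (f k)) = f (- M) - f M" by (simp add: algebra_simps)
    then have "S n - cnj (S n) = f (- M) / 2 ^ n - f M / 2 ^ n" unfolding Sf by (simp add: diff_divide_distrib[symmetric])
    also have "norm \<dots> \<le> norm (f (- M) / 2 ^ n) + norm (f M / 2 ^ n)" by (rule norm_triangle_ineq4)
    also have "\<dots> \<le> sqrt (E0 * (1/2) ^ n) + sqrt (E0 * (1/2) ^ n)"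
      using Un[of n] by (intro add_mono) (simp_all add: f_def norm_divide norm_mult norm_power)
    finally show ?thesis by simp
  qed
  have "(\<lambda>n. 2 * sqrt (E0 * (1/2) ^ n)) \<longlonglongrightarrow> 2 * sqrt (E0 * 0)"
    by (intro tendsto_mult tendsto_const tendsto_real_sqrt LIMSEQ_realpow_zero) auto
  then have "(\<lambda>n. 2 * sqrt (E0 * (1/2) ^ r n)) \<longlonglongrightarrow> 0" using LIMSEQ_subseq_LIMSEQ[OF _ r] by (fastforce simp: o_def)
  then have "(\<lambda>n. S (r n) - cnj (S (r n))) \<longlonglongrightarrow> 0"
    by (rule Lim_null_comparison[rotated]) (simp add: bound)
  moreover define J where "J = (LBINT \<xi>. v \<xi> * (cis (x * \<xi>) * indicator {-real R..<real R} \<xi>))"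
  have "(\<lambda>n. S (r n) - cnj (S (r n))) \<longlonglongrightarrow> J - cnj J" using S unfolding J_def[symmetric] by (intro tendsto_diff tendsto_cnj)
  ultimately have "J = cnj J" using LIMSEQ_unique by fastforce
  then have "Im J = 0" by (metis complex_cnj_cancel_iff cnj.simps(2) equal_neg_zero)
  moreover have "inverse_fourier (band (real R) v) x = J / complex_of_real (2 * pi)"
    by (simp add: inverse_fourier_def band_def J_def mult_ac)
  ultimately show ?thesis by (simp only: Im_divide_of_real div_0)
qed

end

text \<open>Supplies one good time beyond any \<open>T\<close>; monotonicity of the time integral
  then gives bounds at every \<open>T\<close>.\<close>

lemma AE_positive_unbounded:
  assumes "AE t in lborel. 0 < t \<longrightarrow> Q t" shows "\<exists>t>T. 0 < t \<and> Q (t :: real)"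
proof (rule ccontr)
  assume "\<not> ?thesis"
  then have "AE t in lborel. t \<notin> {max 0 T<..<max 0 T + 1}" using assms by auto
  then have "{max 0 T<..<max 0 T + 1} \<in> null_sets lborel" by (subst AE_iff_null_sets) auto
  then show False by (simp add: null_sets_def)
qed

lemma ennreal_enn2real_le: "ennreal (enn2real x) \<le> x"
  by (cases x) auto

context galerkin_family
begin

lemma weak_solution_exists:
  assumes uv0: "has_L2_fourier (\<lambda>x. complex_of_real (u0 x)) v0"
  shows "\<exists>u :: real \<Rightarrow> real \<Rightarrow> real.
    Linfty_L2 u \<and> weak_solution u0 u \<and>
    (\<lambda>s. N_norm (u s)) \<in> borel_measurable (restrict_space lborel {0<..}) \<and>
    (AE t in lborel. 0 < t \<longrightarrow>
       ennreal ((L2norm (u t))^2) + (\<integral>\<^sup>+s\<in>{0<..<t}. (N_norm (u s))^2 \<partial>lborel)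
         \<le> ennreal ((L2norm u0)^2))"
proof -
  obtain r v where r: "strict_mono (r :: nat \<Rightarrow> nat)" and vm[measurable]: "(\<lambda>(t, \<xi>). v t \<xi>) \<in> borel_measurable (lborel \<Otimes>\<^sub>M lborel)"
    and good: "AE t in lborel. 0 < t \<longrightarrow> L2_fun (v t) \<and>
      (\<forall>j i. (\<lambda>n. cellsum (r n) j i (U (r n) t)) \<longlonglongrightarrow> (LBINT \<xi>. v t \<xi> * indicator (dcell j i) \<xi>)) \<and>
      ennreal ((L2norm (v t))^2) + (\<integral>\<^sup>+s. indicator {0<..<t} s * dissip (v s) \<partial>lborel) \<le> ennreal E0"
    using weak_limit_exists unfolding dissip_def by blast
  define W where "W k t x = inverse_fourier (band (4 ^ k) (v t)) x" for k :: nat and t x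
  \<comment> \<open>The good times, described by nonnegative integrals so that \<open>P\<close> is a
    measurable predicate. The last condition makes the syntheses real almost everywhere.\<close>
  define P where "P t \<longleftrightarrow> 0 < t \<and> (\<integral>\<^sup>+\<xi>. ennreal ((norm (v t \<xi>))^2) \<partial>lborel) < \<infinity> \<and> dissip (v t) < \<infinity>
    \<and> (\<forall>k. (\<integral>\<^sup>+x. ennreal ((Im (W k t x))^2) \<partial>lborel) = 0)" for t
  \<comment> \<open>At exceptional times \<open>u\<close> vanishes, hence so does its
    \<open>N_norm\<close>; this gives \<open>N_norm (u s)\<close> an explicit measurable formula at
    every \<open>s\<close>.\<close>
  define u where "u t x = (if P t then Re (lim (\<lambda>k. W k t x)) else 0)" for t x
  have Wm[measurable]: "(\<lambda>(t, x). W k t x) \<in> borel_measurable (lborel \<Otimes>\<^sub>M lborel)" for k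
  proof -
    have [measurable]: "(\<lambda>(t, x). (LBINT \<xi>. cis (x * \<xi>) * (v t \<xi> * indicator {-(4 ^ k)..<4 ^ k} \<xi>))) \<in> borel_measurable (lborel \<Otimes>\<^sub>M lborel)"
      by measurable
    show ?thesis unfolding W_def inverse_fourier_def band_def by measurable
  qed
  have dm[measurable]: "(\<lambda>s. dissip (v s)) \<in> borel_measurable lborel" unfolding dissip_def by measurable
  have Pm[measurable]: "Measurable.pred lborel P" unfolding P_def by measurable
  have um[measurable]: "(\<lambda>(t, x). u t x) \<in> borel_measurable (lborel \<Otimes>\<^sub>M lborel)"
  proof -
    have [measurable]: "(\<lambda>(t, x). lim (\<lambda>k. W k t x)) \<in> borel_measurable (lborel \<Otimes>\<^sub>M lborel)"
      unfolding split_beta' by (rule borel_measurable_lim_metric) (use Wm in \<open>simp add: split_beta'\<close>)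
    show ?thesis unfolding u_def by measurable
  qed
  have vt: "v t \<in> borel_measurable lborel" for t using measurable_Pair2[OF vm, of t] by simp
  have ut: "u t \<in> borel_measurable lborel" for t using measurable_Pair2[OF um, of t] by simp
  have Wt: "W k t \<in> borel_measurable lborel" for k t using measurable_Pair2[OF Wm[of k], of t] by simp
  have vL: "L2_fun (v t)" if "P t" for t using that by (intro L2_funI_nn vt) (simp add: P_def)
  have fourier: "has_L2_fourier (\<lambda>x. complex_of_real (u t x)) (v t)" if p: "P t" for t
  proof -
    have N: "dissip (v t) < \<infinity>" using p by (simp add: P_def)
    have "AE x in lborel. Im (W k t x) = 0" for k
    proof -
      have m: "(\<lambda>x. ennreal ((Im (W k t x))^2)) \<in> borel_measurable lborel" using Wt[of k t] by measurable
      have "(\<integral>\<^sup>+x. ennreal ((Im (W k t x))^2) \<partial>lborel) = 0" using p unfolding P_def by blast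
      then have "AE x in lborel. ennreal ((Im (W k t x))^2) = 0" unfolding nn_integral_0_iff_AE[OF m] .
      then show ?thesis by eventually_elim (simp add: ennreal_eq_0_iff)
    qed
    then have real: "AE x in lborel. \<forall>k. Im (W k t x) = 0" unfolding AE_all_countable by blast
    have conv: "AE x in lborel. convergent (\<lambda>k. W k t x)" unfolding W_def by (rule band_synthesis(1)[OF vL[OF p] N])
    have "AE x in lborel. (\<lambda>k. inverse_fourier (band (4 ^ k) (v t)) x) \<longlonglongrightarrow> complex_of_real (u t x)"
      using real conv
    proof eventually_elim
      case (elim x)
      then have l: "(\<lambda>k. W k t x) \<longlonglongrightarrow> lim (\<lambda>k. W k t x)" by (simp add: convergent_LIMSEQ_iff)
      have "(\<lambda>k. Im (W k t x)) \<longlonglongrightarrow> Im (lim (\<lambda>k. W k t x))" by (rule tendsto_Im[OF l])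
      then have "Im (lim (\<lambda>k. W k t x)) = 0" using elim(1) by (simp add: LIMSEQ_const_iff)
      then have "complex_of_real (u t x) = lim (\<lambda>k. W k t x)" using p by (simp add: u_def complex_eq_iff)
      then show ?case using l by (simp add: W_def)
    qed
    then show ?thesis by (intro band_synthesis(2)[OF vL[OF p] N]) (use ut in auto)
  qed
  have uL: "L2_fun (u t)" if "P t" for t
    using has_L2_fourier_L2(1)[OF fourier[OF that]] by (simp add: L2_fun_of_real_iff)
  have unorm: "(L2norm (v t))\<^sup>2 = 2 * pi * (L2norm (u t))^2" if "P t" for t
    using L2_fourier_norm[OF fourier[OF that]] by (simp add: L2norm_of_real power_mult_distrib)
  have u0norm: "E0 = 2 * pi * (L2norm u0)^2"
    unfolding E0 using L2_fourier_norm[OF uv0] by (simp add: L2norm_of_real power_mult_distrib)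
  have uz: "u t = (\<lambda>_. 0)" if "\<not> P t" for t using that by (auto simp: u_def)

  \<comment> \<open>The energy inequality is known at almost every time only; a good time later than
    \<open>T\<close> is used.\<close>
  have diss: "(\<integral>\<^sup>+s. indicator {0<..<T} s * dissip (v s) \<partial>lborel) \<le> ennreal E0" for T
  proof -
    obtain t where t: "T < t" "ennreal ((L2norm (v t))^2) + (\<integral>\<^sup>+s. indicator {0<..<t} s * dissip (v s) \<partial>lborel) \<le> ennreal E0"
      using AE_positive_unbounded[OF good, of T] by blast
    have "(\<integral>\<^sup>+s. indicator {0<..<T} s * dissip (v s) \<partial>lborel) \<le> (\<integral>\<^sup>+s. indicator {0<..<t} s * dissip (v s) \<partial>lborel)"
      by (intro nn_integral_mono mult_right_mono) (use t(1) in \<open>auto simp: indicator_def\<close>)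
    also have "\<dots> \<le> ennreal ((L2norm (v t))^2) + (\<integral>\<^sup>+s. indicator {0<..<t} s * dissip (v s) \<partial>lborel)" by simp
    also note t(2)
    finally show ?thesis .
  qed
  have dfin: "AE s in lborel. 0 < s \<longrightarrow> dissip (v s) < \<infinity>"
  proof -
    have "AE s in lborel. indicator {0<..<real n} s * dissip (v s) \<noteq> \<infinity>" for n
      by (rule nn_integral_PInf_AE) (use diss[of "real n"] in \<open>auto simp: top_unique\<close>)
    then have "AE s in lborel. \<forall>n. indicator {0<..<real n} s * dissip (v s) \<noteq> \<infinity>" unfolding AE_all_countable by blast
    then show ?thesis
    proof eventually_elim
      case (elim s)
      obtain n :: nat where "s < real n" using reals_Archimedean2 by blast
      then show ?case using elim[rule_format, of n] by (auto simp: less_top)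
    qed
  qed
  have AEP: "AE s in lborel. 0 < s \<longrightarrow> P s \<and> (L2norm (v s))^2 \<le> E0"
    using good dfin
  proof eventually_elim
    case (elim s)
    show ?case
    proof
      assume s: "0 < s"
      have L: "L2_fun (v s)" using elim s by blast
      have lim: "(\<lambda>n. cellsum (r n) j i (U (r n) s)) \<longlonglongrightarrow> (LBINT \<xi>. v s \<xi> * indicator (dcell j i) \<xi>)" for j i
        using elim s by blast
      have "Im (W k s x) = 0" for k x
        using band_synthesis_real[OF r L lim, of "4 ^ k" x] by (simp add: W_def)
      then have "P s" using s elim(2) L2_fun_nn[OF L] by (simp add: P_def)
      moreover have "ennreal ((L2norm (v s))^2) \<le> ennreal ((L2norm (v s))^2) + (\<integral>\<^sup>+t. indicator {0<..<s} t * dissip (v t) \<partial>lborel)" by simp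
      then have "ennreal ((L2norm (v s))^2) \<le> ennreal E0" using elim s by (blast intro: order_trans)
      then have "(L2norm (v s))\<^sup>2 \<le> E0" using E0_nonneg by (simp add: ennreal_le_iff)
      ultimately show "P s \<and> (L2norm (v s))^2 \<le> E0" by simp
    qed
  qed

  have Nn: "N_norm (u s) = (if P s then ennreal (sqrt (enn2real (dissip (v s)) / (2 * pi))) else 0)" for s
  proof (cases "P s")
    case True
    then have "dissip (v s) < \<infinity>" by (simp add: P_def)
    then show ?thesis using N_norm_eq[OF fourier[OF True], folded dissip_def] True by simp
  next
    case False
    have "has_L2_fourier (\<lambda>x. complex_of_real (u s x)) (\<lambda>_. 0)" using has_L2_fourier_zero by (simp add: uz[OF False])
    from N_norm_eq[OF this] False show ?thesis by simp
  qed
  have Nm: "(\<lambda>s. N_norm (u s)) \<in> borel_measurable (restrict_space lborel {0<..})"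
    unfolding Nn by (rule measurable_restrict_space1) measurable
  have N2: "(N_norm (u s))\<^sup>2 \<le> ennreal (1 / (2 * pi)) * dissip (v s)" for s
  proof (cases "P s")
    case True
    then have "dissip (v s) < \<infinity>" by (simp add: P_def)
    then have d: "ennreal (enn2real (dissip (v s))) = dissip (v s)" by simp
    have "(N_norm (u s))\<^sup>2 = ennreal (1 / (2 * pi) * enn2real (dissip (v s)))" using True by (simp add: Nn ennreal_power)
    also have "\<dots> = ennreal (1 / (2 * pi)) * dissip (v s)" by (subst ennreal_mult) (simp_all add: d)
    finally show ?thesis by simp
  qed (simp add: Nn)
  \<comment> \<open>Plancherel divides all three terms of the inequality on the Fourier side by
    \<open>2 * pi\<close>.\<close>
  have energy: "AE t in lborel. 0 < t \<longrightarrow>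
       ennreal ((L2norm (u t))^2) + (\<integral>\<^sup>+s\<in>{0<..<t}. (N_norm (u s))^2 \<partial>lborel) \<le> ennreal ((L2norm u0)^2)"
    using good AEP
  proof eventually_elim
    case (elim t)
    show ?case
    proof
      assume t: "0 < t"
      then have p: "P t" using elim by blast
      have "(\<integral>\<^sup>+s\<in>{0<..<t}. (N_norm (u s))^2 \<partial>lborel) \<le> (\<integral>\<^sup>+s. ennreal (1 / (2 * pi)) * (indicator {0<..<t} s * dissip (v s)) \<partial>lborel)"
        by (rule nn_integral_mono) (use N2 in \<open>auto simp: indicator_def\<close>)
      also have "\<dots> = ennreal (1 / (2 * pi)) * (\<integral>\<^sup>+s. indicator {0<..<t} s * dissip (v s) \<partial>lborel)" by (rule nn_integral_cmult) measurable
      finally have A: "(\<integral>\<^sup>+s\<in>{0<..<t}. (N_norm (u s))^2 \<partial>lborel) \<le> ennreal (1 / (2 * pi)) * (\<integral>\<^sup>+s. indicator {0<..<t} s * dissip (v s) \<partial>lborel)" .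
      have B: "ennreal ((L2norm (u t))^2) = ennreal (1 / (2 * pi)) * ennreal ((L2norm (v t))^2)"
        by (simp add: unorm[OF p] flip: ennreal_mult)
      have "ennreal ((L2norm (u t))^2) + (\<integral>\<^sup>+s\<in>{0<..<t}. (N_norm (u s))^2 \<partial>lborel)
        \<le> ennreal (1 / (2 * pi)) * (ennreal ((L2norm (v t))^2) + (\<integral>\<^sup>+s. indicator {0<..<t} s * dissip (v s) \<partial>lborel))"
        unfolding distrib_left B by (intro add_left_mono A)
      also have "\<dots> \<le> ennreal (1 / (2 * pi)) * ennreal E0" using elim t by (intro mult_left_mono) auto
      also have "\<dots> = ennreal ((L2norm u0)^2)" using E0_nonneg by (simp add: u0norm flip: ennreal_mult)
      finally show "ennreal ((L2norm (u t))^2) + (\<integral>\<^sup>+s\<in>{0<..<t}. (N_norm (u s))^2 \<partial>lborel) \<le> ennreal ((L2norm u0)^2)" .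
    qed
  qed
  have Linf: "Linfty_L2 u"
    unfolding Linfty_L2_def
  proof
    have "{0 :: real<..} \<times> (UNIV :: real set) \<in> sets (lborel \<Otimes>\<^sub>M lborel)" by (intro pair_measureI) auto
    then show "set_borel_measurable lborel ({0<..} \<times> UNIV) (\<lambda>(t, x). u t x)"
      unfolding set_borel_measurable_def lborel_prod[symmetric] by measurable
    have "AE t in lborel. 0 < t \<longrightarrow> L2_fun (u t) \<and> L2norm (u t) \<le> sqrt E0"
      using AEP
    proof eventually_elim
      case (elim t)
      show ?case
      proof
        assume "0 < t"
        then have p: "P t" and b: "(L2norm (v t))\<^sup>2 \<le> E0" using elim by auto
        have "L2norm (u t) \<le> L2norm (v t)" using L2norm_le_fourier[OF fourier[OF p]] by (simp add: L2norm_of_real)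
        also have "\<dots> \<le> sqrt E0" using b by (rule real_le_rsqrt)
        finally show "L2_fun (u t) \<and> L2norm (u t) \<le> sqrt E0" using uL[OF p] by simp
      qed
    qed
    then show "\<exists>C. AE t in lborel. 0 < t \<longrightarrow> L2_fun (u t) \<and> L2norm (u t) \<le> C" by blast
  qed
  have weak: "weak_solution u0 u"
    unfolding weak_solution_def
  proof (intro allI impI conjI)
    fix \<phi> assume \<phi>: "test_fun \<phi>"
    have wm[measurable]: "(\<lambda>(t, x). weak_integrand u \<phi> t x) \<in> borel_measurable (lborel \<Otimes>\<^sub>M lborel)"
      by (rule weak_integrand_measurable[OF \<phi> um])
    obtain K T where K: "0 \<le> K" "0 < T" "\<And>u t x. T \<le> t \<Longrightarrow> weak_integrand u \<phi> t x = 0"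
      "\<And>u t. L2_fun (u t) \<Longrightarrow> (LBINT x. \<bar>weak_integrand u \<phi> t x\<bar>) \<le> K * (1 + (L2norm (u t))^2)"
      using weak_integrand_L1_bound[OF \<phi>] by metis
    show "set_integrable lborel ({0<..} \<times> UNIV) (\<lambda>(t, x). weak_integrand u \<phi> t x)"
      unfolding set_integrable_def lborel_prod[symmetric]
    proof (rule lborel_pair.Fubini_integrable)
      have [measurable]: "{0 :: real<..} \<times> (UNIV :: real set) \<in> sets (lborel \<Otimes>\<^sub>M lborel)" by (intro pair_measureI) auto
      show "(\<lambda>p. indicator ({0<..} \<times> UNIV) p *\<^sub>R (case p of (t, x) \<Rightarrow> weak_integrand u \<phi> t x)) \<in> borel_measurable (lborel \<Otimes>\<^sub>M lborel)"
        by measurable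
      show "AE t in lborel. integrable lborel (\<lambda>x. indicator ({0<..} \<times> UNIV) (t, x) *\<^sub>R (case (t, x) of (t, x) \<Rightarrow> weak_integrand u \<phi> t x))"
        using AEP
      proof eventually_elim
        case (elim t)
        show ?case
        proof (cases "0 < t")
          case True
          then have "P t" using elim by blast
          then show ?thesis using weak_pairing(1)[OF \<phi> fourier] True by simp
        qed simp
      qed
      have e: "(\<lambda>t. (LBINT x. norm (indicator ({0<..} \<times> UNIV) (t, x) *\<^sub>R (case (t, x) of (t, x) \<Rightarrow> weak_integrand u \<phi> t x))))
        = (\<lambda>t. indicator {0<..} t * (LBINT x. \<bar>weak_integrand u \<phi> t x\<bar>))"
        by (rule ext) (simp add: indicator_def)
      show "integrable lborel (\<lambda>t. (LBINT x. norm (indicator ({0<..} \<times> UNIV) (t, x) *\<^sub>R (case (t, x) of (t, x) \<Rightarrow> weak_integrand u \<phi> t x))))"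
        unfolding e
      proof (rule Bochner_Integration.integrable_bound)
        show "integrable lborel (\<lambda>t. indicator {0<..<T} t * (K * (1 + E0)))"
          by (intro integrable_mult_left integrable_real_indicator) (use K(2) in auto)
        show "(\<lambda>t. indicator {0<..} t * (LBINT x. \<bar>weak_integrand u \<phi> t x\<bar>)) \<in> borel_measurable lborel" by measurable
        show "AE t in lborel. norm (indicator {0<..} t * (LBINT x. \<bar>weak_integrand u \<phi> t x\<bar>)) \<le> norm (indicator {0<..<T} t * (K * (1 + E0)))"
          using AEP
        proof eventually_elim
          case (elim t)
          consider "t \<le> 0" | "T \<le> t" | "0 < t" "t < T" by linarith
          then show ?case
          proof cases
            case 2
            then show ?thesis by (simp add: K(3))
          next
            case 3
            then have p: "P t" and b: "(L2norm (v t))\<^sup>2 \<le> E0" using elim by auto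
            have "L2norm (u t) \<le> L2norm (v t)" using L2norm_le_fourier[OF fourier[OF p]] by (simp add: L2norm_of_real)
            then have sq: "(L2norm (u t))\<^sup>2 \<le> (L2norm (v t))^2" by (intro power_mono) auto
            have "K * (1 + (L2norm (u t))^2) \<le> K * (1 + E0)"
              by (intro mult_left_mono add_left_mono order_trans[OF sq b] K(1))
            then have "(LBINT x. \<bar>weak_integrand u \<phi> t x\<bar>) \<le> K * (1 + E0)" using K(4)[of u t, OF uL[OF p]] by linarith
            then show ?thesis using 3 K(1) E0_nonneg by (simp add: abs_mult)
          qed simp
        qed
      qed
    qed
    have u0L: "L2_fun u0" using has_L2_fourier_L2(1)[OF uv0] by (simp add: L2_fun_of_real_iff)
    have "L2_fun (\<phi> 0)" using test_fun_x_integrable(2)[OF \<phi>, of 0] by (simp add: L2_fun_of_real_iff)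
    then show "integrable lborel (\<lambda>x. u0 x * \<phi> 0 x)" by (rule L2_product_abs(1)[OF u0L])
    obtain C where C: "0 \<le> C" "\<And>s v u R. has_L2_fourier (\<lambda>x. complex_of_real (u x)) v \<Longrightarrow> dissip v < \<infinity> \<Longrightarrow> 1 \<le> R \<Longrightarrow>
      norm (cut_rate \<phi> s R v - limit_rate \<phi> s v u) \<le> C * (enn2real (dissip v) + (L2norm v)^2 + 1) / sqrt (real R)"
      using cut_rate_error[OF \<phi>] by metis
    define L where "L s = limit_rate \<phi> s (v s) (u s)" for s
    \<comment> \<open>The squared norm in the error bound is replaced by its bound
      \<open>E0\<close>, so that the dissipation alone varies in time.\<close>
    define g where "g s = C * (enn2real (dissip (v s)) + (E0 + 1))" for s
    have Lm[measurable]: "L \<in> borel_measurable lborel"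
    proof -
      note [measurable] = lam_measurable[OF \<phi>] test_fun_measurable(1)[OF test_fun_partial(1)[OF \<phi>]]
      show ?thesis unfolding L_def[abs_def] limit_rate_def by measurable
    qed
    have gi: "integrable lborel (\<lambda>s. indicator {0<..<T} s * g s)" for T
    proof -
      have "integrable lborel (\<lambda>s. indicator {0<..<T} s * enn2real (dissip (v s)))"
      proof (rule integrableI_nonneg)
        have "(\<integral>\<^sup>+s. ennreal (indicator {0<..<T} s * enn2real (dissip (v s))) \<partial>lborel) \<le> (\<integral>\<^sup>+s. indicator {0<..<T} s * dissip (v s) \<partial>lborel)"
          by (rule nn_integral_mono) (auto simp: indicator_def ennreal_enn2real_le)
        also note diss
        finally show "(\<integral>\<^sup>+s. ennreal (indicator {0<..<T} s * enn2real (dissip (v s))) \<partial>lborel) < \<infinity>" by (rule le_less_trans) simp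
      qed (auto, measurable)
      moreover have "integrable lborel (\<lambda>s. indicator {0<..<T} s * (E0 + 1))"
        by (intro integrable_mult_left integrable_real_indicator emeasure_bounded_finite bounded_subset[OF bounded_closed_interval[of 0 T]]) auto
      ultimately have "integrable lborel (\<lambda>s. C * (indicator {0<..<T} s * enn2real (dissip (v s)) + indicator {0<..<T} s * (E0 + 1)))"
        by (intro integrable_mult_right Bochner_Integration.integrable_add)
      then show ?thesis by (simp add: g_def algebra_simps)
    qed
    have Lg: "AE s in lborel. 0 < s \<longrightarrow> (\<forall>R\<ge>1. norm (cut_rate \<phi> s R (v s) - L s) \<le> g s / sqrt (real R))"
      using AEP
    proof eventually_elim
      case (elim s)
      show ?case
      proof (intro impI allI)
        fix R :: nat assume "0 < s" and R: "1 \<le> R"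
        then have p: "P s" and b: "(L2norm (v s))\<^sup>2 \<le> E0" using elim by auto
        have "dissip (v s) < \<infinity>" using p by (simp add: P_def)
        from C(2)[OF fourier[OF p] this R, of s]
        have "norm (cut_rate \<phi> s R (v s) - L s) \<le> C * (enn2real (dissip (v s)) + (L2norm (v s))^2 + 1) / sqrt (real R)" by (simp only: L_def)
        also have "\<dots> \<le> g s / sqrt (real R)" unfolding g_def using b C(1) by (intro divide_right_mono mult_left_mono) auto
        finally show "norm (cut_rate \<phi> s R (v s) - L s) \<le> g s / sqrt (real R)" .
      qed
    qed
    have good2: "AE s in lborel. 0 < s \<longrightarrow> L2_fun (v s) \<and>
      (\<forall>j i. (\<lambda>n. cellsum (r n) j i (U (r n) s)) \<longlonglongrightarrow> (LBINT \<xi>. v s \<xi> * indicator (dcell j i) \<xi>))"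
      using good by eventually_elim blast
    note LL = limit_weak_form[OF \<phi> r vm good2 Lm gi Lg]
    let ?w = "\<lambda>t. (LBINT x. weak_integrand u \<phi> t x)"
    \<comment> \<open>The limit identity is complex; its real part is \<open>2 * pi\<close> times
      the weak formulation.\<close>
    have "Re (LBINT s. indicator {0<..} s *\<^sub>R L s) = (LBINT s. Re (indicator {0<..} s *\<^sub>R L s))"
      by (rule integral_Re[symmetric, OF LL(1)])
    also have "\<dots> = (LBINT s. 2 * pi * (indicator {0<..} s *\<^sub>R ?w s))"
    proof (rule integral_cong_AE)
      show "(\<lambda>s. Re (indicator {0<..} s *\<^sub>R L s)) \<in> borel_measurable lborel" by measurable
      show "(\<lambda>s. 2 * pi * (indicator {0<..} s *\<^sub>R ?w s)) \<in> borel_measurable lborel" by measurable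
      show "AE s in lborel. Re (indicator {0<..} s *\<^sub>R L s) = 2 * pi * (indicator {0<..} s *\<^sub>R ?w s)"
        using AEP
      proof eventually_elim
        case (elim s)
        show ?case
        proof (cases "0 < s")
          case True
          then have "P s" using elim by blast
          then show ?thesis using weak_pairing(2)[OF \<phi> fourier] True by (simp add: L_def)
        qed simp
      qed
    qed
    also have "\<dots> = 2 * pi * (LBINT s. indicator {0<..} s *\<^sub>R ?w s)" by (rule integral_mult_right_zero)
    finally have 1: "Re (LBINT s. indicator {0<..} s *\<^sub>R L s) = 2 * pi * (LBINT s. indicator {0<..} s *\<^sub>R ?w s)" .
    have "(LBINT \<xi>. v0 \<xi> * cnj (fourier (\<lambda>x. complex_of_real (\<phi> 0 x)) \<xi>)) = 2 * pi * (LBINT x. complex_of_real (u0 x) * cnj (complex_of_real (\<phi> 0 x)))"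
      by (rule L2_fourier_inner[OF uv0 has_L2_fourier_L1[OF test_fun_x_integrable[OF \<phi>]]])
    then have 2: "(LBINT \<xi>. v0 \<xi> * tf \<phi> 0 \<xi>) = 2 * pi * of_real (LBINT x. u0 x * \<phi> 0 x)"
      by (simp add: tf_cnj flip: integral_complex_of_real)
    have "Re ((LBINT s. indicator {0<..} s *\<^sub>R L s) + (LBINT \<xi>. v0 \<xi> * tf \<phi> 0 \<xi>)) = 0" unfolding LL(2) by simp
    then have "2 * pi * ((LBINT s. indicator {0<..} s *\<^sub>R ?w s) + (LBINT x. u0 x * \<phi> 0 x)) = 0"
      unfolding plus_complex.sel 1 2 by (simp add: distrib_left)
    then show "(LINT t:{0<..}|lborel. (LBINT x. weak_integrand u \<phi> t x)) + (LBINT x. u0 x * \<phi> 0 x) = 0"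
      unfolding set_lebesgue_integral_def using pi_gt_zero by simp
  qed
  show ?thesis by (intro exI[of _ u] conjI Linf weak Nm energy)
qed

end

theorem theorem1:
  fixes u0 :: "real \<Rightarrow> real"
  assumes "L2_fun u0"
  shows "\<exists>u :: real \<Rightarrow> real \<Rightarrow> real.
    Linfty_L2 u \<and> weak_solution u0 u \<and>
    (\<lambda>s. N_norm (u s)) \<in> borel_measurable (restrict_space lborel {0<..}) \<and>
    (AE t in lborel. 0 < t \<longrightarrow>
       ennreal ((L2norm (u t))\<^sup>2) + (\<integral>\<^sup>+s\<in>{0<..<t}. (N_norm (u s))\<^sup>2 \<partial>lborel)
         \<le> ennreal ((L2norm u0)\<^sup>2))"
proof -
  have "L2_fun (\<lambda>x. complex_of_real (u0 x))" using assms by (simp add: L2_fun_of_real_iff)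
  then obtain v0 where v0: "has_L2_fourier (\<lambda>x. complex_of_real (u0 x)) v0" using L2_fourier_exists by blast
  obtain \<tau> c where g: "galerkin_family v0 \<tau> c ((L2norm v0)^2)"
    using galerkin_family_exists[OF has_L2_fourier_L2(2)[OF v0] fourier_of_real_hermitian[OF v0]] by blast
  show ?thesis by (rule galerkin_family.weak_solution_exists[OF g v0])
qed

end
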